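(* In the adaptive generalized linear model described in the context, assume (A1), (A2') and (A3') stated there, with the design points $X_i$ generated by the adaptive Wynn-algorithm using adaptive estimators $\widehat{\theta}_n$, $n\ge n_{\mathrm{st}}$. Assume further that $G$ is twice continuously differentiable, that $\overline{\theta}$ is an interior point of $\Theta\subseteq\mathbb{R}^p$, and that $\widehat{\theta}_n\to\overline{\theta}$ almost surely. Then, as $n\to\infty$, $$\sqrt{n}\,M^{1/2}\bigl(\xi_n,\widehat{\theta}_n^{(\mathrm{ML})}\bigr)\,\bigl(\widehat{\theta}_n^{(\mathrm{ML})}-\overline{\theta}\bigr)\ \longrightarrow\ \mathrm{N}(0,I_p)\quad\text{in distribution}.$$ Also, denoting by $M_*=M(\xi^*_{\overline{\theta}},\overline{\theta})$ the information matrix at $\overline{\theta}$ of a locally D-optimal design $\xi^*_{\overline{\theta}}$ at $\overline{\theta}$, $$\sqrt{n}\,\bigl(\widehat{\theta}_n^{(\mathrm{ML})}-\overline{\theta}\bigr)\ \longrightarrow\ \mathrm{N}\bigl(0,M_*^{-1}\bigr)\quad\text{in distribution}.$$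
   Context: Setting. Let $p\in\mathbb{N}$, $\mathcal{X}$ a nonempty compact metric space, $\Theta\subseteq\mathbb{R}^p$ nonempty and compact (Euclidean metric), $\overline{\theta}\in\Theta$ the fixed true parameter point. Let $f:\mathcal{X}\to\mathbb{R}^p$ be continuous with $\mathrm{span}\,f(\mathcal{X})=\mathbb{R}^p$. Let $I\subseteq\mathbb{R}$ be an open interval (possibly unbounded) with $\{f(x)^{T}\theta:(x,\theta)\in\mathcal{X}\times\Theta\}\subseteq I$ and $G:I\to\mathbb{R}$ continuously differentiable with $G'(u)>0$ for all $u\in I$. The mean response is $\mu(x,\theta)=G(f(x)^{T}\theta)$. Exponential family. Let $J\subseteq\mathbb{R}$ be an open interval and $P_\tau$, $\tau\in J$, a one-parameter exponential family in canonical parametrization: $P_\tau$ is a probability distribution on the Borel sets of $\mathbb{R}$ with density $p_\tau(y)=K(y)\exp(\tau y-b(\tau))$ with respect to some Borel measure $\nu$, where $K\ge 0$ is measurable and $b:J\to\mathbb{R}$ is infinitely often differentiable; $b'(\tau)$ and $b''(\tau)>0$ are the expectation and the variance of $P_\tau$. Thus $b'$ is a strictly increasing bijection from $J$ onto the open interval $\mathcal{E}=b'(J)$ of all expectations, with inverse $(b')^{-1}:\mathcal{E}\to J$. Random variables. On a probability space $(\Omega,\mathcal{F},\mathbb{P}_{\overline{\theta}})$ there are $\mathcal{X}$-valued random variables $X_i$ and real random variables $Y_i$, $i\in\mathbb{N}$. (A1) There is a nondecreasing sequence of sub-sigma-fields $\mathcal{F}_0\subseteq\mathcal{F}_1\subseteq\dots$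 of $\mathcal{F}$ such that for each $i\in\mathbb{N}$, $X_i$ is $\mathcal{F}_{i-1}$-measurable and $Y_i$ is $\mathcal{F}_i$-measurable. (A2') $G(I)\subseteq\mathcal{E}$, and for each $i\in\mathbb{N}$ the conditional distribution of $Y_i$ given $\mathcal{F}_{i-1}$ is $P_{\overline{\tau}_i}$ with $\overline{\tau}_i=(b')^{-1}\bigl(G(f(X_i)^{T}\overline{\theta})\bigr)$. (A3') The functions $f_\theta$ defining information matrices are $f_\theta(x)=\varphi(f(x)^{T}\theta)\,f(x)$, $x\in\mathcal{X}$, $\theta\in\Theta$, where $\varphi(u)=G'(u)\big/\sqrt{b''\bigl((b')^{-1}(G(u))\bigr)}$, $u\in I$. Information matrices and algorithm. A design $\xi$ is a probability measure on $\mathcal{X}$ with finite support, and $M(\xi,\theta)=\sum_{x\in\mathrm{supp}(\xi)}\xi(x)f_\theta(x)f_\theta(x)^{T}$. A locally D-optimal design at $\overline{\theta}$ is a design $\xi^*_{\overline{\theta}}$ maximizing $\det M(\xi,\overline{\theta})$ over all designs $\xi$. Let $n_{\mathrm{st}}\in\mathbb{N}$, $\xi_n=\frac1n\sum_{i=1}^n\delta_{X_i}$ for $n\ge n_{\mathrm{st}}$ (a random design; $\delta_x$ is the point mass at $x$), where $M(\xi_{n_{\mathrm{st}}},\theta)$ is positive definite for all $\theta\in\Theta$. The algorithm uses $\Theta$-valued adaptive estimators $\widehat{\theta}_n=\widehat{\theta}_n(X_1,Y_1,\dots,X_n,Y_n)$, $n\ge n_{\mathrm{st}}$, and for each $n\ge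 n_{\mathrm{st}}$ the point $X_{n+1}$ is (pathwise) a maximizer over $x\in\mathcal{X}$ of $f_{\widehat{\theta}_n}(x)^{T}M^{-1}(\xi_n,\widehat{\theta}_n)f_{\widehat{\theta}_n}(x)$. The estimators $\widehat{\theta}_n$ may or may not be the ML-estimators below. ML-estimators. For $n\ge n_{\mathrm{st}}$, $\widehat{\theta}_n^{(\mathrm{ML})}=\widehat{\theta}_n^{(\mathrm{ML})}(X_1,Y_1,\dots,X_n,Y_n)$ is a maximizer over $\theta\in\Theta$ of the log-likelihood $L_n(\theta)=\sum_{i=1}^n\bigl(\log K(Y_i)+\tau_i(\theta)Y_i-b(\tau_i(\theta))\bigr)$, where $\tau_i(\theta)=(b')^{-1}\bigl(G(f(X_i)^{T}\theta)\bigr)$. ($K(Y_i)>0$ for all $i$ with probability one, and this positivity is assumed in the log-likelihood.) Notation. $M^{1/2}$ is the symmetric positive definite square root of a positive definite matrix $M$; $\mathrm{N}(0,C)$ is the $p$-dimensional normal distribution with mean $0$ and covariance matrix $C$; $I_p$ is the $p\times p$ identity matrix. *)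

theory Defs
  imports "HOL-Probability.Probability"
begin

section \<open>Matrices\<close>

definition outer :: "real^'p \<Rightarrow> real^'p^'p" where
  "outer v = (\<chi> i j. v $ i * v $ j)"

definition pos_def :: "real^'p^'p \<Rightarrow> bool" where
  "pos_def A \<longleftrightarrow> transpose A = A \<and> (\<forall>v. v \<noteq> 0 \<longrightarrow> v \<bullet> (A *v v) > 0)"

text \<open>Meaningful for positive definite \<open>A\<close> only, where existence and uniqueness hold.\<close>

definition matrix_sqrt :: "real^'p^'p \<Rightarrow> real^'p^'p" where
  "matrix_sqrt A = (THE B. pos_def B \<and> B ** B = A)"


section \<open>Convergence in distribution and the multivariate normal distribution\<close>

text \<open>\<^const>\<open>weak_conv_m\<close> is restricted to measures on the real line; this is the usual notion for
  measures on a topological space, by means of bounded continuous test functions.\<close>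

definition weak_conv_measures ::
    "(nat \<Rightarrow> 'a::topological_space measure) \<Rightarrow> 'a measure \<Rightarrow> bool" where
  "weak_conv_measures \<mu> \<nu> \<longleftrightarrow>
     (\<forall>g :: 'a \<Rightarrow> real. continuous_on UNIV g \<longrightarrow> bounded (range g) \<longrightarrow>
        (\<lambda>n. \<integral>x. g x \<partial>\<mu> n) \<longlonglongrightarrow> (\<integral>x. g x \<partial>\<nu>))"

definition converges_in_distribution ::
    "'w measure \<Rightarrow> (nat \<Rightarrow> 'w \<Rightarrow> 'a::topological_space) \<Rightarrow> 'a measure \<Rightarrow> bool" where
  "converges_in_distribution M Z \<mu> \<longleftrightarrow> weak_conv_measures (\<lambda>n. distr M borel (Z n)) \<mu>"

text \<open>The \<open>p\<close>-dimensional normal distribution with mean \<open>m\<close> and positive definite covariance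
  matrix \<open>C\<close>. Degenerate covariance matrices are not covered.\<close>

definition multi_normal :: "real^'p \<Rightarrow> real^'p^'p \<Rightarrow> (real^'p) measure" where
  "multi_normal m C = density lborel (\<lambda>x. ennreal
     (exp (- ((x - m) \<bullet> (matrix_inv C *v (x - m))) / 2) / sqrt ((2 * pi) ^ CARD('p) * det C)))"


section \<open>Conditional distributions\<close>

text \<open>The Markov kernel \<open>\<kappa>\<close> is a (regular) conditional distribution of \<open>Y\<close> given the
  sub-sigma-field \<open>F\<close>.\<close>

definition is_cond_distribution ::
    "'w measure \<Rightarrow> 'w measure \<Rightarrow> ('w \<Rightarrow> real) \<Rightarrow> ('w \<Rightarrow> real measure) \<Rightarrow> bool" where
  "is_cond_distribution M F Y \<kappa> \<longleftrightarrow>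
     \<kappa> \<in> F \<rightarrow>\<^sub>M prob_algebra borel \<and>
     (\<forall>B \<in> sets borel. AE \<omega> in M.
        real_cond_exp M F (indicat_real (Y -` B)) \<omega> = measure (\<kappa> \<omega>) B)"


section \<open>One-parameter exponential families in canonical parametrization\<close>

definition expfam :: "real measure \<Rightarrow> (real \<Rightarrow> real) \<Rightarrow> (real \<Rightarrow> real) \<Rightarrow> real \<Rightarrow> real measure" where
  "expfam \<nu> K b \<tau> = density \<nu> (\<lambda>y. ennreal (K y * exp (\<tau> * y - b \<tau>)))"

text \<open>Since the variance integral is required to be nonzero, it is a convergent one, and hence so
  is the integral for the mean.\<close>

locale exponential_family =
  fixes \<nu> :: "real measure" and K b :: "real \<Rightarrow> real" and J :: "real set"
  assumes open_J: "open J" and interval_J: "is_interval J"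
    and sets_nu: "sets \<nu> = sets borel"
    and K_measurable: "K \<in> borel_measurable borel"
    and K_nonneg: "\<And>y. K y \<ge> 0"
    and b_smooth: "\<And>k \<tau>. \<tau> \<in> J \<Longrightarrow> (deriv ^^ k) b differentiable (at \<tau>)"
    and prob: "\<And>\<tau>. \<tau> \<in> J \<Longrightarrow> prob_space (expfam \<nu> K b \<tau>)"
    and mean: "\<And>\<tau>. \<tau> \<in> J \<Longrightarrow> (\<integral>y. y \<partial>expfam \<nu> K b \<tau>) = deriv b \<tau>"
    and var: "\<And>\<tau>. \<tau> \<in> J \<Longrightarrow> (\<integral>y. (y - deriv b \<tau>)\<^sup>2 \<partial>expfam \<nu> K b \<tau>) = deriv (deriv b) \<tau>"
    and var_pos: "\<And>\<tau>. \<tau> \<in> J \<Longrightarrow> deriv (deriv b) \<tau> > 0"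

text \<open>The canonical parameter \<open>\<tau>\<close> for which the expectation \<open>b' \<tau>\<close> equals \<open>e\<close>.\<close>

definition canonical :: "(real \<Rightarrow> real) \<Rightarrow> real set \<Rightarrow> real \<Rightarrow> real" where
  "canonical b J e = inv_into J (deriv b) e"


section \<open>The generalized linear model\<close>

definition glm_tau :: "(real \<Rightarrow> real) \<Rightarrow> real set \<Rightarrow> (real \<Rightarrow> real) \<Rightarrow> ('x \<Rightarrow> real^'p) \<Rightarrow>
    real^'p \<Rightarrow> 'x \<Rightarrow> real" where
  "glm_tau b J G f \<theta> x = canonical b J (G (f x \<bullet> \<theta>))"

definition glm_phi :: "(real \<Rightarrow> real) \<Rightarrow> real set \<Rightarrow> (real \<Rightarrow> real) \<Rightarrow> real \<Rightarrow> real" where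
  "glm_phi b J G u = deriv G u / sqrt (deriv (deriv b) (canonical b J (G u)))"

definition f_theta :: "(real \<Rightarrow> real) \<Rightarrow> real set \<Rightarrow> (real \<Rightarrow> real) \<Rightarrow> ('x \<Rightarrow> real^'p) \<Rightarrow>
    real^'p \<Rightarrow> 'x \<Rightarrow> real^'p" where
  "f_theta b J G f \<theta> x = glm_phi b J G (f x \<bullet> \<theta>) *\<^sub>R f x"

definition log_likelihood :: "(real \<Rightarrow> real) \<Rightarrow> (real \<Rightarrow> real) \<Rightarrow> real set \<Rightarrow> (real \<Rightarrow> real) \<Rightarrow>
    ('x \<Rightarrow> real^'p) \<Rightarrow> nat \<Rightarrow> (nat \<Rightarrow> 'x) \<Rightarrow> (nat \<Rightarrow> real) \<Rightarrow> real^'p \<Rightarrow> real" where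
  "log_likelihood K b J G f n x y \<theta> =
     (\<Sum>i = 1..n. (ln (K (y i)) + glm_tau b J G f \<theta> (x i) * y i - b (glm_tau b J G f \<theta> (x i))))"


section \<open>Designs\<close>

definition design :: "'x set \<Rightarrow> 'x pmf \<Rightarrow> bool" where
  "design \<X> \<xi> \<longleftrightarrow> finite (set_pmf \<xi>) \<and> set_pmf \<xi> \<subseteq> \<X>"

text \<open>The information matrix of \<open>\<xi>\<close> for the regression function \<open>h\<close>; the matrix
  \<open>M(\<xi>, \<theta>)\<close> is obtained for \<open>h = f_theta b J G f \<theta>\<close>.\<close>

definition info_matrix :: "('x \<Rightarrow> real^'p) \<Rightarrow> 'x pmf \<Rightarrow> real^'p^'p" where
  "info_matrix h \<xi> = (\<Sum>x \<in> set_pmf \<xi>. pmf \<xi> x *\<^sub>R outer (h x))"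

definition D_optimal :: "'x set \<Rightarrow> ('x \<Rightarrow> real^'p) \<Rightarrow> 'x pmf \<Rightarrow> bool" where
  "D_optimal \<X> h \<xi> \<longleftrightarrow> is_arg_max (\<lambda>\<eta>. det (info_matrix h \<eta>)) (design \<X>) \<xi>"

text \<open>The uniform distribution on \<open>x 1, \<dots>, x n\<close>, counted with multiplicities, for \<open>n \<ge> 1\<close>.\<close>

definition empirical_design :: "nat \<Rightarrow> (nat \<Rightarrow> 'x) \<Rightarrow> 'x pmf" where
  "empirical_design n x = map_pmf x (pmf_of_set {1..n})"

text \<open>\<open>T\<close> is a \<open>\<Theta>\<close>-valued function of the first \<open>n\<close> observations. Measurability is not included.\<close>

definition estimator :: "'w measure \<Rightarrow> (nat \<Rightarrow> 'w \<Rightarrow> 'x) \<Rightarrow> (nat \<Rightarrow> 'w \<Rightarrow> real) \<Rightarrow> 't set \<Rightarrow>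
    nat \<Rightarrow> ('w \<Rightarrow> 't) \<Rightarrow> bool" where
  "estimator M X Y \<Theta> n T \<longleftrightarrow>
     (\<exists>t. \<forall>\<omega> \<in> space M. T \<omega> = t (\<lambda>i\<in>{1..n}. (X i \<omega>, Y i \<omega>)) \<and> T \<omega> \<in> \<Theta>)"

end

theory Submission
  imports Defs "HOL-Real_Asymp.Real_Asymp"
begin

text \<open>The proof separates the design, the likelihood along a single path, and the probability theory.

  Write \<open>\<delta> n\<close> for the difference of \<open>ln \<circ> det\<close> between the best possible information matrix at \<open>\<theta>bar\<close> and the one
  that is attained after \<open>n\<close> observations. Concavity of \<open>ln \<circ> det\<close> and the matrix determinant lemma show that a
  step of the Wynn algorithm reduces \<open>\<delta> n\<close> by about \<open>\<delta> n / n\<close>. As \<open>\<Sum>1/n\<close> diverges, \<open>\<delta> n\<close> tends to \<open>0\<close>, and by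
  strict concavity the information matrices converge to the unique maximiser of the determinant
  (\<open>wynn_convergence\<close>). This survives the use of \<open>\<theta>hat n\<close> in place of \<open>\<theta>bar\<close>, because the regression
  functions at the two parameters differ by scalar factors that tend to \<open>1\<close> uniformly
  (\<open>adaptive_wynn_convergence\<close>). Hence the design stabilises whatever the adaptive estimators are, provided that
  they converge to \<open>\<theta>bar\<close>.

  For the likelihood, the laws of large numbers for martingales with bounded fourth moments
  (\<open>martingale_slln\<close>) hold outside a null set. There the argument is deterministic (locale \<open>ml_path\<close>): the
  Kullback-Leibler divergence grows quadratically, which gives consistency, and an expansion of the score
  equation gives \<open>sqrt n (\<theta>mle n - \<theta>bar) = opt_info\<^sup>-\<^sup>1 (nscore n) + o (norm (nscore n))\<close>, where \<open>nscore n\<close> is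
  the score at \<open>\<theta>bar\<close> divided by \<open>sqrt n\<close>, and \<open>opt_info\<close> is the limit of the information matrices
  (\<open>asymptotic_linearity\<close>).

  The score is a martingale with bounded third conditional moments whose normalised conditional covariances
  are the information matrices. Since these converge to the constant \<open>opt_info\<close>, its one-dimensional projections
  are asymptotically normal, in the form of convergence of \<open>E cos (t \<bullet> nscore n + c)\<close> (\<open>martingale_clt\<close>).
  Smoothing by a small Gaussian perturbation turns convergence of these integrals, together with tightness, into
  weak convergence in \<open>p\<close> dimensions (\<open>weak_conv_measures_if_cos\<close>). Slutsky's lemma transfers the limit law to
  the estimators; for the first claim the convergence of the information matrices at \<open>\<theta>mle n\<close> and the
  continuity of the matrix square root are used in addition.\<close>

section \<open>Symmetric and positive definite matrices\<close>

lemma inner_matrix_symmetric: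
  fixes A :: "real^'n^'n"
  assumes "transpose A = A"
  shows "v \<bullet> (A *v w) = (A *v v) \<bullet> w"
  by (metis assms dot_lmul_matrix transpose_matrix_vector)

lemma inner_transpose: "v \<bullet> (A *v w) = (transpose A *v v) \<bullet> w" for A :: "real^'n^'m"
  by (simp add: dot_lmul_matrix)

lemma norm_matrix_vector_le: "norm (A *v x) \<le> norm A * norm x" for A :: "real^'n^'m"
proof -
  have "norm (A *v x) = L2_set (\<lambda>i. (A *v x) $ i) UNIV"
    by (simp add: norm_vec_def L2_set_def)
  also have "\<dots> = sqrt (\<Sum>i\<in>UNIV. (A $ i \<bullet> x)\<^sup>2)"
    by (simp add: L2_set_def matrix_vector_mul_component)
  also have "\<dots> \<le> sqrt (\<Sum>i\<in>UNIV. (norm (A $ i) * norm x)\<^sup>2)"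
    by (intro real_sqrt_le_mono sum_mono)
       (metis Cauchy_Schwarz_ineq2 abs_ge_zero power2_abs power_mono)
  also have "\<dots> = norm A * norm x"
    by (simp add: norm_vec_def[of A] L2_set_def power_mult_distrib real_sqrt_mult
        flip: sum_distrib_right)
  finally show ?thesis .
qed

lemma norm_vec_power2: "(norm v)\<^sup>2 = (\<Sum>i\<in>UNIV. (v $ i)\<^sup>2)" for v :: "real^'n"
  unfolding power2_norm_eq_inner inner_vec_def by (simp add: power2_eq_square)

text \<open>An orthonormal family of eigenvectors that does not span is enlarged by a maximiser of
  the quadratic form on the unit sphere of its orthogonal complement: the first order condition at
  the maximum says that this maximiser is an eigenvector.\<close>

lemma eigenvector_orthogonal_exists:
  fixes A :: "real^'n^'n"
  assumes sym: "transpose A = A" and eig: "\<And>s. s \<in> S \<Longrightarrow> \<exists>c. A *v s = c *\<^sub>R s"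
    and S: "span S \<noteq> UNIV"
  obtains v c where "norm v = 1" "\<And>s. s \<in> S \<Longrightarrow> s \<bullet> v = 0" "A *v v = c *\<^sub>R v"
proof -
  define V where "V = {v. \<forall>s\<in>S. s \<bullet> v = 0}"
  have V_add: "x + y \<in> V" and V_scale: "r *\<^sub>R x \<in> V" if "x \<in> V" "y \<in> V" for x y r
    using that by (auto simp: V_def inner_add_right)
  have V_A: "A *v x \<in> V" if "x \<in> V" for x
    unfolding V_def
  proof safe
    fix s assume "s \<in> S"
    with eig obtain c where "A *v s = c *\<^sub>R s" by blast
    then show "s \<bullet> (A *v x) = 0"
      using that \<open>s \<in> S\<close> by (simp add: inner_matrix_symmetric[OF sym] V_def)
  qed
  obtain a where a: "a \<noteq> 0" "\<forall>x \<in> span S. a \<bullet> x = 0"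
    using span_not_UNIV_orthogonal[OF S] by blast
  have "a \<in> V" using a by (auto simp: V_def inner_commute span_base)
  define T where "T = V \<inter> sphere 0 1"
  have "closed V"
  proof -
    have "V = (\<Inter>s\<in>S. {v. s \<bullet> v = 0})" by (auto simp: V_def)
    then show ?thesis by (auto intro!: closed_INT closed_hyperplane)
  qed
  then have "compact T" unfolding T_def by (intro closed_Int_compact) auto
  moreover have "(1 / norm a) *\<^sub>R a \<in> T"
    using a V_scale[OF \<open>a \<in> V\<close> \<open>a \<in> V\<close>] by (auto simp: T_def)
  then have "T \<noteq> {}" by blast
  moreover have "continuous_on T (\<lambda>v. v \<bullet> (A *v v))"
    by (intro continuous_intros linear_continuous_on_compose[of _ id "(*v) A", simplified])
  ultimately obtain v where v: "v \<in> T" and vmax: "\<And>w. w \<in> T \<Longrightarrow> w \<bullet> (A *v w) \<le> v \<bullet> (A *v v)"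
    using continuous_attains_sup[of T "\<lambda>v. v \<bullet> (A *v v)"] by blast
  define c where "c = v \<bullet> (A *v v)"
  have nv: "norm v = 1" "v \<in> V" using v by (auto simp: T_def)
  have le: "w \<bullet> (A *v w) \<le> c * (w \<bullet> w)" if "w \<in> V" for w
  proof (cases "w = 0")
    case False
    have "(1 / norm w) *\<^sub>R w \<in> T" using False V_scale[OF that that] by (auto simp: T_def)
    from vmax[OF this] have "(1 / norm w) * (1 / norm w) * (w \<bullet> (A *v w)) \<le> c"
      by (simp add: matrix_vector_mult_scaleR c_def mult.assoc)
    then show ?thesis
      using False by (simp add: field_simps power2_norm_eq_inner[symmetric] power2_eq_square)
  qed simp
  define u where "u = c *\<^sub>R v - A *v v"
  have uV: "u \<in> V"
    using V_add[OF V_scale[OF nv(2) nv(2), of c] V_scale[OF V_A[OF nv(2)] nv(2), of "-1"]]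
    by (simp add: u_def)
  define q where "q = c * (u \<bullet> u) - u \<bullet> (A *v u)"
  \<comment> \<open>Maximality of \<open>v\<close> along the line through \<open>v\<close> in direction \<open>u\<close>; the linear term must vanish.\<close>
  have quad: "0 \<le> 2 * t * (u \<bullet> u) + t\<^sup>2 * q" for t
  proof -
    have "v + t *\<^sub>R u \<in> V" using V_add V_scale uV nv(2) by blast
    from le[OF this]
    have "0 \<le> c * ((v + t *\<^sub>R u) \<bullet> (v + t *\<^sub>R u)) - (v + t *\<^sub>R u) \<bullet> (A *v (v + t *\<^sub>R u))"
      by simp
    also have "\<dots> = c * (v \<bullet> v) - v \<bullet> (A *v v) + 2 * t * (c * (v \<bullet> u) - u \<bullet> (A *v v)) + t\<^sup>2 * q"
      by (simp add: q_def matrix_vector_right_distrib matrix_vector_mult_scaleR inner_add_left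
          inner_add_right inner_matrix_symmetric[OF sym, of v u] inner_commute power2_eq_square
          algebra_simps)
    also have "c * (v \<bullet> v) - v \<bullet> (A *v v) = 0"
      using nv by (simp add: c_def power2_norm_eq_inner[symmetric])
    also have "c * (v \<bullet> u) - u \<bullet> (A *v v) = u \<bullet> u"
      by (simp add: u_def inner_diff_right inner_commute algebra_simps)
    finally show ?thesis by simp
  qed
  have "u \<bullet> u = 0"
  proof (rule ccontr)
    assume "u \<bullet> u \<noteq> 0"
    then have pos: "u \<bullet> u > 0" by (simp add: inner_gt_zero_iff)
    define t where "t = - (u \<bullet> u) / (\<bar>q\<bar> + 1)"
    have "t < 0" using pos by (auto simp: t_def field_simps)
    have "2 * (u \<bullet> u) + t * q \<le> 0"
      using quad[of t] \<open>t < 0\<close> mult_pos_neg[of "2 * (u \<bullet> u) + t * q" t]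
      by (force simp: power2_eq_square algebra_simps)
    moreover have "\<bar>t * q\<bar> \<le> u \<bullet> u"
      using pos by (simp add: t_def abs_mult field_simps)
    ultimately show False using pos by linarith
  qed
  then have "A *v v = c *\<^sub>R v" by (simp add: u_def)
  then show thesis using that nv by (auto simp: V_def)
qed

definition diag_matrix :: "('n \<Rightarrow> real) \<Rightarrow> real^'n^'n" where
  "diag_matrix d = (\<chi> i j. if i = j then d i else 0)"

lemma diag_matrix_mult: "diag_matrix d ** diag_matrix e = diag_matrix (\<lambda>i. d i * e i)"
proof -
  have "(if i = k then d i else 0) * (if k = j then e k else 0) =
      (if k = i then (if i = j then d i * e i else 0) else 0)" for i j k
    by auto
  then show ?thesis by (simp add: diag_matrix_def matrix_matrix_mult_def vec_eq_iff)
qed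

lemma transpose_diag_matrix [simp]: "transpose (diag_matrix d) = diag_matrix d"
  by (auto simp: diag_matrix_def transpose_def vec_eq_iff)

lemma det_diag_matrix [simp]: "det (diag_matrix d) = (\<Prod>i\<in>UNIV. d i)"
  by (subst det_diagonal) (auto simp: diag_matrix_def)

lemma trace_diag_matrix [simp]: "trace (diag_matrix d) = (\<Sum>i\<in>UNIV. d i)"
  by (simp add: trace_def diag_matrix_def)

lemma mat_1_eq_diag_matrix: "mat 1 = diag_matrix (\<lambda>_. 1)"
  by (simp add: mat_def diag_matrix_def)

lemma diag_matrix_vector: "(diag_matrix d *v v) $ i = d i * v $ i"
  by (simp add: diag_matrix_def matrix_vector_mult_def if_distrib if_distribR cong: if_cong)

lemma inner_diag_matrix: "v \<bullet> (diag_matrix d *v v) = (\<Sum>i\<in>UNIV. d i * (v $ i)\<^sup>2)"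
  by (simp add: inner_vec_def diag_matrix_vector power2_eq_square algebra_simps)

lemma orthonormal_eigenvectors:
  fixes A :: "real^'n^'n"
  assumes sym: "transpose A = A" and "k \<le> CARD('n)"
  shows "\<exists>S. finite S \<and> card S = k \<and> (\<forall>s\<in>S. norm s = 1) \<and> pairwise orthogonal S \<and>
           (\<forall>s\<in>S. \<exists>c. A *v s = c *\<^sub>R s)"
  using assms(2)
proof (induction k)
  case 0
  then show ?case by (intro exI[of _ "{}"]) auto
next
  case (Suc k)
  then obtain S where S: "finite S" "card S = k" "\<forall>s\<in>S. norm s = 1" "pairwise orthogonal S"
    "\<And>s. s \<in> S \<Longrightarrow> \<exists>c. A *v s = c *\<^sub>R s"
    by (auto simp: Suc_le_eq)
  have "dim S \<le> card S" using S(1) by (rule dim_le_card')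
  then have "dim S < CARD('n)" using S(2) Suc.prems by simp
  then have "span S \<noteq> UNIV" by (metis dim_span dim_UNIV DIM_cart DIM_real mult.right_neutral less_irrefl)
  from eigenvector_orthogonal_exists[OF sym S(5) this]
  obtain v c where v: "norm v = 1" "\<And>s. s \<in> S \<Longrightarrow> s \<bullet> v = 0" "A *v v = c *\<^sub>R v" by metis
  have "v \<notin> S" using v by fastforce
  have "pairwise orthogonal (insert v S)"
    using S(4) v(2) by (auto simp: pairwise_insert orthogonal_def inner_commute)
  then show ?case
    using S v \<open>v \<notin> S\<close> by (intro exI[of _ "insert v S"]) auto
qed

theorem spectral_theorem:
  fixes A :: "real^'n^'n"
  assumes sym: "transpose A = A"
  obtains Q d where "orthogonal_matrix Q" "A = Q ** diag_matrix d ** transpose Q"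
proof -
  obtain S where S: "finite S" "card S = CARD('n)" "\<forall>s\<in>S. norm s = 1" "pairwise orthogonal S"
    "\<And>s. s \<in> S \<Longrightarrow> \<exists>c. A *v s = c *\<^sub>R s"
    using orthonormal_eigenvectors[OF sym order_refl] by blast
  obtain q where q: "bij_betw q (UNIV :: 'n set) S"
    using S finite_same_card_bij[of "UNIV :: 'n set" S] by auto
  have "\<forall>i. \<exists>c. A *v q i = c *\<^sub>R q i" using S(5) q by (auto simp: bij_betw_def)
  then obtain d where d: "\<And>i. A *v q i = d i *\<^sub>R q i" by metis
  have qq: "q i \<bullet> q j = (if i = j then 1 else 0)" for i j
  proof (cases "i = j")
    case True
    then show ?thesis using S(3) q by (auto simp: bij_betw_def power2_norm_eq_inner[symmetric])
  next
    case False
    then have "q i \<noteq> q j" "q i \<in> S" "q j \<in> S" using q by (auto simp: bij_betw_def inj_on_def)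
    then show ?thesis using S(4) False by (auto simp: pairwise_def orthogonal_def)
  qed
  define Q :: "real^'n^'n" where "Q = (\<chi> i j. q j $ i)"
  have "transpose Q ** Q = mat 1"
    using qq by (simp add: Q_def transpose_def matrix_matrix_mult_def mat_def vec_eq_iff inner_vec_def)
  then have Q: "orthogonal_matrix Q" by (simp add: orthogonal_matrix)
  have "(A ** Q) $ i $ j = (Q ** diag_matrix d) $ i $ j" for i j
  proof -
    have "(A ** Q) $ i $ j = (A *v q j) $ i"
      by (simp add: Q_def matrix_matrix_mult_def matrix_vector_mult_def)
    also have "\<dots> = (Q ** diag_matrix d) $ i $ j"
      by (simp add: d Q_def matrix_matrix_mult_def diag_matrix_def if_distrib cong: if_cong)
    finally show ?thesis .
  qed
  then have "A ** Q = Q ** diag_matrix d" by (simp add: vec_eq_iff)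
  then have "A = Q ** diag_matrix d ** transpose Q"
    by (metis Q orthogonal_matrix_def matrix_mul_assoc matrix_mul_rid)
  then show thesis using that Q by blast
qed

lemma diag_conj_mult:
  assumes "orthogonal_matrix Q"
  shows "(Q ** diag_matrix d ** transpose Q) ** (Q ** diag_matrix e ** transpose Q) =
         Q ** diag_matrix (\<lambda>i. d i * e i) ** transpose Q"
proof -
  have "(Q ** diag_matrix d ** transpose Q) ** (Q ** diag_matrix e ** transpose Q) =
      Q ** diag_matrix d ** (transpose Q ** Q) ** diag_matrix e ** transpose Q"
    by (simp add: matrix_mul_assoc)
  also have "\<dots> = Q ** (diag_matrix d ** diag_matrix e) ** transpose Q"
    using assms by (simp add: orthogonal_matrix_def matrix_mul_assoc)
  finally show ?thesis by (simp add: diag_matrix_mult)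
qed

lemma diag_conj_1: "orthogonal_matrix Q \<Longrightarrow> Q ** diag_matrix (\<lambda>_. 1) ** transpose Q = mat 1"
  by (simp add: orthogonal_matrix_def flip: mat_1_eq_diag_matrix)

lemma transpose_diag_conj: "transpose (Q ** diag_matrix d ** transpose Q) = Q ** diag_matrix d ** transpose Q"
  by (simp add: matrix_transpose_mul matrix_mul_assoc)

lemma det_diag_conj:
  assumes "orthogonal_matrix Q"
  shows "det (Q ** diag_matrix d ** transpose Q) = (\<Prod>i\<in>UNIV. d i)"
proof -
  have "det Q * det Q = 1"
    using det_orthogonal_matrix[OF assms] by auto
  then show ?thesis by (simp add: det_mul)
qed

lemma trace_diag_conj:
  assumes "orthogonal_matrix Q"
  shows "trace (Q ** diag_matrix d ** transpose Q) = (\<Sum>i\<in>UNIV. d i)"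
  using assms by (subst trace_mul_sym) (simp add: matrix_mul_assoc orthogonal_matrix_def)

lemma inner_diag_conj:
  "v \<bullet> (Q ** diag_matrix d ** transpose Q *v v) = (\<Sum>i\<in>UNIV. d i * ((transpose Q *v v) $ i)\<^sup>2)"
proof -
  have "v \<bullet> (Q ** diag_matrix d ** transpose Q *v v) = 
      (transpose Q *v v) \<bullet> (diag_matrix d *v (transpose Q *v v))"
    by (simp add: matrix_vector_mul_assoc[symmetric] inner_transpose[of v Q] del: transpose_matrix_vector)
  then show ?thesis by (simp only: inner_diag_matrix)
qed

lemma orthogonal_matrix_eq_0_iff:
  "orthogonal_matrix Q \<Longrightarrow> transpose Q *v v = 0 \<longleftrightarrow> v = 0" for Q :: "real^'n^'n"
  by (metis matrix_vector_mul_assoc matrix_vector_mul_lid matrix_vector_mult_0_right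
      orthogonal_matrix_def)

lemma diag_conj_axis:
  assumes "orthogonal_matrix Q"
  shows "(Q ** diag_matrix d ** transpose Q) *v (Q *v axis i 1) = d i *\<^sub>R (Q *v axis i 1)"
    and "norm (Q *v axis i 1) = 1"
proof -
  have "diag_matrix d *v axis i 1 = d i *\<^sub>R axis i 1"
    by (simp add: vec_eq_iff diag_matrix_vector axis_def)
  then show "(Q ** diag_matrix d ** transpose Q) *v (Q *v axis i 1) = d i *\<^sub>R (Q *v axis i 1)"
    using assms unfolding orthogonal_matrix_def
    by (metis matrix_mul_assoc matrix_mul_rid matrix_vector_mul_assoc matrix_vector_mult_scaleR)
  have "orthogonal_transformation ((*v) Q)"
    using assms by (simp add: orthogonal_transformation_matrix)
  then show "norm (Q *v axis i 1) = 1"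
    by (simp add: orthogonal_transformation_norm)
qed

lemma pos_def_diag_conj_iff:
  assumes Q: "orthogonal_matrix Q"
  shows "pos_def (Q ** diag_matrix d ** transpose Q) \<longleftrightarrow> (\<forall>i. d i > 0)"
proof
  assume pd: "pos_def (Q ** diag_matrix d ** transpose Q)"
  show "\<forall>i. d i > 0"
  proof
    fix i
    let ?q = "Q *v axis i 1"
    have n: "norm ?q = 1" by (rule diag_conj_axis[OF Q])
    then have "?q \<noteq> 0" by auto
    then have "?q \<bullet> ((Q ** diag_matrix d ** transpose Q) *v ?q) > 0"
      using pd unfolding pos_def_def by blast
    then show "d i > 0"
      using n by (simp add: diag_conj_axis(1)[OF Q] power2_norm_eq_inner[symmetric])
  qed
next
  assume d: "\<forall>i. d i > 0"
  show "pos_def (Q ** diag_matrix d ** transpose Q)"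
    unfolding pos_def_def
  proof (intro conjI allI impI)
    fix v :: "real^'a" assume "v \<noteq> 0"
    then have "transpose Q *v v \<noteq> 0" using orthogonal_matrix_eq_0_iff[OF Q] by blast
    then obtain i where "(transpose Q *v v) $ i \<noteq> 0" by (auto simp: vec_eq_iff)
    then show "v \<bullet> (Q ** diag_matrix d ** transpose Q *v v) > 0"
      unfolding inner_diag_conj using d
      by (intro sum_pos2[of _ i]) (auto simp: less_imp_le)
  qed (rule transpose_diag_conj)
qed

lemma pos_def_cases:
  fixes A :: "real^'n^'n"
  assumes "pos_def A"
  obtains Q d where "orthogonal_matrix Q" "A = Q ** diag_matrix d ** transpose Q" "\<And>i. d i > 0"
  by (metis assms pos_def_def pos_def_diag_conj_iff spectral_theorem)

lemma pos_def_det: "pos_def A \<Longrightarrow> det A > 0"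
  by (metis det_diag_conj pos_def_cases prod_pos)

lemma pos_def_invertible: "pos_def A \<Longrightarrow> invertible A"
  using pos_def_det[of A] by (simp add: invertible_det_nz)

lemma matrix_inv_mult:
  assumes "invertible (A :: real^'n^'n)"
  shows "A ** matrix_inv A = mat 1" "matrix_inv A ** A = mat 1"
  using someI_ex[OF assms[unfolded invertible_def]] by (auto simp: matrix_inv_def)

lemma matrix_inv_unique:
  assumes "A ** B = mat 1" shows "matrix_inv A = (B :: real^'n^'n)"
  by (metis assms invertible_right_inverse matrix_inv_mult(2) matrix_mul_assoc matrix_mul_lid
      matrix_mul_rid)

lemma matrix_inv_vector:
  assumes "pos_def A" shows "A *v (matrix_inv A *v v) = v" "matrix_inv A *v (A *v v) = v"
  using matrix_inv_mult[OF pos_def_invertible[OF assms]] by (simp_all add: matrix_vector_mul_assoc)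

lemma matrix_inv_diag_conj:
  assumes "orthogonal_matrix Q" "\<And>i. d i \<noteq> 0"
  shows "matrix_inv (Q ** diag_matrix d ** transpose Q) = Q ** diag_matrix (\<lambda>i. 1 / d i) ** transpose Q"
  using assms by (intro matrix_inv_unique) (simp add: diag_conj_mult diag_conj_1)

lemma pos_def_inv: "pos_def A \<Longrightarrow> pos_def (matrix_inv A)"
proof (erule pos_def_cases)
  fix Q and d :: "'a \<Rightarrow> real"
  assume Q: "orthogonal_matrix Q" and A: "A = Q ** diag_matrix d ** transpose Q" and d: "\<And>i. d i > 0"
  have "matrix_inv A = Q ** diag_matrix (\<lambda>i. 1 / d i) ** transpose Q"
    unfolding A using d by (intro matrix_inv_diag_conj Q) (metis less_irrefl)
  then show "pos_def (matrix_inv A)" using d by (simp add: pos_def_diag_conj_iff[OF Q])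
qed

lemma pos_def_lower_bound:
  fixes A :: "real^'n^'n"
  assumes "pos_def A"
  obtains c where "c > 0" "\<And>v. c * (norm v)\<^sup>2 \<le> v \<bullet> (A *v v)"
proof -
  from assms obtain Q d where Q: "orthogonal_matrix Q" and A: "A = Q ** diag_matrix d ** transpose Q"
    and d: "\<And>i. d i > 0" by (rule pos_def_cases) blast
  define c where "c = Min (range d)"
  have "c > 0" using d by (simp add: c_def)
  moreover have "c * (norm v)\<^sup>2 \<le> v \<bullet> (A *v v)" for v
  proof -
    have "orthogonal_transformation ((*v) (transpose Q))"
      using Q by (simp add: orthogonal_transformation_matrix orthogonal_matrix_def)
    then have "norm v = norm (transpose Q *v v)" 
      by (simp only: orthogonal_transformation_norm)
    then have "c * (norm v)\<^sup>2 = (\<Sum>i\<in>UNIV. c * ((transpose Q *v v) $ i)\<^sup>2)"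
      by (simp only: norm_vec_power2 sum_distrib_left)
    also have "\<dots> \<le> v \<bullet> (A *v v)"
      unfolding A inner_diag_conj
      by (intro sum_mono mult_right_mono) (auto simp: c_def)
    finally show ?thesis .
  qed
  ultimately show thesis by (rule that)
qed

text \<open>A unit eigenvector \<open>q\<close> of \<open>B - C\<close> with eigenvalue \<open>d\<close> satisfies
  \<open>q \<bullet> ((B\<^sup>2 - C\<^sup>2) q) = d (q \<bullet> (B q) + q \<bullet> (C q))\<close>. Hence closeness of the squares forces
  closeness of the positive definite matrices themselves.\<close>

lemma pos_def_square_diff:
  fixes B C :: "real^'n^'n"
  assumes B: "pos_def B" and C: "pos_def C" and c: "c > 0" "\<And>v. c * (norm v)\<^sup>2 \<le> v \<bullet> (C *v v)"
  shows "\<bar>(B - C) $ i $ j\<bar> \<le> norm (B ** B - C ** C) / c"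
proof -
  have sym: "transpose B = B" "transpose C = C" using B C by (auto simp: pos_def_def)
  have "transpose (B - C) = B - C"
    using sym by (simp add: transpose_def vec_eq_iff)
  then obtain Q d where Q: "orthogonal_matrix Q" and X: "B - C = Q ** diag_matrix d ** transpose Q"
    by (rule spectral_theorem)
  define m where "m = norm (B ** B - C ** C) / c"
  have d: "\<bar>d k\<bar> \<le> m" for k
  proof -
    define q where "q = Q *v axis k 1"
    have q: "(B - C) *v q = d k *\<^sub>R q" "norm q = 1"
      using diag_conj_axis[OF Q] by (auto simp: X q_def)
    then have qq: "q \<noteq> 0" by auto
    have "q \<bullet> ((B ** B - C ** C) *v q) = q \<bullet> (B *v ((B - C) *v q)) + q \<bullet> ((B - C) *v (C *v q))"
      by (simp add: matrix_vector_mul_assoc[symmetric] matrix_vector_mult_diff_rdistrib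
          matrix_vector_mult_diff_distrib inner_diff_right)
    also have "q \<bullet> ((B - C) *v (C *v q)) = ((B - C) *v q) \<bullet> (C *v q)"
      by (rule inner_matrix_symmetric) fact
    finally have "q \<bullet> ((B ** B - C ** C) *v q) = d k * (q \<bullet> (B *v q) + q \<bullet> (C *v q))"
      unfolding q(1) by (simp add: matrix_vector_mult_scaleR algebra_simps)
    then have "\<bar>d k\<bar> * (q \<bullet> (B *v q) + q \<bullet> (C *v q)) = \<bar>q \<bullet> ((B ** B - C ** C) *v q)\<bar>"
      using B C qq add_pos_pos[of "q \<bullet> (B *v q)" "q \<bullet> (C *v q)"]
      unfolding pos_def_def by (simp add: abs_mult)
    also have "\<dots> \<le> norm (B ** B - C ** C)"
      using order_trans[OF Cauchy_Schwarz_ineq2 mult_left_mono[OF norm_matrix_vector_le]] q(2)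
      by (metis mult.right_neutral mult_1 norm_ge_zero)
    finally have "\<bar>d k\<bar> * (q \<bullet> (B *v q) + q \<bullet> (C *v q)) \<le> norm (B ** B - C ** C)" .
    moreover have "c \<le> q \<bullet> (B *v q) + q \<bullet> (C *v q)"
      using c(2)[of q] q(2) B qq unfolding pos_def_def by (simp add: add_increasing less_imp_le)
    ultimately have "\<bar>d k\<bar> * c \<le> norm (B ** B - C ** C)"
      by (meson abs_ge_zero mult_left_mono order_trans)
    then show ?thesis using c(1) by (simp add: m_def pos_le_divide_eq)
  qed
  have orth: "orthogonal_transformation ((*v) (transpose Q))"
    using Q by (simp add: orthogonal_transformation_matrix orthogonal_matrix_def)
  have "(B - C) $ i $ j = axis i 1 \<bullet> (Q ** diag_matrix d ** transpose Q *v axis j 1)"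
    by (simp add: X[symmetric] matrix_vector_mult_basis inner_axis' column_def)
  also have "\<dots> = (transpose Q *v axis i 1) \<bullet> (diag_matrix d *v (transpose Q *v axis j 1))"
    by (simp add: matrix_vector_mul_assoc[symmetric] inner_transpose[of _ Q] del: transpose_matrix_vector)
  finally have "\<bar>(B - C) $ i $ j\<bar> \<le> norm (transpose Q *v axis i 1) * norm (diag_matrix d *v (transpose Q *v axis j 1))"
    by (simp add: Cauchy_Schwarz_ineq2 del: transpose_matrix_vector)
  also have "norm (transpose Q *v axis i 1) = 1"
    using orth by (simp add: orthogonal_transformation_norm del: transpose_matrix_vector)
  also have "norm (diag_matrix d *v (transpose Q *v axis j 1)) \<le> norm (m *\<^sub>R (transpose Q *v axis j 1))"
    by (intro norm_le_componentwise_cart)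
       (simp add: diag_matrix_vector abs_mult mult_right_mono order_trans[OF d abs_ge_self] del: transpose_matrix_vector)
  also have "\<dots> = m"
    using orth order_trans[OF abs_ge_zero d] by (simp add: orthogonal_transformation_norm del: transpose_matrix_vector)
  finally show ?thesis by (simp add: m_def)
qed

lemma pos_def_square_inj: "pos_def B \<Longrightarrow> pos_def C \<Longrightarrow> B ** B = C ** C \<Longrightarrow> B = C"
proof -
  assume B: "pos_def B" and C: "pos_def C" and eq: "B ** B = C ** C"
  obtain c where c: "c > 0" "\<And>v. c * (norm v)\<^sup>2 \<le> v \<bullet> (C *v v)"
    using pos_def_lower_bound[OF C] by blast
  have "(B - C) $ i $ j = 0" for i j
    using pos_def_square_diff[OF B C c, of i j] eq by simp
  then show ?thesis by (simp add: vec_eq_iff)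
qed

lemma matrix_sqrt:
  assumes "pos_def A"
  shows pos_def_matrix_sqrt: "pos_def (matrix_sqrt A)"
    and matrix_sqrt_square: "matrix_sqrt A ** matrix_sqrt A = A"
proof -
  from assms obtain Q d where Q: "orthogonal_matrix Q" and A: "A = Q ** diag_matrix d ** transpose Q"
    and d: "\<And>i. d i > 0" by (rule pos_def_cases) blast
  define B where "B = Q ** diag_matrix (\<lambda>i. sqrt (d i)) ** transpose Q"
  have "pos_def B \<and> B ** B = A"
    using d by (simp add: B_def A diag_conj_mult[OF Q] pos_def_diag_conj_iff[OF Q] less_imp_le)
  then have "\<exists>!B. pos_def B \<and> B ** B = A" using pos_def_square_inj by metis
  from theI'[OF this] show "pos_def (matrix_sqrt A)" "matrix_sqrt A ** matrix_sqrt A = A"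
    by (auto simp: matrix_sqrt_def)
qed

lemma tendsto_matrix_sqrt:
  fixes A :: "real^'n^'n"
  assumes lim: "(a \<longlongrightarrow> A) net" and A: "pos_def A" and a: "eventually (\<lambda>x. pos_def (a x)) net"
  shows "((\<lambda>x. matrix_sqrt (a x)) \<longlongrightarrow> matrix_sqrt A) net"
proof (intro vec_tendstoI)
  fix i j
  obtain c where c: "c > 0" "\<And>v. c * (norm v)\<^sup>2 \<le> v \<bullet> (matrix_sqrt A *v v)"
    using pos_def_lower_bound[OF pos_def_matrix_sqrt[OF A]] by blast
  have "((\<lambda>x. norm (a x - A) / c) \<longlongrightarrow> norm (A - A) / c) net"
    using c(1) by (intro tendsto_intros lim) auto
  then have lim0: "((\<lambda>x. norm (a x - A) / c) \<longlongrightarrow> 0) net" by simp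
  have "eventually (\<lambda>x. \<bar>(matrix_sqrt (a x) - matrix_sqrt A) $ i $ j\<bar> \<le> norm (a x - A) / c) net"
    using a
  proof eventually_elim
    case (elim x)
    show ?case
      using pos_def_square_diff[OF pos_def_matrix_sqrt[OF elim] pos_def_matrix_sqrt[OF A] c, of i j]
      by (simp add: matrix_sqrt_square A elim)
  qed
  then have "((\<lambda>x. (matrix_sqrt (a x) - matrix_sqrt A) $ i $ j) \<longlongrightarrow> 0) net"
    by (intro Lim_null_comparison[OF _ lim0]) simp
  then show "((\<lambda>x. matrix_sqrt (a x) $ i $ j) \<longlongrightarrow> matrix_sqrt A $ i $ j) net"
    by (subst Lim_null) simp
qed

lemma matrix_inv_sqrt:
  assumes "pos_def A"
  defines "R \<equiv> matrix_inv (matrix_sqrt A)"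
  shows "pos_def R" "R ** matrix_sqrt A = mat 1" "matrix_sqrt A ** R = mat 1" "R ** R = matrix_inv A"
    "R ** A ** R = mat 1"
proof -
  define S where "S = matrix_sqrt A"
  have S: "pos_def S" "S ** S = A" using assms matrix_sqrt by (auto simp: S_def)
  have R: "pos_def R" unfolding R_def by (intro pos_def_inv S[unfolded S_def])
  have RS: "R ** S = mat 1" "S ** R = mat 1"
    using matrix_inv_mult[OF pos_def_invertible[OF S(1)]] by (auto simp: R_def S_def)
  show "pos_def R" "R ** matrix_sqrt A = mat 1" "matrix_sqrt A ** R = mat 1"
    using R RS by (simp_all add: S_def)
  have "A ** (R ** R) = S ** (S ** R) ** R" by (simp add: S(2)[symmetric] matrix_mul_assoc)
  then have "A ** (R ** R) = mat 1" by (simp add: RS)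
  then show "R ** R = matrix_inv A" by (metis matrix_inv_unique)
  have "R ** A ** R = (R ** S) ** (S ** R)" by (simp add: S(2)[symmetric] matrix_mul_assoc)
  then show "R ** A ** R = mat 1" by (simp add: RS)
qed

lemma pos_def_conj:
  fixes R :: "real^'n^'n"
  assumes N: "pos_def N" and R: "invertible R" shows "pos_def (transpose R ** N ** R)"
  unfolding pos_def_def
proof (intro conjI allI impI)
  show "transpose (transpose R ** N ** R) = transpose R ** N ** R"
    using N by (simp add: pos_def_def matrix_transpose_mul matrix_mul_assoc)
  fix v :: "real^'n" assume "v \<noteq> 0"
  then have "R *v v \<noteq> 0"
    using matrix_inv_mult(2)[OF R] by (metis matrix_vector_mul_assoc matrix_vector_mul_lid matrix_vector_mult_0_right)
  moreover have "v \<bullet> (transpose R ** N ** R *v v) = (R *v v) \<bullet> (N *v (R *v v))"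
    by (simp add: matrix_vector_mul_assoc[symmetric] inner_transpose[of v "transpose R"] del: transpose_matrix_vector)
  ultimately show "v \<bullet> (transpose R ** N ** R *v v) > 0"
    using N unfolding pos_def_def by simp
qed

text \<open>Concavity of \<open>ln \<circ> det\<close>. After the congruence by \<open>M\<^sup>-\<^sup>1\<^sup>/\<^sup>2\<close>, which turns \<open>M\<close> into the identity,
  the claim is \<open>ln t \<le> t - 1\<close> for every eigenvalue \<open>t\<close> of the other matrix.\<close>

lemma ln_det_diff_le:
  fixes M N :: "real^'n^'n"
  assumes M: "pos_def M" and N: "pos_def N"
  shows "ln (det N) - ln (det M) \<le> trace (matrix_inv M ** N) - CARD('n)"
    and "M \<noteq> N \<Longrightarrow> ln (det N) - ln (det M) < trace (matrix_inv M ** N) - CARD('n)"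
proof -
  define S where "S = matrix_sqrt M"
  define R where "R = matrix_inv S"
  note R = matrix_inv_sqrt[OF M, folded S_def, folded R_def]
  have sR: "transpose R = R" using R(1) by (simp add: pos_def_def)
  define C where "C = R ** N ** R"
  have "pos_def C" unfolding C_def using pos_def_conj[OF N pos_def_invertible[OF R(1)]] by (simp add: sR)
  then obtain Q d where Q: "orthogonal_matrix Q" and C: "C = Q ** diag_matrix d ** transpose Q"
    and d: "\<And>i. d i > 0" by (rule pos_def_cases) blast
  have SCS: "S ** C ** S = N"
  proof -
    have "S ** C ** S = (S ** R) ** N ** (R ** S)" by (simp add: C_def matrix_mul_assoc)
    then show ?thesis by (simp add: R)
  qed
  have "det N = det S * det S * det C" by (simp add: SCS[symmetric] det_mul)
  also have "det S * det S = det M"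
    by (simp add: S_def det_mul[symmetric] matrix_sqrt_square M)
  finally have detN: "det N = det M * (\<Prod>i\<in>UNIV. d i)" by (simp add: C det_diag_conj[OF Q])
  have d0: "d i \<noteq> 0" for i using d[of i] by simp
  have ln: "ln (det N) - ln (det M) = (\<Sum>i\<in>UNIV. ln (d i))"
    unfolding detN using pos_def_det[OF M] d prod_pos[of UNIV d]
    by (simp add: ln_mult_pos ln_prod d0)
  have "trace (matrix_inv M ** N) = trace (R ** (R ** N))" by (simp add: R(4)[symmetric] matrix_mul_assoc)
  also have "\<dots> = trace C" by (subst trace_mul_sym) (simp add: C_def)
  finally have tr: "trace (matrix_inv M ** N) - CARD('n) = (\<Sum>i\<in>UNIV. d i - 1)"
    by (simp add: C trace_diag_conj[OF Q] sum_subtractf)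
  show "ln (det N) - ln (det M) \<le> trace (matrix_inv M ** N) - CARD('n)"
    unfolding ln tr using d by (intro sum_mono ln_le_minus_one) auto
  assume "M \<noteq> N"
  have "\<exists>i. d i \<noteq> 1"
  proof (rule ccontr)
    assume "\<nexists>i. d i \<noteq> 1"
    then have "d = (\<lambda>_. 1)" by auto
    then have "C = mat 1" by (simp add: C diag_conj_1[OF Q])
    then have "N = M" using SCS by (simp add: S_def matrix_sqrt_square M)
    with \<open>M \<noteq> N\<close> show False by simp
  qed
  then obtain i where "d i \<noteq> 1" by blast
  then have "ln (d i) < d i - 1" using d[of i] ln_eq_minus_one[of "d i"] ln_le_minus_one[of "d i"] by force
  then show "ln (det N) - ln (det M) < trace (matrix_inv M ** N) - CARD('n)"
    unfolding ln tr using d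
    by (intro sum_strict_mono_ex1) (auto intro: ln_le_minus_one)
qed

text \<open>Strict concavity of \<open>ln \<circ> det\<close>: both matrices lie below the tangent at their midpoint, and the two trace
  terms add up to \<open>2 n\<close>.\<close>

lemma det_midpoint_less:
  fixes M N :: "real^'n^'n"
  assumes M: "pos_def M" and N: "pos_def N" and eq: "det M = det N" and ne: "M \<noteq> N"
  shows "det M < det ((1/2) *\<^sub>R (M + N))"
proof -
  let ?K = "(1/2) *\<^sub>R (M + N)"
  have K: "pos_def ?K"
    using M N unfolding pos_def_def
    by (auto simp: transpose_def vec_eq_iff matrix_vector_mult_add_rdistrib inner_add_right
        scaleR_matrix_vector_assoc[symmetric] intro!: add_pos_pos)
  have "?K \<noteq> M"
  proof
    assume "?K = M"
    then have "2 *\<^sub>R ?K = 2 *\<^sub>R M" by simp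
    then have "M + N = M + M" by (simp add: scaleR_2)
    then show False using ne by simp
  qed
  then have "ln (det M) - ln (det ?K) < trace (matrix_inv ?K ** M) - CARD('n)"
    by (intro ln_det_diff_le K M)
  moreover have "ln (det N) - ln (det ?K) \<le> trace (matrix_inv ?K ** N) - CARD('n)"
    by (intro ln_det_diff_le K N)
  moreover have "trace (matrix_inv ?K ** M) + trace (matrix_inv ?K ** N) = 2 * CARD('n)"
  proof -
    have "trace (matrix_inv ?K ** M) + trace (matrix_inv ?K ** N) = trace (matrix_inv ?K ** (2 *\<^sub>R ?K))"
      by (simp add: trace_add[symmetric] matrix_add_ldistrib)
    also have "\<dots> = trace (2 *\<^sub>R (mat 1 :: real^'n^'n))"
      using matrix_inv_mult(2)[OF pos_def_invertible[OF K]] matrix_scalar_ac[of "matrix_inv ?K" 2 ?K]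
        scalar_matrix_assoc[of 2 "matrix_inv ?K" ?K] by (simp only:)
    finally show ?thesis by (simp add: trace_def mat_def)
  qed
  ultimately have "ln (det M) < ln (det ?K)" using eq by simp
  then show ?thesis using pos_def_det[OF M] pos_def_det[OF K] by simp
qed

lemma matrix_add_rdistrib: "(A + B) ** C = A ** C + B ** C" for A B :: "real^'n^'m"
  by (simp add: matrix_matrix_mult_def vec_eq_iff distrib_right sum.distrib)

lemma outer_vector: "outer v *v w = (v \<bullet> w) *\<^sub>R v"
  by (simp add: outer_def matrix_vector_mult_def vec_eq_iff inner_vec_def sum_distrib_left
      algebra_simps)

lemma transpose_outer [simp]: "transpose (outer v) = outer v"
  by (simp add: outer_def transpose_def vec_eq_iff mult.commute)

lemma outer_conj: "A ** outer v ** transpose A = outer (A *v v)"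
  by (simp add: outer_def matrix_matrix_mult_def transpose_def matrix_vector_mult_def vec_eq_iff
      sum_distrib_left sum_distrib_right algebra_simps)

lemma trace_mult_outer: "trace (A ** outer v) = v \<bullet> (A *v v)"
  by (simp add: trace_def matrix_matrix_mult_def outer_def inner_vec_def matrix_vector_mult_def
      sum_distrib_left algebra_simps)

lemma outer_scaleR: "outer (c *\<^sub>R v) = c\<^sup>2 *\<^sub>R outer v"
  by (simp add: outer_def vec_eq_iff power2_eq_square)

text \<open>The matrix determinant lemma. For \<open>A = I\<close> an orthogonal transformation moves \<open>v\<close> to a
  coordinate axis, where the matrix is diagonal; the general case is a congruence by \<open>A\<^sup>1\<^sup>/\<^sup>2\<close>.\<close>

lemma det_add_outer:
  fixes A :: "real^'n^'n"
  assumes A: "pos_def A"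
  shows "det (A + outer v) = det A * (1 + v \<bullet> (matrix_inv A *v v))"
proof -
  define S where "S = matrix_sqrt A"
  define R where "R = matrix_inv S"
  note R = matrix_inv_sqrt[OF A, folded S_def, folded R_def]
  have sR: "transpose R = R" "transpose S = S"
    using R(1) pos_def_matrix_sqrt[OF A] by (simp_all add: pos_def_def S_def)
  define w where "w = R *v v"
  have Sw: "S *v w = v" by (simp add: w_def matrix_vector_mul_assoc R)
  have "A + outer v = S ** (mat 1 + outer w) ** S"
    using outer_conj[of S w] matrix_sqrt_square[OF A, folded S_def]
    by (simp add: Sw sR matrix_add_ldistrib matrix_add_rdistrib)
  then have "det (A + outer v) = det A * det (mat 1 + outer w)"
    by (simp add: det_mul matrix_sqrt_square[OF A, folded S_def, symmetric])
  also have "det (mat 1 + outer w) = 1 + w \<bullet> w"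
  proof -
    \<comment> \<open>any coordinate, the index type being nonempty\<close>
    obtain k :: 'n where True by simp
    obtain g where g: "orthogonal_transformation g" "g w = norm w *\<^sub>R axis k (1::real)"
      using orthogonal_transformation_exists[of w "norm w *\<^sub>R axis k (1::real)"] by auto
    define Q where "Q = matrix g"
    have Q: "orthogonal_matrix Q" and gQ: "g = (*v) Q"
      using g(1) by (auto simp: Q_def orthogonal_transformation_matrix matrix_works)
    have "Q ** (mat 1 + outer w) ** transpose Q = mat 1 + outer (norm w *\<^sub>R axis k 1)"
      using Q g(2) outer_conj[of Q w] 
      by (simp add: matrix_add_ldistrib matrix_add_rdistrib orthogonal_matrix_def gQ)
    also have "\<dots> = diag_matrix (\<lambda>i. if i = k then 1 + w \<bullet> w else 1)"
      by (auto simp: vec_eq_iff diag_matrix_def mat_def outer_def axis_def dot_square_norm power2_eq_square)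
    finally have "det (Q ** (mat 1 + outer w) ** transpose Q) = 1 + w \<bullet> w" by simp
    then have "det Q * det (mat 1 + outer w) * det Q = 1 + w \<bullet> w" by (simp add: det_mul)
    moreover have "det Q * det Q = 1" using det_orthogonal_matrix[OF Q] by auto
    ultimately show ?thesis by (metis mult.assoc mult.commute mult.right_neutral)
  qed
  also have "w \<bullet> w = v \<bullet> (matrix_inv A *v v)"
    by (simp add: w_def R(4)[symmetric] matrix_vector_mul_assoc[symmetric] inner_transpose[of v R] sR
       del: transpose_matrix_vector)
  finally show ?thesis .
qed

text \<open>The Loewner order is reversed by inversion, because \<open>v \<bullet> (A\<^sup>-\<^sup>1 v)\<close> is the maximum of
  \<open>2 (w \<bullet> v) - w \<bullet> (A w)\<close> over all \<open>w\<close>.\<close>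

lemma matrix_inv_antimono:
  fixes A B :: "real^'n^'n"
  assumes A: "pos_def A" and B: "pos_def B" and c: "c > 0"
    and le: "\<And>w. c * (w \<bullet> (A *v w)) \<le> w \<bullet> (B *v w)"
  shows "c * (v \<bullet> (matrix_inv B *v v)) \<le> v \<bullet> (matrix_inv A *v v)"
proof -
  \<comment> \<open>At \<open>w\<close> the variational lower bound for \<open>v \<bullet> (A\<^sup>-\<^sup>1 v)\<close> is at least the left-hand side of the claim.\<close>
  define w where "w = c *\<^sub>R (matrix_inv B *v v)"
  define z where "z = matrix_inv A *v v"
  have sA: "transpose A = A" using A by (simp add: pos_def_def)
  have Az: "A *v z = v" by (simp add: z_def matrix_inv_vector[OF A])
  have "0 \<le> (z - w) \<bullet> (A *v (z - w))"
    using A unfolding pos_def_def by (cases "z - w = 0") (auto intro: less_imp_le)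
  also have "\<dots> = z \<bullet> v - 2 * (w \<bullet> v) + w \<bullet> (A *v w)"
    using inner_matrix_symmetric[OF sA, of z w]
    by (simp add: matrix_vector_mult_diff_distrib inner_diff_left inner_diff_right Az inner_commute)
  finally have "2 * (w \<bullet> v) - w \<bullet> (A *v w) \<le> z \<bullet> v" by simp
  moreover have "c * (w \<bullet> (A *v w)) \<le> c * (w \<bullet> v)"
    using le[of w] by (simp add: w_def matrix_vector_mult_scaleR matrix_inv_vector[OF B] inner_commute)
  then have "w \<bullet> (A *v w) \<le> w \<bullet> v" using c by simp
  ultimately have "w \<bullet> v \<le> z \<bullet> v" by linarith
  then show ?thesis by (simp add: w_def z_def inner_commute)
qed

section \<open>Convergence of the Wynn recursion\<close>

text \<open>A defect \<open>\<delta> n \<ge> \<eta>\<close> decreases by at least \<open>\<eta> / (4 n)\<close>, while a defect below \<open>\<eta>\<close> increases by at most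
  \<open>p / n\<close>. As the harmonic series diverges, the defect falls below \<open>\<eta>\<close> at some time, and it cannot
  exceed \<open>2 \<eta>\<close> afterwards.\<close>

lemma wynn_defect_tendsto_0:
  fixes \<delta> :: "nat \<Rightarrow> real" and p :: real
  assumes p: "p > 0" and nonneg: "\<And>n. n \<ge> n0 \<Longrightarrow> \<delta> n \<ge> 0"
    and rec: "\<And>c. 0 < c \<Longrightarrow> c < 1 \<Longrightarrow> eventually (\<lambda>n.
       \<delta> (Suc n) \<le> \<delta> n + p * ln (1 + 1 / n) - ln (1 + c * (p + \<delta> n) / n)) sequentially"
  shows "\<delta> \<longlonglongrightarrow> 0"
proof -
  have bound: "eventually (\<lambda>n. \<delta> n \<le> 2 * \<eta>) sequentially" if \<eta>: "\<eta> > 0" for \<eta>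
  proof -
    \<comment> \<open>For \<open>\<delta> n \<ge> \<eta>\<close> the factor \<open>c < 1\<close> still leaves \<open>c (p + \<delta> n) \<ge> s\<close>, that is, a gain of \<open>\<eta> / 2\<close> over \<open>p\<close>.\<close>
    define s where "s = p + \<eta> / 2"
    have s: "s > 0" using p \<eta> by (simp add: s_def)
    define c where "c = s / (p + \<eta>)"
    have c: "0 < c" "c < 1" "c * (p + \<eta>) = s"
      using p \<eta> s by (auto simp: c_def s_def)
    have "eventually (\<lambda>n. real n \<ge> max (4 * s\<^sup>2 / \<eta>) (max s (p / \<eta>))) sequentially"
      using filterlim_real_sequentially unfolding filterlim_at_top by blast
    moreover have "eventually (\<lambda>n. n \<ge> max n0 1) sequentially" by (rule eventually_ge_at_top)
    ultimately have "eventually (\<lambda>n. \<delta> (Suc n) \<le> \<delta> n + p * ln (1 + 1 / n) - ln (1 + c * (p + \<delta> n) / n) \<and>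
        real n \<ge> 4 * s\<^sup>2 / \<eta> \<and> real n \<ge> s \<and> real n \<ge> p / \<eta> \<and> n \<ge> n0 \<and> n \<ge> 1) sequentially"
      using rec[OF c(1,2)] by eventually_elim auto
    then obtain N where N: "\<And>n. n \<ge> N \<Longrightarrow>
        \<delta> (Suc n) \<le> \<delta> n + p * ln (1 + 1 / n) - ln (1 + c * (p + \<delta> n) / n) \<and>
        real n \<ge> 4 * s\<^sup>2 / \<eta> \<and> real n \<ge> s \<and> real n \<ge> p / \<eta> \<and> n \<ge> n0 \<and> n \<ge> 1"
      unfolding eventually_sequentially by blast
    have ln_le: "p * ln (1 + 1 / n) \<le> p / n" for n :: nat
      using p ln_add_one_self_le_self[of "1 / n"] by (simp add: divide_inverse)
    have down: "\<delta> (Suc n) \<le> \<delta> n - \<eta> / (4 * n)" if n: "n \<ge> N" and ge: "\<delta> n \<ge> \<eta>" for n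
    proof -
      have n': "real n > 0" "n \<ge> n0" "n \<ge> 1" using N[OF n] by auto
      have "s \<le> c * (p + \<delta> n)" using c ge by (simp flip: c(3))
      then have "s / n \<le> c * (p + \<delta> n) / n" by (simp add: divide_right_mono)
      then have "ln (1 + s / n) \<le> ln (1 + c * (p + \<delta> n) / n)"
        using divide_pos_pos[OF s n'(1)] by (subst ln_le_cancel_iff) linarith+
      moreover have "s / n - (s / n)\<^sup>2 \<le> ln (1 + s / n)"
        using s N[OF n] n' by (intro ln_one_plus_pos_lower_bound) auto
      moreover have "(s / n)\<^sup>2 \<le> \<eta> / (4 * n)"
        using N[OF n] n' \<eta> by (simp add: field_simps power2_eq_square)
      moreover have "p / n - s / n = - 2 * (\<eta> / (4 * n))" using n' by (simp add: s_def field_simps)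
      moreover have "\<delta> (Suc n) \<le> \<delta> n + p * ln (1 + 1 / n) - ln (1 + c * (p + \<delta> n) / n)"
        using N[OF n] by blast
      ultimately show ?thesis using ln_le[of n] by linarith
    qed
    have up: "\<delta> (Suc n) \<le> 2 * \<eta>" if n: "n \<ge> N" and less: "\<delta> n < \<eta>" for n
    proof -
      have n': "real n > 0" "n \<ge> n0" "n \<ge> 1" using N[OF n] by auto
      have "0 \<le> c * (p + \<delta> n) / n" using n' c p nonneg[OF n'(2)] by simp
      then have "0 \<le> ln (1 + c * (p + \<delta> n) / n)" by simp
      moreover have "p / n \<le> \<eta>" using N[OF n] n' \<eta> by (simp add: field_simps)
      ultimately show ?thesis using N[OF n] ln_le[of n] less by simp
    qed
    have "\<exists>m\<ge>N. \<delta> m < \<eta>"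
    proof (rule ccontr)
      assume "\<not> ?thesis"
      then have big: "\<delta> n \<ge> \<eta>" if "n \<ge> N" for n using that by force
      have desc: "\<delta> (N + k) + \<eta> / 4 * ln (real (N + k)) \<le> \<delta> N + \<eta> / 4 * ln (real N)" for k
      proof (induction k)
        case (Suc k)
        have n: "real (N + k) > 0" using N[of "N + k"] by simp
        have "ln (real (N + Suc k)) - ln (real (N + k)) = ln (1 + 1 / real (N + k))"
        proof -
          have "1 + 1 / real (N + k) = real (N + Suc k) / real (N + k)" using n by (simp add: field_simps)
          then show ?thesis using n by (simp add: ln_div del: of_nat_Suc of_nat_add)
        qed
        also have "\<dots> \<le> 1 / real (N + k)" using ln_add_one_self_le_self[of "1 / real (N + k)"] by simp
        finally have *: "\<eta> / 4 * (ln (real (N + Suc k)) - ln (real (N + k))) \<le> \<eta> / 4 * (1 / real (N + k))"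
          using \<eta> by (intro mult_left_mono) auto
        then have "\<eta> / 4 * ln (real (N + Suc k)) \<le> \<eta> / 4 * ln (real (N + k)) + \<eta> / (4 * real (N + k))"
        proof -
          have "\<eta> / 4 * (1 / real (N + k)) = \<eta> / (4 * real (N + k))" by simp
          with * show ?thesis unfolding right_diff_distrib by linarith
        qed
        with down[of "N + k"] big[of "N + k"] Suc.IH show ?case by simp
      qed simp
      obtain k :: nat where k: "exp (ln (real N) + 4 * \<delta> N / \<eta>) < real k" using reals_Archimedean2 by blast
      have "exp (ln (real N) + 4 * \<delta> N / \<eta>) < real (N + k)" using k by simp
      then have "ln (real N) + 4 * \<delta> N / \<eta> < ln (real (N + k))"
        using N[of N] by (metis exp_gt_zero exp_less_cancel_iff exp_ln order_less_trans)
      then have "\<eta> / 4 * (ln (real N) + 4 * \<delta> N / \<eta>) < \<eta> / 4 * ln (real (N + k))"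
        using \<eta> by (intro mult_strict_left_mono) auto
      then have "\<eta> / 4 * ln (real N) + \<delta> N < \<eta> / 4 * ln (real (N + k))"
        using \<eta> by (simp add: distrib_left)
      with desc[of k] big[of "N + k"] \<eta> show False by simp
    qed
    then obtain m where m: "m \<ge> N" "\<delta> m < \<eta>" by blast
    have "\<delta> n \<le> 2 * \<eta>" if "n \<ge> m" for n
      using that
    proof (induction n rule: dec_induct)
      case base
      then show ?case using m \<eta> by simp
    next
      case (step n)
      then have n: "n \<ge> N" using m by simp
      show ?case
      proof (cases "\<delta> n < \<eta>")
        case True
        then show ?thesis by (rule up[OF n])
      next
        case False
        then have "\<delta> (Suc n) \<le> \<delta> n - \<eta> / (4 * n)" using down[OF n] by simp
        moreover have "0 \<le> \<eta> / (4 * n)" using \<eta> by simp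
        ultimately show ?thesis using step.IH by linarith
      qed
    qed
    then show ?thesis unfolding eventually_sequentially by blast
  qed
  show ?thesis
  proof (rule tendstoI)
    fix e :: real assume "e > 0"
    then have "eventually (\<lambda>n. \<delta> n \<le> 2 * (e / 4)) sequentially" by (intro bound) simp
    moreover have "eventually (\<lambda>n. n \<ge> n0) sequentially" by (rule eventually_ge_at_top)
    ultimately show "eventually (\<lambda>n. dist (\<delta> n) 0 < e) sequentially"
      by eventually_elim (use \<open>e > 0\<close> nonneg in \<open>auto simp: dist_real_def\<close>)
  qed
qed

lemma det_scaleR: "det (c *\<^sub>R A) = c ^ CARD('n) * det A" for A :: "real^'n^'n"
proof -
  have "c *\<^sub>R A = diag_matrix (\<lambda>_. c) ** A"
    by (simp add: diag_matrix_def matrix_matrix_mult_def vec_eq_iff if_distrib if_distribR cong: if_cong)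
  then show ?thesis by (simp add: det_mul)
qed

lemma pos_def_scaleR: "pos_def A \<Longrightarrow> c > 0 \<Longrightarrow> pos_def (c *\<^sub>R A)"
  unfolding pos_def_def by (auto simp: transpose_scalar scaleR_matrix_vector_assoc[symmetric])

lemma matrix_inv_scaleR:
  fixes A :: "real^'n^'n"
  assumes "pos_def A" "c > 0"
  shows "matrix_inv (c *\<^sub>R A) = (1 / c) *\<^sub>R matrix_inv A"
  using assms by (intro matrix_inv_unique)
    (simp add: matrix_scalar_ac scalar_matrix_assoc[symmetric] matrix_inv_mult(1)[OF pos_def_invertible])

lemma continuous_on_det: "continuous_on S (det :: real^'n^'n \<Rightarrow> real)"
  unfolding det_def by (intro continuous_intros)

definition psd :: "real^'n^'n \<Rightarrow> bool" where
  "psd A \<longleftrightarrow> transpose A = A \<and> (\<forall>v. 0 \<le> v \<bullet> (A *v v))"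

lemma psd_outer: "psd (outer v)"
  by (simp add: psd_def outer_vector inner_commute)

lemma psd_scaleR: "psd A \<Longrightarrow> c \<ge> 0 \<Longrightarrow> psd (c *\<^sub>R A)"
  unfolding psd_def by (auto simp: transpose_scalar scaleR_matrix_vector_assoc[symmetric])

lemma transpose_add: "transpose (A + B) = transpose A + transpose B"
  by (simp add: transpose_def vec_eq_iff)

lemma psd_add: "psd A \<Longrightarrow> psd B \<Longrightarrow> psd (A + B)"
  unfolding psd_def by (simp add: matrix_vector_mult_add_rdistrib inner_add_right transpose_add)

lemma pos_def_add_psd: "pos_def A \<Longrightarrow> psd B \<Longrightarrow> pos_def (A + B)"
  unfolding psd_def pos_def_def
  by (auto simp: matrix_vector_mult_add_rdistrib inner_add_right transpose_add intro: add_pos_nonneg)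

lemma psd_sum: "(\<And>i. i \<in> I \<Longrightarrow> psd (A i)) \<Longrightarrow> psd (\<Sum>i\<in>I. A i)"
proof (induction I rule: infinite_finite_induct)
  case (insert x F)
  then show ?case by (auto intro: psd_add)
qed (auto simp: psd_def transpose_def vec_eq_iff)

lemma psd_det_pos_def:
  assumes A: "psd A" and det: "det A \<noteq> 0"
  shows "pos_def A"
proof -
  obtain Q d where Q: "orthogonal_matrix Q" and Ad: "A = Q ** diag_matrix d ** transpose Q"
    using A spectral_theorem unfolding psd_def by blast
  have "d i > 0" for i
  proof -
    let ?q = "Q *v axis i 1"
    have "0 \<le> ?q \<bullet> (A *v ?q)" using A by (simp add: psd_def)
    then have "0 \<le> d i"
      unfolding Ad using diag_conj_axis(1)[OF Q, of d i] diag_conj_axis(2)[OF Q, of i] by (simp add: power2_norm_eq_inner[symmetric])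
    moreover have "d i \<noteq> 0" using det by (simp add: Ad det_diag_conj[OF Q])
    ultimately show ?thesis by simp
  qed
  then show ?thesis by (simp add: Ad pos_def_diag_conj_iff[OF Q])
qed

lemma psd_hull: "N \<in> convex hull (outer ` S) \<Longrightarrow> psd N"
proof -
  have "convex (Collect psd)"
    by (auto simp: convex_def intro: psd_add psd_scaleR)
  moreover have "outer ` S \<subseteq> Collect psd" by (auto simp: psd_outer)
  ultimately show "N \<in> convex hull (outer ` S) \<Longrightarrow> psd N" using hull_minimal[of "outer ` S"] by blast
qed

lemma trace_hull_le:
  assumes N: "N \<in> convex hull (outer ` S)" and le: "\<And>v. v \<in> S \<Longrightarrow> v \<bullet> (A *v v) \<le> m"
  shows "trace (A ** N) \<le> m"
proof -
  have "convex {N. trace (A ** N) \<le> m}"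
  proof (rule convexI)
    fix x y :: "real^'a^'a" and u v :: real
    assume *: "x \<in> {N. trace (A ** N) \<le> m}" "y \<in> {N. trace (A ** N) \<le> m}" "0 \<le> u" "0 \<le> v" "u + v = 1"
    have "trace (A ** (u *\<^sub>R x + v *\<^sub>R y)) = u * trace (A ** x) + v * trace (A ** y)"
      by (simp add: matrix_add_ldistrib trace_add matrix_scalar_ac scalar_matrix_assoc[symmetric])
         (simp add: trace_def sum_distrib_left)
    also have "\<dots> \<le> u * m + v * m" using * by (intro add_mono mult_left_mono) auto
    also have "\<dots> = m" using *(5) by (simp flip: distrib_right)
    finally show "u *\<^sub>R x + v *\<^sub>R y \<in> {N. trace (A ** N) \<le> m}" by simp
  qed
  moreover have "outer ` S \<subseteq> {N. trace (A ** N) \<le> m}" using le by (auto simp: trace_mult_outer)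
  ultimately show ?thesis using N hull_minimal[of "outer ` S"] by blast
qed

lemma compact_outer_hull: "compact S \<Longrightarrow> compact (convex hull (outer ` S))" for S :: "(real^'n) set"
proof -
  have "continuous_on S outer"
    unfolding outer_def by (intro continuous_intros)
  then show "compact S \<Longrightarrow> ?thesis" by (intro compact_convex_hull compact_continuous_image)
qed

text \<open>The midpoint of two different maximisers would have a larger determinant.\<close>

lemma det_max_unique:
  assumes N: "N \<in> convex hull (outer ` S)" "\<And>L. L \<in> convex hull (outer ` S) \<Longrightarrow> det L \<le> det N" "det N > 0"
    and L: "L \<in> convex hull (outer ` S)" "det L \<ge> det N"
  shows "L = N"
proof (rule ccontr)
  assume "L \<noteq> N"
  have eq: "det L = det N" using N L by (meson antisym)
  then have "pos_def L" "pos_def N"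
    using psd_det_pos_def psd_hull N L by (metis less_irrefl)+
  then have "det L < det ((1/2) *\<^sub>R (L + N))" using eq \<open>L \<noteq> N\<close> by (rule det_midpoint_less)
  moreover have "(1/2) *\<^sub>R (L + N) \<in> convex hull (outer ` S)"
    using convexD[OF convex_convex_hull L(1) N(1), of "1/2" "1/2"] by (simp add: scaleR_add_right)
  ultimately show False using N(2) eq by fastforce
qed

text \<open>With \<open>\<delta> n = ln (det N) - ln (det (M n))\<close>, concavity of \<open>ln \<circ> det\<close> shows that the maximum of
  \<open>y \<bullet> (M n)\<^sup>-\<^sup>1 y\<close> is at least \<open>p + \<delta> n\<close>, and the matrix determinant lemma turns this into the recursion
  for \<open>\<delta>\<close> above. Strict concavity then gives convergence of the matrices. The factors \<open>c < 1\<close> allow for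
  an asymptotically exact maximisation.\<close>

theorem wynn_convergence:
  fixes S :: "(real^'p) set" and z :: "nat \<Rightarrow> real^'p"
  defines "H \<equiv> convex hull (outer ` S)" and "A \<equiv> \<lambda>n. \<Sum>i=1..n. outer (z i)"
  assumes S: "compact S" and z: "\<And>i. i \<ge> 1 \<Longrightarrow> z i \<in> S"
    and n0: "n0 \<ge> 1" "pos_def (A n0)"
    and step: "\<And>c. 0 < c \<Longrightarrow> c < 1 \<Longrightarrow> eventually (\<lambda>n. \<forall>y\<in>S.
        c * (y \<bullet> (matrix_inv (A n) *v y)) \<le> z (Suc n) \<bullet> (matrix_inv (A n) *v z (Suc n))) sequentially"
    and N: "N \<in> H" "\<And>L. L \<in> H \<Longrightarrow> det L \<le> det N"
  shows "(\<lambda>n. (1 / real n) *\<^sub>R A n) \<longlonglongrightarrow> N"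
proof -
  define M where "M = (\<lambda>n. (1 / real n) *\<^sub>R A n)"
  have A_Suc: "A (Suc n) = A n + outer (z (Suc n))" for n by (simp add: A_def)
  have pdA: "pos_def (A n)" if "n \<ge> n0" for n
    using that by (induction n rule: dec_induct) (auto simp: n0 A_Suc intro: pos_def_add_psd psd_outer)
  have pdM: "pos_def (M n)" if "n \<ge> n0" for n
    unfolding M_def using that n0 by (intro pos_def_scaleR pdA) auto
  have MH: "M n \<in> H" if "n \<ge> 1" for n
  proof -
    have "(\<Sum>i=1..n. (1 / real n) *\<^sub>R outer (z i)) \<in> H"
      unfolding H_def using that
      by (intro convex_sum) (auto intro!: hull_inc imageI z)
    then show ?thesis by (simp add: M_def A_def scaleR_sum_right)
  qed
  have detM: "det (M n) \<le> det N" "det (M n) > 0" if "n \<ge> n0" for n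
    using that n0 N(2)[OF MH[of n]] pos_def_det[OF pdM] by auto
  have detN: "det N > 0" using detM[of n0] by simp
  have pdN: "pos_def N" using psd_det_pos_def[of N] psd_hull N(1) detN by (auto simp: H_def)
  define \<delta> where "\<delta> = (\<lambda>n. ln (det N) - ln (det (M n)))"
  have "\<delta> \<longlonglongrightarrow> 0"
  proof (rule wynn_defect_tendsto_0[of "real CARD('p)" n0])
    show "0 \<le> \<delta> n" if "n \<ge> n0" for n using detM[OF that] by (simp add: \<delta>_def)
    fix c :: real assume c: "0 < c" "c < 1"
    let ?p = "real CARD('p)"
    from step[OF c] eventually_ge_at_top[of n0]
    show "eventually (\<lambda>n. \<delta> (Suc n) \<le> \<delta> n + ?p * ln (1 + 1 / n) - ln (1 + c * (?p + \<delta> n) / n)) sequentially"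
    proof eventually_elim
    case (elim n)
    then have n: "n \<ge> n0" "n \<ge> 1" using n0 by auto
    let ?q = "z (Suc n) \<bullet> (matrix_inv (A n) *v z (Suc n))"
    have invM: "matrix_inv (M n) = real n *\<^sub>R matrix_inv (A n)"
      unfolding M_def using n by (subst matrix_inv_scaleR[OF pdA]) auto
    \<comment> \<open>The trace is linear in \<open>N\<close>, so it is at most its maximum over the extreme points of the hull.\<close>
    have "trace (matrix_inv (M n) ** N) \<le> real n * ?q / c"
    proof (rule trace_hull_le[OF N(1)[unfolded H_def]])
      fix v assume "v \<in> S"
      with elim c have "v \<bullet> (matrix_inv (A n) *v v) \<le> ?q / c"
        by (simp add: pos_le_divide_eq mult.commute)
      then have "real n * (v \<bullet> (matrix_inv (A n) *v v)) \<le> real n * (?q / c)"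
        by (intro mult_left_mono) auto
      then show "v \<bullet> (matrix_inv (M n) *v v) \<le> real n * ?q / c"
        by (simp add: invM scaleR_matrix_vector_assoc[symmetric])
    qed
    with ln_det_diff_le(1)[OF pdM[OF n(1)] pdN] have "?p + \<delta> n \<le> real n * ?q / c"
      by (simp add: \<delta>_def)
    then have q: "c * (?p + \<delta> n) / n \<le> ?q" using c n by (simp add: field_simps)
    have detA: "det (A m) = real m ^ CARD('p) * det (M m)" if "m \<ge> 1" for m
      using that by (simp add: M_def det_scaleR power_divide)
    have "det (A (Suc n)) = det (A n) * (1 + ?q)"
      unfolding A_Suc by (rule det_add_outer[OF pdA[OF n(1)]])
    then have eq: "real (Suc n) ^ CARD('p) * det (M (Suc n)) = real n ^ CARD('p) * det (M n) * (1 + ?q)"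
      using detA[of n] detA[of "Suc n"] n by simp
    have "0 \<le> ?q"
      using pos_def_inv[OF pdA[OF n(1)]] unfolding pos_def_def
      by (cases "z (Suc n) = 0") (auto intro: less_imp_le)
    then have "?p * ln (real (Suc n)) + ln (det (M (Suc n))) = ?p * ln (real n) + ln (det (M n)) + ln (1 + ?q)"
      using arg_cong[OF eq, of ln] detM(2)[of n] detM(2)[of "Suc n"] n
      by (simp add: ln_mult_pos ln_realpow del: of_nat_Suc)
    moreover have "ln (real (Suc n)) - ln (real n) = ln (1 + 1 / real n)"
    proof -
      have "1 + 1 / real n = real (Suc n) / real n" using n by (simp add: field_simps)
      then show ?thesis using n by (simp add: ln_div del: of_nat_Suc)
    qed
    then have "?p * ln (real (Suc n)) = ?p * ln (real n) + ?p * ln (1 + 1 / real n)"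
      by (simp add: algebra_simps)
    moreover have "ln (1 + c * (?p + \<delta> n) / n) \<le> ln (1 + ?q)"
    proof -
      have "0 \<le> c * (?p + \<delta> n) / n"
        using c detM[OF n(1)] by (simp add: \<delta>_def)
      then show ?thesis using q by simp
    qed
    ultimately show "\<delta> (Suc n) \<le> \<delta> n + ?p * ln (1 + 1 / n) - ln (1 + c * (?p + \<delta> n) / n)"
      by (simp add: \<delta>_def)
    qed
  qed simp
  then have "(\<lambda>n. exp (ln (det N) - \<delta> n)) \<longlonglongrightarrow> exp (ln (det N) - 0)"
    by (intro tendsto_intros)
  moreover have "eventually (\<lambda>n. exp (ln (det N) - \<delta> n) = det (M n)) sequentially"
    using eventually_ge_at_top[of n0] by eventually_elim (simp add: \<delta>_def detM)
  ultimately have lim: "(\<lambda>n. det (M n)) \<longlonglongrightarrow> det N"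
    using detN by (simp add: tendsto_cong)
  have "M \<longlonglongrightarrow> N"
  proof (rule tendstoI)
    fix e :: real assume e: "e > 0"
    define T where "T = H \<inter> {L. e \<le> dist L N}"
    have "compact T"
      unfolding T_def H_def
      by (intro compact_Int_closed compact_outer_hull S closed_Collect_le continuous_intros)
    have "\<exists>c<det N. \<forall>L\<in>T. det L \<le> c"
    proof (cases "T = {}")
      case False
      then obtain L where L: "L \<in> T" "\<And>L'. L' \<in> T \<Longrightarrow> det L' \<le> det L"
        using continuous_attains_sup[OF \<open>compact T\<close> False continuous_on_det] by blast
      have "L \<noteq> N" using L(1) e by (auto simp: T_def)
      then have "det L < det N"
        using det_max_unique[of N S L] N L(1) detN by (fastforce simp: H_def T_def not_le[symmetric])
      with L show ?thesis by blast
    qed (auto intro: exI[of _ "det N - 1"])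
    then obtain c where c: "c < det N" "\<And>L. L \<in> T \<Longrightarrow> det L \<le> c" by blast
    have "eventually (\<lambda>n. c < det (M n)) sequentially" using lim c(1) by (rule order_tendstoD)
    moreover have "eventually (\<lambda>n. n \<ge> 1) sequentially" by (rule eventually_ge_at_top)
    ultimately show "eventually (\<lambda>n. dist (M n) N < e) sequentially"
      by eventually_elim (use c(2) MH in \<open>force simp: T_def not_less\<close>)
  qed
  then show ?thesis by (simp add: M_def)
qed

text \<open>As the factors \<open>r n\<close> tend to \<open>1\<close> uniformly, maximising the variance function of
  \<open>\<lambda>x. r n x *\<^sub>R a x\<close> is, up to factors tending to \<open>1\<close>, the same as maximising
  that of \<open>a\<close>, by monotonicity of the matrix inverse.\<close>

theorem adaptive_wynn_convergence:
  fixes D :: "'x set" and a :: "'x \<Rightarrow> real^'p" and r :: "nat \<Rightarrow> 'x \<Rightarrow> real" and x :: "nat \<Rightarrow> 'x"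
  defines "H \<equiv> convex hull (outer ` a ` D)"
    and "B \<equiv> \<lambda>n. (1 / real n) *\<^sub>R (\<Sum>i=1..n. outer (r n (x i) *\<^sub>R a (x i)))"
  assumes D: "compact (a ` D)" and x: "\<And>i. i \<ge> 1 \<Longrightarrow> x i \<in> D"
    and n0: "n0 \<ge> 1" "pos_def (\<Sum>i=1..n0. outer (a (x i)))"
    and r: "uniform_limit D r (\<lambda>_. 1) sequentially"
    and max: "\<And>n y. n \<ge> n0 \<Longrightarrow> y \<in> D \<Longrightarrow>
       (r n y *\<^sub>R a y) \<bullet> (matrix_inv (B n) *v (r n y *\<^sub>R a y)) \<le>
       (r n (x (Suc n)) *\<^sub>R a (x (Suc n))) \<bullet> (matrix_inv (B n) *v (r n (x (Suc n)) *\<^sub>R a (x (Suc n))))"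
    and N: "N \<in> H" "\<And>L. L \<in> H \<Longrightarrow> det L \<le> det N"
  shows "(\<lambda>n. (1 / real n) *\<^sub>R (\<Sum>i=1..n. outer (a (x i)))) \<longlonglongrightarrow> N"
proof -
  define A where "A = (\<lambda>n. \<Sum>i=1..n. outer (a (x i)))"
  have A_Suc: "A (Suc n) = A n + outer (a (x (Suc n)))" for n by (simp add: A_def)
  have pdA: "pos_def (A n)" if "n \<ge> n0" for n
    using that
  proof (induction n rule: dec_induct)
    case base
    show ?case using n0(2) by (simp add: A_def)
  qed (auto simp: A_Suc intro: pos_def_add_psd psd_outer)
  have qA: "v \<bullet> (A n *v v) = (\<Sum>i=1..n. (a (x i) \<bullet> v)\<^sup>2)" for v n
    by (induction n) (auto simp: A_def matrix_vector_mult_add_rdistrib inner_add_right outer_vector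
        power2_eq_square inner_commute)
  have qB: "v \<bullet> (B n *v v) = (1 / real n) * (\<Sum>i=1..n. (r n (x i))\<^sup>2 * (a (x i) \<bullet> v)\<^sup>2)" for v n
  proof -
    have "v \<bullet> ((\<Sum>i=1..m. outer (r n (x i) *\<^sub>R a (x i))) *v v) = (\<Sum>i=1..m. (r n (x i))\<^sup>2 * (a (x i) \<bullet> v)\<^sup>2)" for m
      by (induction m) (auto simp: matrix_vector_mult_add_rdistrib inner_add_right outer_vector
        power2_eq_square inner_commute)
    then show ?thesis by (simp add: B_def scaleR_matrix_vector_assoc[symmetric])
  qed
  have key: "\<exists>N\<ge>n0. \<forall>n\<ge>N. \<forall>y\<in>D. ((1 - \<epsilon>) / (1 + \<epsilon>))\<^sup>2 * (a y \<bullet> (matrix_inv (A n) *v a y)) \<le>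
      a (x (Suc n)) \<bullet> (matrix_inv (A n) *v a (x (Suc n)))" if \<epsilon>: "0 < \<epsilon>" "\<epsilon> < 1" for \<epsilon>
  proof -
    have "uniform_limit D (\<lambda>n y. (r n y)\<^sup>2) (\<lambda>_. 1\<^sup>2) sequentially"
      unfolding power2_eq_square by (intro uniform_lim_mult r) (auto simp: image_constant_conv)
    then have "eventually (\<lambda>n. \<forall>y\<in>D. dist ((r n y)\<^sup>2) (1\<^sup>2) < \<epsilon>) sequentially"
      using \<epsilon>(1) by (rule uniform_limitD)
    then obtain N where N: "\<And>n y. n \<ge> N \<Longrightarrow> y \<in> D \<Longrightarrow> \<bar>(r n y)\<^sup>2 - 1\<bar> < \<epsilon>"
      unfolding eventually_sequentially by (auto simp: dist_real_def)
    show ?thesis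
    proof (intro exI[of _ "max N n0"] conjI allI impI ballI)
      fix n y assume n: "max N n0 \<le> n" and y: "y \<in> D"
      then have n': "n \<ge> n0" "n \<ge> 1" "real n > 0" using n0 by auto
      have rb: "1 - \<epsilon> \<le> (r n u)\<^sup>2" "(r n u)\<^sup>2 \<le> 1 + \<epsilon>" if "u \<in> D" for u
        using N[of n u] that n by auto
      let ?A = "(1 / real n) *\<^sub>R A n"
      have pA: "pos_def ?A" using pdA[OF n'(1)] n' by (intro pos_def_scaleR) auto
      have lo: "(1 - \<epsilon>) * (v \<bullet> (?A *v v)) \<le> v \<bullet> (B n *v v)"
        and up: "v \<bullet> (B n *v v) \<le> (1 + \<epsilon>) * (v \<bullet> (?A *v v))" for v
        unfolding qB scaleR_matrix_vector_assoc[symmetric] inner_scaleR_right qA sum_distrib_left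
        using rb x
        by (auto intro!: sum_mono simp: mult.left_commute[of _ "1 / real n"] intro!: mult_left_mono mult_right_mono divide_right_mono)
      have pB: "pos_def (B n)"
      proof -
        have "psd (B n)" unfolding B_def by (intro psd_scaleR psd_sum psd_outer) simp
        moreover have "0 < v \<bullet> (B n *v v)" if "v \<noteq> 0" for v
        proof -
          have "0 < (1 - \<epsilon>) * (v \<bullet> (?A *v v))"
            using pA \<epsilon> that unfolding pos_def_def by (intro mult_pos_pos) auto
          with lo[of v] show ?thesis by linarith
        qed
        ultimately show ?thesis unfolding pos_def_def psd_def by blast
      qed
      have i1: "(1 - \<epsilon>) * (v \<bullet> (matrix_inv (B n) *v v)) \<le> v \<bullet> (matrix_inv ?A *v v)" for v
        using \<epsilon> by (intro matrix_inv_antimono pA pB lo) auto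
      have i2: "(1 / (1 + \<epsilon>)) * (v \<bullet> (matrix_inv ?A *v v)) \<le> v \<bullet> (matrix_inv (B n) *v v)" for v
        using \<epsilon> up by (intro matrix_inv_antimono pA pB) (auto simp: field_simps)
      let ?u = "x (Suc n)"
      have u: "?u \<in> D" by (intro x) simp
      have nonneg: "0 \<le> v \<bullet> (matrix_inv (B n) *v v)" for v
        using pos_def_inv[OF pB] unfolding pos_def_def by (cases "v = 0") (auto intro: less_imp_le)
      have "(1 - \<epsilon>) / (1 + \<epsilon>) * (a y \<bullet> (matrix_inv ?A *v a y)) = (1 - \<epsilon>) * ((1 / (1 + \<epsilon>)) * (a y \<bullet> (matrix_inv ?A *v a y)))"
        by simp
      also have "\<dots> \<le> (1 - \<epsilon>) * (a y \<bullet> (matrix_inv (B n) *v a y))"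
        using \<epsilon> by (intro mult_left_mono i2) auto
      also have "\<dots> \<le> (r n y)\<^sup>2 * (a y \<bullet> (matrix_inv (B n) *v a y))"
        by (intro mult_right_mono rb y nonneg)
      also have "\<dots> \<le> (r n ?u)\<^sup>2 * (a ?u \<bullet> (matrix_inv (B n) *v a ?u))"
        using max[OF n'(1) y] by (simp add: matrix_vector_mult_scaleR power2_eq_square mult.assoc)
      also have "\<dots> \<le> (1 + \<epsilon>) * (a ?u \<bullet> (matrix_inv (B n) *v a ?u))"
        by (intro mult_right_mono rb u nonneg)
      finally have "(1 - \<epsilon>) * ((1 - \<epsilon>) / (1 + \<epsilon>) * (a y \<bullet> (matrix_inv ?A *v a y))) \<le>
          (1 - \<epsilon>) * ((1 + \<epsilon>) * (a ?u \<bullet> (matrix_inv (B n) *v a ?u)))"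
        using \<epsilon> by (intro mult_left_mono) auto
      also have "\<dots> \<le> (1 + \<epsilon>) * (a ?u \<bullet> (matrix_inv ?A *v a ?u))"
        using i1[of "a ?u"] \<epsilon> by (simp add: mult.left_commute)
      finally have fin: "(1 - \<epsilon>) * ((1 - \<epsilon>) / (1 + \<epsilon>) * (a y \<bullet> (matrix_inv ?A *v a y))) \<le>
          (1 + \<epsilon>) * (a ?u \<bullet> (matrix_inv ?A *v a ?u))" .
      have "((1 - \<epsilon>) / (1 + \<epsilon>))\<^sup>2 * (a y \<bullet> (matrix_inv ?A *v a y)) \<le> a ?u \<bullet> (matrix_inv ?A *v a ?u)"
      proof -
        define t where "t = (1 - \<epsilon>) / (1 + \<epsilon>)"
        have t: "1 - \<epsilon> = (1 + \<epsilon>) * t" using \<epsilon> by (simp add: t_def)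
        from fin have "(1 + \<epsilon>) * (t\<^sup>2 * (a y \<bullet> (matrix_inv ?A *v a y))) \<le> (1 + \<epsilon>) * (a ?u \<bullet> (matrix_inv ?A *v a ?u))"
          unfolding t_def[symmetric] unfolding t by (simp add: power2_eq_square mult.assoc)
        then show ?thesis using \<epsilon> by (simp add: t_def)
      qed
      then have "n * (((1 - \<epsilon>) / (1 + \<epsilon>))\<^sup>2 * (a y \<bullet> (matrix_inv (A n) *v a y))) \<le> n * (a ?u \<bullet> (matrix_inv (A n) *v a ?u))"
        using n' by (simp add: matrix_inv_scaleR[OF pdA] scaleR_matrix_vector_assoc[symmetric] mult.left_commute)
      then show "((1 - \<epsilon>) / (1 + \<epsilon>))\<^sup>2 * (a y \<bullet> (matrix_inv (A n) *v a y)) \<le>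
          a (x (Suc n)) \<bullet> (matrix_inv (A n) *v a (x (Suc n)))"
        using n' by simp
    qed simp
  qed
  have step: "eventually (\<lambda>n. \<forall>y\<in>a ` D. c * (y \<bullet> (matrix_inv (A n) *v y)) \<le>
      a (x (Suc n)) \<bullet> (matrix_inv (A n) *v a (x (Suc n)))) sequentially" if c: "0 < c" "c < 1" for c
  proof -
    have "((\<lambda>\<epsilon>::real. ((1 - \<epsilon>) / (1 + \<epsilon>))\<^sup>2) \<longlongrightarrow> ((1 - 0) / (1 + 0))\<^sup>2) (at_right 0)"
      by (intro tendsto_intros) auto
    then have "eventually (\<lambda>\<epsilon>::real. c < ((1 - \<epsilon>) / (1 + \<epsilon>))\<^sup>2) (at_right 0)"
      by (rule order_tendstoD) (use c in simp)
    moreover have "eventually (\<lambda>\<epsilon>::real. 0 < \<epsilon> \<and> \<epsilon> < 1) (at_right 0)"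
      by (auto simp: eventually_at_right_field intro!: exI[of _ 1])
    ultimately have "eventually (\<lambda>\<epsilon>::real. c < ((1 - \<epsilon>) / (1 + \<epsilon>))\<^sup>2 \<and> 0 < \<epsilon> \<and> \<epsilon> < 1) (at_right 0)"
      by eventually_elim auto
    then obtain \<epsilon> where \<epsilon>: "c < ((1 - \<epsilon>) / (1 + \<epsilon>))\<^sup>2" "0 < \<epsilon>" "\<epsilon> < 1"
      using eventually_happens'[OF trivial_limit_at_right_real] by blast
    from key[OF \<epsilon>(2,3)] obtain N where N: "n0 \<le> N" "\<And>n y. n \<ge> N \<Longrightarrow> y \<in> D \<Longrightarrow>
        ((1 - \<epsilon>) / (1 + \<epsilon>))\<^sup>2 * (a y \<bullet> (matrix_inv (A n) *v a y)) \<le>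
        a (x (Suc n)) \<bullet> (matrix_inv (A n) *v a (x (Suc n)))" by blast
    show ?thesis
      unfolding eventually_sequentially
    proof (intro exI[of _ N] allI impI ballI)
      fix n y assume n: "N \<le> n" and "y \<in> a ` D"
      then obtain u where u: "u \<in> D" "y = a u" by blast
      have "0 \<le> y \<bullet> (matrix_inv (A n) *v y)"
        using pos_def_inv[OF pdA[of n]] N(1) n unfolding pos_def_def by (cases "y = 0") (auto intro: less_imp_le)
      then have "c * (y \<bullet> (matrix_inv (A n) *v y)) \<le> ((1 - \<epsilon>) / (1 + \<epsilon>))\<^sup>2 * (y \<bullet> (matrix_inv (A n) *v y))"
        using \<epsilon> by (intro mult_right_mono) auto
      with N(2)[OF n u(1)] u(2)
      show "c * (y \<bullet> (matrix_inv (A n) *v y)) \<le> a (x (Suc n)) \<bullet> (matrix_inv (A n) *v a (x (Suc n)))"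
        by simp
    qed
  qed
  show ?thesis
    using x n0 N step by (intro wynn_convergence[OF D, of "\<lambda>i. a (x i)"]) (auto simp: A_def H_def)
qed

section \<open>Weak convergence in Euclidean space\<close>

subsection \<open>The multivariate normal distribution\<close>

lemma sets_multi_normal [measurable_cong, simp]: "sets (multi_normal m C) = sets borel"
  by (simp add: multi_normal_def)

lemma space_multi_normal [simp]: "space (multi_normal m C) = UNIV"
  by (simp add: multi_normal_def)

lemma norm_power2_Basis: "(norm x)\<^sup>2 = (\<Sum>b\<in>Basis. (x \<bullet> b)\<^sup>2)" for x :: "'a::euclidean_space"
  unfolding power2_norm_eq_inner by (subst euclidean_inner) (simp add: power2_eq_square)

lemma std_multi_normal_density:
  fixes x :: "real^'n"
  shows "exp (- ((x - 0) \<bullet> (matrix_inv (mat 1) *v (x - 0))) / 2) / sqrt ((2 * pi) ^ CARD('n) * det (mat 1 :: real^'n^'n))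
       = (\<Prod>b\<in>Basis. std_normal_density (x \<bullet> b))"
proof -
  have inv: "matrix_inv (mat 1 :: real^'n^'n) = mat 1" by (rule matrix_inv_unique) simp
  have "(\<Prod>b\<in>(Basis :: (real^'n) set). std_normal_density (x \<bullet> b)) =
      (\<Prod>b\<in>(Basis :: (real^'n) set). exp (- (x \<bullet> b)\<^sup>2 / 2)) / sqrt (2 * pi) ^ card (Basis :: (real^'n) set)"
    by (simp add: std_normal_density_def prod_dividef prod.distrib field_simps power_one_over)
  also have "(\<Prod>b\<in>(Basis :: (real^'n) set). exp (- (x \<bullet> b)\<^sup>2 / 2)) = exp (- (x \<bullet> x) / 2)"
    unfolding power2_norm_eq_inner[symmetric] norm_power2_Basis
    by (simp add: exp_sum[symmetric] sum_negf sum_divide_distrib)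
  also have "sqrt (2 * pi) ^ card (Basis :: (real^'n) set) = sqrt ((2 * pi) ^ CARD('n))"
  proof -
    have "card (Basis :: (real^'n) set) = CARD('n)" by simp
    then show ?thesis by (simp only: real_sqrt_power)
  qed
  finally show ?thesis by (simp add: inv)
qed

lemma std_multi_normal_eq:
  "multi_normal 0 (mat 1 :: real^'n^'n) = density lborel (\<lambda>x. ennreal (\<Prod>b\<in>Basis. std_normal_density (x \<bullet> b)))"
  unfolding multi_normal_def std_multi_normal_density ..

lemma prob_space_std_multi_normal: "prob_space (multi_normal 0 (mat 1 :: real^'n^'n))"
proof
  have "emeasure (multi_normal 0 (mat 1 :: real^'n^'n)) (space (multi_normal 0 (mat 1 :: real^'n^'n))) =
      (\<integral>\<^sup>+ x. ennreal (\<Prod>b\<in>Basis. std_normal_density (x \<bullet> b)) \<partial>(lborel :: (real^'n) measure))"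
    by (simp add: std_multi_normal_eq emeasure_density)
  also have "\<dots> = (\<integral>\<^sup>+ x. (\<Prod>b\<in>Basis. ennreal (std_normal_density (x \<bullet> b))) \<partial>(lborel :: (real^'n) measure))"
    by (simp add: prod_ennreal)
  also have "\<dots> = (\<Prod>b\<in>(Basis :: (real^'n) set). \<integral>\<^sup>+ x. ennreal (std_normal_density x) \<partial>lborel)"
    by (rule nn_integral_lborel_prod) auto
  also have "(\<integral>\<^sup>+ x. ennreal (std_normal_density x) \<partial>lborel) = 1"
    using prob_space.emeasure_space_1[OF prob_space_normal_density[of 1 0]] by (simp add: emeasure_density)
  finally show "emeasure (multi_normal 0 (mat 1 :: real^'n^'n)) (space (multi_normal 0 (mat 1 :: real^'n^'n))) = 1"
    by simp
qed

lemma char_std_multi_normal: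
  fixes t :: "real^'n"
  shows "(LINT x|multi_normal 0 (mat 1). iexp (t \<bullet> x)) = complex_of_real (exp (- (norm t)\<^sup>2 / 2))"
proof -
  interpret P: product_sigma_finite "\<lambda>_::real^'n. lborel :: real measure" by standard
  have int: "integrable lborel (\<lambda>u. complex_of_real (std_normal_density u) * iexp (s * u))" for s
  proof -
    have "integrable lborel (\<lambda>u. std_normal_density u *\<^sub>R iexp (s * u))"
      by (rule Bochner_Integration.integrable_bound[of lborel std_normal_density])
         (auto intro: integrable_normal_moment[of 1 0 0, simplified])
    then show ?thesis by (simp add: scaleR_conv_of_real)
  qed
  have one: "(LINT u|lborel. complex_of_real (std_normal_density u) * iexp (s * u)) = complex_of_real (exp (- s\<^sup>2 / 2))" for s
    using char_std_normal_distribution[THEN fun_cong, of s]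
    by (simp add: char_def integral_density scaleR_conv_of_real)
  have "(LINT x|multi_normal 0 (mat 1). iexp (t \<bullet> x)) =
      (LINT x|lborel. (\<Prod>b\<in>Basis. std_normal_density (x \<bullet> b)) *\<^sub>R iexp (t \<bullet> x))"
    unfolding std_multi_normal_eq by (rule integral_density) (auto intro!: prod_nonneg)
  also have "\<dots> = (LINT x|lborel. (\<Prod>b\<in>Basis. complex_of_real (std_normal_density (x \<bullet> b)) * iexp ((t \<bullet> b) * (x \<bullet> b))))"
  proof (intro Bochner_Integration.integral_cong refl)
    fix x
    have "iexp (t \<bullet> x) = exp (\<Sum>b\<in>Basis. \<i> * complex_of_real ((t \<bullet> b) * (x \<bullet> b)))"
      by (subst euclidean_inner) (simp add: sum_distrib_left)
    also have "\<dots> = (\<Prod>b\<in>Basis. iexp ((t \<bullet> b) * (x \<bullet> b)))"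
      by (rule exp_sum) simp
    finally show "(\<Prod>b\<in>Basis. std_normal_density (x \<bullet> b)) *\<^sub>R iexp (t \<bullet> x) =
        (\<Prod>b\<in>Basis. complex_of_real (std_normal_density (x \<bullet> b)) * iexp ((t \<bullet> b) * (x \<bullet> b)))"
      by (simp only: scaleR_conv_of_real prod.distrib of_real_prod)
  qed
  also have "\<dots> = (LINT f|(\<Pi>\<^sub>M b\<in>(Basis::(real^'n) set). lborel).
      (\<Prod>b\<in>Basis. complex_of_real (std_normal_density (f b)) * iexp ((t \<bullet> b) * f b)))"
    unfolding lborel_eq[where 'a="real^'n"]
    by (subst integral_distr) (auto intro!: Bochner_Integration.integral_cong prod.cong)
  also have "\<dots> = (\<Prod>b\<in>Basis. LINT u|lborel. complex_of_real (std_normal_density u) * iexp ((t \<bullet> b) * u))"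
    by (rule P.product_integral_prod[OF finite_Basis int])
  also have "\<dots> = (\<Prod>b\<in>Basis. complex_of_real (exp (- (t \<bullet> b)\<^sup>2 / 2)))"
    unfolding one ..
  also have "\<dots> = complex_of_real (exp (- (norm t)\<^sup>2 / 2))"
    by (simp add: norm_power2_Basis exp_sum sum_negf[symmetric] sum_divide_distrib del: of_real_exp)
  finally show ?thesis by simp
qed

lemma cos_std_multi_normal:
  fixes t :: "real^'n"
  shows "(LINT x|multi_normal 0 (mat 1). cos (t \<bullet> x + c)) = exp (- (norm t)\<^sup>2 / 2) * cos c"
proof -
  interpret prob_space "multi_normal 0 (mat 1 :: real^'n^'n)" by (rule prob_space_std_multi_normal)
  have int: "integrable (multi_normal 0 (mat 1 :: real^'n^'n)) (\<lambda>x. cos (t \<bullet> x))"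
    "integrable (multi_normal 0 (mat 1 :: real^'n^'n)) (\<lambda>x. sin (t \<bullet> x))"
    by (auto intro!: integrable_const_bound[of _ 1])
  have i: "integrable (multi_normal 0 (mat 1 :: real^'n^'n)) (\<lambda>x. iexp (t \<bullet> x))"
    by (auto intro!: integrable_const_bound[of _ 1])
  have "(LINT x|multi_normal 0 (mat 1). cos (t \<bullet> x)) = Re (LINT x|multi_normal 0 (mat 1). iexp (t \<bullet> x))"
    using integral_Re[OF i] by (simp add: Re_exp)
  moreover have "(LINT x|multi_normal 0 (mat 1). sin (t \<bullet> x)) = Im (LINT x|multi_normal 0 (mat 1). iexp (t \<bullet> x))"
    using integral_Im[OF i] by (simp add: Im_exp)
  ultimately have "(LINT x|multi_normal 0 (mat 1). cos (t \<bullet> x)) = exp (- (norm t)\<^sup>2 / 2)"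
    "(LINT x|multi_normal 0 (mat 1). sin (t \<bullet> x)) = 0"
    unfolding char_std_multi_normal Re_complex_of_real Im_complex_of_real by simp_all
  then show ?thesis using int by (simp add: cos_add)
qed

lemma borel_measurable_matrix_vector [measurable]: "(*v) A \<in> borel_measurable borel" for A :: "real^'n^'m"
  by (intro borel_measurable_continuous_onI linear_continuous_on) auto

text \<open>By averaging over translations and Tonelli's theorem, the integral of \<open>f \<circ> (*v) Q\<close> is compared with that
  of \<open>f\<close>; the comparison factor is the measure of the unit ball, which \<open>Q\<close> maps onto itself.\<close>

lemma lborel_orthogonal:
  fixes Q :: "real^'n^'n"
  assumes Q: "orthogonal_matrix Q"
  shows "distr lborel borel ((*v) Q) = lborel"
proof (rule measure_eqI)
  fix X assume "X \<in> sets (distr lborel borel ((*v) Q))"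
  then have X[measurable]: "X \<in> sets borel" by simp
  define f :: "real^'n \<Rightarrow> ennreal" where "f = indicator X"
  define g :: "real^'n \<Rightarrow> ennreal" where "g = indicator (ball 0 1)"
  have [measurable]: "f \<in> borel_measurable borel" "g \<in> borel_measurable borel" by (auto simp: f_def g_def intro!: borel_measurable_indicator)
  define T where "T = (*v) (transpose Q)"
  have [measurable]: "T \<in> borel_measurable borel" unfolding T_def by measurable
  have QT: "Q *v T x = x" for x
    using Q unfolding T_def orthogonal_matrix_def by (simp only: matrix_vector_mul_assoc) simp
  have ot: "orthogonal_transformation ((*v) Q)" using Q by (simp add: orthogonal_transformation_matrix)
  have shift: "(\<integral>\<^sup>+x. h (x + c) \<partial>lborel) = (\<integral>\<^sup>+x. h x \<partial>lborel)"
    if [measurable]: "h \<in> borel_measurable borel" for h :: "real^'n \<Rightarrow> ennreal" and c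
    by (subst (2) lborel_distr_plus[of c, symmetric]) (simp add: nn_integral_distr add.commute)
  have reflect: "(\<integral>\<^sup>+x. h (c - x) \<partial>lborel) = (\<integral>\<^sup>+x. h x \<partial>lborel)"
    if [measurable]: "h \<in> borel_measurable borel" for h :: "real^'n \<Rightarrow> ennreal" and c
    by (subst (2) lborel_affine[of "-1" c]) (simp_all add: nn_integral_distr nn_integral_density)
  have "(\<integral>\<^sup>+x. f x \<partial>lborel) * (\<integral>\<^sup>+x. g x \<partial>lborel) = (\<integral>\<^sup>+z. (\<integral>\<^sup>+x. f x \<partial>lborel) * g (Q *v z) \<partial>lborel)"
    using ot by (simp add: nn_integral_cmult g_def indicator_def orthogonal_transformation_norm)
  also have "\<dots> = (\<integral>\<^sup>+z. (\<integral>\<^sup>+x. f (x + Q *v z) * g (Q *v z) \<partial>lborel) \<partial>lborel)"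
    by (simp add: nn_integral_multc shift)
  also have "\<dots> = (\<integral>\<^sup>+x. (\<integral>\<^sup>+z. f (x + Q *v z) * g (Q *v z) \<partial>lborel) \<partial>lborel)"
    by (rule lborel_pair.Fubini') measurable
  also have "\<dots> = (\<integral>\<^sup>+x. (\<integral>\<^sup>+z. f (x + Q *v (z + - T x)) * g (Q *v (z + - T x)) \<partial>lborel) \<partial>lborel)"
    by (intro nn_integral_cong shift[symmetric]) measurable
  also have "\<dots> = (\<integral>\<^sup>+x. (\<integral>\<^sup>+z. f (Q *v z) * g (Q *v z - x) \<partial>lborel) \<partial>lborel)"
    by (simp add: matrix_vector_mult_diff_distrib QT)
  also have "\<dots> = (\<integral>\<^sup>+z. (\<integral>\<^sup>+x. f (Q *v z) * g (Q *v z - x) \<partial>lborel) \<partial>lborel)"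
    by (rule lborel_pair.Fubini') measurable
  also have "\<dots> = (\<integral>\<^sup>+z. f (Q *v z) \<partial>lborel) * (\<integral>\<^sup>+x. g x \<partial>lborel)"
    by (simp add: nn_integral_cmult nn_integral_multc reflect)
  finally have "(\<integral>\<^sup>+x. f x \<partial>lborel) * (\<integral>\<^sup>+x. g x \<partial>lborel) = (\<integral>\<^sup>+z. f (Q *v z) \<partial>lborel) * (\<integral>\<^sup>+x. g x \<partial>lborel)" .
  moreover have "(\<integral>\<^sup>+x. g x \<partial>lborel) = emeasure lborel (ball (0 :: real^'n) 1)"
    by (simp add: g_def)
  moreover have "emeasure lborel (ball (0 :: real^'n) 1) \<noteq> \<infinity>"
    using emeasure_lborel_ball_finite[of "0 :: real^'n" 1] by simp
  moreover have "emeasure lborel (ball (0 :: real^'n) 1) \<noteq> 0"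
    using content_ball_pos[of 1 "0 :: real^'n"] by (auto simp: measure_def)
  ultimately have "(\<integral>\<^sup>+x. f x \<partial>lborel) = (\<integral>\<^sup>+z. f (Q *v z) \<partial>lborel)"
    by (simp add: ennreal_mult_cancel_left mult.commute[of _ "emeasure lborel (ball 0 1)"])
  then show "emeasure (distr lborel borel ((*v) Q)) X = emeasure lborel X"
    using measurable_sets_borel[of "(*v) Q" borel X]
    by (simp add: f_def emeasure_distr indicator_vimage[symmetric])
qed simp

lemma sum_Basis_cart:
  fixes g :: "real^'n \<Rightarrow> 'b::comm_monoid_add"
  shows "(\<Sum>b\<in>Basis. g b) = (\<Sum>i\<in>UNIV. g (axis i 1))"
proof -
  have "Basis = (\<lambda>i. axis i 1 :: real^'n) ` (UNIV :: 'n set)" by (auto simp: Basis_vec_def Basis_real_def)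
  note Basis_eq = this
  show ?thesis
    unfolding Basis_eq by (subst sum.reindex) (auto simp: inj_on_def axis_eq_axis)
qed

lemma prod_Basis_cart:
  fixes g :: "real^'n \<Rightarrow> 'b::comm_monoid_mult"
  shows "(\<Prod>b\<in>Basis. g b) = (\<Prod>i\<in>UNIV. g (axis i 1))"
proof -
  have "Basis = (\<lambda>i. axis i 1 :: real^'n) ` (UNIV :: 'n set)" by (auto simp: Basis_vec_def Basis_real_def)
  note Basis_eq = this
  show ?thesis
    unfolding Basis_eq by (subst prod.reindex) (auto simp: inj_on_def axis_eq_axis)
qed

lemma lborel_diag:
  fixes d :: "'n::finite \<Rightarrow> real"
  assumes d: "\<And>i. d i > 0"
  shows "lborel = density (distr lborel borel ((*v) (diag_matrix d))) (\<lambda>_. ennreal (\<Prod>i\<in>UNIV. d i))"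
proof -
  define c :: "real^'n \<Rightarrow> real" where "c = (\<lambda>b. b \<bullet> (diag_matrix d *v b))"
  have ax: "diag_matrix d *v axis i 1 = d i *\<^sub>R axis i 1" for i
    by (simp add: vec_eq_iff diag_matrix_vector axis_def)
  have c: "c (axis i 1) = d i" for i by (simp add: c_def ax inner_axis_axis)
  have "c b \<noteq> 0" if "b \<in> Basis" for b
  proof -
    from that obtain i where "b = axis i 1" by (auto simp: Basis_vec_def Basis_real_def)
    then show ?thesis using d[of i] by (simp add: c)
  qed
  then have "lborel = density (distr lborel borel (\<lambda>x. 0 + (\<Sum>j\<in>Basis. (c j * (x \<bullet> j)) *\<^sub>R j))) (\<lambda>_. \<Prod>j\<in>Basis. \<bar>c j\<bar>)"
    by (rule lborel_affine_euclidean)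
  also have "(\<lambda>x. 0 + (\<Sum>j\<in>Basis. (c j * (x \<bullet> j)) *\<^sub>R j)) = (*v) (diag_matrix d)"
  proof (rule ext)
    fix x :: "real^'n"
    have "0 + (\<Sum>j\<in>Basis. (c j * (x \<bullet> j)) *\<^sub>R j) = (\<Sum>i\<in>UNIV. (d i * x $ i) *\<^sub>R axis i 1)"
      by (simp add: sum_Basis_cart c inner_axis)
    also have "\<dots> = diag_matrix d *v x"
      by (simp add: vec_eq_iff diag_matrix_vector axis_def if_distrib cong: if_cong)
    finally show "0 + (\<Sum>j\<in>Basis. (c j * (x \<bullet> j)) *\<^sub>R j) = diag_matrix d *v x" .
  qed
  also have "(\<Prod>j\<in>(Basis :: (real^'n) set). \<bar>c j\<bar>) = (\<Prod>i\<in>UNIV. d i)"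
    using d by (simp add: prod_Basis_cart c less_imp_le)
  finally show ?thesis .
qed

lemma nn_integral_lborel_pos_def:
  fixes B :: "real^'n^'n"
  assumes B: "pos_def B" and [measurable]: "h \<in> borel_measurable borel"
  shows "(\<integral>\<^sup>+x. h x \<partial>lborel) = (\<integral>\<^sup>+x. ennreal (det B) * h (B *v x) \<partial>lborel)"
proof -
  from B obtain Q d where Q: "orthogonal_matrix Q" and Bd: "B = Q ** diag_matrix d ** transpose Q"
    and d: "\<And>i. d i > 0" by (rule pos_def_cases) blast
  have Q': "orthogonal_matrix (transpose Q)" using Q by (simp add: orthogonal_matrix_def)
  have rot: "(\<integral>\<^sup>+x. k (P *v x) \<partial>lborel) = (\<integral>\<^sup>+x. k x \<partial>lborel)"
    if "orthogonal_matrix P" and [measurable]: "k \<in> borel_measurable borel" for P :: "real^'n^'n" and k :: "real^'n \<Rightarrow> ennreal"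
    by (subst (2) lborel_orthogonal[OF that(1), symmetric]) (simp add: nn_integral_distr)
  have "(\<integral>\<^sup>+x. h x \<partial>lborel) = (\<integral>\<^sup>+x. h (Q *v x) \<partial>lborel)" by (rule rot[OF Q, symmetric]) measurable
  also have "\<dots> = (\<integral>\<^sup>+x. ennreal (\<Prod>i\<in>UNIV. d i) * h (Q *v (diag_matrix d *v x)) \<partial>lborel)"
    by (subst lborel_diag[of d]) (simp_all add: d nn_integral_density nn_integral_distr)
  also have "\<dots> = (\<integral>\<^sup>+x. ennreal (\<Prod>i\<in>UNIV. d i) * h (Q *v (diag_matrix d *v (transpose Q *v x))) \<partial>lborel)"
    by (rule rot[OF Q', symmetric]) measurable
  finally show ?thesis by (simp add: Bd det_diag_conj[OF Q] matrix_vector_mul_assoc matrix_mul_assoc del: transpose_matrix_vector)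
qed

text \<open>Change of variables with \<open>B = C\<^sup>1\<^sup>/\<^sup>2\<close>: the quadratic form of \<open>C\<^sup>-\<^sup>1\<close> at \<open>B x\<close> is \<open>x \<bullet> x\<close>, and the Jacobian factor
  \<open>det B\<close> is the square root of \<open>det C\<close> in the normalising constant.\<close>

lemma multi_normal_eq_distr:
  fixes C :: "real^'n^'n"
  assumes C: "pos_def C"
  shows "multi_normal 0 C = distr (multi_normal 0 (mat 1)) borel ((*v) (matrix_sqrt C))"
proof (rule measure_eqI)
  define B where "B = matrix_sqrt C"
  have B: "pos_def B" "B ** B = C" using matrix_sqrt[OF C] by (auto simp: B_def)
  have detB: "det B > 0" by (rule pos_def_det) fact
  have detC: "det C = (det B)\<^sup>2" by (simp add: B(2)[symmetric] det_mul power2_eq_square)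
  define \<phi> where "\<phi> = (\<lambda>C. \<lambda>x :: real^'n. exp (- ((x - 0) \<bullet> (matrix_inv C *v (x - 0))) / 2) / sqrt ((2 * pi) ^ CARD('n) * det C))"
  have [measurable]: "\<phi> C \<in> borel_measurable borel" for C unfolding \<phi>_def by measurable
  have inv1: "matrix_inv (mat 1 :: real^'n^'n) = mat 1" by (rule matrix_inv_unique) simp
  have \<phi>B: "det B * \<phi> C (B *v x) = \<phi> (mat 1) x" for x
  proof -
    have "(B *v x) \<bullet> (matrix_inv C *v (B *v x)) = x \<bullet> ((B ** matrix_inv C ** B) *v x)"
      using B(1) by (simp add: matrix_vector_mul_assoc[symmetric] pos_def_def inner_matrix_symmetric[of B])
    also have "B ** matrix_inv C ** B = mat 1"
      using matrix_inv_sqrt(2,3,4)[OF C]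
      by (simp add: B_def matrix_inv_sqrt(4)[OF C, symmetric] matrix_mul_assoc)
    finally show ?thesis using detB by (simp add: \<phi>_def inv1 detC real_sqrt_mult)
  qed
  have mn: "multi_normal 0 C = density lborel (\<lambda>x. ennreal (\<phi> C x))" for C
    by (simp only: multi_normal_def \<phi>_def)
  fix X assume "X \<in> sets (multi_normal 0 C)"
  then have [measurable]: "X \<in> sets borel" by simp
  have "emeasure (multi_normal 0 C) X = (\<integral>\<^sup>+x. ennreal (\<phi> C x) * indicator X x \<partial>lborel)"
    by (simp add: mn emeasure_density)
  also have "\<dots> = (\<integral>\<^sup>+x. ennreal (det B) * (ennreal (\<phi> C (B *v x)) * indicator X (B *v x)) \<partial>lborel)"
    by (rule nn_integral_lborel_pos_def[OF B(1)]) measurable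
  also have "\<dots> = (\<integral>\<^sup>+x. ennreal (\<phi> (mat 1) x) * indicator ((*v) B -` X) x \<partial>lborel)"
    using detB by (simp add: \<phi>B[symmetric] ennreal_mult' mult.assoc indicator_vimage)
  also have "\<dots> = emeasure (distr (multi_normal 0 (mat 1)) borel ((*v) B)) X"
    using measurable_sets_borel[of "(*v) B" borel X] by (simp add: mn emeasure_distr emeasure_density)
  finally show "emeasure (multi_normal 0 C) X = emeasure (distr (multi_normal 0 (mat 1)) borel ((*v) (matrix_sqrt C))) X"
    by (simp add: B_def)
qed simp

lemma
  fixes C :: "real^'n^'n"
  assumes C: "pos_def C"
  shows prob_space_multi_normal: "prob_space (multi_normal 0 C)"
    and cos_multi_normal: "(LINT x|multi_normal 0 C. cos (t \<bullet> x + c)) = exp (- (t \<bullet> (C *v t)) / 2) * cos c"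
proof -
  note eq = multi_normal_eq_distr[OF C]
  show "prob_space (multi_normal 0 C)"
    unfolding eq by (rule prob_space.prob_space_distr[OF prob_space_std_multi_normal]) measurable
  let ?B = "matrix_sqrt C"
  have s: "transpose ?B = ?B" using pos_def_matrix_sqrt[OF C] by (simp add: pos_def_def)
  have "(LINT x|multi_normal 0 C. cos (t \<bullet> x + c)) = (LINT x|multi_normal 0 (mat 1). cos ((?B *v t) \<bullet> x + c))"
    unfolding eq by (subst integral_distr) (auto simp: inner_matrix_symmetric[OF s])
  also have "\<dots> = exp (- (norm (?B *v t))\<^sup>2 / 2) * cos c" by (rule cos_std_multi_normal)
  also have "(norm (?B *v t))\<^sup>2 = t \<bullet> (C *v t)"
    by (simp add: power2_norm_eq_inner inner_matrix_symmetric[OF s, symmetric] matrix_vector_mul_assoc matrix_sqrt_square[OF C])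
  finally show "(LINT x|multi_normal 0 C. cos (t \<bullet> x + c)) = exp (- (t \<bullet> (C *v t)) / 2) * cos c" .
qed

subsection \<open>Convergence of characteristic functions implies weak convergence\<close>

text \<open>The Gaussian bump is the characteristic function of the standard normal distribution, so that
  convergence of characteristic functions gives convergence of its expectations by dominated
  convergence.\<close>

lemma tendsto_integral_gauss_bump:
  fixes \<mu> :: "nat \<Rightarrow> (real^'n) measure"
  assumes \<mu>: "\<And>n. prob_space (\<mu> n)" "\<And>n. sets (\<mu> n) = sets borel"
    and \<nu>: "prob_space \<nu>" "sets \<nu> = sets borel"
    and cos: "\<And>t c. (\<lambda>n. LINT x|\<mu> n. cos (t \<bullet> x + c)) \<longlonglongrightarrow> (LINT x|\<nu>. cos (t \<bullet> x + c))"
  shows "(\<lambda>n. LINT x|\<mu> n. exp (- (norm ((y - x) /\<^sub>R \<sigma>))\<^sup>2 / 2)) \<longlonglongrightarrow> (LINT x|\<nu>. exp (- (norm ((y - x) /\<^sub>R \<sigma>))\<^sup>2 / 2))"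
proof -
  define \<gamma> where "\<gamma> = multi_normal 0 (mat 1 :: real^'n^'n)"
  have \<gamma>: "prob_space \<gamma>" "sets \<gamma> = sets borel" by (auto simp: \<gamma>_def prob_space_std_multi_normal)
  note [measurable_cong] = \<gamma>(2)
  interpret \<gamma>: prob_space \<gamma> by fact
  have rep: "(LINT x|\<rho>. exp (- (norm ((y - x) /\<^sub>R \<sigma>))\<^sup>2 / 2)) =
      (LINT s|\<gamma>. LINT x|\<rho>. cos ((- s /\<^sub>R \<sigma>) \<bullet> x + (s /\<^sub>R \<sigma>) \<bullet> y))"
    if \<rho>: "prob_space \<rho>" "sets \<rho> = sets borel" for \<rho>
  proof -
    interpret \<rho>: prob_space \<rho> by fact
    interpret pair_prob_space \<rho> \<gamma> ..
    note [measurable_cong] = \<rho>(2)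
    have "(LINT x|\<rho>. exp (- (norm ((y - x) /\<^sub>R \<sigma>))\<^sup>2 / 2)) = (LINT x|\<rho>. LINT s|\<gamma>. cos (((y - x) /\<^sub>R \<sigma>) \<bullet> s + 0))"
      unfolding \<gamma>_def cos_std_multi_normal by simp
    also have "\<dots> = (LINT x|\<rho>. LINT s|\<gamma>. cos ((- s /\<^sub>R \<sigma>) \<bullet> x + (s /\<^sub>R \<sigma>) \<bullet> y))"
      by (simp add: inner_diff_left inner_diff_right algebra_simps inner_commute)
    also have "\<dots> = (LINT s|\<gamma>. LINT x|\<rho>. cos ((- s /\<^sub>R \<sigma>) \<bullet> x + (s /\<^sub>R \<sigma>) \<bullet> y))"
      by (rule Fubini_integral[symmetric]) (rule integrable_const_bound[of _ 1], auto)
    finally show ?thesis .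
  qed
  have meas: "(\<lambda>s. LINT x|\<rho>. cos ((- s /\<^sub>R \<sigma>) \<bullet> x + (s /\<^sub>R \<sigma>) \<bullet> y)) \<in> borel_measurable \<gamma>"
    if \<rho>: "prob_space \<rho>" "sets \<rho> = sets borel" for \<rho>
  proof -
    interpret \<rho>: prob_space \<rho> by fact
    note [measurable_cong] = \<rho>(2)
    show ?thesis by measurable
  qed
  have le1: "norm (LINT x|\<mu> n. cos (t \<bullet> x + c)) \<le> 1" for n t c
  proof -
    interpret \<mu>n: prob_space "\<mu> n" by (rule \<mu>)
    note [measurable_cong] = \<mu>(2)
    have "norm (LINT x|\<mu> n. cos (t \<bullet> x + c)) \<le> (LINT x|\<mu> n. norm (cos (t \<bullet> x + c)))"
      by (rule integral_norm_bound)
    also have "\<dots> \<le> (LINT x|\<mu> n. 1)"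
      by (intro integral_mono \<mu>n.integrable_const_bound[of _ 1]) auto
    finally show ?thesis by (simp add: \<mu>n.prob_space)
  qed
  show ?thesis
    unfolding rep[OF \<mu>] rep[OF \<nu>]
    by (rule integral_dominated_convergence[where w="\<lambda>_. 1"])
       (rule meas[OF \<mu>] meas[OF \<nu>] | intro AE_I2 cos le1 | simp)+
qed

text \<open>The substitution \<open>y = x + \<sigma> s\<close> turns an average over Gaussian perturbations of \<open>x\<close> into a superposition, with
  weights \<open>g y\<close>, of the bumps centred at \<open>y\<close>.\<close>

lemma gauss_smoothing:
  fixes g :: "real^'n \<Rightarrow> real"
  assumes [measurable]: "g \<in> borel_measurable borel" and \<sigma>: "\<sigma> > 0"
  shows "(LINT s|multi_normal 0 (mat 1). g (x + \<sigma> *\<^sub>R s)) =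
    (LINT y|lborel. g y * exp (- (norm ((y - x) /\<^sub>R \<sigma>))\<^sup>2 / 2)) / (sqrt ((2 * pi) ^ CARD('n)) * \<sigma> ^ CARD('n))"
proof -
  define k where "k = (\<lambda>s::real^'n. exp (- (norm s)\<^sup>2 / 2) / sqrt ((2 * pi) ^ CARD('n)))"
  have [measurable]: "k \<in> borel_measurable borel" unfolding k_def by measurable
  have inv1: "matrix_inv (mat 1 :: real^'n^'n) = mat 1" by (rule matrix_inv_unique) simp
  have dens: "multi_normal 0 (mat 1 :: real^'n^'n) = density lborel (\<lambda>s. ennreal (k s))"
    by (simp add: multi_normal_def k_def inv1 power2_norm_eq_inner[symmetric])
  define h where "h = (\<lambda>y. k ((y - x) /\<^sub>R \<sigma>) * g y)"
  have [measurable]: "h \<in> borel_measurable borel" unfolding h_def by measurable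
  have "(LINT s|multi_normal 0 (mat 1). g (x + \<sigma> *\<^sub>R s)) = (LINT s|lborel. k s *\<^sub>R g (x + \<sigma> *\<^sub>R s))"
    unfolding dens by (rule integral_density) (auto simp: k_def)
  also have "\<dots> = (LINT s|lborel. h (x + \<sigma> *\<^sub>R s))"
    using \<sigma> by (simp add: h_def)
  also have "\<dots> = (LINT y|lborel. h y) / \<sigma> ^ CARD('n)"
  proof -
    have "(LINT y|lborel. h y) = (LINT y|density (distr lborel borel (\<lambda>s. x + \<sigma> *\<^sub>R s)) (\<lambda>_. ennreal (\<sigma> ^ CARD('n))). h y)"
      using \<sigma> by (subst lborel_affine[of \<sigma> x]) auto
    also have "\<dots> = (LINT y|distr lborel borel (\<lambda>s. x + \<sigma> *\<^sub>R s). \<sigma> ^ CARD('n) *\<^sub>R h y)"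
      using \<sigma> by (intro integral_density) auto
    also have "\<dots> = \<sigma> ^ CARD('n) * (LINT s|lborel. h (x + \<sigma> *\<^sub>R s))"
      by (simp add: integral_distr)
    finally show ?thesis using \<sigma> by simp
  qed
  also have "(LINT y|lborel. h y) = (LINT y|lborel. g y * exp (- (norm ((y - x) /\<^sub>R \<sigma>))\<^sup>2 / 2)) / sqrt ((2 * pi) ^ CARD('n))"
    unfolding h_def k_def by (subst integral_divide_zero[symmetric]) (simp add: mult.commute)
  finally show ?thesis by (simp add: field_simps)
qed

lemma compact_support_integrable:
  fixes g :: "real^'n \<Rightarrow> real"
  assumes g: "continuous_on UNIV g" and supp: "\<And>x. norm x > R \<Longrightarrow> g x = 0"
  shows "integrable lborel g"
proof -
  have "set_integrable lborel (cball 0 R) g"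
    unfolding set_integrable_def by (rule borel_integrable_compact) (auto intro: continuous_on_subset[OF g])
  moreover have "(\<lambda>x. indicator (cball 0 R) x *\<^sub>R g x) = g"
    using supp by (auto simp: fun_eq_iff indicator_def not_le)
  ultimately show ?thesis by (simp add: set_integrable_def)
qed

lemma compact_support_uniformly_continuous:
  fixes g :: "real^'n \<Rightarrow> real"
  assumes g: "continuous_on UNIV g" and supp: "\<And>x. norm x > R \<Longrightarrow> g x = 0" and e: "e > 0"
  obtains d where "d > 0" "\<And>x y. dist x y < d \<Longrightarrow> \<bar>g x - g y\<bar> < e"
proof -
  have "uniformly_continuous_on (cball 0 (R + 1)) g"
    by (intro compact_uniformly_continuous continuous_on_subset[OF g]) auto
  then obtain d0 where d0: "d0 > 0" "\<And>x y. norm x \<le> R + 1 \<Longrightarrow> norm y \<le> R + 1 \<Longrightarrow> dist x y < d0 \<Longrightarrow> \<bar>g x - g y\<bar> < e"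
    unfolding uniformly_continuous_on_def using e by (auto simp: dist_real_def dist_commute)
  have "\<bar>g x - g y\<bar> < e" if "dist x y < min d0 1" for x y
  proof (cases "norm x > R \<and> norm y > R")
    case True
    then show ?thesis using supp e by simp
  next
    case False
    moreover have "norm x \<le> norm y + dist x y" "norm y \<le> norm x + dist x y"
      by (simp_all add: norm_triangle_sub dist_norm norm_minus_commute)
         (metis norm_minus_commute norm_triangle_sub)
    ultimately have "norm x \<le> R + 1" "norm y \<le> R + 1" using that by auto
    then show ?thesis using that by (intro d0) auto
  qed
  with d0(1) show thesis by (intro that[of "min d0 1"]) auto
qed

text \<open>The average \<open>S \<sigma>\<close> of \<open>g\<close> over Gaussian perturbations of size \<open>\<sigma>\<close> is a superposition of Gaussian bumps, so
  that its integrals converge; as \<open>\<sigma>\<close> tends to \<open>0\<close>, it approximates the uniformly continuous function \<open>g\<close>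
  uniformly.\<close>

lemma weak_convergence_compact_support:
  fixes \<mu> :: "nat \<Rightarrow> (real^'n) measure" and g :: "real^'n \<Rightarrow> real"
  assumes \<mu>: "\<And>n. prob_space (\<mu> n)" "\<And>n. sets (\<mu> n) = sets borel"
    and \<nu>: "prob_space \<nu>" "sets \<nu> = sets borel"
    and cos: "\<And>t c. (\<lambda>n. LINT x|\<mu> n. cos (t \<bullet> x + c)) \<longlonglongrightarrow> (LINT x|\<nu>. cos (t \<bullet> x + c))"
    and g: "continuous_on UNIV g" and supp: "\<And>x. norm x > R \<Longrightarrow> g x = 0"
  shows "(\<lambda>n. LINT x|\<mu> n. g x) \<longlonglongrightarrow> (LINT x|\<nu>. g x)"
proof -
  define \<gamma> where "\<gamma> = multi_normal 0 (mat 1 :: real^'n^'n)"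
  have \<gamma>: "prob_space \<gamma>" "sets \<gamma> = sets borel" by (auto simp: \<gamma>_def prob_space_std_multi_normal)
  note [measurable_cong] = \<gamma>(2)
  interpret \<gamma>: prob_space \<gamma> by fact
  have [measurable]: "g \<in> borel_measurable borel" using g by (rule borel_measurable_continuous_onI)
  have gint: "integrable lborel g" by (rule compact_support_integrable[OF g supp])
  have "bounded (g ` cball 0 R)"
    by (intro compact_imp_bounded compact_continuous_image continuous_on_subset[OF g]) auto
  then obtain B0 where "\<forall>y\<in>g ` cball 0 R. norm y \<le> B0" unfolding bounded_iff by blast
  then have B0: "\<bar>g x\<bar> \<le> B0" if "norm x \<le> R" for x using that by auto
  define B where "B = max B0 0"
  have B: "\<bar>g x\<bar> \<le> B" "0 \<le> B" for x
    using B0[of x] supp[of x] by (cases "norm x \<le> R"; force simp: B_def)+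
  define S where "S = (\<lambda>\<sigma> x. LINT s|\<gamma>. g (x + \<sigma> *\<^sub>R s))"
  define bump where "bump = (\<lambda>\<sigma> (y::real^'n) x. exp (- (norm ((y - x) /\<^sub>R \<sigma>))\<^sup>2 / 2))"
  have [measurable]: "(\<lambda>(y, x). bump \<sigma> y x) \<in> borel_measurable (borel \<Otimes>\<^sub>M borel)" for \<sigma>
    unfolding bump_def by measurable
  have bump01: "0 \<le> bump \<sigma> y x" "bump \<sigma> y x \<le> 1" for \<sigma> y x by (auto simp: bump_def)
  have g_bump: "\<bar>g y\<bar> * bump \<sigma> y x \<le> \<bar>g y\<bar>" for \<sigma> y x
    using bump01 by (intro mult_left_le) auto
  have rep: "(LINT x|\<rho>. S \<sigma> x) = (LINT y|lborel. g y * (LINT x|\<rho>. bump \<sigma> y x)) / (sqrt ((2 * pi) ^ CARD('n)) * \<sigma> ^ CARD('n))"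
    if \<rho>: "prob_space \<rho>" "sets \<rho> = sets borel" and \<sigma>: "\<sigma> > 0" for \<rho> \<sigma>
  proof -
    interpret \<rho>: prob_space \<rho> by fact
    interpret pair_sigma_finite \<rho> "lborel :: (real^'n) measure" ..
    note [measurable_cong] = \<rho>(2)
    have "integrable (\<rho> \<Otimes>\<^sub>M lborel) (\<lambda>(x, y). g y * bump \<sigma> y x)"
    proof (rule Fubini_integrable)
      show "(\<lambda>(x, y). g y * bump \<sigma> y x) \<in> borel_measurable (\<rho> \<Otimes>\<^sub>M lborel)" by measurable
      have i: "integrable lborel (\<lambda>y. g y * bump \<sigma> y x)" for x
        by (rule Bochner_Integration.integrable_bound[OF gint])
           (use bump01 g_bump in \<open>auto simp: abs_mult\<close>)
      then show "AE x in \<rho>. integrable lborel (\<lambda>y. case (x, y) of (x, y) \<Rightarrow> g y * bump \<sigma> y x)" by simp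
      have "(LINT y|lborel. norm (g y * bump \<sigma> y x)) \<le> (LINT y|lborel. norm (g y))" for x
        by (intro integral_mono integrable_norm i gint) (use bump01 g_bump in \<open>auto simp: abs_mult\<close>)
      moreover have "0 \<le> (LINT y|lborel. norm (g y * bump \<sigma> y x))" for x by (intro integral_nonneg_AE) auto
      ultimately show "integrable \<rho> (\<lambda>x. LINT y|lborel. norm (case (x, y) of (x, y) \<Rightarrow> g y * bump \<sigma> y x))"
        by (intro \<rho>.integrable_const_bound[of _ "LINT y|lborel. norm (g y)"]) auto
    qed
    then have "(LINT y|lborel. LINT x|\<rho>. g y * bump \<sigma> y x) = (LINT x|\<rho>. LINT y|lborel. g y * bump \<sigma> y x)"
      by (rule Fubini_integral)
    then show ?thesis
      unfolding S_def \<gamma>_def by (simp add: gauss_smoothing[OF _ \<sigma>] bump_def)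
  qed
  have smooth: "(\<lambda>n. LINT x|\<mu> n. S \<sigma> x) \<longlonglongrightarrow> (LINT x|\<nu>. S \<sigma> x)" if \<sigma>: "\<sigma> > 0" for \<sigma>
  proof -
    have meas: "(\<lambda>y. g y * (LINT x|\<rho>. bump \<sigma> y x)) \<in> borel_measurable lborel"
      if \<rho>: "prob_space \<rho>" "sets \<rho> = sets borel" for \<rho>
    proof -
      interpret \<rho>: prob_space \<rho> by fact
      note [measurable_cong] = \<rho>(2)
      show ?thesis by measurable
    qed
    have le1: "\<bar>LINT x|\<mu> n. bump \<sigma> y x\<bar> \<le> 1" for n y
    proof -
      interpret \<mu>n: prob_space "\<mu> n" by (rule \<mu>)
      note [measurable_cong] = \<mu>(2)
      have "(LINT x|\<mu> n. bump \<sigma> y x) \<le> (LINT x|\<mu> n. 1)"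
        using bump01 by (intro integral_mono \<mu>n.integrable_const_bound[of _ 1]) auto
      moreover have "0 \<le> (LINT x|\<mu> n. bump \<sigma> y x)" using bump01 by (intro integral_nonneg_AE) auto
      ultimately show ?thesis by (simp add: \<mu>n.prob_space)
    qed
    have "(\<lambda>n. LINT y|lborel. g y * (LINT x|\<mu> n. bump \<sigma> y x)) \<longlonglongrightarrow> (LINT y|lborel. g y * (LINT x|\<nu>. bump \<sigma> y x))"
    proof (rule integral_dominated_convergence[where w="\<lambda>y. \<bar>g y\<bar>"])
      show "AE y in lborel. (\<lambda>n. g y * (LINT x|\<mu> n. bump \<sigma> y x)) \<longlonglongrightarrow> g y * (LINT x|\<nu>. bump \<sigma> y x)"
        unfolding bump_def
        by (intro AE_I2 tendsto_mult tendsto_const tendsto_integral_gauss_bump \<mu> \<nu> cos)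
      show "AE y in lborel. norm (g y * (LINT x|\<mu> n. bump \<sigma> y x)) \<le> \<bar>g y\<bar>" for n
      proof (intro AE_I2)
        fix y
        show "norm (g y * (LINT x|\<mu> n. bump \<sigma> y x)) \<le> \<bar>g y\<bar>"
          using mult_left_le[OF le1[of n y], of "\<bar>g y\<bar>"] by (simp add: abs_mult)
      qed
    qed (use gint meas \<mu> \<nu> in auto)
    then show ?thesis
      unfolding rep[OF \<mu> \<sigma>] rep[OF \<nu> \<sigma>] using \<sigma> by (intro tendsto_divide tendsto_const) auto
  qed
  have close: "\<exists>\<sigma>>0. \<forall>x. \<bar>S \<sigma> x - g x\<bar> \<le> e" if e: "e > 0" for e
  proof -
    obtain d where d: "d > 0" "\<And>x y. dist x y < d \<Longrightarrow> \<bar>g x - g y\<bar> < e / 2"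
      using compact_support_uniformly_continuous[of g R "e / 2", OF g supp] e by auto
    define tail where "tail = (\<lambda>n::nat. LINT s|\<gamma>. indicat_real {s. d \<le> norm s / real (Suc n)} s)"
    have "tail \<longlonglongrightarrow> (LINT s|\<gamma>. 0)"
      unfolding tail_def
    proof (rule integral_dominated_convergence[where w="\<lambda>_. 1"])
      have "(\<lambda>n. indicat_real {s. d \<le> norm s / real (Suc n)} s) \<longlonglongrightarrow> 0" for s
      proof (rule tendsto_eventually)
        have "(\<lambda>n. norm s / real (Suc n)) \<longlonglongrightarrow> 0" by (rule LIMSEQ_Suc[OF lim_const_over_n])
        then have "eventually (\<lambda>n. norm s / real (Suc n) < d) sequentially" using d(1) by (rule order_tendstoD)
        then show "eventually (\<lambda>n. indicat_real {s. d \<le> norm s / real (Suc n)} s = 0) sequentially"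
          by eventually_elim (simp add: indicator_def)
      qed
      then show "AE s in \<gamma>. (\<lambda>n. indicat_real {s. d \<le> norm s / real (Suc n)} s) \<longlonglongrightarrow> 0" by (intro AE_I2)
    qed (auto simp: indicator_def)
    then have "(\<lambda>n. 2 * B * tail n) \<longlonglongrightarrow> 2 * B * 0" by (intro tendsto_intros) simp
    then have "eventually (\<lambda>n. 2 * B * tail n < e / 2) sequentially"
      by (rule order_tendstoD) (use e in simp)
    then obtain n where n: "2 * B * tail n < e / 2" by (auto simp: eventually_sequentially)
    define \<sigma> where "\<sigma> = 1 / real (Suc n)"
    have \<sigma>: "\<sigma> > 0" by (simp add: \<sigma>_def)
    have gi: "integrable \<gamma> (\<lambda>s. g (x + \<sigma> *\<^sub>R s))" for x
      using B by (intro \<gamma>.integrable_const_bound[of _ B]) auto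
    have ti: "integrable \<gamma> (\<lambda>s. indicat_real {s. d \<le> norm s / real (Suc n)} s)"
      by (intro \<gamma>.integrable_const_bound[of _ 1]) (auto simp: indicator_def)
    have "\<bar>S \<sigma> x - g x\<bar> \<le> e" for x
    proof -
      have "S \<sigma> x - g x = (LINT s|\<gamma>. g (x + \<sigma> *\<^sub>R s) - g x)"
        using gi by (simp add: S_def \<gamma>.prob_space)
      also have "\<bar>\<dots>\<bar> \<le> (LINT s|\<gamma>. \<bar>g (x + \<sigma> *\<^sub>R s) - g x\<bar>)" by (rule integral_abs_bound)
      also have "\<dots> \<le> (LINT s|\<gamma>. e / 2 + 2 * B * indicat_real {s. d \<le> norm s / real (Suc n)} s)"
      proof (intro integral_mono integrable_abs Bochner_Integration.integrable_diff gi)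
        fix s
        show "\<bar>g (x + \<sigma> *\<^sub>R s) - g x\<bar> \<le> e / 2 + 2 * B * indicat_real {s. d \<le> norm s / real (Suc n)} s"
        proof (cases "d \<le> norm s / real (Suc n)")
          case True
          then show ?thesis using B(1)[of "x + \<sigma> *\<^sub>R s"] B(1)[of x] e by simp
        next
          case False
          then have "dist (x + \<sigma> *\<^sub>R s) x < d" using \<sigma> by (simp add: dist_norm \<sigma>_def)
          from d(2)[OF this] show ?thesis using B(2) by (simp add: indicator_def)
        qed
      qed (use ti in auto)
      also have "\<dots> = e / 2 + 2 * B * tail n"
        using ti by (simp add: tail_def \<gamma>.prob_space)
      finally show ?thesis using n by simp
    qed
    with \<sigma> show ?thesis by blast
  qed
  have Smeas: "S \<sigma> \<in> borel_measurable borel" for \<sigma> unfolding S_def by measurable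
  have diff: "\<bar>(LINT x|\<rho>. S \<sigma> x) - (LINT x|\<rho>. g x)\<bar> \<le> e"
    if \<rho>: "prob_space \<rho>" "sets \<rho> = sets borel" and le: "\<And>x. \<bar>S \<sigma> x - g x\<bar> \<le> e" for \<rho> \<sigma> e
  proof -
    interpret \<rho>: prob_space \<rho> by fact
    note [measurable_cong] = \<rho>(2)
    have gi: "integrable \<rho> g" using B by (intro \<rho>.integrable_const_bound[of _ B]) auto
    have "\<bar>S \<sigma> x\<bar> \<le> B + e" for x using B(1)[of x] le[of x] by linarith
    then have Si: "integrable \<rho> (S \<sigma>)"
      using Smeas by (intro \<rho>.integrable_const_bound[of _ "B + e"]) auto
    have "\<bar>(LINT x|\<rho>. S \<sigma> x) - (LINT x|\<rho>. g x)\<bar> = \<bar>LINT x|\<rho>. S \<sigma> x - g x\<bar>" using gi Si by simp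
    also have "\<dots> \<le> (LINT x|\<rho>. \<bar>S \<sigma> x - g x\<bar>)" by (rule integral_abs_bound)
    also have "\<dots> \<le> (LINT x|\<rho>. e)" using gi Si le by (intro integral_mono) auto
    finally show ?thesis by (simp add: \<rho>.prob_space)
  qed
  show ?thesis
  proof (rule tendstoI)
    fix e :: real assume e: "e > 0"
    obtain \<sigma> where \<sigma>: "\<sigma> > 0" "\<And>x. \<bar>S \<sigma> x - g x\<bar> \<le> e / 4" using close[of "e / 4"] e by auto
    have "eventually (\<lambda>n. dist (LINT x|\<mu> n. S \<sigma> x) (LINT x|\<nu>. S \<sigma> x) < e / 2) sequentially"
      using smooth[OF \<sigma>(1)] e by (intro tendstoD) auto
    then show "eventually (\<lambda>n. dist (LINT x|\<mu> n. g x) (LINT x|\<nu>. g x) < e) sequentially"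
    proof eventually_elim
      case (elim n)
      then show ?case
        using diff[OF \<mu> \<sigma>(2), of n] diff[OF \<nu> \<sigma>(2)] unfolding dist_real_def by linarith
    qed
  qed
qed

text \<open>Tightness reduces bounded test functions to those with compact support: multiplication by a cutoff
  function changes the integrals by little, uniformly in \<open>n\<close>.\<close>

theorem weak_conv_measures_if_cos:
  fixes \<mu> :: "nat \<Rightarrow> (real^'n) measure"
  assumes \<mu>: "\<And>n. prob_space (\<mu> n)" "\<And>n. sets (\<mu> n) = sets borel"
    and \<nu>: "prob_space \<nu>" "sets \<nu> = sets borel"
    and cos: "\<And>t c. (\<lambda>n. LINT x|\<mu> n. cos (t \<bullet> x + c)) \<longlonglongrightarrow> (LINT x|\<nu>. cos (t \<bullet> x + c))"
    and tight: "\<And>\<epsilon>. \<epsilon> > 0 \<Longrightarrow> \<exists>R. eventually (\<lambda>n. measure (\<mu> n) {x. norm x > R} \<le> \<epsilon>) sequentially"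
  shows "weak_conv_measures \<mu> \<nu>"
  unfolding weak_conv_measures_def
proof (intro allI impI)
  fix g :: "real^'n \<Rightarrow> real"
  assume g: "continuous_on UNIV g" and bd: "bounded (range g)"
  then obtain B where B: "\<And>x. \<bar>g x\<bar> \<le> B" by (auto simp: bounded_iff)
  have B0: "0 \<le> B" using B[of 0] by linarith
  have [measurable]: "g \<in> borel_measurable borel" using g by (rule borel_measurable_continuous_onI)
  interpret \<nu>: prob_space \<nu> by fact
  have [measurable_cong]: "sets \<nu> = sets borel" "\<And>n. sets (\<mu> n) = sets borel" by fact+
  define cut where "cut = (\<lambda>R (x::real^'n). max 0 (min 1 (R + 1 - norm x)))"
  have cut_cont: "continuous_on UNIV (cut R)" for R unfolding cut_def by (intro continuous_intros)
  have [measurable]: "cut R \<in> borel_measurable borel" for R using cut_cont by (rule borel_measurable_continuous_onI)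
  have cut_bounds: "0 \<le> cut R x" "cut R x \<le> 1" for R x by (auto simp: cut_def)
  have trunc: "\<bar>(LINT x|\<rho>. g x) - (LINT x|\<rho>. g x * cut R x)\<bar> \<le> B * measure \<rho> {x. norm x > R}"
    if \<rho>: "prob_space \<rho>" "sets \<rho> = sets borel" for \<rho> R
  proof -
    interpret \<rho>: prob_space \<rho> by fact
    note [measurable_cong] = \<rho>(2)
    have [simp]: "space \<rho> = UNIV" using sets_eq_imp_space_eq[OF \<rho>(2)] by simp
    have 1: "integrable \<rho> g" using B by (intro \<rho>.integrable_const_bound[of _ B]) auto
    have 2: "integrable \<rho> (\<lambda>x. g x * cut R x)"
      using B cut_bounds by (intro \<rho>.integrable_const_bound[of _ B]) (auto simp: abs_mult intro!: AE_I2 order_trans[OF mult_left_le])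
    have "\<bar>(LINT x|\<rho>. g x) - (LINT x|\<rho>. g x * cut R x)\<bar> = \<bar>LINT x|\<rho>. g x - g x * cut R x\<bar>" using 1 2 by simp
    also have "\<dots> \<le> (LINT x|\<rho>. \<bar>g x - g x * cut R x\<bar>)" by (rule integral_abs_bound)
    also have "\<dots> \<le> (LINT x|\<rho>. B * indicat_real {x. norm x > R} x)"
    proof (intro integral_mono)
      fix x
      have "\<bar>g x - g x * cut R x\<bar> = \<bar>g x\<bar> * (1 - cut R x)"
      proof -
        have "g x - g x * cut R x = g x * (1 - cut R x)" by (simp add: right_diff_distrib)
        then show ?thesis using cut_bounds[of R x] by (simp add: abs_mult)
      qed
      also have "\<dots> \<le> B * indicat_real {x. norm x > R} x"
        using B[of x] cut_bounds[of R x] B0 by (intro mult_mono) (auto simp: cut_def indicator_def)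
      finally show "\<bar>g x - g x * cut R x\<bar> \<le> B * indicat_real {x. norm x > R} x" .
    qed (use 1 2 in \<open>auto intro!: integrable_mult_right \<rho>.integrable_const_bound[of _ 1] simp: indicator_def\<close>)
    also have "\<dots> = B * measure \<rho> {x. norm x > R}" by simp
    finally show ?thesis .
  qed
  have tail: "\<exists>R0. \<forall>R\<ge>R0. B * measure \<nu> {x. norm x > R} \<le> e" if e: "e > 0" for e
  proof -
    have [simp]: "space \<nu> = UNIV" using sets_eq_imp_space_eq[OF \<nu>(2)] by simp
    have "(\<lambda>n::nat. measure \<nu> {x. norm x > real n}) \<longlonglongrightarrow> measure \<nu> (\<Inter>n::nat. {x. norm x > real n})"
      by (rule \<nu>.finite_Lim_measure_decseq) (auto simp: decseq_def)
    also have "(\<Inter>n::nat. {x::real^'n. norm x > real n}) = {}"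
      by auto (meson not_less real_arch_simple)
    finally have "(\<lambda>n::nat. B * measure \<nu> {x. norm x > real n}) \<longlonglongrightarrow> B * 0" by (intro tendsto_intros) simp
    then have "eventually (\<lambda>n::nat. B * measure \<nu> {x. norm x > real n} < e) sequentially"
      by (rule order_tendstoD) (use e in simp)
    then obtain m :: nat where m: "B * measure \<nu> {x. norm x > real m} < e" by (auto simp: eventually_sequentially)
    have "B * measure \<nu> {x. norm x > R} \<le> e" if "R \<ge> real m" for R
    proof -
      have "measure \<nu> {x. norm x > R} \<le> measure \<nu> {x. norm x > real m}"
        using that by (intro \<nu>.finite_measure_mono) auto
      then show ?thesis using m mult_left_mono[OF _ B0] by fastforce
    qed
    then show ?thesis by blast
  qed
  show "(\<lambda>n. LINT x|\<mu> n. g x) \<longlonglongrightarrow> (LINT x|\<nu>. g x)"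
  proof (rule tendstoI)
    fix e :: real assume e: "e > 0"
    have eB: "e / (4 * (B + 1)) > 0" using e B0 by simp
    from tail[of "e / 4"] e obtain R0 where R0: "\<And>R. R \<ge> R0 \<Longrightarrow> B * measure \<nu> {x. norm x > R} \<le> e / 4" by auto
    from tight[OF eB] obtain R1 where R1: "eventually (\<lambda>n. measure (\<mu> n) {x. norm x > R1} \<le> e / (4 * (B + 1))) sequentially" by blast
    define R where "R = max R0 R1"
    have "(\<lambda>n. LINT x|\<mu> n. g x * cut R x) \<longlonglongrightarrow> (LINT x|\<nu>. g x * cut R x)"
      by (rule weak_convergence_compact_support[where R="R + 1", OF \<mu> \<nu> cos])
         (intro continuous_on_mult g cut_cont, simp add: cut_def)
    then have "eventually (\<lambda>n. dist (LINT x|\<mu> n. g x * cut R x) (LINT x|\<nu>. g x * cut R x) < e / 4) sequentially"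
      using e by (intro tendstoD) auto
    with R1 show "eventually (\<lambda>n. dist (LINT x|\<mu> n. g x) (LINT x|\<nu>. g x) < e) sequentially"
    proof eventually_elim
      case (elim n)
      interpret \<mu>n: prob_space "\<mu> n" by (rule \<mu>)
      have [simp]: "space (\<mu> n) = UNIV" using sets_eq_imp_space_eq[OF \<mu>(2)] by simp
      have "measure (\<mu> n) {x. norm x > R} \<le> measure (\<mu> n) {x. norm x > R1}"
        by (intro \<mu>n.finite_measure_mono) (auto simp: R_def)
      then have "B * measure (\<mu> n) {x. norm x > R} \<le> B * (e / (4 * (B + 1)))"
        using elim B0 by (intro mult_left_mono) auto
      also have "\<dots> \<le> e / 4" using B0 e by (simp add: field_simps)
      finally show ?case
        using trunc[OF \<mu>, of n R] trunc[OF \<nu>, of R] R0[of R, unfolded R_def, OF max.cobounded1] elim(2) e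
        unfolding dist_real_def R_def[symmetric] by arith
    qed
  qed
qed

text \<open>The error is allowed to be relative to \<open>1 + norm (W n)\<close>. On the event \<open>norm (W n) \<le> R\<close>, whose
  probability is close to \<open>1\<close> uniformly in \<open>n\<close> for large \<open>R\<close>, it tends to \<open>0\<close>, and there the test function
  is uniformly continuous. Measurability of finitely many of the \<open>V n\<close> does not affect the limit.\<close>

lemma slutsky:
  fixes V W :: "nat \<Rightarrow> 'w \<Rightarrow> real^'n"
  assumes M: "prob_space M" and W [measurable]: "\<And>n. W n \<in> borel_measurable M"
    and V: "\<And>n. n \<ge> n0 \<Longrightarrow> V n \<in> borel_measurable M"
    and conv: "converges_in_distribution M W \<nu>"
    and tight: "\<And>\<epsilon>. \<epsilon> > 0 \<Longrightarrow> \<exists>R. eventually (\<lambda>n. measure M {\<omega>\<in>space M. norm (W n \<omega>) > R} \<le> \<epsilon>) sequentially"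
    and close: "AE \<omega> in M. \<forall>\<epsilon>>0. eventually (\<lambda>n. norm (V n \<omega> - W n \<omega>) \<le> \<epsilon> * (1 + norm (W n \<omega>))) sequentially"
  shows "converges_in_distribution M V \<nu>"
  unfolding converges_in_distribution_def weak_conv_measures_def
proof (intro allI impI)
  fix g :: "real^'n \<Rightarrow> real"
  assume g: "continuous_on UNIV g" and bd: "bounded (range g)"
  then obtain B where B: "\<And>x. \<bar>g x\<bar> \<le> B" by (auto simp: bounded_iff)
  have B0: "0 \<le> B" using B[of 0] by linarith
  interpret prob_space M by fact
  have [measurable]: "g \<in> borel_measurable borel" using g by (rule borel_measurable_continuous_onI)
  have [measurable]: "V (n + n0) \<in> borel_measurable M" for n by (rule V) simp
  have limW: "(\<lambda>n. expectation (\<lambda>\<omega>. g (W n \<omega>))) \<longlonglongrightarrow> (LINT x|\<nu>. g x)"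
  proof -
    have "(LINT x|distr M borel (W n). g x) = expectation (\<lambda>\<omega>. g (W n \<omega>))" for n
      by (rule integral_distr) measurable
    moreover have "(\<lambda>n. LINT x|distr M borel (W n). g x) \<longlonglongrightarrow> (LINT x|\<nu>. g x)"
      using conv g bd unfolding converges_in_distribution_def weak_conv_measures_def by blast
    ultimately show ?thesis by (simp only:)
  qed
  have int: "integrable M (\<lambda>\<omega>. g (W n \<omega>))" "integrable M (\<lambda>\<omega>. g (V (n + n0) \<omega>))" for n
    using B by (auto intro!: integrable_const_bound[of _ B])
  have "(\<lambda>n. expectation (\<lambda>\<omega>. g (V (n + n0) \<omega>)) - expectation (\<lambda>\<omega>. g (W (n + n0) \<omega>))) \<longlonglongrightarrow> 0"
  proof (rule tendstoI)
    fix e :: real assume e: "e > 0"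
    have eB: "e / (4 * (B + 1)) > 0" using e B0 by simp
    from tight[OF eB] obtain R0 where R0: "eventually (\<lambda>n. prob {\<omega>\<in>space M. norm (W n \<omega>) > R0} \<le> e / (4 * (B + 1))) sequentially"
      by blast
    define R where "R = max R0 0"
    \<comment> \<open>Dominated convergence applies to the difference restricted to this event.\<close>
    define h where "h = (\<lambda>n \<omega>. \<bar>g (V (n + n0) \<omega>) - g (W (n + n0) \<omega>)\<bar> * indicat_real {\<omega>. norm (W (n + n0) \<omega>) \<le> R} \<omega>)"
    have [measurable]: "h n \<in> borel_measurable M" for n unfolding h_def by measurable
    have h_le: "\<bar>h n \<omega>\<bar> \<le> 2 * B" for n \<omega>
      using B[of "V (n + n0) \<omega>"] B[of "W (n + n0) \<omega>"] B0 by (auto simp: h_def indicator_def)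
    have "AE \<omega> in M. (\<lambda>n. h n \<omega>) \<longlonglongrightarrow> 0"
      using close
    proof eventually_elim
      case (elim \<omega>)
      show ?case
      proof (rule tendstoI)
        fix e' :: real assume e': "e' > 0"
        have "uniformly_continuous_on (cball 0 (R + 1)) g"
          by (intro compact_uniformly_continuous continuous_on_subset[OF g]) auto
        then obtain d where d: "d > 0" "\<And>x y. norm x \<le> R + 1 \<Longrightarrow> norm y \<le> R + 1 \<Longrightarrow> dist x y < d \<Longrightarrow> \<bar>g x - g y\<bar> < e'"
          unfolding uniformly_continuous_on_def using e' by (auto simp: dist_real_def dist_commute)
        define \<epsilon> where "\<epsilon> = min d 1 / (2 * (1 + R))"
        have "1 + R > 0" by (simp add: R_def)
        then have \<epsilon>: "\<epsilon> > 0" "\<epsilon> * (1 + R) = min d 1 / 2"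
          using d(1) by (auto simp: \<epsilon>_def divide_simps)
        have "eventually (\<lambda>n. norm (V (n + n0) \<omega> - W (n + n0) \<omega>) \<le> \<epsilon> * (1 + norm (W (n + n0) \<omega>))) sequentially"
          using elim \<epsilon>(1) sequentially_offset[of "\<lambda>n. norm (V n \<omega> - W n \<omega>) \<le> \<epsilon> * (1 + norm (W n \<omega>))" n0] by blast
        then show "eventually (\<lambda>n. dist (h n \<omega>) 0 < e') sequentially"
        proof eventually_elim
          case (elim n)
          show ?case
          proof (cases "norm (W (n + n0) \<omega>) \<le> R")
            case True
            have "norm (V (n + n0) \<omega> - W (n + n0) \<omega>) \<le> \<epsilon> * (1 + R)"
              using elim True \<epsilon>(1) by (smt (verit) mult_left_mono)
            then have near: "norm (V (n + n0) \<omega> - W (n + n0) \<omega>) \<le> min d 1 / 2" by (simp add: \<epsilon>)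
            then have "norm (V (n + n0) \<omega>) \<le> R + 1"
              using True norm_triangle_sub[of "V (n + n0) \<omega>" "W (n + n0) \<omega>"] by (simp split: if_splits)
            then have "\<bar>g (V (n + n0) \<omega>) - g (W (n + n0) \<omega>)\<bar> < e'"
              using True near d(1) by (intro d(2)) (auto simp: dist_norm)
            then show ?thesis using True by (simp add: h_def)
          qed (use e' in \<open>simp add: h_def\<close>)
        qed
      qed
    qed
    then have "(\<lambda>n. expectation (h n)) \<longlonglongrightarrow> expectation (\<lambda>_. 0)"
      using h_le by (intro integral_dominated_convergence[where w="\<lambda>_. 2 * B"]) auto
    then have "eventually (\<lambda>n. \<bar>expectation (h n)\<bar> < e / 2) sequentially"
      using e tendstoD[of "\<lambda>n. expectation (h n)" 0 sequentially "e / 2"] by simp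
    moreover have "eventually (\<lambda>n. prob {\<omega>\<in>space M. norm (W (n + n0) \<omega>) > R0} \<le> e / (4 * (B + 1))) sequentially"
      using R0 by (rule sequentially_offset)
    ultimately show "eventually (\<lambda>n. dist (expectation (\<lambda>\<omega>. g (V (n + n0) \<omega>)) - expectation (\<lambda>\<omega>. g (W (n + n0) \<omega>))) 0 < e) sequentially"
    proof eventually_elim
      case (elim n)
      let ?T = "{\<omega>\<in>space M. norm (W (n + n0) \<omega>) > R}"
      have hi: "integrable M (h n)" using h_le by (intro integrable_const_bound[of _ "2 * B"]) auto
      have Ti: "integrable M (indicat_real ?T)"
        by (intro integrable_const_bound[of _ 1]) (auto simp: indicator_def)
      have "\<bar>expectation (\<lambda>\<omega>. g (V (n + n0) \<omega>)) - expectation (\<lambda>\<omega>. g (W (n + n0) \<omega>))\<bar> =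
          \<bar>expectation (\<lambda>\<omega>. g (V (n + n0) \<omega>) - g (W (n + n0) \<omega>))\<bar>" using int by simp
      also have "\<dots> \<le> expectation (\<lambda>\<omega>. \<bar>g (V (n + n0) \<omega>) - g (W (n + n0) \<omega>)\<bar>)" by (rule integral_abs_bound)
      also have "\<dots> \<le> expectation (\<lambda>\<omega>. h n \<omega> + 2 * B * indicat_real ?T \<omega>)"
      proof (intro integral_mono)
        fix \<omega> assume "\<omega> \<in> space M"
        then show "\<bar>g (V (n + n0) \<omega>) - g (W (n + n0) \<omega>)\<bar> \<le> h n \<omega> + 2 * B * indicat_real ?T \<omega>"
          using B[of "V (n + n0) \<omega>"] B[of "W (n + n0) \<omega>"] by (auto simp: h_def indicator_def)
      qed (use int hi Ti in auto)
      also have "\<dots> = expectation (h n) + 2 * B * prob ?T"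
        using hi Ti by simp
      also have "2 * B * prob ?T \<le> 2 * B * (e / (4 * (B + 1)))"
      proof -
        have "prob ?T \<le> prob {\<omega>\<in>space M. norm (W (n + n0) \<omega>) > R0}"
          by (rule finite_measure_mono) (auto simp: R_def)
        then show ?thesis using elim(2) B0 by (intro mult_left_mono) auto
      qed
      also have "\<dots> \<le> e / 2" using B0 e by (simp add: field_simps)
      finally show ?case using elim(1) by simp
    qed
  qed
  moreover have "(\<lambda>n. expectation (\<lambda>\<omega>. g (W (n + n0) \<omega>))) \<longlonglongrightarrow> (LINT x|\<nu>. g x)"
    using limW by (rule LIMSEQ_ignore_initial_segment)
  ultimately have "(\<lambda>n. expectation (\<lambda>\<omega>. g (V (n + n0) \<omega>))) \<longlonglongrightarrow> (LINT x|\<nu>. g x)"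
    using tendsto_add by fastforce
  moreover have "(LINT x|distr M borel (V (n + n0)). g x) = expectation (\<lambda>\<omega>. g (V (n + n0) \<omega>))" for n
    by (rule integral_distr) measurable
  ultimately have "(\<lambda>n. LINT x|distr M borel (V (n + n0)). g x) \<longlonglongrightarrow> (LINT x|\<nu>. g x)"
    by simp
  then show "(\<lambda>n. LINT x|distr M borel (V n). g x) \<longlonglongrightarrow> (LINT x|\<nu>. g x)"
    by (rule LIMSEQ_offset)
qed

section \<open>Martingale limit theorems from conditional distributions\<close>

subsection \<open>Disintegration\<close>

lemma measurable_id_subalgebra: "subalgebra M F \<Longrightarrow> (\<lambda>\<omega>. \<omega>) \<in> M \<rightarrow>\<^sub>M F"
  unfolding subalgebra_def by (intro measurableI) (auto intro: sets.Int_space_eq2)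

text \<open>On a rectangle \<open>A \<times> B\<close> with \<open>A \<in> F\<close> both sides are the integral over \<open>A\<close> of the conditional probability of
  \<open>Y \<in> B\<close>, and the rectangles are an intersection-stable generator.\<close>

lemma distr_pair_eq_bind_kernel:
  fixes Y :: "'w \<Rightarrow> real"
  assumes M: "prob_space M" and F: "subalgebra M F"
    and Y [measurable]: "Y \<in> borel_measurable M" and \<kappa>: "is_cond_distribution M F Y \<kappa>"
  shows "(\<lambda>\<omega>. distr (\<kappa> \<omega>) (F \<Otimes>\<^sub>M borel) (Pair \<omega>)) \<in> M \<rightarrow>\<^sub>M subprob_algebra (F \<Otimes>\<^sub>M borel)"
    and "distr M (F \<Otimes>\<^sub>M borel) (\<lambda>\<omega>. (\<omega>, Y \<omega>)) = M \<bind> (\<lambda>\<omega>. distr (\<kappa> \<omega>) (F \<Otimes>\<^sub>M borel) (Pair \<omega>))"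
proof -
  interpret prob_space M by fact
  interpret finite_measure_subalgebra M F using F by unfold_locales
  let ?P = "F \<Otimes>\<^sub>M (borel :: real measure)"
  let ?N = "\<lambda>\<omega>. distr (\<kappa> \<omega>) ?P (Pair \<omega>)"
  have spF: "space F = space M" using F by (simp add: subalgebra_def)
  have idF [measurable]: "(\<lambda>\<omega>. \<omega>) \<in> M \<rightarrow>\<^sub>M F" using F by (rule measurable_id_subalgebra)
  have \<kappa>F: "\<kappa> \<in> F \<rightarrow>\<^sub>M subprob_algebra borel"
    using \<kappa> unfolding is_cond_distribution_def by (auto dest: measurable_prob_algebraD)
  have \<kappa>M [measurable]: "\<kappa> \<in> M \<rightarrow>\<^sub>M subprob_algebra borel"
    using measurable_compose[OF idF \<kappa>F] .
  have \<kappa>_prob: "prob_space (\<kappa> \<omega>)" "sets (\<kappa> \<omega>) = sets borel" if "\<omega> \<in> space M" for \<omega>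
    using \<kappa> that measurable_space[of \<kappa> F "prob_algebra borel" \<omega>] spF
    unfolding is_cond_distribution_def by (auto simp: space_prob_algebra)
  show N: "?N \<in> M \<rightarrow>\<^sub>M subprob_algebra ?P"
    by (rule measurable_distr2[where M=borel]) measurable
  have m1 [measurable]: "(\<lambda>\<omega>. (\<omega>, Y \<omega>)) \<in> M \<rightarrow>\<^sub>M ?P" by measurable
  show "distr M ?P (\<lambda>\<omega>. (\<omega>, Y \<omega>)) = M \<bind> ?N"
  proof (rule measure_eqI_generator_eq[OF Int_stable_pair_measure_generator[of F borel]])
    let ?E = "{a \<times> b |a b. a \<in> sets F \<and> b \<in> sets (borel :: real measure)}"
    show "?E \<subseteq> Pow (space ?P)"
      using sets.space_closed[of F] by (auto simp: space_pair_measure)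
    show "sets (distr M ?P (\<lambda>\<omega>. (\<omega>, Y \<omega>))) = sigma_sets (space ?P) ?E"
      by (simp add: sets_pair_measure space_pair_measure)
    have "sets (M \<bind> ?N) = sets ?P"
      using N not_empty by (subst sets_bind[where N="?P"]) (auto dest: sets_kernel)
    then show "sets (M \<bind> ?N) = sigma_sets (space ?P) ?E"
      by (simp add: sets_pair_measure space_pair_measure)
    show "range (\<lambda>_::nat. space F \<times> UNIV) \<subseteq> ?E" by (intro image_subsetI CollectI exI[of _ "space F"] exI[of _ UNIV] conjI) auto
    show "(\<Union>i::nat. space F \<times> UNIV) = space ?P" by (auto simp: space_pair_measure)
    show "emeasure (distr M ?P (\<lambda>\<omega>. (\<omega>, Y \<omega>))) (space F \<times> UNIV) \<noteq> \<infinity>"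
      by (subst emeasure_distr) (auto simp: emeasure_eq_measure)
  next
    fix E assume "E \<in> {a \<times> b |a b. a \<in> sets F \<and> b \<in> sets (borel :: real measure)}"
    then obtain A B where E: "E = A \<times> B" and A[measurable]: "A \<in> sets F" and B[measurable]: "B \<in> sets borel" by auto
    have AM [measurable]: "A \<in> sets M" using A F by (auto simp: subalgebra_def)
    have YB: "indicat_real (Y -` B) \<in> borel_measurable M"
      using measurable_sets[OF Y B] by (simp add: borel_measurable_indicator_iff)
    have int: "integrable M (\<lambda>\<omega>. indicat_real A \<omega> * indicat_real (Y -` B) \<omega>)"
      using YB by (intro integrable_const_bound[of _ 1]) (auto simp: indicator_def)
    have "emeasure (distr M ?P (\<lambda>\<omega>. (\<omega>, Y \<omega>))) E = emeasure M {\<omega>\<in>space M. \<omega> \<in> A \<and> Y \<omega> \<in> B}"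
      unfolding E by (subst emeasure_distr) (auto intro!: arg_cong[where f="emeasure M"])
    also have "\<dots> = (\<integral>\<^sup>+\<omega>. ennreal (indicat_real A \<omega> * indicat_real (Y -` B) \<omega>) \<partial>M)"
    proof -
      have "(\<integral>\<^sup>+\<omega>. ennreal (indicat_real A \<omega> * indicat_real (Y -` B) \<omega>) \<partial>M) =
          (\<integral>\<^sup>+\<omega>. indicator {\<omega>\<in>space M. \<omega> \<in> A \<and> Y \<omega> \<in> B} \<omega> \<partial>M)"
        by (intro nn_integral_cong) (auto simp: indicator_def)
      then show ?thesis by simp
    qed
    also have "\<dots> = ennreal (\<integral>\<omega>. indicat_real A \<omega> * indicat_real (Y -` B) \<omega> \<partial>M)"
      using int by (intro nn_integral_eq_integral) auto
    also have "(\<integral>\<omega>. indicat_real A \<omega> * indicat_real (Y -` B) \<omega> \<partial>M) =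
        (\<integral>\<omega>. indicat_real A \<omega> * real_cond_exp M F (indicat_real (Y -` B)) \<omega> \<partial>M)"
      using real_cond_exp_intg(2)[OF int _ YB] by simp
    also have "\<dots> = (\<integral>\<omega>. indicat_real A \<omega> * measure (\<kappa> \<omega>) B \<partial>M)"
    proof (rule integral_cong_AE)
      show "AE \<omega> in M. indicat_real A \<omega> * real_cond_exp M F (indicat_real (Y -` B)) \<omega> = indicat_real A \<omega> * measure (\<kappa> \<omega>) B"
        using \<kappa> B unfolding is_cond_distribution_def by auto
    qed measurable
    also have "ennreal \<dots> = (\<integral>\<^sup>+\<omega>. ennreal (indicat_real A \<omega> * measure (\<kappa> \<omega>) B) \<partial>M)"
    proof (rule nn_integral_eq_integral[symmetric])
      show "integrable M (\<lambda>\<omega>. indicat_real A \<omega> * measure (\<kappa> \<omega>) B)"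
        using \<kappa>_prob by (intro integrable_const_bound[of _ 1]) (auto simp: indicator_def prob_space.prob_le_1)
    qed auto
    also have "\<dots> = (\<integral>\<^sup>+\<omega>. emeasure (?N \<omega>) E \<partial>M)"
    proof (rule nn_integral_cong)
      fix \<omega> assume \<omega>: "\<omega> \<in> space M"
      interpret k: prob_space "\<kappa> \<omega>" by (rule \<kappa>_prob[OF \<omega>])
      have Pm: "Pair \<omega> \<in> \<kappa> \<omega> \<rightarrow>\<^sub>M ?P"
        using \<omega> spF by (intro measurable_Pair measurable_const) (auto simp: \<kappa>_prob(2)[OF \<omega>] measurable_ident_sets)
      have vimg: "Pair \<omega> -` E \<inter> space (\<kappa> \<omega>) = (if \<omega> \<in> A then B else {})"
        using sets_eq_imp_space_eq[OF \<kappa>_prob(2)[OF \<omega>]] by (auto simp: E)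
      have "E \<in> sets ?P" unfolding E using A B by (rule pair_measureI)
      then have "emeasure (?N \<omega>) E = emeasure (\<kappa> \<omega>) (if \<omega> \<in> A then B else {})"
        unfolding vimg[symmetric] by (rule emeasure_distr[OF Pm])
      then have "emeasure (?N \<omega>) E = indicator A \<omega> * emeasure (\<kappa> \<omega>) B"
        by (cases "\<omega> \<in> A") simp_all
      then show "ennreal (indicat_real A \<omega> * measure (\<kappa> \<omega>) B) = emeasure (?N \<omega>) E"
        by (simp add: k.emeasure_eq_measure indicator_def)
    qed
    also have "\<dots> = emeasure (M \<bind> ?N) E"
      unfolding E using N not_empty by (intro emeasure_bind[symmetric]) auto
    finally show "emeasure (distr M ?P (\<lambda>\<omega>. (\<omega>, Y \<omega>))) E = emeasure (M \<bind> ?N) E" .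
  qed
qed

lemma kernel_prob_space:
  assumes "subalgebra M F" "is_cond_distribution M F Y \<kappa>" "\<omega> \<in> space M"
  shows "prob_space (\<kappa> \<omega>)" "sets (\<kappa> \<omega>) = sets borel"
  using assms measurable_space[of \<kappa> F "prob_algebra borel" \<omega>]
  unfolding is_cond_distribution_def subalgebra_def by (auto simp: space_prob_algebra)

lemma
  fixes Y :: "'w \<Rightarrow> real"
  assumes M: "prob_space M" and F: "subalgebra M F"
    and Y [measurable]: "Y \<in> borel_measurable M" and \<kappa>: "is_cond_distribution M F Y \<kappa>"
  shows nn_integral_disintegrate: "\<And>H. (\<lambda>(\<omega>, y). H \<omega> y) \<in> borel_measurable (F \<Otimes>\<^sub>M borel) \<Longrightarrow>
      (\<integral>\<^sup>+\<omega>. H \<omega> (Y \<omega>) \<partial>M) = (\<integral>\<^sup>+\<omega>. \<integral>\<^sup>+y. H \<omega> y \<partial>\<kappa> \<omega> \<partial>M)"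
    and integral_disintegrate: "\<And>h B. (\<lambda>(\<omega>, y). h \<omega> y) \<in> borel_measurable (F \<Otimes>\<^sub>M borel) \<Longrightarrow>
      (\<And>\<omega> y. \<bar>h \<omega> y :: real\<bar> \<le> B) \<Longrightarrow> (\<integral>\<omega>. h \<omega> (Y \<omega>) \<partial>M) = (\<integral>\<omega>. \<integral>y. h \<omega> y \<partial>\<kappa> \<omega> \<partial>M)"
proof -
  interpret prob_space M by fact
  let ?P = "F \<Otimes>\<^sub>M (borel :: real measure)"
  let ?N = "\<lambda>\<omega>. distr (\<kappa> \<omega>) ?P (Pair \<omega>)"
  note N = distr_pair_eq_bind_kernel[OF M F Y \<kappa>]
  have [measurable]: "(\<lambda>\<omega>. \<omega>) \<in> M \<rightarrow>\<^sub>M F" using F by (rule measurable_id_subalgebra)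
  have pm [measurable]: "(\<lambda>\<omega>. (\<omega>, Y \<omega>)) \<in> M \<rightarrow>\<^sub>M ?P" by measurable
  have Pair_meas: "Pair \<omega> \<in> \<kappa> \<omega> \<rightarrow>\<^sub>M ?P" if "\<omega> \<in> space M" for \<omega>
    using that F kernel_prob_space(2)[OF F \<kappa> that]
    by (intro measurable_Pair measurable_const) (auto simp: subalgebra_def measurable_ident_sets)
  fix H :: "'w \<Rightarrow> real \<Rightarrow> ennreal" assume H: "(\<lambda>(\<omega>, y). H \<omega> y) \<in> borel_measurable ?P"
  have "(\<integral>\<^sup>+\<omega>. H \<omega> (Y \<omega>) \<partial>M) = (\<integral>\<^sup>+p. (case p of (\<omega>, y) \<Rightarrow> H \<omega> y) \<partial>distr M ?P (\<lambda>\<omega>. (\<omega>, Y \<omega>)))"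
    using H by (subst nn_integral_distr[OF pm]) auto
  also have "\<dots> = (\<integral>\<^sup>+\<omega>. \<integral>\<^sup>+p. (case p of (\<omega>, y) \<Rightarrow> H \<omega> y) \<partial>?N \<omega> \<partial>M)"
    unfolding N(2) by (rule nn_integral_bind[OF H N(1)])
  also have "\<dots> = (\<integral>\<^sup>+\<omega>. \<integral>\<^sup>+y. H \<omega> y \<partial>\<kappa> \<omega> \<partial>M)"
    using H by (intro nn_integral_cong, subst nn_integral_distr[OF Pair_meas]) auto
  finally show "(\<integral>\<^sup>+\<omega>. H \<omega> (Y \<omega>) \<partial>M) = (\<integral>\<^sup>+\<omega>. \<integral>\<^sup>+y. H \<omega> y \<partial>\<kappa> \<omega> \<partial>M)" .
next
  interpret prob_space M by fact
  let ?P = "F \<Otimes>\<^sub>M (borel :: real measure)"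
  let ?N = "\<lambda>\<omega>. distr (\<kappa> \<omega>) ?P (Pair \<omega>)"
  note N = distr_pair_eq_bind_kernel[OF M F Y \<kappa>]
  have [measurable]: "(\<lambda>\<omega>. \<omega>) \<in> M \<rightarrow>\<^sub>M F" using F by (rule measurable_id_subalgebra)
  have pm [measurable]: "(\<lambda>\<omega>. (\<omega>, Y \<omega>)) \<in> M \<rightarrow>\<^sub>M ?P" by measurable
  have Pair_meas: "Pair \<omega> \<in> \<kappa> \<omega> \<rightarrow>\<^sub>M ?P" if "\<omega> \<in> space M" for \<omega>
    using that F kernel_prob_space(2)[OF F \<kappa> that]
    by (intro measurable_Pair measurable_const) (auto simp: subalgebra_def measurable_ident_sets)
  fix h :: "'w \<Rightarrow> real \<Rightarrow> real" and B assume h: "(\<lambda>(\<omega>, y). h \<omega> y) \<in> borel_measurable ?P"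
    and B: "\<And>\<omega> y. \<bar>h \<omega> y\<bar> \<le> B"
  have "(\<integral>\<omega>. h \<omega> (Y \<omega>) \<partial>M) = (\<integral>p. (case p of (\<omega>, y) \<Rightarrow> h \<omega> y) \<partial>distr M ?P (\<lambda>\<omega>. (\<omega>, Y \<omega>)))"
    using h by (subst integral_distr[OF pm]) auto
  also have "\<dots> = (\<integral>\<omega>. \<integral>p. (case p of (\<omega>, y) \<Rightarrow> h \<omega> y) \<partial>?N \<omega> \<partial>M)"
    unfolding N(2)
  proof (rule integral_bind[OF h _ N(1), where B=B and B'=1])
    show "finite_measure M" by unfold_locales
    show "AE \<omega> in M. emeasure (?N \<omega>) (space (?N \<omega>)) \<le> ennreal 1"
    proof (rule AE_I2)
      fix \<omega> assume \<omega>: "\<omega> \<in> space M"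
      have "prob_space (?N \<omega>)"
        by (rule prob_space.prob_space_distr[OF kernel_prob_space(1)[OF F \<kappa> \<omega>] Pair_meas[OF \<omega>]])
      from prob_space.emeasure_space_1[OF this]
      show "emeasure (?N \<omega>) (space (?N \<omega>)) \<le> ennreal 1" by simp
    qed
  qed (use B in auto)
  also have "\<dots> = (\<integral>\<omega>. \<integral>y. h \<omega> y \<partial>\<kappa> \<omega> \<partial>M)"
    using h by (intro Bochner_Integration.integral_cong refl, subst integral_distr[OF Pair_meas]) auto
  finally show "(\<integral>\<omega>. h \<omega> (Y \<omega>) \<partial>M) = (\<integral>\<omega>. \<integral>y. h \<omega> y \<partial>\<kappa> \<omega> \<partial>M)" .
qed

lemma integral_kernel_measurable:
  fixes Y :: "'w \<Rightarrow> real" and h :: "'w \<Rightarrow> real \<Rightarrow> real"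
  assumes M: "prob_space M" and F: "subalgebra M F"
    and Y: "Y \<in> borel_measurable M" and \<kappa>: "is_cond_distribution M F Y \<kappa>"
    and h: "(\<lambda>(\<omega>, y). h \<omega> y) \<in> borel_measurable (F \<Otimes>\<^sub>M borel)"
  shows "(\<lambda>\<omega>. \<integral>y. h \<omega> y \<partial>\<kappa> \<omega>) \<in> borel_measurable M"
proof -
  let ?N = "\<lambda>\<omega>. distr (\<kappa> \<omega>) (F \<Otimes>\<^sub>M borel) (Pair \<omega>)"
  have N: "(\<lambda>\<omega>. \<integral>p. (case p of (\<omega>, y) \<Rightarrow> h \<omega> y) \<partial>?N \<omega>) \<in> borel_measurable M"
    by (rule measurable_compose[OF distr_pair_eq_bind_kernel(1)[OF M F Y \<kappa>] integral_measurable_subprob_algebra[OF h]])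
  have eq: "(\<integral>p. (case p of (\<omega>, y) \<Rightarrow> h \<omega> y) \<partial>?N \<omega>) = (\<integral>y. h \<omega> y \<partial>\<kappa> \<omega>)" if "\<omega> \<in> space M" for \<omega>
  proof -
    have Pm: "Pair \<omega> \<in> \<kappa> \<omega> \<rightarrow>\<^sub>M F \<Otimes>\<^sub>M borel"
      using that F kernel_prob_space(2)[OF F \<kappa> that]
      by (intro measurable_Pair measurable_const) (auto simp: subalgebra_def measurable_ident_sets)
    show ?thesis by (subst integral_distr[OF Pm h]) simp
  qed
  show ?thesis by (rule measurable_cong[THEN iffD1, OF eq N])
qed

subsection \<open>Adapted sequences\<close>

lemma abs_power_le_even_power:
  fixes x :: real
  assumes j: "j \<le> m" and m: "even m"
  shows "\<bar>x\<bar> ^ j \<le> 1 + x ^ m"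
proof (cases "\<bar>x\<bar> \<le> 1")
  case True
  then have "\<bar>x\<bar> ^ j \<le> 1" by (intro power_le_one) auto
  moreover have "0 \<le> x ^ m" using m by (rule zero_le_even_power)
  ultimately show ?thesis by linarith
next
  case False
  then have "\<bar>x\<bar> ^ j \<le> \<bar>x\<bar> ^ m" using j by (intro power_increasing) auto
  then show ?thesis using m by (simp add: power_even_abs)
qed

text \<open>The terms that are linear in the centred variable \<open>X\<close> vanish, so that \<open>s\<close> enters the increments of the
  moments with exponent at most \<open>0\<close> and \<open>2\<close>, respectively. The constant \<open>C\<close> bounds the moments of all
  orders up to four at once.\<close>

lemma (in prob_space) centred_moments:
  fixes X :: "'a \<Rightarrow> real"
  assumes X [measurable]: "X \<in> borel_measurable M" and int: "integrable M (\<lambda>x. X x ^ 4)"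
    and mean: "expectation X = 0" and C: "expectation (\<lambda>x. X x ^ 4) + 1 \<le> C"
  shows "(\<integral>\<^sup>+x. ennreal ((s + X x)\<^sup>2) \<partial>M) \<le> ennreal (s\<^sup>2 + C)"
    and "(\<integral>\<^sup>+x. ennreal ((s + X x) ^ 4) \<partial>M) \<le> ennreal (s ^ 4 + 8 * C * s\<^sup>2 + 3 * C)"
proof -
  have dom: "integrable M (\<lambda>x. 1 + X x ^ 4)" using int by simp
  have int_j: "integrable M (\<lambda>x. X x ^ j)" and abs_j: "\<bar>expectation (\<lambda>x. X x ^ j)\<bar> \<le> C" if "j \<le> 4" for j
  proof -
    show i: "integrable M (\<lambda>x. X x ^ j)"
      by (rule Bochner_Integration.integrable_bound[OF dom])
         (use abs_power_le_even_power[OF that, simplified] in \<open>auto simp: power_abs intro!: order_trans[OF _ abs_ge_self]\<close>)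
    have "\<bar>expectation (\<lambda>x. X x ^ j)\<bar> \<le> expectation (\<lambda>x. \<bar>X x ^ j\<bar>)" by (rule integral_abs_bound)
    also have "\<dots> \<le> expectation (\<lambda>x. 1 + X x ^ 4)"
      using i dom abs_power_le_even_power[OF that, simplified]
      by (intro integral_mono integrable_abs) (auto simp: power_abs)
    also have "\<dots> \<le> C" using int C by (simp add: prob_space)
    finally show "\<bar>expectation (\<lambda>x. X x ^ j)\<bar> \<le> C" .
  qed
  have i: "integrable M X" "integrable M (\<lambda>x. (X x)\<^sup>2)" "integrable M (\<lambda>x. X x ^ 3)"
    using int_j[of 1] int_j[of 2] int_j[of 3] by auto
  have "(\<integral>\<^sup>+x. ennreal ((s + X x)\<^sup>2) \<partial>M) = ennreal (expectation (\<lambda>x. (s + X x)\<^sup>2))"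
  proof (rule nn_integral_eq_integral)
    show "integrable M (\<lambda>x. (s + X x)\<^sup>2)" using i by (simp add: power2_sum)
  qed simp
  also have "expectation (\<lambda>x. (s + X x)\<^sup>2) = s\<^sup>2 + expectation (\<lambda>x. (X x)\<^sup>2)"
    using i by (simp add: power2_sum mean prob_space)
  also have "\<dots> \<le> s\<^sup>2 + C" using abs_j[of 2] by simp
  finally show "(\<integral>\<^sup>+x. ennreal ((s + X x)\<^sup>2) \<partial>M) \<le> ennreal (s\<^sup>2 + C)" by (simp add: ennreal_leI)
  have expand: "(s + X x) ^ 4 = s ^ 4 + 4 * s ^ 3 * X x + 6 * s\<^sup>2 * (X x)\<^sup>2 + 4 * s * X x ^ 3 + X x ^ 4" for x
    by (simp add: power4_eq_xxxx power3_eq_cube power2_eq_square algebra_simps)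
  have "(\<integral>\<^sup>+x. ennreal ((s + X x) ^ 4) \<partial>M) = ennreal (expectation (\<lambda>x. (s + X x) ^ 4))"
  proof (rule nn_integral_eq_integral)
    show "integrable M (\<lambda>x. (s + X x) ^ 4)" using i int by (simp add: expand)
  qed simp
  also have "expectation (\<lambda>x. (s + X x) ^ 4) =
      s ^ 4 + 6 * s\<^sup>2 * expectation (\<lambda>x. (X x)\<^sup>2) + 4 * s * expectation (\<lambda>x. X x ^ 3) + expectation (\<lambda>x. X x ^ 4)"
    using i int by (simp add: expand mean prob_space)
  also have "\<dots> \<le> s ^ 4 + 6 * s\<^sup>2 * C + (2 * s\<^sup>2 + 2) * C + C"
  proof (intro add_mono mult_left_mono)
    \<comment> \<open>absorbs the term with the third moment into the other two\<close>
    have "4 * \<bar>s\<bar> \<le> 2 * s\<^sup>2 + 2"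
      using zero_le_power2[of "\<bar>s\<bar> - 1"] by (simp add: power2_diff)
    have "4 * s * expectation (\<lambda>x. X x ^ 3) \<le> \<bar>4 * s\<bar> * \<bar>expectation (\<lambda>x. X x ^ 3)\<bar>"
      by (simp flip: abs_mult)
    also have "\<dots> \<le> (2 * s\<^sup>2 + 2) * C"
      using abs_j[of 3] \<open>4 * \<bar>s\<bar> \<le> 2 * s\<^sup>2 + 2\<close> by (intro mult_mono) auto
    finally show "4 * s * expectation (\<lambda>x. X x ^ 3) \<le> (2 * s\<^sup>2 + 2) * C" .
  qed (use abs_j[of 2] abs_j[of 4] in auto)
  also have "\<dots> = s ^ 4 + 8 * C * s\<^sup>2 + 3 * C" by (simp add: algebra_simps)
  finally show "(\<integral>\<^sup>+x. ennreal ((s + X x) ^ 4) \<partial>M) \<le> ennreal (s ^ 4 + 8 * C * s\<^sup>2 + 3 * C)"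
    by (simp add: ennreal_leI)
qed

text \<open>The variable \<open>Y k\<close> is revealed between the times \<open>k\<close> and \<open>k + 1\<close>, and \<open>\<kappa> k\<close> is its conditional distribution given
  the past. Conditional expectations of functions of the past and \<open>Y k\<close> are thus integrals with respect to
  \<open>\<kappa> k \<omega>\<close>, for each \<open>\<omega>\<close> separately.\<close>

locale adapted_sequence =
  fixes M :: "'w measure" and F :: "nat \<Rightarrow> 'w measure" and Y :: "nat \<Rightarrow> 'w \<Rightarrow> real"
    and \<kappa> :: "nat \<Rightarrow> 'w \<Rightarrow> real measure"
  assumes prob: "prob_space M" and sub: "\<And>k. subalgebra M (F k)"
    and mono: "\<And>j k. j \<le> k \<Longrightarrow> sets (F j) \<subseteq> sets (F k)"
    and Y_meas: "\<And>k. Y k \<in> borel_measurable (F (Suc k))"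
    and cond: "\<And>k. is_cond_distribution M (F k) (Y k) (\<kappa> k)"
begin

sublocale prob_space M by (rule prob)

lemma space_F: "space (F k) = space M"
  using sub by (simp add: subalgebra_def)

lemma measurable_F_mono: "f \<in> F j \<rightarrow>\<^sub>M N \<Longrightarrow> j \<le> k \<Longrightarrow> f \<in> F k \<rightarrow>\<^sub>M N"
  using mono[of j k] by (auto simp: measurable_def space_F)

lemma measurable_F_M: "f \<in> F j \<rightarrow>\<^sub>M N \<Longrightarrow> f \<in> M \<rightarrow>\<^sub>M N"
  using sub by (rule measurable_from_subalg)

lemma Y_M: "Y k \<in> borel_measurable M"
  using Y_meas by (rule measurable_F_M)

lemma kernel: "\<omega> \<in> space M \<Longrightarrow> prob_space (\<kappa> k \<omega>)" "\<omega> \<in> space M \<Longrightarrow> sets (\<kappa> k \<omega>) = sets borel"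
  using kernel_prob_space[OF sub cond] by auto

lemma measurable_insert_Y:
  assumes g: "(\<lambda>(\<omega>, y). g \<omega> y) \<in> F k \<Otimes>\<^sub>M borel \<rightarrow>\<^sub>M N"
  shows "(\<lambda>\<omega>. g \<omega> (Y k \<omega>)) \<in> F (Suc k) \<rightarrow>\<^sub>M N"
proof -
  have "(\<lambda>\<omega>. \<omega>) \<in> F (Suc k) \<rightarrow>\<^sub>M F k"
    by (rule measurable_F_mono[of _ k]) auto
  then have "(\<lambda>\<omega>. (\<omega>, Y k \<omega>)) \<in> F (Suc k) \<rightarrow>\<^sub>M F k \<Otimes>\<^sub>M borel"
    by (intro measurable_Pair Y_meas)
  from measurable_compose[OF this g] show ?thesis by simp
qed

lemma partial_sum_measurable:
  fixes g :: "nat \<Rightarrow> 'w \<Rightarrow> real \<Rightarrow> real"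
  assumes g: "\<And>k. (\<lambda>(\<omega>, y). g k \<omega> y) \<in> borel_measurable (F k \<Otimes>\<^sub>M borel)"
  shows "(\<lambda>\<omega>. \<Sum>k<n. g k \<omega> (Y k \<omega>)) \<in> borel_measurable (F n)"
proof (rule borel_measurable_sum)
  fix k assume "k \<in> {..<n}"
  then show "(\<lambda>\<omega>. g k \<omega> (Y k \<omega>)) \<in> borel_measurable (F n)"
    by (intro measurable_F_mono[OF measurable_insert_Y[OF g]]) auto
qed

lemma kernel_measurable_section:
  assumes g: "(\<lambda>(\<omega>, y). g \<omega> y) \<in> F k \<Otimes>\<^sub>M borel \<rightarrow>\<^sub>M N" and \<omega>: "\<omega> \<in> space M"
  shows "g \<omega> \<in> \<kappa> k \<omega> \<rightarrow>\<^sub>M N"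
proof -
  have "g \<omega> \<in> borel \<rightarrow>\<^sub>M N"
    using measurable_compose[OF measurable_Pair1' g, of \<omega>] \<omega> by (simp add: space_F)
  then show ?thesis using kernel(2)[OF \<omega>] by (simp cong: measurable_cong_sets)
qed

lemma nn_integral_past_and_next:
  assumes s [measurable]: "s \<in> borel_measurable (F k)" and g [measurable]: "(\<lambda>(\<omega>, y). g \<omega> y) \<in> borel_measurable (F k \<Otimes>\<^sub>M borel)"
    and p: "(\<lambda>(x, y). p x y) \<in> borel_measurable (borel \<Otimes>\<^sub>M borel)"
  shows "(\<integral>\<^sup>+\<omega>. p (s \<omega> :: real) (g \<omega> (Y k \<omega>) :: real) \<partial>M) = (\<integral>\<^sup>+\<omega>. \<integral>\<^sup>+y. p (s \<omega>) (g \<omega> y) \<partial>\<kappa> k \<omega> \<partial>M)"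
proof (rule nn_integral_disintegrate[OF prob sub Y_M cond])
  have "(\<lambda>q. (s (fst q), g (fst q) (snd q))) \<in> F k \<Otimes>\<^sub>M borel \<rightarrow>\<^sub>M borel \<Otimes>\<^sub>M borel"
    using g by (intro measurable_Pair) (auto simp: split_beta)
  from measurable_compose[OF this p]
  show "(\<lambda>(\<omega>, y). p (s \<omega>) (g \<omega> y)) \<in> borel_measurable (F k \<Otimes>\<^sub>M borel)"
    by (simp add: split_beta)
qed

lemma
  fixes g :: "nat \<Rightarrow> 'w \<Rightarrow> real \<Rightarrow> real" and S :: "nat \<Rightarrow> 'w \<Rightarrow> real"
  assumes g: "\<And>k. (\<lambda>(\<omega>, y). g k \<omega> y) \<in> borel_measurable (F k \<Otimes>\<^sub>M borel)"
    and int: "\<And>k \<omega>. \<omega> \<in> space M \<Longrightarrow> integrable (\<kappa> k \<omega>) (\<lambda>y. g k \<omega> y ^ 4)"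
    and mean: "\<And>k \<omega>. \<omega> \<in> space M \<Longrightarrow> (\<integral>y. g k \<omega> y \<partial>\<kappa> k \<omega>) = 0"
    and C: "\<And>k \<omega>. \<omega> \<in> space M \<Longrightarrow> (\<integral>y. g k \<omega> y ^ 4 \<partial>\<kappa> k \<omega>) + 1 \<le> C" "C \<ge> 1"
  defines "S \<equiv> \<lambda>n \<omega>. \<Sum>k<n. g k \<omega> (Y k \<omega>)"
  shows martingale_second_moment: "\<And>n. (\<integral>\<^sup>+\<omega>. ennreal ((S n \<omega>)\<^sup>2) \<partial>M) \<le> ennreal (real n * C)"
    and martingale_fourth_moment: "\<And>n. (\<integral>\<^sup>+\<omega>. ennreal (S n \<omega> ^ 4) \<partial>M) \<le> ennreal (11 * C\<^sup>2 * (real n)\<^sup>2)"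
proof -
  have S_meas: "S n \<in> borel_measurable (F n)" for n
    unfolding S_def by (rule partial_sum_measurable[OF g])
  have [measurable]: "S n \<in> borel_measurable M" for n using S_meas by (rule measurable_F_M)
  have m: "(\<integral>\<^sup>+y. ennreal ((s + g n \<omega> y)\<^sup>2) \<partial>\<kappa> n \<omega>) \<le> ennreal (s\<^sup>2 + C)"
     "(\<integral>\<^sup>+y. ennreal ((s + g n \<omega> y) ^ 4) \<partial>\<kappa> n \<omega>) \<le> ennreal (s ^ 4 + 8 * C * s\<^sup>2 + 3 * C)"
    if "\<omega> \<in> space M" for \<omega> n s
    using prob_space.centred_moments[OF kernel(1)[OF that] kernel_measurable_section[OF g that] int[OF that] mean[OF that] C(1)[OF that]]
    by blast+
  have S_Suc: "S (Suc n) \<omega> = S n \<omega> + g n \<omega> (Y n \<omega>)" for n \<omega> by (simp add: S_def)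
  have 2: "(\<integral>\<^sup>+\<omega>. ennreal ((S n \<omega>)\<^sup>2) \<partial>M) \<le> ennreal (real n * C)" for n
  proof (induction n)
    case (Suc n)
    have "(\<integral>\<^sup>+\<omega>. ennreal ((S (Suc n) \<omega>)\<^sup>2) \<partial>M) = (\<integral>\<^sup>+\<omega>. \<integral>\<^sup>+y. ennreal ((S n \<omega> + g n \<omega> y)\<^sup>2) \<partial>\<kappa> n \<omega> \<partial>M)"
      unfolding S_Suc by (rule nn_integral_past_and_next[OF S_meas g, where p="\<lambda>x y. ennreal ((x + y)\<^sup>2)"]) measurable
    also have "\<dots> \<le> (\<integral>\<^sup>+\<omega>. ennreal ((S n \<omega>)\<^sup>2) + ennreal C \<partial>M)"
      using C(2) by (intro nn_integral_mono order_trans[OF m(1)]) (auto simp: ennreal_plus[symmetric] simp del: ennreal_plus)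
    also have "\<dots> = (\<integral>\<^sup>+\<omega>. ennreal ((S n \<omega>)\<^sup>2) \<partial>M) + ennreal C"
      by (subst nn_integral_add) (auto simp: emeasure_space_1)
    also have "\<dots> \<le> ennreal (real n * C) + ennreal C" using Suc by (intro add_right_mono)
    also have "\<dots> = ennreal (real (Suc n) * C)"
      using C(2) by (subst ennreal_plus[symmetric]) (auto simp: algebra_simps)
    finally show ?case .
  qed (simp add: S_def)
  show "(\<integral>\<^sup>+\<omega>. ennreal ((S n \<omega>)\<^sup>2) \<partial>M) \<le> ennreal (real n * C)" for n by (rule 2)
  show "(\<integral>\<^sup>+\<omega>. ennreal (S n \<omega> ^ 4) \<partial>M) \<le> ennreal (11 * C\<^sup>2 * (real n)\<^sup>2)" for n
  proof (induction n)
    case (Suc n)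
    have "(\<integral>\<^sup>+\<omega>. ennreal (S (Suc n) \<omega> ^ 4) \<partial>M) = (\<integral>\<^sup>+\<omega>. \<integral>\<^sup>+y. ennreal ((S n \<omega> + g n \<omega> y) ^ 4) \<partial>\<kappa> n \<omega> \<partial>M)"
      unfolding S_Suc by (rule nn_integral_past_and_next[OF S_meas g, where p="\<lambda>x y. ennreal ((x + y) ^ 4)"]) measurable
    also have "\<dots> \<le> (\<integral>\<^sup>+\<omega>. ennreal (S n \<omega> ^ 4) + ennreal (8 * C) * ennreal ((S n \<omega>)\<^sup>2) + ennreal (3 * C) \<partial>M)"
    proof (rule nn_integral_mono)
      fix \<omega> assume \<omega>: "\<omega> \<in> space M"
      have "ennreal (S n \<omega> ^ 4 + 8 * C * (S n \<omega>)\<^sup>2 + 3 * C) = ennreal (S n \<omega> ^ 4) + ennreal (8 * C) * ennreal ((S n \<omega>)\<^sup>2) + ennreal (3 * C)"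
        using C(2) by (simp add: ennreal_plus ennreal_mult')
      with m(2)[OF \<omega>, of n "S n \<omega>"]
      show "(\<integral>\<^sup>+y. ennreal ((S n \<omega> + g n \<omega> y) ^ 4) \<partial>\<kappa> n \<omega>) \<le> ennreal (S n \<omega> ^ 4) + ennreal (8 * C) * ennreal ((S n \<omega>)\<^sup>2) + ennreal (3 * C)"
        by simp
    qed
    also have "\<dots> = (\<integral>\<^sup>+\<omega>. ennreal (S n \<omega> ^ 4) \<partial>M) + ennreal (8 * C) * (\<integral>\<^sup>+\<omega>. ennreal ((S n \<omega>)\<^sup>2) \<partial>M) + ennreal (3 * C)"
      by (simp add: nn_integral_add nn_integral_cmult emeasure_space_1)
    also have "\<dots> \<le> ennreal (11 * C\<^sup>2 * (real n)\<^sup>2) + ennreal (8 * C) * ennreal (real n * C) + ennreal (3 * C)"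
      using Suc 2[of n] by (intro add_mono mult_left_mono) auto
    also have "\<dots> = ennreal (11 * C\<^sup>2 * (real n)\<^sup>2 + 8 * C * (real n * C) + 3 * C)"
      using C(2) by (simp add: ennreal_plus ennreal_mult')
    \<comment> \<open>\<open>11\<close> is the sum of the constants \<open>8\<close> and \<open>3\<close> from the one-step bound.\<close>
    also have "\<dots> \<le> ennreal (11 * C\<^sup>2 * (real (Suc n))\<^sup>2)"
    proof (rule ennreal_leI)
      have "C \<le> C\<^sup>2" using C(2) by (simp add: power2_eq_square)
      moreover have "11 * C\<^sup>2 * (real (Suc n))\<^sup>2 = 11 * C\<^sup>2 * (real n)\<^sup>2 + 22 * C\<^sup>2 * real n + 11 * C\<^sup>2"
        by (simp add: power2_eq_square algebra_simps)
      moreover have "8 * C * (real n * C) \<le> 22 * C\<^sup>2 * real n"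
        using C(2) by (simp add: power2_eq_square algebra_simps)
      ultimately show "11 * C\<^sup>2 * (real n)\<^sup>2 + 8 * C * (real n * C) + 3 * C \<le> 11 * C\<^sup>2 * (real (Suc n))\<^sup>2"
        using C(2) by linarith
    qed
    finally show ?case .
  qed (simp add: S_def)
qed

text \<open>With the fourth moment of the sum of order \<open>n\<^sup>2\<close>, the series of the expectations of \<open>(S n / n) ^ 4\<close>
  converges, so that almost surely the series itself converges.\<close>

theorem martingale_slln:
  fixes g :: "nat \<Rightarrow> 'w \<Rightarrow> real \<Rightarrow> real"
  assumes g: "\<And>k. (\<lambda>(\<omega>, y). g k \<omega> y) \<in> borel_measurable (F k \<Otimes>\<^sub>M borel)"
    and int: "\<And>k \<omega>. \<omega> \<in> space M \<Longrightarrow> integrable (\<kappa> k \<omega>) (\<lambda>y. g k \<omega> y ^ 4)"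
    and mean: "\<And>k \<omega>. \<omega> \<in> space M \<Longrightarrow> (\<integral>y. g k \<omega> y \<partial>\<kappa> k \<omega>) = 0"
    and C: "\<And>k \<omega>. \<omega> \<in> space M \<Longrightarrow> (\<integral>y. g k \<omega> y ^ 4 \<partial>\<kappa> k \<omega>) \<le> C"
  shows "AE \<omega> in M. (\<lambda>n. (\<Sum>k<n. g k \<omega> (Y k \<omega>)) / real n) \<longlonglongrightarrow> 0"
proof -
  define S where "S = (\<lambda>n \<omega>. \<Sum>k<n. g k \<omega> (Y k \<omega>))"
  define D where "D = \<bar>C\<bar> + 1"
  have "D \<ge> 1" by (simp add: D_def)
  have S_meas: "S n \<in> borel_measurable (F n)" for n
    unfolding S_def by (rule partial_sum_measurable[OF g])
  have [measurable]: "S n \<in> borel_measurable M" for n using S_meas by (rule measurable_F_M)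
  have 4: "(\<integral>\<^sup>+\<omega>. ennreal (S n \<omega> ^ 4) \<partial>M) \<le> ennreal (11 * D\<^sup>2 * (real n)\<^sup>2)" for n
    unfolding S_def using \<open>D \<ge> 1\<close>
    by (intro martingale_fourth_moment g int mean) (auto simp: D_def intro: order_trans[OF C])
  define Z where "Z = (\<lambda>n \<omega>. (S (Suc n) \<omega> / real (Suc n)) ^ 4)"
  have [measurable]: "Z n \<in> borel_measurable M" for n unfolding Z_def by measurable
  have EZ: "(\<integral>\<^sup>+\<omega>. ennreal (Z n \<omega>) \<partial>M) \<le> ennreal (11 * D\<^sup>2 * (1 / (real (Suc n))\<^sup>2))" for n
  proof -
    have "(\<integral>\<^sup>+\<omega>. ennreal (Z n \<omega>) \<partial>M) = (\<integral>\<^sup>+\<omega>. ennreal (1 / real (Suc n) ^ 4) * ennreal (S (Suc n) \<omega> ^ 4) \<partial>M)"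
      by (intro nn_integral_cong) (simp add: Z_def power_divide ennreal_mult'[symmetric])
    also have "\<dots> = ennreal (1 / real (Suc n) ^ 4) * (\<integral>\<^sup>+\<omega>. ennreal (S (Suc n) \<omega> ^ 4) \<partial>M)"
      by (rule nn_integral_cmult) measurable
    also have "\<dots> \<le> ennreal (1 / real (Suc n) ^ 4) * ennreal (11 * D\<^sup>2 * (real (Suc n))\<^sup>2)"
      by (intro mult_left_mono 4) auto
    also have "\<dots> = ennreal (11 * D\<^sup>2 * (1 / (real (Suc n))\<^sup>2))"
      by (subst ennreal_mult'[symmetric])
         (auto simp: power4_eq_xxxx power2_eq_square simp del: of_nat_Suc)
    finally show ?thesis .
  qed
  have summ: "summable (\<lambda>n. 11 * D\<^sup>2 * (1 / (real (Suc n))\<^sup>2))"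
    by (intro summable_mult)
       (use inverse_power_summable[of 2, where 'a=real] in \<open>simp add: summable_Suc_iff[of "\<lambda>n. 1 / (real n)\<^sup>2"] inverse_eq_divide del: of_nat_Suc\<close>)
  have "(\<integral>\<^sup>+\<omega>. (\<Sum>n. ennreal (Z n \<omega>)) \<partial>M) = (\<Sum>n. \<integral>\<^sup>+\<omega>. ennreal (Z n \<omega>) \<partial>M)"
    by (rule nn_integral_suminf) measurable
  also have "\<dots> \<le> (\<Sum>n. ennreal (11 * D\<^sup>2 * (1 / (real (Suc n))\<^sup>2)))"
    by (intro suminf_le EZ) auto
  also have "\<dots> < \<infinity>"
    using summ by (subst suminf_ennreal_eq[OF _ summable_sums]) auto
  finally have "AE \<omega> in M. (\<Sum>n. ennreal (Z n \<omega>)) \<noteq> \<infinity>"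
    by (intro nn_integral_PInf_AE) auto
  then show ?thesis
  proof eventually_elim
    case (elim \<omega>)
    then have "summable (\<lambda>n. Z n \<omega>)"
      by (intro summable_suminf_not_top) (auto simp: Z_def)
    then have "(\<lambda>n. Z n \<omega>) \<longlonglongrightarrow> 0" by (rule summable_LIMSEQ_zero)
    then have "(\<lambda>n. root 4 (Z n \<omega>)) \<longlonglongrightarrow> root 4 0" by (rule tendsto_real_root)
    moreover have "root 4 (Z n \<omega>) = \<bar>S (Suc n) \<omega> / real (Suc n)\<bar>" for n
      unfolding Z_def by (subst power_even_abs[symmetric]) (simp_all add: real_root_power_cancel del: of_nat_Suc)
    ultimately have "(\<lambda>n. S (Suc n) \<omega> / real (Suc n)) \<longlonglongrightarrow> 0"
      using tendsto_rabs_zero_iff[of "\<lambda>n. S (Suc n) \<omega> / real (Suc n)" sequentially] by simp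
    then show "(\<lambda>n. (\<Sum>k<n. g k \<omega> (Y k \<omega>)) / real n) \<longlonglongrightarrow> 0"
      unfolding S_def by (rule LIMSEQ_imp_Suc)
  qed
qed

end

subsection \<open>The central limit theorem\<close>

lemma cos_taylor: "\<bar>cos (a + x) - (cos a * (1 - x\<^sup>2 / 2) - sin a * x)\<bar> \<le> \<bar>x\<bar> ^ 3 / 6" for a x :: real
proof -
  have "(\<Sum>k\<le>2. (\<i> * complex_of_real x) ^ k / fact k) = 1 + \<i> * x - x\<^sup>2 / 2"
  proof -
    have "{..2::nat} = {0, 1, 2}" by auto
    then show ?thesis by (simp add: power_mult_distrib)
  qed
  then have b: "cmod (iexp x - (1 + \<i> * x - x\<^sup>2 / 2)) \<le> \<bar>x\<bar> ^ 3 / 6"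
    using iexp_approx1[of x 2] by (simp add: numeral_3_eq_3 numeral_2_eq_2 fact_numeral)
  have "Re (iexp a * (iexp x - (1 + \<i> * x - x\<^sup>2 / 2))) = cos (a + x) - (cos a * (1 - x\<^sup>2 / 2) - sin a * x)"
    by (simp add: Re_exp Im_exp cos_add algebra_simps)
  moreover have "\<bar>Re (iexp a * (iexp x - (1 + \<i> * x - x\<^sup>2 / 2)))\<bar> \<le> cmod (iexp a * (iexp x - (1 + \<i> * x - x\<^sup>2 / 2)))"
    by (rule abs_Re_le_cmod)
  moreover have "\<dots> = cmod (iexp x - (1 + \<i> * x - x\<^sup>2 / 2))" by (simp add: norm_mult)
  ultimately show ?thesis using b by linarith
qed

lemma exp_minus_taylor: "0 \<le> x \<Longrightarrow> \<bar>1 - x - exp (- x)\<bar> \<le> x\<^sup>2 / 2" for x :: real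
proof -
  assume x: "0 \<le> x"
  have "1 - x \<le> exp (- x)" using exp_ge_add_one_self[of "- x"] by simp
  moreover have "exp (- x) \<le> 1 - x + x\<^sup>2 / 2"
  proof -
    have "((\<lambda>t. 1 - t + t\<^sup>2 / 2 - exp (- t)) has_real_derivative (- 1 + t + exp (- t))) (at t)" for t :: real
      by (auto intro!: derivative_eq_intros)
    moreover have "0 \<le> - 1 + t + exp (- t)" for t :: real using exp_ge_add_one_self[of "- t"] by simp
    ultimately have "1 - 0 + 0\<^sup>2 / 2 - exp (- 0) \<le> 1 - x + x\<^sup>2 / 2 - exp (- x)"
      using x by (intro DERIV_nonneg_imp_nondecreasing[of 0 x "\<lambda>t. 1 - t + t\<^sup>2 / 2 - exp (- t)"]) auto
    then show ?thesis by simp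
  qed
  ultimately show ?thesis by simp
qed

text \<open>Second-order Taylor expansion; the linear term has expectation \<open>0\<close>, and \<open>1 - h\<^sup>2 v / 2\<close> is replaced by the
  exponential.\<close>

lemma (in prob_space) cos_expectation_approx:
  fixes X :: "'a \<Rightarrow> real" and a h v \<beta> :: real
  assumes X: "integrable M X" "integrable M (\<lambda>x. (X x)\<^sup>2)" "integrable M (\<lambda>x. \<bar>X x\<bar> ^ 3)"
    and mean: "expectation X = 0" and var: "expectation (\<lambda>x. (X x)\<^sup>2) = v" and third: "expectation (\<lambda>x. \<bar>X x\<bar> ^ 3) \<le> \<beta>"
    and h: "h > 0"
  shows "\<bar>expectation (\<lambda>x. cos (a + h * X x)) - cos a * exp (- (h\<^sup>2 * v / 2))\<bar> \<le> h ^ 3 * \<beta> / 6 + (h\<^sup>2 * v)\<^sup>2 / 8"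
proof -
  have [measurable]: "X \<in> borel_measurable M" using X(1) by auto
  have v: "v \<ge> 0" unfolding var[symmetric] by (rule Bochner_Integration.integral_nonneg) simp
  have ci: "integrable M (\<lambda>x. cos (a + h * X x))" by (intro integrable_const_bound[of _ 1]) auto
  define t where "t = (\<lambda>x. cos a * (1 - (h * X x)\<^sup>2 / 2) - sin a * (h * X x))"
  have ti: "integrable M t" using X unfolding t_def by (simp add: power_mult_distrib)
  have Et: "expectation t = cos a * (1 - h\<^sup>2 * v / 2)"
    using X by (simp add: t_def power_mult_distrib mean var prob_space right_diff_distrib)
  have "\<bar>expectation (\<lambda>x. cos (a + h * X x)) - expectation t\<bar> = \<bar>expectation (\<lambda>x. cos (a + h * X x) - t x)\<bar>"
    using ci ti by simp
  also have "\<dots> \<le> expectation (\<lambda>x. \<bar>cos (a + h * X x) - t x\<bar>)" by (rule integral_abs_bound)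
  also have "\<dots> \<le> expectation (\<lambda>x. h ^ 3 / 6 * \<bar>X x\<bar> ^ 3)"
  proof (rule integral_mono)
    show "integrable M (\<lambda>x. \<bar>cos (a + h * X x) - t x\<bar>)" using ci ti by simp
    show "integrable M (\<lambda>x. h ^ 3 / 6 * \<bar>X x\<bar> ^ 3)" using X(3) by simp
    show "\<bar>cos (a + h * X x) - t x\<bar> \<le> h ^ 3 / 6 * \<bar>X x\<bar> ^ 3" for x
      using cos_taylor[of a "h * X x"] h by (simp add: t_def abs_mult power_mult_distrib)
  qed
  also have "\<dots> \<le> h ^ 3 * \<beta> / 6" using third h by simp
  finally have 1: "\<bar>expectation (\<lambda>x. cos (a + h * X x)) - expectation t\<bar> \<le> h ^ 3 * \<beta> / 6" .
  have "\<bar>1 - h\<^sup>2 * v / 2 - exp (- (h\<^sup>2 * v / 2))\<bar> \<le> (h\<^sup>2 * v / 2)\<^sup>2 / 2"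
    using v by (intro exp_minus_taylor) auto
  then have "\<bar>cos a\<bar> * \<bar>1 - h\<^sup>2 * v / 2 - exp (- (h\<^sup>2 * v / 2))\<bar> \<le> 1 * ((h\<^sup>2 * v)\<^sup>2 / 8)"
    by (intro mult_mono) (auto simp: power_divide)
  then have "\<bar>expectation t - cos a * exp (- (h\<^sup>2 * v / 2))\<bar> \<le> (h\<^sup>2 * v)\<^sup>2 / 8"
    unfolding Et right_diff_distrib[symmetric] abs_mult by simp
  with 1 show ?thesis by linarith
qed

text \<open>Let \<open>S j\<close> be the partial sums and \<open>V j\<close> the accumulated conditional variances. As the latter are at
  most \<open>j * \<beta>\<close>, the factor \<open>exp (V j / (2 n))\<close> stays bounded for \<open>j \<le> n\<close>, and with it
  \<open>cos (c + S j / sqrt n) * exp (V j / (2 n))\<close> is a martingale up to an error of order \<open>n powr (-3/2)\<close> in each of the \<open>n\<close> steps.\<close>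

theorem (in adapted_sequence) martingale_clt:
  fixes g :: "nat \<Rightarrow> 'w \<Rightarrow> real \<Rightarrow> real" and v :: "nat \<Rightarrow> 'w \<Rightarrow> real"
  assumes g: "\<And>k. (\<lambda>(\<omega>, y). g k \<omega> y) \<in> borel_measurable (F k \<Otimes>\<^sub>M borel)"
    and int: "\<And>k \<omega>. \<omega> \<in> space M \<Longrightarrow> integrable (\<kappa> k \<omega>) (g k \<omega>)" "\<And>k \<omega>. \<omega> \<in> space M \<Longrightarrow> integrable (\<kappa> k \<omega>) (\<lambda>y. (g k \<omega> y)\<^sup>2)"
      "\<And>k \<omega>. \<omega> \<in> space M \<Longrightarrow> integrable (\<kappa> k \<omega>) (\<lambda>y. \<bar>g k \<omega> y\<bar> ^ 3)"
    and mean: "\<And>k \<omega>. \<omega> \<in> space M \<Longrightarrow> (\<integral>y. g k \<omega> y \<partial>\<kappa> k \<omega>) = 0"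
    and var: "\<And>k \<omega>. \<omega> \<in> space M \<Longrightarrow> (\<integral>y. (g k \<omega> y)\<^sup>2 \<partial>\<kappa> k \<omega>) = v k \<omega>"
    and third: "\<And>k \<omega>. \<omega> \<in> space M \<Longrightarrow> (\<integral>y. \<bar>g k \<omega> y\<bar> ^ 3 \<partial>\<kappa> k \<omega>) \<le> \<beta>"
    and v: "\<And>k. v k \<in> borel_measurable (F k)" "\<And>k \<omega>. \<omega> \<in> space M \<Longrightarrow> v k \<omega> \<le> \<beta>"
    and lim: "AE \<omega> in M. (\<lambda>n. (\<Sum>k<n. v k \<omega>) / real n) \<longlonglongrightarrow> L"
  shows "(\<lambda>n. expectation (\<lambda>\<omega>. cos (c + (\<Sum>k<n. g k \<omega> (Y k \<omega>)) / sqrt (real n)))) \<longlonglongrightarrow> exp (- L / 2) * cos c"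
proof -
  obtain \<omega>0 where "\<omega>0 \<in> space M" using not_empty by blast
  have v0: "0 \<le> v k \<omega>" if "\<omega> \<in> space M" for k \<omega> unfolding var[OF that, symmetric] by (intro integral_nonneg_AE) auto
  have \<beta>0: "0 \<le> \<beta>" using v0[OF \<open>\<omega>0 \<in> space M\<close>] v(2)[OF \<open>\<omega>0 \<in> space M\<close>] order_trans by blast
  define S where "S = (\<lambda>n \<omega>. \<Sum>k<n. g k \<omega> (Y k \<omega>))"
  have S_F: "S n \<in> borel_measurable (F n)" for n unfolding S_def by (rule partial_sum_measurable[OF g])
  have [measurable]: "S n \<in> borel_measurable M" for n using S_F by (rule measurable_F_M)
  define V where "V = (\<lambda>n \<omega>. \<Sum>k<n. v k \<omega>)"
  have V_F: "V n \<in> borel_measurable (F k)" if "n \<le> Suc k" for n k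
    unfolding V_def using that by (intro borel_measurable_sum measurable_F_mono[OF v(1)]) auto
  have [measurable]: "V n \<in> borel_measurable M" for n using measurable_F_M[OF V_F[of n n]] by simp
  have V_bd: "0 \<le> V n \<omega>" "V n \<omega> \<le> real n * \<beta>" if "\<omega> \<in> space M" for n \<omega>
  proof -
    show "0 \<le> V n \<omega>" unfolding V_def using v0[OF that] by (intro sum_nonneg) auto
    have "V n \<omega> \<le> (\<Sum>k<n. \<beta>)" unfolding V_def using v(2)[OF that] by (intro sum_mono) auto
    then show "V n \<omega> \<le> real n * \<beta>" by simp
  qed
  define \<Phi> where "\<Phi> = (\<lambda>n j. expectation (\<lambda>\<omega>. exp (V j \<omega> / (2 * real n)) * cos (c + S j \<omega> / sqrt (real n))))"
  have exp_bd: "exp (V j \<omega> / (2 * real n)) \<le> exp (\<beta> / 2)" if "\<omega> \<in> space M" "j \<le> n" for j n \<omega>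
  proof (cases "n = 0")
    case False
    have "V j \<omega> \<le> real n * \<beta>"
      using V_bd(2)[OF that(1), of j] that(2) \<beta>0 by (meson mult_right_mono of_nat_le_iff order_trans)
    then show ?thesis using False by (simp add: field_simps)
  qed (use \<beta>0 in simp)
  have step: "\<bar>\<Phi> n (Suc j) - \<Phi> n j\<bar> \<le> exp (\<beta> / 2) * (\<beta> / (6 * (real n * sqrt (real n))) + \<beta>\<^sup>2 / (8 * (real n)\<^sup>2))"
    if j: "j < n" for n j
  proof -
    define h where "h = 1 / sqrt (real n)"
    have h: "h > 0" "h\<^sup>2 = 1 / real n" "h ^ 3 = 1 / (real n * sqrt (real n))"
      using j by (simp_all add: h_def power_divide power3_eq_cube)
    \<comment> \<open>The conditional variance is predictable: \<open>V (Suc j)\<close> is known at time \<open>j\<close>, so that this factor can be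
      taken out of the conditional expectation.\<close>
    define E where "E = (\<lambda>\<omega>. exp (V (Suc j) \<omega> / (2 * real n)))"
    have E_F: "E \<in> borel_measurable (F j)" unfolding E_def using V_F[of "Suc j" j] by measurable
    have [measurable]: "E \<in> borel_measurable M" using E_F by (rule measurable_F_M)
    have E_bd: "0 < E \<omega>" "\<omega> \<in> space M \<Longrightarrow> E \<omega> \<le> exp (\<beta> / 2)" for \<omega>
      using exp_bd[of \<omega> "Suc j" n] j by (auto simp: E_def)
    \<comment> \<open>equal to \<open>E\<close> on the sample space, but bounded everywhere\<close>
    define e where "e = (\<lambda>\<omega>. min (E \<omega>) (exp (\<beta> / 2)))"
    have e: "e \<omega> = E \<omega>" if "\<omega> \<in> space M" for \<omega> using E_bd(2)[OF that] by (simp add: e_def)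
    have e_F: "e \<in> borel_measurable (F j)" unfolding e_def using E_F by measurable
    have k: "\<And>\<omega>. \<omega> \<in> space M \<Longrightarrow> prob_space (\<kappa> j \<omega>)" by (rule kernel)
    have gs: "g j \<omega> \<in> borel_measurable (\<kappa> j \<omega>)" if "\<omega> \<in> space M" for \<omega>
      by (rule kernel_measurable_section[OF g that])
    define A where "A = (\<lambda>\<omega>. \<integral>y. cos ((c + h * S j \<omega>) + h * g j \<omega> y) \<partial>\<kappa> j \<omega>)"
    have approx: "\<bar>A \<omega> - cos (c + h * S j \<omega>) * exp (- (h\<^sup>2 * v j \<omega> / 2))\<bar> \<le> \<beta> / (6 * (real n * sqrt (real n))) + \<beta>\<^sup>2 / (8 * (real n)\<^sup>2)"
      if \<omega>: "\<omega> \<in> space M" for \<omega>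
    proof -
      have "\<bar>A \<omega> - cos (c + h * S j \<omega>) * exp (- (h\<^sup>2 * v j \<omega> / 2))\<bar> \<le> h ^ 3 * \<beta> / 6 + (h\<^sup>2 * v j \<omega>)\<^sup>2 / 8"
        unfolding A_def
        by (rule prob_space.cos_expectation_approx[OF k[OF \<omega>] int[OF \<omega>] mean[OF \<omega>] var[OF \<omega>] third[OF \<omega>] h(1)])
      also have "(h\<^sup>2 * v j \<omega>)\<^sup>2 \<le> (h\<^sup>2 * \<beta>)\<^sup>2"
        using v0[OF \<omega>] v(2)[OF \<omega>] by (intro power_mono mult_left_mono) auto
      finally show ?thesis by (simp add: h power_divide power_mult_distrib)
    qed
    have H_meas: "(\<lambda>(\<omega>, y). e \<omega> * cos ((c + h * S j \<omega>) + h * g j \<omega> y)) \<in> borel_measurable (F j \<Otimes>\<^sub>M borel)"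
    proof -
      note [measurable] = e_F S_F[of j] g[of j]
      have [measurable]: "(\<lambda>q. g j (fst q) (snd q)) \<in> borel_measurable (F j \<Otimes>\<^sub>M borel)"
        using g[of j] by (simp add: split_beta)
      show ?thesis unfolding split_beta by measurable
    qed
    have cov: "\<Phi> n (Suc j) = expectation (\<lambda>\<omega>. E \<omega> * A \<omega>)"
    proof -
      have "\<Phi> n (Suc j) = expectation (\<lambda>\<omega>. e \<omega> * cos ((c + h * S j \<omega>) + h * g j \<omega> (Y j \<omega>)))"
        unfolding \<Phi>_def
        by (intro Bochner_Integration.integral_cong refl)
           (simp add: e E_def S_def h_def add_divide_distrib ac_simps)
      also have "\<dots> = expectation (\<lambda>\<omega>. \<integral>y. e \<omega> * cos ((c + h * S j \<omega>) + h * g j \<omega> y) \<partial>\<kappa> j \<omega>)"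
        by (rule integral_disintegrate[OF prob sub Y_M cond H_meas, of "exp (\<beta> / 2)"])
           (use E_bd(1) in \<open>auto simp: e_def abs_mult intro!: order_trans[OF mult_left_le] simp: less_imp_le min_def\<close>)
      also have "\<dots> = expectation (\<lambda>\<omega>. E \<omega> * A \<omega>)"
        by (intro Bochner_Integration.integral_cong refl) (simp add: A_def e)
      finally show ?thesis .
    qed
    have prev: "\<Phi> n j = expectation (\<lambda>\<omega>. E \<omega> * (cos (c + h * S j \<omega>) * exp (- (h\<^sup>2 * v j \<omega> / 2))))"
      unfolding \<Phi>_def
    proof (intro Bochner_Integration.integral_cong refl)
      fix \<omega>
      have "V (Suc j) \<omega> / (2 * real n) = V j \<omega> / (2 * real n) + h\<^sup>2 * v j \<omega> / 2"
        by (simp add: V_def h add_divide_distrib)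
      then have "E \<omega> * exp (- (h\<^sup>2 * v j \<omega> / 2)) = exp (V j \<omega> / (2 * real n))"
        unfolding E_def by (simp only: exp_add[symmetric]) simp
      then show "exp (V j \<omega> / (2 * real n)) * cos (c + S j \<omega> / sqrt (real n)) =
          E \<omega> * (cos (c + h * S j \<omega>) * exp (- (h\<^sup>2 * v j \<omega> / 2)))"
        by (simp add: h_def mult.left_commute[of "E \<omega>"] mult.commute)
    qed
    have vM [measurable]: "v j \<in> borel_measurable M" using v(1) by (rule measurable_F_M)
    have A_meas [measurable]: "A \<in> borel_measurable M"
      unfolding A_def
    proof (rule integral_kernel_measurable[OF prob sub Y_M cond])
      have [measurable]: "(\<lambda>q. g j (fst q) (snd q)) \<in> borel_measurable (F j \<Otimes>\<^sub>M borel)"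
        using g[of j] by (simp add: split_beta)
      note [measurable] = S_F[of j]
      show "(\<lambda>(\<omega>, y). cos ((c + h * S j \<omega>) + h * g j \<omega> y)) \<in> borel_measurable (F j \<Otimes>\<^sub>M borel)"
        unfolding split_beta by measurable
    qed
    have A_bd: "\<bar>A \<omega>\<bar> \<le> 1" if \<omega>: "\<omega> \<in> space M" for \<omega>
    proof -
      interpret k: prob_space "\<kappa> j \<omega>" by (rule k[OF \<omega>])
      note [measurable] = gs[OF \<omega>]
      have "\<bar>A \<omega>\<bar> \<le> (\<integral>y. \<bar>cos ((c + h * S j \<omega>) + h * g j \<omega> y)\<bar> \<partial>\<kappa> j \<omega>)"
        unfolding A_def by (rule integral_abs_bound)
      also have "\<dots> \<le> (\<integral>y. 1 \<partial>\<kappa> j \<omega>)"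
        by (intro integral_mono k.integrable_const_bound[of _ 1]) auto
      finally show ?thesis by (simp add: k.prob_space)
    qed
    have i1: "integrable M (\<lambda>\<omega>. E \<omega> * A \<omega>)"
    proof (rule integrable_const_bound[of _ "exp (\<beta> / 2)"])
      show "AE \<omega> in M. norm (E \<omega> * A \<omega>) \<le> exp (\<beta> / 2)"
      proof (rule AE_I2)
        fix \<omega> assume \<omega>: "\<omega> \<in> space M"
        have "\<bar>E \<omega>\<bar> * \<bar>A \<omega>\<bar> \<le> exp (\<beta> / 2) * 1"
          using E_bd[of \<omega>] \<omega> A_bd[OF \<omega>] by (intro mult_mono) auto
        then show "norm (E \<omega> * A \<omega>) \<le> exp (\<beta> / 2)" by (simp add: abs_mult)
      qed
    qed measurable
    have i2: "integrable M (\<lambda>\<omega>. E \<omega> * (cos (c + h * S j \<omega>) * exp (- (h\<^sup>2 * v j \<omega> / 2))))"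
    proof (rule integrable_const_bound[of _ "exp (\<beta> / 2)"])
      show "AE \<omega> in M. norm (E \<omega> * (cos (c + h * S j \<omega>) * exp (- (h\<^sup>2 * v j \<omega> / 2)))) \<le> exp (\<beta> / 2)"
      proof (rule AE_I2)
        fix \<omega> assume \<omega>: "\<omega> \<in> space M"
        have "\<bar>E \<omega>\<bar> * (\<bar>cos (c + h * S j \<omega>)\<bar> * exp (- (h\<^sup>2 * v j \<omega> / 2))) \<le> exp (\<beta> / 2) * (1 * 1)"
          using E_bd[of \<omega>] \<omega> v0[OF \<omega>] by (intro mult_mono) auto
        then show "norm (E \<omega> * (cos (c + h * S j \<omega>) * exp (- (h\<^sup>2 * v j \<omega> / 2)))) \<le> exp (\<beta> / 2)"
          by (simp add: abs_mult)
      qed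
    qed measurable
    let ?d = "\<beta> / (6 * (real n * sqrt (real n))) + \<beta>\<^sup>2 / (8 * (real n)\<^sup>2)"
    have "\<bar>\<Phi> n (Suc j) - \<Phi> n j\<bar> = \<bar>expectation (\<lambda>\<omega>. E \<omega> * A \<omega> - E \<omega> * (cos (c + h * S j \<omega>) * exp (- (h\<^sup>2 * v j \<omega> / 2))))\<bar>"
      using i1 i2 by (simp add: cov prev)
    also have "\<dots> \<le> expectation (\<lambda>\<omega>. \<bar>E \<omega> * A \<omega> - E \<omega> * (cos (c + h * S j \<omega>) * exp (- (h\<^sup>2 * v j \<omega> / 2)))\<bar>)"
      by (rule integral_abs_bound)
    also have "\<dots> \<le> expectation (\<lambda>\<omega>. exp (\<beta> / 2) * ?d)"
    proof (rule integral_mono)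
      fix \<omega> assume \<omega>: "\<omega> \<in> space M"
      have "\<bar>E \<omega>\<bar> * \<bar>A \<omega> - cos (c + h * S j \<omega>) * exp (- (h\<^sup>2 * v j \<omega> / 2))\<bar> \<le> exp (\<beta> / 2) * ?d"
        using E_bd[of \<omega>] \<omega> approx[OF \<omega>] by (intro mult_mono) auto
      then show "\<bar>E \<omega> * A \<omega> - E \<omega> * (cos (c + h * S j \<omega>) * exp (- (h\<^sup>2 * v j \<omega> / 2)))\<bar> \<le> exp (\<beta> / 2) * ?d"
        by (simp only: right_diff_distrib[symmetric] abs_mult)
    qed (use i1 i2 in auto)
    finally show ?thesis by (simp add: prob_space)
  qed
  have total: "\<bar>\<Phi> n n - cos c\<bar> \<le> exp (\<beta> / 2) * (\<beta> / (6 * sqrt (real n)) + \<beta>\<^sup>2 / (8 * real n))" if n: "n \<ge> 1" for n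
  proof -
    let ?d = "exp (\<beta> / 2) * (\<beta> / (6 * (real n * sqrt (real n))) + \<beta>\<^sup>2 / (8 * (real n)\<^sup>2))"
    have "\<bar>\<Phi> n j - cos c\<bar> \<le> real j * ?d" if "j \<le> n" for j
      using that
    proof (induction j)
      case 0
      show ?case by (simp add: \<Phi>_def V_def S_def prob_space)
    next
      case (Suc j)
      then have "\<bar>\<Phi> n (Suc j) - \<Phi> n j\<bar> \<le> ?d" "\<bar>\<Phi> n j - cos c\<bar> \<le> real j * ?d" using step[of j n] by auto
      moreover have "real (Suc j) * x = real j * x + x" for x by (simp add: algebra_simps)
      then have "real (Suc j) * ?d = real j * ?d + ?d" .
      ultimately show ?case by linarith
    qed
    from this[OF order_refl] have "\<bar>\<Phi> n n - cos c\<bar> \<le> real n * ?d" .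
    also have "real n * ?d = exp (\<beta> / 2) * (\<beta> / (6 * sqrt (real n)) + \<beta>\<^sup>2 / (8 * real n))"
      using n by (simp add: field_simps power2_eq_square)
    finally show ?thesis .
  qed
  have "(\<lambda>n. \<Phi> n n - cos c) \<longlonglongrightarrow> 0"
  proof (rule Lim_null_comparison)
    show "eventually (\<lambda>n. norm (\<Phi> n n - cos c) \<le> exp (\<beta> / 2) * (\<beta> / (6 * sqrt (real n)) + \<beta>\<^sup>2 / (8 * real n))) sequentially"
      using eventually_ge_at_top[of 1] by eventually_elim (use total in simp)
    show "(\<lambda>n. exp (\<beta> / 2) * (\<beta> / (6 * sqrt (real n)) + \<beta>\<^sup>2 / (8 * real n))) \<longlonglongrightarrow> 0" by real_asymp
  qed
  then have lim1: "(\<lambda>n. \<Phi> n n) \<longlonglongrightarrow> cos c" by (simp add: LIM_zero_iff)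
  define T where "T = (\<lambda>n \<omega>. cos (c + S n \<omega> / sqrt (real n)))"
  have T_int: "integrable M (T n)" for n unfolding T_def by (intro integrable_const_bound[of _ 1]) auto
  \<comment> \<open>The accumulated variance being close to its deterministic limit, the random factor can be taken out.\<close>
  have "(\<lambda>n. expectation (\<lambda>\<omega>. (exp (V n \<omega> / (2 * real n)) - exp (L / 2)) * T n \<omega>)) \<longlonglongrightarrow> expectation (\<lambda>_. 0)"
  proof (rule integral_dominated_convergence[where w="\<lambda>_. exp (\<beta> / 2) + exp (L / 2)"])
    show "AE \<omega> in M. (\<lambda>n. (exp (V n \<omega> / (2 * real n)) - exp (L / 2)) * T n \<omega>) \<longlonglongrightarrow> 0"
      using lim
    proof eventually_elim
      case (elim \<omega>)
      then have "(\<lambda>n. exp ((\<Sum>k<n. v k \<omega>) / real n / 2) - exp (L / 2)) \<longlonglongrightarrow> exp (L / 2) - exp (L / 2)"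
        by (intro tendsto_intros) auto
      then have z: "(\<lambda>n. exp (V n \<omega> / (2 * real n)) - exp (L / 2)) \<longlonglongrightarrow> 0"
        by (simp add: V_def mult.commute)
      show ?case
      proof (rule Lim_null_comparison)
        have "norm ((exp (V n \<omega> / (2 * real n)) - exp (L / 2)) * T n \<omega>) \<le> \<bar>exp (V n \<omega> / (2 * real n)) - exp (L / 2)\<bar>" for n
          by (simp add: abs_mult T_def mult_left_le)
        then show "eventually (\<lambda>n. norm ((exp (V n \<omega> / (2 * real n)) - exp (L / 2)) * T n \<omega>) \<le>
            \<bar>exp (V n \<omega> / (2 * real n)) - exp (L / 2)\<bar>) sequentially" by (rule always_eventually[OF allI])
        show "(\<lambda>n. \<bar>exp (V n \<omega> / (2 * real n)) - exp (L / 2)\<bar>) \<longlonglongrightarrow> 0"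
          using z by (rule tendsto_rabs_zero)
      qed
    qed
    show "AE \<omega> in M. norm ((exp (V n \<omega> / (2 * real n)) - exp (L / 2)) * T n \<omega>) \<le> exp (\<beta> / 2) + exp (L / 2)" for n
    proof (rule AE_I2)
      fix \<omega> assume \<omega>: "\<omega> \<in> space M"
      have "\<bar>exp (V n \<omega> / (2 * real n)) - exp (L / 2)\<bar> \<le> exp (V n \<omega> / (2 * real n)) + exp (L / 2)" by (smt (verit) exp_gt_zero)
      also have "\<dots> \<le> exp (\<beta> / 2) + exp (L / 2)" using exp_bd[OF \<omega>, of n n] by simp
      finally have "\<bar>exp (V n \<omega> / (2 * real n)) - exp (L / 2)\<bar> * \<bar>T n \<omega>\<bar> \<le> (exp (\<beta> / 2) + exp (L / 2)) * 1"
        by (intro mult_mono) (auto simp: T_def add_nonneg_nonneg)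
      then show "norm ((exp (V n \<omega> / (2 * real n)) - exp (L / 2)) * T n \<omega>) \<le> exp (\<beta> / 2) + exp (L / 2)"
        by (simp add: abs_mult)
    qed
  qed (auto simp: T_def)
  moreover have "expectation (\<lambda>\<omega>. (exp (V n \<omega> / (2 * real n)) - exp (L / 2)) * T n \<omega>) = \<Phi> n n - exp (L / 2) * expectation (T n)" for n
  proof -
    have "integrable M (\<lambda>\<omega>. exp (V n \<omega> / (2 * real n)) * T n \<omega>)"
    proof (rule integrable_const_bound[of _ "exp (\<beta> / 2)"])
      show "AE \<omega> in M. norm (exp (V n \<omega> / (2 * real n)) * T n \<omega>) \<le> exp (\<beta> / 2)"
      proof (rule AE_I2)
        fix \<omega> assume \<omega>: "\<omega> \<in> space M"
        have "exp (V n \<omega> / (2 * real n)) * \<bar>T n \<omega>\<bar> \<le> exp (\<beta> / 2) * 1"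
          using exp_bd[OF \<omega>, of n n] by (intro mult_mono) (auto simp: T_def)
        then show "norm (exp (V n \<omega> / (2 * real n)) * T n \<omega>) \<le> exp (\<beta> / 2)" by (simp add: abs_mult)
      qed
    qed (auto simp: T_def)
    then show ?thesis using T_int[of n] by (simp add: left_diff_distrib \<Phi>_def T_def)
  qed
  ultimately have "(\<lambda>n. \<Phi> n n - exp (L / 2) * expectation (T n)) \<longlonglongrightarrow> 0" by simp
  from tendsto_diff[OF lim1 this] have "(\<lambda>n. exp (L / 2) * expectation (T n)) \<longlonglongrightarrow> cos c" by simp
  then have "(\<lambda>n. exp (- L / 2) * (exp (L / 2) * expectation (T n))) \<longlonglongrightarrow> exp (- L / 2) * cos c"
    by (intro tendsto_mult tendsto_const)
  then show ?thesis
    by (simp add: mult.assoc[symmetric] exp_add[symmetric] T_def S_def)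
qed

section \<open>Exponential families and the link function\<close>

lemma power8_le_exp: "x ^ 8 \<le> 8 ^ 8 * exp \<bar>x\<bar>" for x :: real
proof -
  have "\<bar>x\<bar> / 8 \<le> exp (\<bar>x\<bar> / 8)" using exp_ge_add_one_self[of "\<bar>x\<bar> / 8"] by linarith
  then have "(\<bar>x\<bar> / 8) ^ 8 \<le> exp (\<bar>x\<bar> / 8) ^ 8" by (intro power_mono) auto
  also have "exp (\<bar>x\<bar> / 8) ^ 8 = exp \<bar>x\<bar>" by (simp flip: exp_of_nat_mult)
  finally show ?thesis by (simp add: power_divide power_even_abs field_simps)
qed

context exponential_family
begin

lemma K_meas [measurable]: "K \<in> borel_measurable borel" by (rule K_measurable)

lemma sets_expfam [simp]: "sets (expfam \<nu> K b \<tau>) = sets borel"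
  by (simp add: expfam_def sets_nu)

lemma meas_nu: "f \<in> borel_measurable borel \<Longrightarrow> f \<in> borel_measurable \<nu>"
  using sets_nu by (simp cong: measurable_cong_sets)

lemma nn_integral_exp_expfam:
  assumes \<tau>: "\<tau> \<in> J" "\<tau> + t \<in> J"
  shows "(\<integral>\<^sup>+y. ennreal (exp (t * y)) \<partial>expfam \<nu> K b \<tau>) = ennreal (exp (b (\<tau> + t) - b \<tau>))"
proof -
  have "(\<integral>\<^sup>+y. ennreal (exp (t * y)) \<partial>expfam \<nu> K b \<tau>) =
      (\<integral>\<^sup>+y. ennreal (K y * exp (\<tau> * y - b \<tau>)) * ennreal (exp (t * y)) \<partial>\<nu>)"
    unfolding expfam_def by (intro nn_integral_density meas_nu) measurable
  also have "\<dots> = (\<integral>\<^sup>+y. ennreal (exp (b (\<tau> + t) - b \<tau>)) * ennreal (K y * exp ((\<tau> + t) * y - b (\<tau> + t))) \<partial>\<nu>)"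
  proof (intro nn_integral_cong)
    fix y
    have "exp (\<tau> * y - b \<tau>) * exp (t * y) = exp (b (\<tau> + t) - b \<tau>) * exp ((\<tau> + t) * y - b (\<tau> + t))"
      by (simp only: exp_add[symmetric]) (simp add: algebra_simps)
    then have "K y * exp (\<tau> * y - b \<tau>) * exp (t * y) = exp (b (\<tau> + t) - b \<tau>) * (K y * exp ((\<tau> + t) * y - b (\<tau> + t)))"
      by (simp only: mult.assoc mult.left_commute)
    then show "ennreal (K y * exp (\<tau> * y - b \<tau>)) * ennreal (exp (t * y)) =
        ennreal (exp (b (\<tau> + t) - b \<tau>)) * ennreal (K y * exp ((\<tau> + t) * y - b (\<tau> + t)))"
      using K_nonneg[of y] by (simp add: ennreal_mult'[symmetric] ennreal_mult''[symmetric])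
  qed
  also have "\<dots> = ennreal (exp (b (\<tau> + t) - b \<tau>)) * (\<integral>\<^sup>+y. ennreal (K y * exp ((\<tau> + t) * y - b (\<tau> + t))) \<partial>\<nu>)"
    by (intro nn_integral_cmult meas_nu) measurable
  also have "(\<integral>\<^sup>+y. ennreal (K y * exp ((\<tau> + t) * y - b (\<tau> + t))) \<partial>\<nu>) = 1"
  proof -
    interpret P: prob_space "expfam \<nu> K b (\<tau> + t)" by (rule prob[OF \<tau>(2)])
    have "(\<lambda>y. ennreal (K y * exp ((\<tau> + t) * y - b (\<tau> + t)))) \<in> borel_measurable \<nu>"
      by (intro meas_nu) measurable
    then show ?thesis
      using P.emeasure_space_1 by (simp add: expfam_def emeasure_density)
  qed
  finally show ?thesis by simp
qed

lemma b_deriv: "\<tau> \<in> J \<Longrightarrow> ((deriv ^^ k) b has_real_derivative (deriv ^^ Suc k) b \<tau>) (at \<tau>)"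
  using b_smooth[of \<tau> k] by (simp add: DERIV_deriv_iff_real_differentiable)

lemma continuous_on_deriv_b: "continuous_on J ((deriv ^^ k) b)"
  by (rule DERIV_continuous_on) (rule has_field_derivative_at_within[OF b_deriv])

text \<open>On a compact part of the parameter interval the exponential moments \<open>E (exp (\<plusminus> \<delta> Y))\<close>, given by
  \<open>b (\<tau> \<plusminus> \<delta>)\<close>, are bounded, and they dominate all power moments. Eighth moments are what the laws of large numbers below
  for the squared noise require.\<close>

lemma uniform_moments:
  assumes l: "l \<in> J" "r \<in> J" "l \<le> r"
  obtains C where "C \<ge> 0" "\<And>\<tau>. l \<le> \<tau> \<Longrightarrow> \<tau> \<le> r \<Longrightarrow> integrable (expfam \<nu> K b \<tau>) (\<lambda>y. (y - deriv b \<tau>) ^ 8)"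
    "\<And>\<tau>. l \<le> \<tau> \<Longrightarrow> \<tau> \<le> r \<Longrightarrow> (\<integral>y. (y - deriv b \<tau>) ^ 8 \<partial>expfam \<nu> K b \<tau>) \<le> C"
proof -
  have sub: "{p..q} \<subseteq> J" if "p \<in> J" "q \<in> J" for p q
    using interval_J that unfolding is_interval_1 by fastforce
  obtain d1 where d1: "d1 > 0" "ball l d1 \<subseteq> J" using open_J l(1) by (meson openE)
  obtain d2 where d2: "d2 > 0" "ball r d2 \<subseteq> J" using open_J l(2) by (meson openE)
  define \<delta> where "\<delta> = min d1 d2 / 2"
  have \<delta>: "\<delta> > 0" using d1 d2 by (simp add: \<delta>_def)
  have "l - \<delta> \<in> J" using d1 d2 by (intro subsetD[OF d1(2)]) (auto simp: \<delta>_def dist_real_def)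
  moreover have "r + \<delta> \<in> J" using d1 d2 by (intro subsetD[OF d2(2)]) (auto simp: \<delta>_def dist_real_def)
  ultimately have J': "{l - \<delta>..r + \<delta>} \<subseteq> J" by (rule sub)
  have "compact (b ` {l - \<delta>..r + \<delta>})"
    using continuous_on_subset[OF continuous_on_deriv_b[of 0] J'] by (intro compact_continuous_image) auto
  note this[THEN compact_imp_bounded, unfolded bounded_iff]
  then obtain B where "\<forall>x\<in>b ` {l - \<delta>..r + \<delta>}. norm x \<le> B" by blast
  then have B: "\<bar>b \<tau>\<bar> \<le> B" if "l - \<delta> \<le> \<tau>" "\<tau> \<le> r + \<delta>" for \<tau> using that by auto
  have "compact (deriv b ` {l..r})"
    using continuous_on_subset[OF continuous_on_deriv_b[of 1] sub[OF l(1,2)]] by (intro compact_continuous_image) auto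
  note this[THEN compact_imp_bounded, unfolded bounded_iff]
  then obtain m where "\<forall>x\<in>deriv b ` {l..r}. norm x \<le> m" by blast
  then have m: "\<bar>deriv b \<tau>\<bar> \<le> m" if "l \<le> \<tau>" "\<tau> \<le> r" for \<tau> using that by auto
  define c where "c = 8 ^ 8 * exp (\<delta> * m) / \<delta> ^ 8"
  have c: "c \<ge> 0" using \<delta> by (simp add: c_def)
  have pt: "(y - deriv b \<tau>) ^ 8 \<le> c * (exp (\<delta> * y) + exp (- \<delta> * y))" if \<tau>: "l \<le> \<tau>" "\<tau> \<le> r" for y \<tau>
  proof -
    have "(\<delta> * (y - deriv b \<tau>)) ^ 8 \<le> 8 ^ 8 * exp \<bar>\<delta> * (y - deriv b \<tau>)\<bar>" by (rule power8_le_exp)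
    also have "exp \<bar>\<delta> * (y - deriv b \<tau>)\<bar> \<le> exp (\<delta> * m + \<delta> * \<bar>y\<bar>)"
    proof -
      have "\<bar>y - deriv b \<tau>\<bar> \<le> m + \<bar>y\<bar>" using m[OF \<tau>] by linarith
      then have "\<delta> * \<bar>y - deriv b \<tau>\<bar> \<le> \<delta> * (m + \<bar>y\<bar>)" using \<delta> by (intro mult_left_mono) auto
      then show ?thesis using \<delta> by (simp add: abs_mult distrib_left)
    qed
    also have "\<dots> \<le> exp (\<delta> * m) * (exp (\<delta> * y) + exp (- \<delta> * y))"
    proof -
      have "exp (\<delta> * \<bar>y\<bar>) \<le> exp (\<delta> * y) + exp (- \<delta> * y)" by (cases "y \<ge> 0") auto
      then show ?thesis by (simp add: exp_add)
    qed
    finally have "\<delta> ^ 8 * (y - deriv b \<tau>) ^ 8 \<le> 8 ^ 8 * (exp (\<delta> * m) * (exp (\<delta> * y) + exp (- \<delta> * y)))"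
      by (simp add: power_mult_distrib)
    then show ?thesis using \<delta> by (simp add: c_def field_simps)
  qed
  define C where "C = c * (2 * exp (2 * B))"
  have nn: "(\<integral>\<^sup>+y. ennreal ((y - deriv b \<tau>) ^ 8) \<partial>expfam \<nu> K b \<tau>) \<le> ennreal C" if \<tau>: "l \<le> \<tau>" "\<tau> \<le> r" for \<tau>
  proof -
    have \<tau>J: "\<tau> \<in> J" "\<tau> + \<delta> \<in> J" "\<tau> + - \<delta> \<in> J" using \<tau> J' \<delta> by auto
    have "(\<integral>\<^sup>+y. ennreal ((y - deriv b \<tau>) ^ 8) \<partial>expfam \<nu> K b \<tau>) \<le>
        (\<integral>\<^sup>+y. ennreal c * (ennreal (exp (\<delta> * y)) + ennreal (exp (- \<delta> * y))) \<partial>expfam \<nu> K b \<tau>)"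
      using pt[OF \<tau>] c
      by (intro nn_integral_mono) (auto simp: ennreal_plus[symmetric] ennreal_mult'[symmetric] simp del: ennreal_plus intro!: ennreal_leI)
    also have "\<dots> = ennreal c * ((\<integral>\<^sup>+y. ennreal (exp (\<delta> * y)) \<partial>expfam \<nu> K b \<tau>) + (\<integral>\<^sup>+y. ennreal (exp (- \<delta> * y)) \<partial>expfam \<nu> K b \<tau>))"
      by (subst nn_integral_cmult) (auto simp: nn_integral_add cong: measurable_cong_sets)
    also have "\<dots> = ennreal c * (ennreal (exp (b (\<tau> + \<delta>) - b \<tau>)) + ennreal (exp (b (\<tau> + - \<delta>) - b \<tau>)))"
      using nn_integral_exp_expfam[OF \<tau>J(1,2)] nn_integral_exp_expfam[OF \<tau>J(1,3)] by simp
    also have "\<dots> = ennreal (c * (exp (b (\<tau> + \<delta>) - b \<tau>) + exp (b (\<tau> + - \<delta>) - b \<tau>)))"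
      using c by (simp add: ennreal_plus[symmetric] ennreal_mult' del: ennreal_plus)
    also have "\<dots> \<le> ennreal C"
    proof (rule ennreal_leI)
      have "b (\<tau> + \<delta>) - b \<tau> \<le> 2 * B" "b (\<tau> + - \<delta>) - b \<tau> \<le> 2 * B"
        using B[of "\<tau> + \<delta>"] B[of "\<tau> + - \<delta>"] B[of \<tau>] \<tau> \<delta> by auto
      then have "exp (b (\<tau> + \<delta>) - b \<tau>) + exp (b (\<tau> + - \<delta>) - b \<tau>) \<le> 2 * exp (2 * B)"
        by (smt (verit) exp_le_cancel_iff)
      then show "c * (exp (b (\<tau> + \<delta>) - b \<tau>) + exp (b (\<tau> + - \<delta>) - b \<tau>)) \<le> C"
        unfolding C_def using c by (rule mult_left_mono)
    qed
    finally show ?thesis .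
  qed
  have int: "integrable (expfam \<nu> K b \<tau>) (\<lambda>y. (y - deriv b \<tau>) ^ 8)" if \<tau>: "l \<le> \<tau>" "\<tau> \<le> r" for \<tau>
  proof (rule integrableI_bounded)
    show "(\<lambda>y. (y - deriv b \<tau>) ^ 8) \<in> borel_measurable (expfam \<nu> K b \<tau>)" by (simp cong: measurable_cong_sets)
    show "(\<integral>\<^sup>+y. ennreal (norm ((y - deriv b \<tau>) ^ 8)) \<partial>expfam \<nu> K b \<tau>) < \<infinity>"
      using le_less_trans[OF nn[OF \<tau>] ennreal_less_top] by (simp add: power_even_abs)
  qed
  show thesis
  proof (rule that[of C])
    show "C \<ge> 0" using c by (simp add: C_def)
    fix \<tau> assume \<tau>: "l \<le> \<tau>" "\<tau> \<le> r"
    show "integrable (expfam \<nu> K b \<tau>) (\<lambda>y. (y - deriv b \<tau>) ^ 8)" by (rule int[OF \<tau>])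
    have "ennreal (\<integral>y. (y - deriv b \<tau>) ^ 8 \<partial>expfam \<nu> K b \<tau>) \<le> ennreal C"
      using nn[OF \<tau>] nn_integral_eq_integral[OF int[OF \<tau>]] by simp
    then show "(\<integral>y. (y - deriv b \<tau>) ^ 8 \<partial>expfam \<nu> K b \<tau>) \<le> C"
      using c by (simp add: C_def)
  qed
qed

lemma measure_K_pos:
  assumes "\<tau> \<in> J" shows "measure (expfam \<nu> K b \<tau>) {y. K y \<le> 0} = 0"
proof -
  have "{y. K y \<le> 0} \<in> sets \<nu>" unfolding sets_nu by measurable
  moreover have "(\<lambda>y. ennreal (K y * exp (\<tau> * y - b \<tau>))) \<in> borel_measurable \<nu>"
    by (intro meas_nu) measurable
  ultimately have "emeasure (expfam \<nu> K b \<tau>) {y. K y \<le> 0} =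
      (\<integral>\<^sup>+y. ennreal (K y * exp (\<tau> * y - b \<tau>)) * indicator {y. K y \<le> 0} y \<partial>\<nu>)"
    unfolding expfam_def by (simp add: emeasure_density)
  also have "\<dots> = (\<integral>\<^sup>+y. 0 \<partial>\<nu>)"
    by (intro nn_integral_cong) (auto simp: indicator_def ennreal_neg mult_nonpos_nonneg)
  finally show ?thesis by (simp add: measure_def)
qed

lemma deriv_b_strict_mono:
  assumes "x \<in> J" "y \<in> J" "x < y" shows "deriv b x < deriv b y"
proof (rule DERIV_pos_imp_increasing[OF assms(3)])
  fix t assume "x \<le> t" "t \<le> y"
  then have "t \<in> J" using interval_J assms unfolding is_interval_1 by blast
  then show "\<exists>d. (deriv b has_real_derivative d) (at t) \<and> 0 < d"
    using b_deriv[of t 1] var_pos[of t] by auto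
qed

lemma inj_deriv_b: "inj_on (deriv b) J"
  using deriv_b_strict_mono by (metis inj_onI linorder_neqE less_irrefl)

lemma canonical:
  assumes "e \<in> deriv b ` J" shows "canonical b J e \<in> J" "deriv b (canonical b J e) = e"
  using assms unfolding canonical_def by (auto intro: inv_into_into f_inv_into_f)

lemma canonical_has_derivative:
  assumes e: "e \<in> deriv b ` J"
  shows "(canonical b J has_real_derivative 1 / deriv (deriv b) (canonical b J e)) (at e)"
proof -
  let ?\<tau> = "canonical b J e"
  have \<tau>: "?\<tau> \<in> J" "deriv b ?\<tau> = e" by (rule canonical[OF e])+
  have nz: "deriv (deriv b) ?\<tau> \<noteq> 0" using var_pos[OF \<tau>(1)] by simp
  have "(canonical b J has_derivative (*) (inverse (deriv (deriv b) ?\<tau>))) (at (deriv b ?\<tau>))"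
  proof (rule has_derivative_inverse_strong[of J ?\<tau> "deriv b" "canonical b J" "(*) (deriv (deriv b) ?\<tau>)"])
    show "(deriv b has_derivative (*) (deriv (deriv b) ?\<tau>)) (at ?\<tau>)"
      using b_deriv[OF \<tau>(1), of 1] by (simp add: has_field_derivative_def)
    show "(*) (deriv (deriv b) ?\<tau>) \<circ> (*) (inverse (deriv (deriv b) ?\<tau>)) = id"
      using nz by (simp add: fun_eq_iff)
    show "continuous_on J (deriv b)" using continuous_on_deriv_b[of 1] by simp
    show "canonical b J (deriv b z) = z" if "z \<in> J" for z
      using that inj_deriv_b by (simp add: canonical_def)
  qed (use open_J \<tau> in auto)
  then show ?thesis by (simp add: \<tau> inverse_eq_divide has_field_derivative_def)
qed

end

lemma C1_has_derivative:
  fixes G :: "real \<Rightarrow> real"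
  assumes "G C1_differentiable_on I"
  shows "u \<in> I \<Longrightarrow> (G has_real_derivative deriv G u) (at u)" "continuous_on I (deriv G)"
proof -
  obtain D where D: "\<And>x. x \<in> I \<Longrightarrow> (G has_vector_derivative D x) (at x)" "continuous_on I D"
    using assms unfolding C1_differentiable_on_def by blast
  have d: "(G has_real_derivative D u) (at u)" if "u \<in> I" for u
    using D(1)[OF that] by (simp add: has_real_derivative_iff_has_vector_derivative)
  then have eq: "deriv G u = D u" if "u \<in> I" for u using that DERIV_imp_deriv by blast
  show "u \<in> I \<Longrightarrow> (G has_real_derivative deriv G u) (at u)" using d eq by simp
  show "continuous_on I (deriv G)" using D(2) eq by (simp cong: continuous_on_cong)
qed

text \<open>The function \<open>link\<close> gives the canonical parameter in terms of the linear predictor, so that \<open>G\<close> is the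
  mean response \<open>deriv b \<circ> link\<close>.\<close>

locale glm_link = exponential_family +
  fixes G :: "real \<Rightarrow> real" and I :: "real set"
  assumes G: "G C1_differentiable_on I" "\<And>u. u \<in> I \<Longrightarrow> deriv G u > 0" and G_C2: "deriv G C1_differentiable_on I"
    and GI: "G ` I \<subseteq> deriv b ` J"
begin

definition link :: "real \<Rightarrow> real" where "link u = canonical b J (G u)"

definition link' :: "real \<Rightarrow> real" where "link' u = deriv G u / deriv (deriv b) (link u)"

definition link'' :: "real \<Rightarrow> real" where
  "link'' u = (deriv (deriv G) u * deriv (deriv b) (link u) - deriv G u * ((deriv ^^ 3) b (link u) * link' u)) /
     (deriv (deriv b) (link u) * deriv (deriv b) (link u))"

lemma link: "u \<in> I \<Longrightarrow> link u \<in> J" "u \<in> I \<Longrightarrow> deriv b (link u) = G u"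
  using canonical[of "G u"] GI by (auto simp: link_def)

lemma link_deriv: "u \<in> I \<Longrightarrow> (link has_real_derivative link' u) (at u)"
  unfolding link_def[abs_def] link'_def
  using DERIV_chain2[OF canonical_has_derivative C1_has_derivative(1)[OF G(1)], of u] GI by (auto simp: link_def)

lemma link'_pos: "u \<in> I \<Longrightarrow> link' u > 0"
  using G(2) var_pos link(1) by (simp add: link'_def)

lemma link'_deriv: "u \<in> I \<Longrightarrow> (link' has_real_derivative link'' u) (at u)"
proof -
  assume u: "u \<in> I"
  have "((deriv ^^ 2) b has_real_derivative (deriv ^^ 3) b (link u)) (at (link u))"
    using b_deriv[OF link(1)[OF u], of 2] by (simp add: numeral_3_eq_3 numeral_2_eq_2)
  from DERIV_chain2[OF this link_deriv[OF u]]
  have "((\<lambda>u. deriv (deriv b) (link u)) has_real_derivative (deriv ^^ 3) b (link u) * link' u) (at u)"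
    by (simp add: numeral_2_eq_2)
  from DERIV_divide[OF C1_has_derivative(1)[OF G_C2 u] this] var_pos[OF link(1)[OF u]]
  show ?thesis unfolding link'_def[abs_def] link''_def by (simp add: link'_def)
qed

lemma continuous_on_link: "continuous_on I link" "continuous_on I link'" "continuous_on I link''"
proof -
  show l: "continuous_on I link" and l': "continuous_on I link'"
    by (rule DERIV_continuous_on, erule has_field_derivative_at_within[OF link_deriv])
      (rule DERIV_continuous_on, erule has_field_derivative_at_within[OF link'_deriv])
  have bk: "continuous_on I (\<lambda>u. (deriv ^^ k) b (link u))" for k
    using link(1) by (intro continuous_on_compose2[OF continuous_on_deriv_b l]) auto
  have "deriv (deriv b) (link u) \<noteq> 0" if "u \<in> I" for u using var_pos[OF link(1)[OF that]] by simp
  then show "continuous_on I link''"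
    unfolding link''_def
    using bk[of 2] bk[of 3] C1_has_derivative(2)[OF G_C2] C1_has_derivative(2)[OF G(1)] l'
    by (intro continuous_intros) (auto simp: numeral_2_eq_2)
qed

text \<open>The weight \<open>\<phi>\<^sup>2\<close> of an observation has two further forms, as the expected negative second derivative of the
  log-likelihood and as the variance of its first derivative.\<close>

lemma glm_phi_power2: "u \<in> I \<Longrightarrow> (glm_phi b J G u)\<^sup>2 = link' u * deriv G u"
  using var_pos[OF link(1), of u]
  by (simp add: glm_phi_def link'_def power_divide link_def power2_eq_square less_imp_le)

lemma variance_link: "u \<in> I \<Longrightarrow> (link' u)\<^sup>2 * deriv (deriv b) (link u) = (glm_phi b J G u)\<^sup>2"
  using var_pos[OF link(1), of u]
  by (simp add: glm_phi_def link'_def power_divide link_def power2_eq_square less_imp_le)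

lemma glm_phi_pos: "u \<in> I \<Longrightarrow> glm_phi b J G u > 0"
  using G(2) var_pos[OF link(1), of u] by (simp add: glm_phi_def link_def)

lemma continuous_on_glm_phi: "continuous_on I (glm_phi b J G)"
proof -
  have "continuous_on I (\<lambda>u. sqrt ((glm_phi b J G u)\<^sup>2))"
    using glm_phi_power2 continuous_on_link(2) C1_has_derivative(2)[OF G(1)]
    by (intro continuous_on_real_sqrt) (auto intro!: continuous_intros cong: continuous_on_cong)
  then show ?thesis
    by (rule continuous_on_eq) (use glm_phi_pos in \<open>auto simp: less_imp_le\<close>)
qed

lemma b_link_deriv: "u \<in> I \<Longrightarrow> ((\<lambda>u. b (link u)) has_real_derivative G u * link' u) (at u)"
proof -
  assume u: "u \<in> I"
  have "(b has_real_derivative G u) (at (link u))"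
    using b_deriv[OF link(1)[OF u], where k=0] by (simp add: link(2)[OF u])
  from DERIV_chain2[OF this link_deriv[OF u]] show ?thesis by simp
qed

end

section \<open>Maximum likelihood along a single path\<close>

lemma continuous_on_compact_interval_bounds:
  fixes g :: "real \<Rightarrow> real"
  assumes "continuous_on {a..b} g"
  obtains B where "B > 0" "\<And>u. u \<in> {a..b} \<Longrightarrow> \<bar>g u\<bar> \<le> B"
proof -
  have "bounded (g ` {a..b})"
    using assms by (intro compact_imp_bounded compact_continuous_image) auto
  then obtain B where "\<forall>x\<in>g ` {a..b}. norm x \<le> B" unfolding bounded_iff by blast
  then have B: "\<bar>g u\<bar> \<le> B" if "u \<in> {a..b}" for u using that by auto
  then show thesis by (intro that[of "max B 1"]) fastforce+
qed

lemma continuous_on_compact_interval_lower_bound: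
  fixes g :: "real \<Rightarrow> real"
  assumes g: "continuous_on {a..b} g" and pos: "\<And>u. u \<in> {a..b} \<Longrightarrow> g u > 0"
  obtains c where "c > 0" "\<And>u. u \<in> {a..b} \<Longrightarrow> c \<le> g u"
proof (cases "a \<le> b")
  case True
  then obtain x where "x \<in> {a..b}" "\<And>u. u \<in> {a..b} \<Longrightarrow> g x \<le> g u"
    using continuous_attains_inf[of "{a..b}" g] g by auto
  then show thesis using pos that by blast
next
  case False
  then show thesis by (intro that[of 1]) auto
qed

lemma uniformly_continuous_interval:
  fixes g :: "real \<Rightarrow> real"
  assumes g: "continuous_on {a..b} g" and e: "e > 0"
  obtains d where "d > 0" "\<And>u v. u \<in> {a..b} \<Longrightarrow> v \<in> {a..b} \<Longrightarrow> \<bar>u - v\<bar> < d \<Longrightarrow> \<bar>g u - g v\<bar> < e"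
proof -
  have "uniformly_continuous_on {a..b} g" using g by (intro compact_uniformly_continuous) auto
  then show thesis
    using e that unfolding uniformly_continuous_on_def dist_real_def by blast
qed

lemma mean_value_between:
  fixes g :: "real \<Rightarrow> real"
  assumes g: "\<And>u. u \<in> {a..b} \<Longrightarrow> (g has_real_derivative g' u) (at u)" and uv: "u \<in> {a..b}" "v \<in> {a..b}"
  obtains \<xi> where "\<xi> \<in> {a..b}" "\<bar>\<xi> - v\<bar> \<le> \<bar>u - v\<bar>" "g u - g v = g' \<xi> * (u - v)"
proof (cases u v rule: linorder_cases)
  case less
  then obtain \<xi> where "u < \<xi>" "\<xi> < v" "g v - g u = (v - u) * g' \<xi>" using MVT2[of u v g g'] g uv by auto
  then show thesis using uv by (intro that[of \<xi>]) (auto simp: algebra_simps)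
next
  case equal
  then show thesis using uv by (intro that[of u]) auto
next
  case greater
  then obtain \<xi> where "v < \<xi>" "\<xi> < u" "g u - g v = (u - v) * g' \<xi>" using MVT2[of v u g g'] g uv by auto
  then show thesis using uv by (intro that[of \<xi>]) (auto simp: algebra_simps)
qed

text \<open>The Kullback-Leibler divergence between the response distributions at \<open>u\<close> and \<open>v\<close>, which is
  \<open>\<beta> u - \<beta> v - G v * (h u - h v)\<close>, grows at least quadratically, because its derivative
  \<open>(G u - G v) * h' u\<close> grows linearly.\<close>

lemma divergence_lower_bound:
  fixes h h' G G' \<beta> :: "real \<Rightarrow> real"
  assumes h: "\<And>u. u \<in> {a..b} \<Longrightarrow> (h has_real_derivative h' u) (at u)"
    and G: "\<And>u. u \<in> {a..b} \<Longrightarrow> (G has_real_derivative G' u) (at u)"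
    and \<beta>: "\<And>u. u \<in> {a..b} \<Longrightarrow> (\<beta> has_real_derivative G u * h' u) (at u)"
    and c1: "c1 > 0" "\<And>u. u \<in> {a..b} \<Longrightarrow> c1 \<le> h' u" and c2: "c2 > 0" "\<And>u. u \<in> {a..b} \<Longrightarrow> c2 \<le> G' u"
    and uv: "u \<in> {a..b}" "v \<in> {a..b}"
  shows "c1 * c2 / 2 * (u - v)\<^sup>2 \<le> \<beta> u - \<beta> v - G v * (h u - h v)"
proof -
  define k where "k = (\<lambda>t. \<beta> t - G v * h t - c1 * c2 / 2 * (t - v)\<^sup>2)"
  have k: "(k has_real_derivative (G t - G v) * h' t - c1 * c2 * (t - v)) (at t)" if "t \<in> {a..b}" for t
    unfolding k_def by (auto intro!: derivative_eq_intros h[OF that] \<beta>[OF that] simp: field_simps)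
  have slope: "\<exists>s\<ge>c1 * c2. (G t - G v) * h' t = s * (t - v)" if t: "t \<in> {a..b}" for t
  proof -
    obtain \<xi> where \<xi>: "\<xi> \<in> {a..b}" "G t - G v = G' \<xi> * (t - v)"
      using mean_value_between[of a b G G', OF G t uv(2)] by metis
    have "c1 * c2 \<le> h' t * G' \<xi>" using c1 c2 t \<xi>(1) by (intro mult_mono) (auto intro: order_trans[OF less_imp_le])
    then show ?thesis using \<xi>(2) by (intro exI[of _ "h' t * G' \<xi>"]) simp
  qed
  have "k v \<le> k u"
  proof (cases "v \<le> u")
    case True
    show ?thesis
    proof (rule DERIV_nonneg_imp_nondecreasing[OF True])
      fix t assume t: "v \<le> t" "t \<le> u"
      then have "t \<in> {a..b}" using uv by auto
      moreover obtain s where s: "s \<ge> c1 * c2" "(G t - G v) * h' t = s * (t - v)"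
        using slope[OF \<open>t \<in> {a..b}\<close>] by blast
      have "c1 * c2 * (t - v) \<le> (G t - G v) * h' t"
        unfolding s(2) using t s(1) by (intro mult_right_mono) auto
      ultimately show "\<exists>y. (k has_real_derivative y) (at t) \<and> 0 \<le> y" using k by force
    qed
  next
    case False
    then have "u \<le> v" by simp
    then show ?thesis
    proof (rule DERIV_nonpos_imp_nonincreasing)
      fix t assume t: "u \<le> t" "t \<le> v"
      then have "t \<in> {a..b}" using uv by auto
      moreover obtain s where s: "s \<ge> c1 * c2" "(G t - G v) * h' t = s * (t - v)"
        using slope[OF \<open>t \<in> {a..b}\<close>] by blast
      have "(G t - G v) * h' t \<le> c1 * c2 * (t - v)"
        unfolding s(2) using t s(1) by (intro mult_right_mono_neg) auto
      ultimately show "\<exists>y. (k has_real_derivative y) (at t) \<and> y \<le> 0" using k by force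
    qed
  qed
  then show ?thesis by (simp add: k_def algebra_simps)
qed

lemma inner_sum_outer: "v \<bullet> ((\<Sum>k\<in>I. w k *\<^sub>R outer (z k)) *v v) = (\<Sum>k\<in>I. w k * (z k \<bullet> v)\<^sup>2)"
proof (induction I rule: infinite_finite_induct)
  case (insert x F)
  then show ?case
    by (simp add: matrix_vector_mult_add_rdistrib inner_add_right scaleR_matrix_vector_assoc[symmetric]
        outer_vector power2_eq_square inner_commute)
qed simp_all

lemma sum_outer_vector: "(\<Sum>k\<in>I. w k *\<^sub>R outer (z k)) *v v = (\<Sum>k\<in>I. (w k * (z k \<bullet> v)) *\<^sub>R z k)"
proof (induction I rule: infinite_finite_induct)
  case (insert x F)
  then show ?case
    by (simp add: matrix_vector_mult_add_rdistrib scaleR_matrix_vector_assoc[symmetric] outer_vector)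
qed simp_all

text \<open>A deterministic sequence of regressors \<open>z k\<close> and responses \<open>y k\<close> with the log-likelihood
  \<open>\<Sum>k<n. h (z k \<bullet> \<eta>) * y k - \<beta> (z k \<bullet> \<eta>)\<close>. The assumptions \<open>info\<close>, \<open>noise\<close>, \<open>noise'\<close> and \<open>abs_noise\<close>
  are those consequences of the laws of large numbers that hold for almost every path; to make this possible,
  \<open>noise\<close> is restricted to a set \<open>T\<close> that may be countable.\<close>

locale ml_path =
  fixes h h' h'' G G' \<beta> :: "real \<Rightarrow> real" and a b :: real
    and z :: "nat \<Rightarrow> real^'p" and y :: "nat \<Rightarrow> real" and \<Theta> :: "(real^'p) set" and \<theta>bar :: "real^'p"
    and N :: "real^'p^'p" and R C :: real and T :: "(real^'p) set" and \<theta> :: "nat \<Rightarrow> real^'p" and n0 :: nat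
  assumes h: "\<And>u. u \<in> {a..b} \<Longrightarrow> (h has_real_derivative h' u) (at u)"
    and h': "\<And>u. u \<in> {a..b} \<Longrightarrow> (h' has_real_derivative h'' u) (at u)"
    and G: "\<And>u. u \<in> {a..b} \<Longrightarrow> (G has_real_derivative G' u) (at u)"
    and \<beta>: "\<And>u. u \<in> {a..b} \<Longrightarrow> (\<beta> has_real_derivative G u * h' u) (at u)"
    and pos: "\<And>u. u \<in> {a..b} \<Longrightarrow> h' u > 0" "\<And>u. u \<in> {a..b} \<Longrightarrow> G' u > 0"
    and cont: "continuous_on {a..b} h'" "continuous_on {a..b} h''" "continuous_on {a..b} G'"
    and z: "\<And>k \<eta>. \<eta> \<in> \<Theta> \<Longrightarrow> z k \<bullet> \<eta> \<in> {a..b}" "\<And>k. norm (z k) \<le> R" and R: "R > 0"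
    and \<Theta>: "compact \<Theta>" "\<theta>bar \<in> interior \<Theta>"
    and T: "T \<subseteq> \<Theta>" "\<Theta> \<subseteq> closure T"
    and N: "pos_def N"
    and info: "(\<lambda>n. (1 / real n) *\<^sub>R (\<Sum>k<n. (h' (z k \<bullet> \<theta>bar) * G' (z k \<bullet> \<theta>bar)) *\<^sub>R outer (z k))) \<longlonglongrightarrow> N"
    and noise: "\<And>\<eta>. \<eta> \<in> T \<Longrightarrow> (\<lambda>n. (\<Sum>k<n. (h (z k \<bullet> \<eta>) - h (z k \<bullet> \<theta>bar)) * (y k - G (z k \<bullet> \<theta>bar))) / real n) \<longlonglongrightarrow> 0"
    and noise': "(\<lambda>n. (1 / real n) *\<^sub>R (\<Sum>k<n. (h'' (z k \<bullet> \<theta>bar) * (y k - G (z k \<bullet> \<theta>bar))) *\<^sub>R outer (z k))) \<longlonglongrightarrow> 0"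
    and abs_noise: "eventually (\<lambda>n. (\<Sum>k<n. \<bar>y k - G (z k \<bullet> \<theta>bar)\<bar>) \<le> C * real n) sequentially"
    and ml: "\<And>n. n \<ge> n0 \<Longrightarrow> \<theta> n \<in> \<Theta>"
      "\<And>n \<eta>. n \<ge> n0 \<Longrightarrow> \<eta> \<in> \<Theta> \<Longrightarrow> (\<Sum>k<n. h (z k \<bullet> \<eta>) * y k - \<beta> (z k \<bullet> \<eta>)) \<le> (\<Sum>k<n. h (z k \<bullet> \<theta> n) * y k - \<beta> (z k \<bullet> \<theta> n))"
begin

definition e :: "nat \<Rightarrow> real" where "e k = y k - G (z k \<bullet> \<theta>bar)"

definition score :: "nat \<Rightarrow> real^'p" where "score n = (\<Sum>k<n. (h' (z k \<bullet> \<theta>bar) * e k) *\<^sub>R z k)"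

text \<open>The random part of the averaged log-likelihood ratio of \<open>\<eta>\<close> against \<open>\<theta>bar\<close>; the remaining part is minus an
  average of Kullback-Leibler divergences.\<close>

definition Q :: "nat \<Rightarrow> real^'p \<Rightarrow> real" where
  "Q n \<eta> = (\<Sum>k<n. (h (z k \<bullet> \<eta>) - h (z k \<bullet> \<theta>bar)) * e k) / real n"

lemma \<theta>bar_mem: "\<theta>bar \<in> \<Theta>" using \<Theta>(2) interior_subset by blast

lemma zbar: "z k \<bullet> \<theta>bar \<in> {a..b}" by (rule z(1)[OF \<theta>bar_mem])

lemma C_nonneg: "C \<ge> 0"
proof -
  obtain n where n: "(\<Sum>k<n. \<bar>e k\<bar>) \<le> C * real n" "n \<ge> 1"
    using eventually_conj[OF abs_noise eventually_ge_at_top[of 1]] unfolding e_def eventually_sequentially by blast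
  have "0 \<le> (\<Sum>k<n. \<bar>e k\<bar>)" by (intro sum_nonneg) auto
  with n(1) have "0 \<le> C * real n" by linarith
  then show ?thesis using n(2) by (simp add: zero_le_mult_iff)
qed

text \<open>Pointwise convergence on a dense set extends to uniform convergence, since the functions \<open>Q n\<close> have
  a common Lipschitz constant.\<close>

lemma Q_uniform:
  assumes \<epsilon>: "\<epsilon> > 0"
  shows "eventually (\<lambda>n. \<forall>\<eta>\<in>\<Theta>. \<bar>Q n \<eta>\<bar> \<le> \<epsilon>) sequentially"
proof -
  obtain B where B: "B > 0" "\<And>u. u \<in> {a..b} \<Longrightarrow> \<bar>h' u\<bar> \<le> B"
    using continuous_on_compact_interval_bounds[OF cont(1)] by blast
  have lip: "\<bar>h u - h v\<bar> \<le> B * \<bar>u - v\<bar>" if uv: "u \<in> {a..b}" "v \<in> {a..b}" for u v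
  proof -
    obtain \<xi> where "\<xi> \<in> {a..b}" "h u - h v = h' \<xi> * (u - v)"
      using mean_value_between[of a b h h', OF h uv] by metis
    then show ?thesis using B(2) by (simp add: abs_mult mult_right_mono)
  qed
  define r where "r = \<epsilon> / (2 * (B * R * (C + 1)))"
  have BRC: "B * R * (C + 1) > 0" using B(1) R C_nonneg by simp
  then have r: "r > 0" using \<epsilon> by (simp add: r_def)
  have "\<Theta> \<subseteq> (\<Union>t\<in>T. ball t r)"
  proof
    fix x assume "x \<in> \<Theta>"
    then have "x \<in> closure T" using T(2) by blast
    then show "x \<in> (\<Union>t\<in>T. ball t r)" using r by (auto simp: closure_approachable)
  qed
  then obtain D where D: "D \<subseteq> T" "finite D" "\<Theta> \<subseteq> (\<Union>t\<in>D. ball t r)"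
    using compactE_image[OF \<Theta>(1), of T "\<lambda>t. ball t r"] by (metis open_ball)
  have "eventually (\<lambda>n. \<bar>Q n t\<bar> < \<epsilon> / 2) sequentially" if "t \<in> D" for t
  proof -
    have "(\<lambda>n. Q n t) \<longlonglongrightarrow> 0" using noise[of t] that D(1) unfolding Q_def e_def by blast
    then show ?thesis using \<epsilon> tendstoD[of "\<lambda>n. Q n t" 0 sequentially "\<epsilon> / 2"] by simp
  qed
  then have "eventually (\<lambda>n. \<forall>t\<in>D. \<bar>Q n t\<bar> < \<epsilon> / 2) sequentially"
    using D(2) by (intro eventually_ball_finite) auto
  with abs_noise show ?thesis
  proof eventually_elim
    case (elim n)
    show ?case
    proof
      fix \<eta> assume \<eta>: "\<eta> \<in> \<Theta>"
      then obtain t where t: "t \<in> D" "dist t \<eta> < r" using D(3) by auto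
      have t\<Theta>: "t \<in> \<Theta>" using t(1) D(1) T(1) by blast
      have "Q n \<eta> - Q n t = (\<Sum>k<n. (h (z k \<bullet> \<eta>) - h (z k \<bullet> t)) * e k) / real n"
        by (simp add: Q_def diff_divide_distrib[symmetric] sum_subtractf[symmetric] algebra_simps)
      also have "\<bar>\<dots>\<bar> \<le> (\<Sum>k<n. B * R * r * \<bar>e k\<bar>) / real n"
      proof -
        have "\<bar>(h (z k \<bullet> \<eta>) - h (z k \<bullet> t)) * e k\<bar> \<le> B * R * r * \<bar>e k\<bar>" for k
        proof -
          have "\<bar>h (z k \<bullet> \<eta>) - h (z k \<bullet> t)\<bar> \<le> B * \<bar>z k \<bullet> \<eta> - z k \<bullet> t\<bar>" using z(1) \<eta> t\<Theta> by (intro lip) auto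
          also have "\<bar>z k \<bullet> \<eta> - z k \<bullet> t\<bar> \<le> norm (z k) * norm (\<eta> - t)"
            by (simp flip: inner_diff_right add: Cauchy_Schwarz_ineq2)
          also have "\<dots> \<le> R * r" using z(2)[of k] t(2) R by (intro mult_mono) (auto simp: dist_norm norm_minus_commute)
          finally have "\<bar>h (z k \<bullet> \<eta>) - h (z k \<bullet> t)\<bar> \<le> B * (R * r)" using B(1) by simp
          from mult_right_mono[OF this abs_ge_zero[of "e k"]] show ?thesis by (simp add: abs_mult mult.assoc)
        qed
        then have "\<bar>\<Sum>k<n. (h (z k \<bullet> \<eta>) - h (z k \<bullet> t)) * e k\<bar> \<le> (\<Sum>k<n. B * R * r * \<bar>e k\<bar>)"
          by (intro order_trans[OF sum_abs] sum_mono) auto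
        then show ?thesis by (simp add: divide_right_mono)
      qed
      also have "\<dots> = B * R * r * (\<Sum>k<n. \<bar>e k\<bar>) / real n" by (simp add: sum_distrib_left)
      also have "\<dots> \<le> B * R * r * (C * real n) / real n"
        using elim(1) B(1) R r by (intro divide_right_mono mult_left_mono) (auto simp: e_def)
      also have "\<dots> \<le> B * R * r * (C + 1)"
        using C_nonneg B(1) R r by (cases "n = 0") auto
      also have "\<dots> = B * R * (C + 1) * r" by (simp only: mult_ac)
      also have "\<dots> = \<epsilon> / 2"
      proof -
        have "X * (\<epsilon> / (2 * X)) = \<epsilon> / 2" if "X > 0" for X using that by simp
        from this[OF BRC] show ?thesis by (simp only: r_def)
      qed
      finally have "\<bar>Q n \<eta> - Q n t\<bar> \<le> \<epsilon> / 2" .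
      moreover have "\<bar>Q n t\<bar> < \<epsilon> / 2" using elim(2) t(1) by blast
      ultimately show "\<bar>Q n \<eta>\<bar> \<le> \<epsilon>" by linarith
    qed
  qed
qed

text \<open>As \<open>\<theta> n\<close> maximises the likelihood, the averaged divergence at \<open>\<theta> n\<close> is at most \<open>Q n (\<theta> n)\<close>, which tends to
  \<open>0\<close>. On the other hand it is at least a multiple of \<open>(norm (\<theta> n - \<theta>bar))\<^sup>2\<close>, by the quadratic lower bound and
  because the normalised information matrices converge to a positive definite one.\<close>

lemma consistent: "\<theta> \<longlonglongrightarrow> \<theta>bar"
proof -
  obtain c1 where c1: "c1 > 0" "\<And>u. u \<in> {a..b} \<Longrightarrow> c1 \<le> h' u"
    using continuous_on_compact_interval_lower_bound[OF cont(1) pos(1)] by blast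
  obtain c2 where c2: "c2 > 0" "\<And>u. u \<in> {a..b} \<Longrightarrow> c2 \<le> G' u"
    using continuous_on_compact_interval_lower_bound[OF cont(3) pos(2)] by blast
  have "continuous_on {a..b} (\<lambda>u. h' u * G' u)" by (intro continuous_intros cont)
  then obtain W where W: "W > 0" "\<And>u. u \<in> {a..b} \<Longrightarrow> \<bar>h' u * G' u\<bar> \<le> W"
    using continuous_on_compact_interval_bounds by blast
  obtain l where l: "l > 0" "\<And>v. l * (norm v)\<^sup>2 \<le> v \<bullet> (N *v v)" using pos_def_lower_bound[OF N] by blast
  let ?A = "\<lambda>n. (1 / real n) *\<^sub>R (\<Sum>k<n. (h' (z k \<bullet> \<theta>bar) * G' (z k \<bullet> \<theta>bar)) *\<^sub>R outer (z k))"
  define \<rho> where "\<rho> = c1 * c2 / 2 * (l / (2 * W))"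
  have \<rho>: "\<rho> > 0" using c1 c2 l W by (simp add: \<rho>_def)
  have key: "eventually (\<lambda>n. \<rho> * (norm (\<theta> n - \<theta>bar))\<^sup>2 \<le> Q n (\<theta> n)) sequentially"
  proof -
    have "eventually (\<lambda>n. dist (?A n) N < l / 2) sequentially" using info l(1) by (intro tendstoD) auto
    moreover have "eventually (\<lambda>n. n \<ge> max n0 1) sequentially" by (rule eventually_ge_at_top)
    ultimately show ?thesis
    proof eventually_elim
      case (elim n)
      define \<Delta> where "\<Delta> = \<theta> n - \<theta>bar"
      have n: "n \<ge> n0" "real n > 0" using elim(2) by auto
      have \<theta>n: "\<theta> n \<in> \<Theta>" by (rule ml(1)[OF n(1)])
      have "\<bar>\<Delta> \<bullet> ((?A n - N) *v \<Delta>)\<bar> \<le> norm \<Delta> * (norm (?A n - N) * norm \<Delta>)"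
        by (intro order_trans[OF Cauchy_Schwarz_ineq2] mult_left_mono norm_matrix_vector_le) auto
      also have "\<dots> = norm (?A n - N) * (norm \<Delta>)\<^sup>2" by (simp add: power2_eq_square)
      also have "\<dots> \<le> l / 2 * (norm \<Delta>)\<^sup>2"
        using elim(1) by (intro mult_right_mono) (auto simp: dist_norm)
      finally have "\<bar>\<Delta> \<bullet> (?A n *v \<Delta>) - \<Delta> \<bullet> (N *v \<Delta>)\<bar> \<le> l / 2 * (norm \<Delta>)\<^sup>2"
        by (simp add: matrix_vector_mult_diff_rdistrib inner_diff_right)
      with l(2)[of \<Delta>] have "l / 2 * (norm \<Delta>)\<^sup>2 \<le> \<Delta> \<bullet> (?A n *v \<Delta>)" by linarith
      also have "\<dots> = (\<Sum>k<n. h' (z k \<bullet> \<theta>bar) * G' (z k \<bullet> \<theta>bar) * (z k \<bullet> \<Delta>)\<^sup>2) / real n"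
        unfolding scaleR_matrix_vector_assoc[symmetric] inner_scaleR_right inner_sum_outer by simp
      also have "\<dots> \<le> (\<Sum>k<n. W * (z k \<bullet> \<Delta>)\<^sup>2) / real n"
        using W(2)[OF zbar] by (intro divide_right_mono sum_mono mult_right_mono) (auto intro: order_trans[OF abs_ge_self])
      finally have "l / 2 * (norm \<Delta>)\<^sup>2 \<le> W * ((\<Sum>k<n. (z k \<bullet> \<Delta>)\<^sup>2) / real n)"
        by (simp add: sum_distrib_left)
      then have low: "l / (2 * W) * (norm \<Delta>)\<^sup>2 \<le> (\<Sum>k<n. (z k \<bullet> \<Delta>)\<^sup>2) / real n"
        using W(1) by (simp add: field_simps)
      have div: "c1 * c2 / 2 * (z k \<bullet> \<Delta>)\<^sup>2 \<le> \<beta> (z k \<bullet> \<theta> n) - \<beta> (z k \<bullet> \<theta>bar) - G (z k \<bullet> \<theta>bar) * (h (z k \<bullet> \<theta> n) - h (z k \<bullet> \<theta>bar))" for k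
        unfolding \<Delta>_def inner_diff_right
        by (rule divergence_lower_bound[OF h G \<beta> c1 c2 z(1)[OF \<theta>n] zbar])
      have "(\<Sum>k<n. c1 * c2 / 2 * (z k \<bullet> \<Delta>)\<^sup>2) \<le>
          (\<Sum>k<n. \<beta> (z k \<bullet> \<theta> n) - \<beta> (z k \<bullet> \<theta>bar) - G (z k \<bullet> \<theta>bar) * (h (z k \<bullet> \<theta> n) - h (z k \<bullet> \<theta>bar)))"
        by (intro sum_mono div)
      also have "\<dots> = real n * Q n (\<theta> n) - ((\<Sum>k<n. h (z k \<bullet> \<theta> n) * y k - \<beta> (z k \<bullet> \<theta> n)) - (\<Sum>k<n. h (z k \<bullet> \<theta>bar) * y k - \<beta> (z k \<bullet> \<theta>bar)))"
        using n(2) by (simp add: Q_def e_def sum_subtractf[symmetric] algebra_simps)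
      also have "\<dots> \<le> real n * Q n (\<theta> n)" using ml(2)[OF n(1) \<theta>bar_mem] by simp
      finally have fin: "(\<Sum>k<n. c1 * c2 / 2 * (z k \<bullet> \<Delta>)\<^sup>2) \<le> real n * Q n (\<theta> n)" .
      have "c1 * c2 / 2 * ((\<Sum>k<n. (z k \<bullet> \<Delta>)\<^sup>2) / real n) \<le> Q n (\<theta> n)"
      proof -
        from fin have "c1 * c2 / 2 * (\<Sum>k<n. (z k \<bullet> \<Delta>)\<^sup>2) \<le> Q n (\<theta> n) * real n"
          by (simp only: sum_distrib_left mult.commute[of "real n"])
        then have "c1 * c2 / 2 * (\<Sum>k<n. (z k \<bullet> \<Delta>)\<^sup>2) / real n \<le> Q n (\<theta> n)"
          using n(2) by (simp only: pos_divide_le_eq)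
        then show ?thesis by simp
      qed
      moreover have "\<rho> * (norm \<Delta>)\<^sup>2 \<le> c1 * c2 / 2 * ((\<Sum>k<n. (z k \<bullet> \<Delta>)\<^sup>2) / real n)"
        unfolding \<rho>_def mult.assoc[of "c1 * c2 / 2"] using c1(1) c2(1) by (intro mult_left_mono low) auto
      ultimately show ?case by (simp add: \<Delta>_def)
    qed
  qed
  show ?thesis
  proof (rule tendstoI)
    fix \<epsilon> :: real assume \<epsilon>: "\<epsilon> > 0"
    have "eventually (\<lambda>n. \<forall>\<eta>\<in>\<Theta>. \<bar>Q n \<eta>\<bar> \<le> \<rho> * \<epsilon>\<^sup>2 / 2) sequentially"
      using \<rho> \<epsilon> by (intro Q_uniform) simp
    with key eventually_ge_at_top[of n0] show "eventually (\<lambda>n. dist (\<theta> n) \<theta>bar < \<epsilon>) sequentially"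
    proof eventually_elim
      case (elim n)
      have "\<rho> * (norm (\<theta> n - \<theta>bar))\<^sup>2 \<le> \<rho> * \<epsilon>\<^sup>2 / 2" using elim ml(1)[of n] by force
      also have "\<dots> < \<rho> * \<epsilon>\<^sup>2" using \<rho> \<epsilon> by simp
      finally have "(norm (\<theta> n - \<theta>bar))\<^sup>2 < \<epsilon>\<^sup>2" using \<rho> by simp
      then show ?case using \<epsilon> by (simp add: dist_norm power_less_imp_less_base)
    qed
  qed
qed

text \<open>The first order condition, obtained on each line through the interior maximum.\<close>

lemma score_equation:
  assumes n: "n \<ge> n0" and int: "\<theta> n \<in> interior \<Theta>"
  shows "(\<Sum>k<n. (h' (z k \<bullet> \<theta> n) * (y k - G (z k \<bullet> \<theta> n))) *\<^sub>R z k) = 0"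
proof -
  have \<theta>n: "\<theta> n \<in> \<Theta>" by (rule ml(1)[OF n])
  have "v \<bullet> (\<Sum>k<n. (h' (z k \<bullet> \<theta> n) * (y k - G (z k \<bullet> \<theta> n))) *\<^sub>R z k) = 0" for v
  proof -
    obtain r where r: "r > 0" "ball (\<theta> n) r \<subseteq> \<Theta>" using int by (meson mem_interior)
    define L where "L = (\<lambda>s. \<Sum>k<n. h (z k \<bullet> (\<theta> n + s *\<^sub>R v)) * y k - \<beta> (z k \<bullet> (\<theta> n + s *\<^sub>R v)))"
    have inner_deriv: "((\<lambda>s. z k \<bullet> (\<theta> n + s *\<^sub>R v)) has_real_derivative z k \<bullet> v) (at 0)" for k
      unfolding inner_add_right inner_scaleR_right by (auto intro!: derivative_eq_intros)
    have "(L has_real_derivative (\<Sum>k<n. h' (z k \<bullet> \<theta> n) * (z k \<bullet> v) * y k - G (z k \<bullet> \<theta> n) * h' (z k \<bullet> \<theta> n) * (z k \<bullet> v))) (at 0)"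
      unfolding L_def
    proof (intro DERIV_sum DERIV_diff DERIV_cmult_right)
      fix k
      show "((\<lambda>s. h (z k \<bullet> (\<theta> n + s *\<^sub>R v))) has_real_derivative h' (z k \<bullet> \<theta> n) * (z k \<bullet> v)) (at 0)"
        using DERIV_chain2[OF _ inner_deriv[of k], of h "h' (z k \<bullet> \<theta> n)"] h[OF z(1)[OF \<theta>n, of k]] by simp
      show "((\<lambda>s. \<beta> (z k \<bullet> (\<theta> n + s *\<^sub>R v))) has_real_derivative G (z k \<bullet> \<theta> n) * h' (z k \<bullet> \<theta> n) * (z k \<bullet> v)) (at 0)"
        using DERIV_chain2[OF _ inner_deriv[of k], of \<beta> "G (z k \<bullet> \<theta> n) * h' (z k \<bullet> \<theta> n)"] \<beta>[OF z(1)[OF \<theta>n, of k]] by simp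
    qed
    moreover have "0 < r / (norm v + 1)" using r(1) by (simp add: add_nonneg_pos)
    moreover have "\<forall>s. \<bar>0 - s\<bar> < r / (norm v + 1) \<longrightarrow> L s \<le> L 0"
    proof (intro allI impI)
      fix s assume "\<bar>0 - s\<bar> < r / (norm v + 1)"
      then have "\<bar>s\<bar> * (norm v + 1) < r" by (simp add: pos_less_divide_eq add_nonneg_pos)
      moreover have "\<bar>s\<bar> * norm v \<le> \<bar>s\<bar> * (norm v + 1)" by (intro mult_left_mono) auto
      ultimately have "\<theta> n + s *\<^sub>R v \<in> ball (\<theta> n) r" by (simp add: dist_norm)
      then have "\<theta> n + s *\<^sub>R v \<in> \<Theta>" using r(2) by blast
      from ml(2)[OF n this] show "L s \<le> L 0" by (simp add: L_def)
    qed
    ultimately have "(\<Sum>k<n. h' (z k \<bullet> \<theta> n) * (z k \<bullet> v) * y k - G (z k \<bullet> \<theta> n) * h' (z k \<bullet> \<theta> n) * (z k \<bullet> v)) = 0"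
      by (rule DERIV_local_max)
    then show ?thesis by (simp add: inner_sum_right inner_commute algebra_simps)
  qed
  from this[of "\<Sum>k<n. (h' (z k \<bullet> \<theta> n) * (y k - G (z k \<bullet> \<theta> n))) *\<^sub>R z k"] show ?thesis by simp
qed

text \<open>Expanding the score equation around \<open>\<theta>bar\<close>. Up to Taylor remainders of smaller order, the second derivative
  \<open>h''\<close> enters only in a term that is linear in the noise, and this term is negligible by the law of large
  numbers.\<close>

lemma score_expansion:
  assumes \<epsilon>: "\<epsilon> > 0"
  shows "eventually (\<lambda>n. norm (score n - real n *\<^sub>R (N *v (\<theta> n - \<theta>bar))) \<le> \<epsilon> * (real n * norm (\<theta> n - \<theta>bar))) sequentially"
proof -
  let ?A = "\<lambda>n. (1 / real n) *\<^sub>R (\<Sum>k<n. (h' (z k \<bullet> \<theta>bar) * G' (z k \<bullet> \<theta>bar)) *\<^sub>R outer (z k))"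
  let ?B = "\<lambda>n. (1 / real n) *\<^sub>R (\<Sum>k<n. (h'' (z k \<bullet> \<theta>bar) * e k) *\<^sub>R outer (z k))"
  obtain H where H: "H > 0" "\<And>u. u \<in> {a..b} \<Longrightarrow> \<bar>h' u\<bar> \<le> H" using continuous_on_compact_interval_bounds[OF cont(1)] by blast
  obtain W where W: "W > 0" "\<And>u. u \<in> {a..b} \<Longrightarrow> \<bar>G' u\<bar> \<le> W" using continuous_on_compact_interval_bounds[OF cont(3)] by blast
  define \<alpha> where "\<alpha> = \<epsilon> / (4 * (R * R * (C + 1)))"
  have RC: "R * R * (C + 1) > 0" using R C_nonneg by simp
  have \<alpha>: "\<alpha> > 0" using \<epsilon> RC by (simp add: \<alpha>_def)
  obtain d1 where d1: "d1 > 0" "\<And>u v. u \<in> {a..b} \<Longrightarrow> v \<in> {a..b} \<Longrightarrow> \<bar>u - v\<bar> < d1 \<Longrightarrow> \<bar>h'' u - h'' v\<bar> < \<alpha>"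
    using uniformly_continuous_interval[OF cont(2) \<alpha>] by blast
  have "\<alpha> / (2 * W) > 0" "\<alpha> / (2 * H) > 0" using \<alpha> W H by auto
  from uniformly_continuous_interval[OF cont(1) this(1)] uniformly_continuous_interval[OF cont(3) this(2)]
  obtain d2 d3 where d2: "d2 > 0" "\<And>u v. u \<in> {a..b} \<Longrightarrow> v \<in> {a..b} \<Longrightarrow> \<bar>u - v\<bar> < d2 \<Longrightarrow> \<bar>h' u - h' v\<bar> < \<alpha> / (2 * W)"
    and d3: "d3 > 0" "\<And>u v. u \<in> {a..b} \<Longrightarrow> v \<in> {a..b} \<Longrightarrow> \<bar>u - v\<bar> < d3 \<Longrightarrow> \<bar>G' u - G' v\<bar> < \<alpha> / (2 * H)"
    by metis
  define d where "d = min d1 (min d2 d3)"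
  have d: "d > 0" using d1 d2 d3 by (simp add: d_def)
  have rem1: "\<bar>h' u - h' v - h'' v * (u - v)\<bar> \<le> \<alpha> * \<bar>u - v\<bar>" if uv: "u \<in> {a..b}" "v \<in> {a..b}" "\<bar>u - v\<bar> < d" for u v
  proof -
    obtain \<xi> where \<xi>: "\<xi> \<in> {a..b}" "\<bar>\<xi> - v\<bar> \<le> \<bar>u - v\<bar>" "h' u - h' v = h'' \<xi> * (u - v)"
      using mean_value_between[of a b h' h'', OF h' uv(1,2)] by metis
    have "\<bar>h'' \<xi> - h'' v\<bar> < \<alpha>" using \<xi> uv by (intro d1) (auto simp: d_def)
    then have "\<bar>h'' \<xi> - h'' v\<bar> * \<bar>u - v\<bar> \<le> \<alpha> * \<bar>u - v\<bar>" by (intro mult_right_mono) auto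
    then show ?thesis by (simp add: \<xi>(3) abs_mult[symmetric] left_diff_distrib)
  qed
  have rem2: "\<bar>h' u * (G u - G v) - h' v * G' v * (u - v)\<bar> \<le> \<alpha> * \<bar>u - v\<bar>" if uv: "u \<in> {a..b}" "v \<in> {a..b}" "\<bar>u - v\<bar> < d" for u v
  proof -
    obtain \<xi> where \<xi>: "\<xi> \<in> {a..b}" "\<bar>\<xi> - v\<bar> \<le> \<bar>u - v\<bar>" "G u - G v = G' \<xi> * (u - v)"
      using mean_value_between[of a b G G', OF G uv(1,2)] by metis
    have "h' u * G' \<xi> - h' v * G' v = (h' u - h' v) * G' \<xi> + h' v * (G' \<xi> - G' v)" by (simp add: algebra_simps)
    also have "\<bar>\<dots>\<bar> \<le> \<bar>h' u - h' v\<bar> * \<bar>G' \<xi>\<bar> + \<bar>h' v\<bar> * \<bar>G' \<xi> - G' v\<bar>"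
      unfolding abs_mult[symmetric] by (rule abs_triangle_ineq)
    also have "\<dots> \<le> \<alpha> / (2 * W) * W + H * (\<alpha> / (2 * H))"
      using d2(2)[of u v] d3(2)[of \<xi> v] H W \<xi> uv \<alpha>
      by (intro add_mono mult_mono) (auto simp: d_def intro: less_imp_le)
    also have "\<dots> = \<alpha>" using H W by simp
    finally have "\<bar>h' u * G' \<xi> - h' v * G' v\<bar> * \<bar>u - v\<bar> \<le> \<alpha> * \<bar>u - v\<bar>" by (intro mult_right_mono) auto
    then show ?thesis by (simp add: \<xi>(3) abs_mult[symmetric] algebra_simps)
  qed
  have "eventually (\<lambda>n. dist (?A n) N < \<epsilon> / 4) sequentially" using info \<epsilon> by (intro tendstoD) auto
  moreover have "eventually (\<lambda>n. dist (?B n) 0 < \<epsilon> / 4) sequentially" using noise' \<epsilon> unfolding e_def by (intro tendstoD) auto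
  moreover have "eventually (\<lambda>n. \<theta> n \<in> interior \<Theta>) sequentially"
    using consistent \<Theta>(2) by (rule topological_tendstoD[OF _ open_interior])
  moreover have "eventually (\<lambda>n. dist (\<theta> n) \<theta>bar < d / R) sequentially" using consistent d R by (intro tendstoD) auto
  moreover have "eventually (\<lambda>n. n \<ge> max n0 1) sequentially" by (rule eventually_ge_at_top)
  ultimately show ?thesis using abs_noise
  proof eventually_elim
    case (elim n)
    define \<Delta> where "\<Delta> = \<theta> n - \<theta>bar"
    have n: "n \<ge> n0" "real n > 0" using elim(5) by auto
    have \<theta>n: "\<theta> n \<in> \<Theta>" by (rule ml(1)[OF n(1)])
    define u v where "u = (\<lambda>k. z k \<bullet> \<theta> n)" and "v = (\<lambda>k. z k \<bullet> \<theta>bar)"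
    have uv: "u k \<in> {a..b}" "v k \<in> {a..b}" for k using z(1)[OF \<theta>n] zbar by (auto simp: u_def v_def)
    have diff: "u k - v k = z k \<bullet> \<Delta>" for k by (simp add: u_def v_def \<Delta>_def inner_diff_right)
    have abs_le: "\<bar>u k - v k\<bar> \<le> R * norm \<Delta>" for k
      unfolding diff by (intro order_trans[OF Cauchy_Schwarz_ineq2] mult_right_mono z(2)) auto
    have small: "\<bar>u k - v k\<bar> < d" for k
    proof -
      have "R * norm \<Delta> < d" using elim(4) R by (simp add: \<Delta>_def dist_norm field_simps)
      then show ?thesis using abs_le[of k] by simp
    qed
    define p where "p = (\<lambda>k. h' (u k) - h' (v k) - h'' (v k) * (u k - v k))"
    define q where "q = (\<lambda>k. h' (u k) * (G (u k) - G (v k)) - h' (v k) * G' (v k) * (u k - v k))"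
    \<comment> \<open>The first summand on the right is the one in the score equation, \<open>p k\<close> and \<open>q k\<close> are Taylor remainders.\<close>
    have eq: "h' (v k) * e k - h' (v k) * G' (v k) * (z k \<bullet> \<Delta>) =
        h' (u k) * (y k - G (u k)) - (p k * e k + h'' (v k) * e k * (z k \<bullet> \<Delta>)) + q k" for k
    proof -
      have ek: "e k = y k - G (v k)" by (simp add: e_def v_def)
      show ?thesis unfolding p_def q_def diff[symmetric] ek by (simp add: algebra_simps)
    qed
    have vec: "score n - real n *\<^sub>R (?A n *v \<Delta>) = (\<Sum>k<n. (q k - p k * e k) *\<^sub>R z k) - real n *\<^sub>R (?B n *v \<Delta>)"
    proof -
      have "score n - real n *\<^sub>R (?A n *v \<Delta>) = (\<Sum>k<n. (h' (v k) * e k - h' (v k) * G' (v k) * (z k \<bullet> \<Delta>)) *\<^sub>R z k)"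
        using n(2) by (simp add: score_def scaleR_matrix_vector_assoc[symmetric] sum_outer_vector v_def sum_subtractf scaleR_left_diff_distrib)
      also have "\<dots> = (\<Sum>k<n. (h' (u k) * (y k - G (u k))) *\<^sub>R z k) + (\<Sum>k<n. (q k - p k * e k) *\<^sub>R z k) - (\<Sum>k<n. (h'' (v k) * e k * (z k \<bullet> \<Delta>)) *\<^sub>R z k)"
        unfolding eq by (simp add: sum_subtractf sum.distrib scaleR_left_diff_distrib scaleR_left_distrib)
      also have "(\<Sum>k<n. (h' (u k) * (y k - G (u k))) *\<^sub>R z k) = 0"
        unfolding u_def by (rule score_equation[OF n(1) elim(3)])
      also have "(\<Sum>k<n. (h'' (v k) * e k * (z k \<bullet> \<Delta>)) *\<^sub>R z k) = real n *\<^sub>R (?B n *v \<Delta>)"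
        using n(2) by (simp add: scaleR_matrix_vector_assoc[symmetric] sum_outer_vector v_def)
      finally show ?thesis by simp
    qed
    have "norm (\<Sum>k<n. (q k - p k * e k) *\<^sub>R z k) \<le> (\<Sum>k<n. \<alpha> * (R * norm \<Delta>) * R * (1 + \<bar>e k\<bar>))"
    proof (rule sum_norm_le)
      fix k
      have "\<bar>q k - p k * e k\<bar> \<le> \<bar>q k\<bar> + \<bar>p k\<bar> * \<bar>e k\<bar>" by (metis abs_mult abs_triangle_ineq4)
      also have "\<dots> \<le> \<alpha> * \<bar>u k - v k\<bar> + \<alpha> * \<bar>u k - v k\<bar> * \<bar>e k\<bar>"
        unfolding p_def q_def by (intro add_mono rem2 mult_right_mono rem1 uv small) auto
      also have "\<dots> = \<alpha> * \<bar>u k - v k\<bar> * (1 + \<bar>e k\<bar>)" by (simp add: algebra_simps)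
      also have "\<dots> \<le> \<alpha> * (R * norm \<Delta>) * (1 + \<bar>e k\<bar>)"
        using abs_le[of k] \<alpha> by (intro mult_right_mono mult_left_mono) auto
      finally have "\<bar>q k - p k * e k\<bar> * norm (z k) \<le> \<alpha> * (R * norm \<Delta>) * (1 + \<bar>e k\<bar>) * R"
        using z(2)[of k] \<alpha> R by (intro mult_mono) auto
      then show "norm ((q k - p k * e k) *\<^sub>R z k) \<le> \<alpha> * (R * norm \<Delta>) * R * (1 + \<bar>e k\<bar>)"
        by (simp only: norm_scaleR mult_ac)
    qed
    also have "\<dots> = \<alpha> * (R * norm \<Delta>) * R * (real n + (\<Sum>k<n. \<bar>e k\<bar>))"
      by (simp add: sum_distrib_left[symmetric] sum.distrib)
    also have "\<dots> \<le> \<alpha> * (R * norm \<Delta>) * R * (real n + C * real n)"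
      using elim(6) \<alpha> R by (intro mult_left_mono add_left_mono) (auto simp: e_def)
    also have "\<dots> = \<alpha> * (R * R * (C + 1)) * (real n * norm \<Delta>)" by (simp add: algebra_simps)
    also have "\<alpha> * (R * R * (C + 1)) = \<epsilon> / 4" using RC R C_nonneg by (simp add: \<alpha>_def)
    finally have 1: "norm (\<Sum>k<n. (q k - p k * e k) *\<^sub>R z k) \<le> \<epsilon> / 4 * (real n * norm \<Delta>)" .
    have mv: "norm (real n *\<^sub>R (X *v \<Delta>)) \<le> \<epsilon> / 4 * (real n * norm \<Delta>)" if "norm X < \<epsilon> / 4" for X :: "real^'p^'p"
    proof -
      have "norm (X *v \<Delta>) \<le> \<epsilon> / 4 * norm \<Delta>"
        using that by (intro order_trans[OF norm_matrix_vector_le] mult_right_mono) auto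
      then have "real n * norm (X *v \<Delta>) \<le> real n * (\<epsilon> / 4 * norm \<Delta>)" by (intro mult_left_mono) auto
      then show ?thesis by (simp add: algebra_simps)
    qed
    have 2: "norm (real n *\<^sub>R (?B n *v \<Delta>)) \<le> \<epsilon> / 4 * (real n * norm \<Delta>)" using elim(2) by (intro mv) (simp add: dist_norm)
    have 3: "norm (real n *\<^sub>R ((?A n - N) *v \<Delta>)) \<le> \<epsilon> / 4 * (real n * norm \<Delta>)" using elim(1) by (intro mv) (simp add: dist_norm)
    have "score n - real n *\<^sub>R (N *v \<Delta>) = (\<Sum>k<n. (q k - p k * e k) *\<^sub>R z k) - real n *\<^sub>R (?B n *v \<Delta>) + real n *\<^sub>R ((?A n - N) *v \<Delta>)"
      unfolding vec[symmetric] matrix_vector_mult_diff_rdistrib scaleR_right_diff_distrib by simp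
    note split = this
    have "norm (score n - real n *\<^sub>R (N *v \<Delta>)) \<le>
        norm (\<Sum>k<n. (q k - p k * e k) *\<^sub>R z k) + norm (real n *\<^sub>R (?B n *v \<Delta>)) + norm (real n *\<^sub>R ((?A n - N) *v \<Delta>))"
      unfolding split by (rule order_trans[OF norm_triangle_ineq add_right_mono[OF norm_triangle_ineq4]])
    also have "\<dots> \<le> 3 * (\<epsilon> / 4 * (real n * norm \<Delta>))" using 1 2 3 by linarith
    also have "\<dots> \<le> \<epsilon> * (real n * norm \<Delta>)" using \<epsilon> by simp
    finally show ?case by (simp add: \<Delta>_def)
  qed
qed

text \<open>Since \<open>N\<close> is nondegenerate, an error relative to \<open>\<theta> n - \<theta>bar\<close> is also one relative to the score.\<close>

theorem asymptotic_linearity: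
  assumes \<epsilon>: "\<epsilon> > 0"
  shows "eventually (\<lambda>n. norm (sqrt (real n) *\<^sub>R (\<theta> n - \<theta>bar) - matrix_inv N *v (score n /\<^sub>R sqrt (real n))) \<le>
    \<epsilon> * norm (score n /\<^sub>R sqrt (real n))) sequentially"
proof -
  obtain l where l: "l > 0" "\<And>v. l * (norm v)\<^sup>2 \<le> v \<bullet> (N *v v)" using pos_def_lower_bound[OF N] by blast
  have lower: "l * norm v \<le> norm (N *v v)" for v
  proof (cases "v = 0")
    case False
    have "l * norm v * norm v \<le> norm v * norm (N *v v)"
      using l(2)[of v] norm_cauchy_schwarz[of v "N *v v"] by (simp add: power2_eq_square mult.assoc)
    then show ?thesis using False by simp
  qed simp
  \<comment> \<open>The first bound gives \<open>norm D \<le> 2 / l * norm W\<close> for the normalised error \<open>D\<close> and score \<open>W\<close>,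
    the second one then the claim.\<close>
  define \<epsilon>' where "\<epsilon>' = min (l / 2) (\<epsilon> * l * l / 2)"
  have \<epsilon>': "\<epsilon>' > 0" "\<epsilon>' \<le> l / 2" "\<epsilon>' \<le> \<epsilon> * l * l / 2" using l(1) \<epsilon> by (auto simp: \<epsilon>'_def)
  from score_expansion[OF \<epsilon>'(1)] eventually_ge_at_top[of 1] show ?thesis
  proof eventually_elim
    case (elim n)
    define D where "D = sqrt (real n) *\<^sub>R (\<theta> n - \<theta>bar)"
    define W where "W = score n /\<^sub>R sqrt (real n)"
    have sn: "sqrt (real n) > 0" using elim(2) by simp
    have "sqrt (real n) * norm (W - N *v D) = norm (score n - real n *\<^sub>R (N *v (\<theta> n - \<theta>bar)))"
    proof -
      have "score n - real n *\<^sub>R (N *v (\<theta> n - \<theta>bar)) = sqrt (real n) *\<^sub>R (W - N *v D)"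
      proof -
        have "N *v D = sqrt (real n) *\<^sub>R (N *v (\<theta> n - \<theta>bar))" unfolding D_def by (rule matrix_vector_mult_scaleR)
        then show ?thesis using sn by (simp add: W_def scaleR_right_diff_distrib)
      qed
      then show ?thesis using sn by simp
    qed
    also have "\<dots> \<le> \<epsilon>' * (real n * norm (\<theta> n - \<theta>bar))" by (rule elim(1))
    also have "\<dots> = sqrt (real n) * (\<epsilon>' * norm D)"
    proof -
      have "real n = sqrt (real n) * sqrt (real n)" by simp
      then show ?thesis using sn by (simp add: D_def mult_ac)
    qed
    finally have 1: "norm (W - N *v D) \<le> \<epsilon>' * norm D" using sn by simp
    have "l * norm D \<le> norm W + \<epsilon>' * norm D"
      using lower[of D] 1 norm_triangle_sub[of "N *v D" W] by (simp add: norm_minus_commute)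
    moreover have "\<epsilon>' * norm D \<le> l / 2 * norm D" using \<epsilon>'(2) by (intro mult_right_mono) auto
    ultimately have 2: "norm D \<le> 2 / l * norm W" using l(1) by (simp add: field_simps)
    have "l * norm (D - matrix_inv N *v W) \<le> norm (N *v (D - matrix_inv N *v W))" by (rule lower)
    also have "\<dots> = norm (W - N *v D)"
      by (simp add: matrix_vector_mult_diff_distrib matrix_inv_vector[OF N] norm_minus_commute)
    also have "\<dots> \<le> \<epsilon>' * (2 / l * norm W)" using 1 2 \<epsilon>'(1) by (meson less_imp_le mult_left_mono order_trans)
    also have "\<dots> \<le> \<epsilon> * l * l / 2 * (2 / l * norm W)" using \<epsilon>'(3) l(1) by (intro mult_right_mono) auto
    also have "\<dots> = l * (\<epsilon> * norm W)" using l(1) by (simp add: field_simps)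
    finally show ?case using l(1) by (simp add: D_def W_def)
  qed
qed

end

section \<open>The adaptive generalized linear model\<close>

lemma info_matrix_empirical:
  assumes n: "n \<ge> 1"
  shows "info_matrix h (empirical_design n x) = (1 / real n) *\<^sub>R (\<Sum>k<n. outer (h (x (Suc k))))"
proof -
  let ?\<xi> = "empirical_design n x"
  have fin: "finite (set_pmf ?\<xi>)" using n by (simp add: empirical_design_def set_pmf_of_set)
  have "info_matrix h ?\<xi> = (LINT y|measure_pmf ?\<xi>. outer (h y))"
    unfolding info_matrix_def by (subst integral_measure_pmf[OF fin]) (auto simp: set_pmf_iff)
  also have "\<dots> = (LINT i|measure_pmf (pmf_of_set {1..n}). outer (h (x i)))"
    unfolding empirical_design_def by (rule integral_map_pmf)
  also have "\<dots> = (\<Sum>i\<in>{1..n}. pmf (pmf_of_set {1..n}) i *\<^sub>R outer (h (x i)))"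
    using n by (intro integral_measure_pmf) (auto simp: set_pmf_of_set)
  also have "\<dots> = (1 / real n) *\<^sub>R (\<Sum>i\<in>{1..n}. outer (h (x i)))"
    using n by (simp add: pmf_of_set scaleR_sum_right)
  also have "(\<Sum>i\<in>{1..n}. outer (h (x i))) = (\<Sum>k<n. outer (h (x (Suc k))))"
    by (simp add: sum.atLeast1_atMost_eq)
  finally show ?thesis .
qed

lemma info_matrix_in_hull:
  assumes "design D \<xi>"
  shows "info_matrix h \<xi> \<in> convex hull (outer ` h ` D)"
  using assms unfolding info_matrix_def design_def
  by (intro convex_sum) (auto intro: hull_inc simp: sum_pmf_eq_1)

lemma measurable_continuous_on_compose:
  assumes "continuous_on S \<phi>" "g \<in> borel_measurable M" "\<And>\<omega>. \<omega> \<in> space M \<Longrightarrow> g \<omega> \<in> S"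
  shows "(\<lambda>\<omega>. \<phi> (g \<omega>)) \<in> borel_measurable M"
  by (rule measurable_compose[OF measurable_restrict_space2[of g M S borel] borel_measurable_continuous_on_restrict])
     (use assms in auto)

lemma borel_measurable_matrix_vector_mult:
  fixes A :: "'w \<Rightarrow> real^'n^'m" and v :: "'w \<Rightarrow> real^'n"
  assumes "A \<in> borel_measurable M" "v \<in> borel_measurable M"
  shows "(\<lambda>\<omega>. A \<omega> *v v \<omega>) \<in> borel_measurable M"
  by (rule borel_measurable_continuous_Pair[OF assms])
     (simp add: matrix_vector_mult_def, intro continuous_intros)

lemma continuous_on_outer: "continuous_on S (outer :: real^'n \<Rightarrow> real^'n^'n)"
  unfolding outer_def by (intro continuous_intros)

lemma continuous_on_matrix_sqrt: "continuous_on {A :: real^'n^'n. pos_def A} matrix_sqrt"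
  unfolding continuous_on_def
  by (auto intro!: tendsto_matrix_sqrt simp: eventually_at_filter)

lemma tight_if_second_moment:
  fixes W :: "nat \<Rightarrow> 'w \<Rightarrow> 'b::{real_normed_vector, second_countable_topology}"
  assumes M: "prob_space M" and W: "\<And>n. W n \<in> borel_measurable M"
    and C: "\<And>n. (\<integral>\<^sup>+\<omega>. ennreal ((norm (W n \<omega>))\<^sup>2) \<partial>M) \<le> ennreal C" and \<epsilon>: "\<epsilon> > 0"
  shows "\<exists>R. eventually (\<lambda>n. measure M {\<omega>\<in>space M. norm (W n \<omega>) > R} \<le> \<epsilon>) sequentially"
proof -
  interpret prob_space M by fact
  note [measurable] = W
  define D where "D = \<bar>C\<bar> + 1"
  have D: "D > 0" "C \<le> D" by (auto simp: D_def)
  define R where "R = sqrt (D / \<epsilon>)"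
  have R: "R > 0" "R\<^sup>2 = D / \<epsilon>" using D \<epsilon> by (auto simp: R_def)
  have "prob {\<omega>\<in>space M. norm (W n \<omega>) > R} \<le> \<epsilon>" for n
  proof -
    have "ennreal (R\<^sup>2) * emeasure M {\<omega>\<in>space M. norm (W n \<omega>) > R} = (\<integral>\<^sup>+\<omega>. ennreal (R\<^sup>2) * indicator {\<omega>\<in>space M. norm (W n \<omega>) > R} \<omega> \<partial>M)"
      by (rule nn_integral_cmult_indicator[symmetric]) measurable
    also have "\<dots> \<le> (\<integral>\<^sup>+\<omega>. ennreal ((norm (W n \<omega>))\<^sup>2) \<partial>M)"
      using R(1) by (intro nn_integral_mono) (auto simp: indicator_def intro!: ennreal_leI power_mono)
    also have "\<dots> \<le> ennreal D" using C[of n] D(2) by (meson ennreal_leI order_trans)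
    finally have "R\<^sup>2 * prob {\<omega>\<in>space M. norm (W n \<omega>) > R} \<le> D"
      using D by (simp add: emeasure_eq_measure ennreal_mult'[symmetric])
    then show ?thesis using D \<epsilon> by (simp add: R(2) field_simps)
  qed
  then show ?thesis by (intro exI[of _ R]) simp
qed

lemma (in prob_space) moments_from_eighth:
  fixes X :: "'a \<Rightarrow> real"
  assumes X [measurable]: "X \<in> borel_measurable M" and int: "integrable M (\<lambda>x. X x ^ 8)"
    and C: "expectation (\<lambda>x. X x ^ 8) + 1 \<le> C" and j: "j \<le> 8"
  shows "integrable M (\<lambda>x. \<bar>X x\<bar> ^ j)" "expectation (\<lambda>x. \<bar>X x\<bar> ^ j) \<le> C"
proof -
  have le: "\<bar>t\<bar> ^ j \<le> 1 + t ^ 8" for t :: real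
    using j by (rule abs_power_le_even_power) simp
  have dom: "integrable M (\<lambda>x. 1 + X x ^ 8)" using int by simp
  show i: "integrable M (\<lambda>x. \<bar>X x\<bar> ^ j)"
    by (rule Bochner_Integration.integrable_bound[OF dom])
       (use le in \<open>auto intro!: order_trans[OF _ abs_ge_self]\<close>)
  have "expectation (\<lambda>x. \<bar>X x\<bar> ^ j) \<le> expectation (\<lambda>x. 1 + X x ^ 8)"
    using i dom le by (intro integral_mono) auto
  then show "expectation (\<lambda>x. \<bar>X x\<bar> ^ j) \<le> C" using int C by (simp add: prob_space)
qed

context glm_link
begin

lemma noise_moments:
  assumes ab: "a \<le> c" "{a..c} \<subseteq> I"
  obtains C where "C \<ge> 1"
    "\<And>u j. u \<in> {a..c} \<Longrightarrow> j \<le> 8 \<Longrightarrow> integrable (expfam \<nu> K b (link u)) (\<lambda>y. \<bar>y - G u\<bar> ^ j)"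
    "\<And>u j. u \<in> {a..c} \<Longrightarrow> j \<le> 8 \<Longrightarrow> (\<integral>y. \<bar>y - G u\<bar> ^ j \<partial>expfam \<nu> K b (link u)) \<le> C"
    "\<And>u. u \<in> {a..c} \<Longrightarrow> (\<integral>y. y - G u \<partial>expfam \<nu> K b (link u)) = 0"
    "\<And>u. u \<in> {a..c} \<Longrightarrow> (\<integral>y. (y - G u)\<^sup>2 \<partial>expfam \<nu> K b (link u)) = deriv (deriv b) (link u)"
proof -
  have lc: "continuous_on {a..c} link" using continuous_on_link(1) ab(2) by (rule continuous_on_subset)
  obtain p where p: "p \<in> {a..c}" "\<And>u. u \<in> {a..c} \<Longrightarrow> link p \<le> link u"
    using continuous_attains_inf[OF compact_Icc _ lc] ab(1) by auto
  obtain q where q: "q \<in> {a..c}" "\<And>u. u \<in> {a..c} \<Longrightarrow> link u \<le> link q"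
    using continuous_attains_sup[OF compact_Icc _ lc] ab(1) by auto
  have J: "link p \<in> J" "link q \<in> J" using p(1) q(1) ab(2) link(1) by auto
  obtain C0 where C0: "C0 \<ge> 0" "\<And>\<tau>. link p \<le> \<tau> \<Longrightarrow> \<tau> \<le> link q \<Longrightarrow> integrable (expfam \<nu> K b \<tau>) (\<lambda>y. (y - deriv b \<tau>) ^ 8)"
    "\<And>\<tau>. link p \<le> \<tau> \<Longrightarrow> \<tau> \<le> link q \<Longrightarrow> (\<integral>y. (y - deriv b \<tau>) ^ 8 \<partial>expfam \<nu> K b \<tau>) \<le> C0"
    using uniform_moments[OF J p(2)[OF q(1)]] by blast
  have uI: "u \<in> I" if "u \<in> {a..c}" for u using that ab(2) by blast
  have P: "prob_space (expfam \<nu> K b (link u))" if "u \<in> {a..c}" for u by (rule prob[OF link(1)[OF uI[OF that]]])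
  have meas: "(\<lambda>y. y - G u) \<in> borel_measurable (expfam \<nu> K b (link u))" for u
    by (simp cong: measurable_cong_sets)
  have 8: "integrable (expfam \<nu> K b (link u)) (\<lambda>y. (y - G u) ^ 8)" "(\<integral>y. (y - G u) ^ 8 \<partial>expfam \<nu> K b (link u)) + 1 \<le> C0 + 1"
    if "u \<in> {a..c}" for u
    using C0(2,3)[OF p(2)[OF that] q(2)[OF that]] link(2)[OF uI[OF that]] by auto
  note mom = prob_space.moments_from_eighth[OF P meas 8]
  show thesis
  proof (rule that[of "C0 + 1"])
    show "C0 + 1 \<ge> 1" using C0(1) by simp
    show "integrable (expfam \<nu> K b (link u)) (\<lambda>y. \<bar>y - G u\<bar> ^ j)" if "u \<in> {a..c}" "j \<le> 8" for u j
      by (rule mom(1)[OF that(1) that(1) that(1) that(2)])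
    show "(\<integral>y. \<bar>y - G u\<bar> ^ j \<partial>expfam \<nu> K b (link u)) \<le> C0 + 1" if "u \<in> {a..c}" "j \<le> 8" for u j
      by (rule mom(2)[OF that(1) that(1) that(1) that(2)])
    fix u assume u: "u \<in> {a..c}"
    interpret P: prob_space "expfam \<nu> K b (link u)" by (rule P[OF u])
    have "integrable (expfam \<nu> K b (link u)) (\<lambda>y. \<bar>y - G u\<bar>)" using mom(1)[OF u u u, of 1] by simp
    then have "integrable (expfam \<nu> K b (link u)) (\<lambda>y. y - G u)"
      using meas[of u] by (rule integrable_abs_cancel)
    from Bochner_Integration.integrable_add[OF this, of "\<lambda>_. G u"]
    have "integrable (expfam \<nu> K b (link u)) (\<lambda>y. y)" by simp
    then show "(\<integral>y. y - G u \<partial>expfam \<nu> K b (link u)) = 0"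
      using mean[OF link(1)[OF uI[OF u]]] link(2)[OF uI[OF u]] by (simp add: P.prob_space)
    show "(\<integral>y. (y - G u)\<^sup>2 \<partial>expfam \<nu> K b (link u)) = deriv (deriv b) (link u)"
      using var[OF link(1)[OF uI[OF u]]] link(2)[OF uI[OF u]] by simp
  qed
qed

end

text \<open>The part of the model that does not depend on how the design points and the estimators are chosen.\<close>

locale adaptive_glm = glm_link \<nu> K b J G I
  for \<nu> :: "real measure" and K b :: "real \<Rightarrow> real" and J :: "real set" and G :: "real \<Rightarrow> real" and I :: "real set" +
  fixes \<X> :: "'x::metric_space set" and \<Theta> :: "(real^'p) set" and \<theta>bar :: "real^'p" and f :: "'x \<Rightarrow> real^'p"
    and M :: "'w measure" and F :: "nat \<Rightarrow> 'w measure" and X :: "nat \<Rightarrow> 'w \<Rightarrow> 'x" and Y :: "nat \<Rightarrow> 'w \<Rightarrow> real"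
  assumes \<X>: "compact \<X>" "\<X> \<noteq> {}" and \<Theta>: "compact \<Theta>" "\<theta>bar \<in> interior \<Theta>"
    and f: "continuous_on \<X> f" and I: "is_interval I" "\<And>x \<theta>. x \<in> \<X> \<Longrightarrow> \<theta> \<in> \<Theta> \<Longrightarrow> f x \<bullet> \<theta> \<in> I"
    and M: "prob_space M" and filt: "filtration (space M) F" "\<And>i. subalgebra M (F i)"
    and X: "\<And>i. i \<ge> 1 \<Longrightarrow> X i \<in> F (i - 1) \<rightarrow>\<^sub>M restrict_space borel \<X>"
    and Y: "\<And>i. i \<ge> 1 \<Longrightarrow> Y i \<in> F i \<rightarrow>\<^sub>M borel"
    and cond: "\<And>i. i \<ge> 1 \<Longrightarrow> is_cond_distribution M (F (i - 1)) (Y i)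
                        (\<lambda>\<omega>. expfam \<nu> K b (glm_tau b J G f \<theta>bar (X i \<omega>)))"
begin

lemma \<theta>bar_mem: "\<theta>bar \<in> \<Theta>" using \<Theta>(2) interior_subset by blast

sublocale adapted_sequence M F "\<lambda>k. Y (Suc k)" "\<lambda>k \<omega>. expfam \<nu> K b (link (f (X (Suc k) \<omega>) \<bullet> \<theta>bar))"
proof (rule adapted_sequence.intro)
  show "prob_space M" by (rule M)
  show "subalgebra M (F k)" for k by (rule filt)
  show "sets (F j) \<subseteq> sets (F k)" if "j \<le> k" for j k using filtration.sets_F_mono[OF filt(1) that] .
  show "Y (Suc k) \<in> borel_measurable (F (Suc k))" for k by (rule Y) simp
  show "is_cond_distribution M (F k) (Y (Suc k)) (\<lambda>\<omega>. expfam \<nu> K b (link (f (X (Suc k) \<omega>) \<bullet> \<theta>bar)))" for k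
    using cond[of "Suc k"] by (simp add: glm_tau_def link_def)
qed

lemma X_mem: "\<omega> \<in> space M \<Longrightarrow> X (Suc k) \<omega> \<in> \<X>"
  using measurable_space[OF X[of "Suc k"], of \<omega>] space_F[of k] by (auto simp: space_restrict_space)

lemma X_meas: "continuous_on \<X> c \<Longrightarrow> (\<lambda>\<omega>. c (X (Suc k) \<omega>)) \<in> borel_measurable (F k)"
  by (rule measurable_compose[OF _ borel_measurable_continuous_on_restrict])
     (use X[of "Suc k"] in auto)

lemma linear_predictor_interval:
  obtains l r where "l \<le> r" "{l..r} \<subseteq> I" "\<And>x \<theta>. x \<in> \<X> \<Longrightarrow> \<theta> \<in> \<Theta> \<Longrightarrow> f x \<bullet> \<theta> \<in> {l..r}"
proof -
  define U where "U = (\<lambda>(x, \<theta>). f x \<bullet> \<theta>) ` (\<X> \<times> \<Theta>)"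
  have "continuous_on (\<X> \<times> \<Theta>) (\<lambda>(x, \<theta>). f x \<bullet> \<theta>)"
  proof -
    have "continuous_on (\<X> \<times> \<Theta>) (\<lambda>p. f (fst p))"
      by (rule continuous_on_compose2[OF f]) (auto intro!: continuous_intros)
    from continuous_on_inner[OF this continuous_on_snd[OF continuous_on_id]]
    show ?thesis by (simp add: split_beta)
  qed
  then have "compact U" unfolding U_def by (intro compact_continuous_image compact_Times \<X> \<Theta>)
  moreover have "U \<noteq> {}" using \<X>(2) \<theta>bar_mem by (auto simp: U_def)
  ultimately have cU: "compact U" "U \<noteq> {}" .
  obtain l where l: "l \<in> U" "\<And>u. u \<in> U \<Longrightarrow> l \<le> u" using compact_attains_inf[OF cU] by blast
  obtain r where r: "r \<in> U" "\<And>u. u \<in> U \<Longrightarrow> u \<le> r" using compact_attains_sup[OF cU] by blast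
  have "U \<subseteq> I" using I(2) by (auto simp: U_def)
  then have lr: "l \<in> I" "r \<in> I" using l(1) r(1) by blast+
  have "{l..r} \<subseteq> I"
  proof
    fix u assume "u \<in> {l..r}"
    then have "l \<le> u" "u \<le> r" by simp_all
    then show "u \<in> I" using I(1) lr unfolding is_interval_1 by blast
  qed
  moreover have "f x \<bullet> \<theta> \<in> {l..r}" if "x \<in> \<X>" "\<theta> \<in> \<Theta>" for x \<theta>
    using l(2) r(2) that by (force simp: U_def)
  ultimately show thesis using l r by (intro that[of l r]) auto
qed

text \<open>The end points of a compact interval inside \<open>I\<close> that contains all linear predictors. All bounds on the
  functions of the predictor are taken over this interval.\<close>

definition "lo = (SOME l. \<exists>r. l \<le> r \<and> {l..r} \<subseteq> I \<and> (\<forall>x\<in>\<X>. \<forall>\<theta>\<in>\<Theta>. f x \<bullet> \<theta> \<in> {l..r}))"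
definition "hi = (SOME r. lo \<le> r \<and> {lo..r} \<subseteq> I \<and> (\<forall>x\<in>\<X>. \<forall>\<theta>\<in>\<Theta>. f x \<bullet> \<theta> \<in> {lo..r}))"

lemma lo_hi: "lo \<le> hi" "{lo..hi} \<subseteq> I" "x \<in> \<X> \<Longrightarrow> \<theta> \<in> \<Theta> \<Longrightarrow> f x \<bullet> \<theta> \<in> {lo..hi}"
proof -
  have "\<exists>l r. l \<le> r \<and> {l..r} \<subseteq> I \<and> (\<forall>x\<in>\<X>. \<forall>\<theta>\<in>\<Theta>. f x \<bullet> \<theta> \<in> {l..r})"
    using linear_predictor_interval by metis
  from someI_ex[OF this, folded lo_def] have "\<exists>r. lo \<le> r \<and> {lo..r} \<subseteq> I \<and> (\<forall>x\<in>\<X>. \<forall>\<theta>\<in>\<Theta>. f x \<bullet> \<theta> \<in> {lo..r})" .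
  from someI_ex[OF this, folded hi_def]
  show "lo \<le> hi" "{lo..hi} \<subseteq> I" "x \<in> \<X> \<Longrightarrow> \<theta> \<in> \<Theta> \<Longrightarrow> f x \<bullet> \<theta> \<in> {lo..hi}" by auto
qed

text \<open>The index is shifted, so that \<open>Z k\<close> is known at time \<open>k\<close>, and \<open>noise k\<close> is revealed after it.\<close>

definition Z :: "nat \<Rightarrow> 'w \<Rightarrow> real^'p" where "Z k \<omega> = f (X (Suc k) \<omega>)"

definition noise :: "nat \<Rightarrow> 'w \<Rightarrow> real" where "noise k \<omega> = Y (Suc k) \<omega> - G (Z k \<omega> \<bullet> \<theta>bar)"

lemma Z_interval: "\<omega> \<in> space M \<Longrightarrow> \<theta> \<in> \<Theta> \<Longrightarrow> Z k \<omega> \<bullet> \<theta> \<in> {lo..hi}"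
  unfolding Z_def by (intro lo_hi X_mem)

lemma f_bound: obtains R where "R > 0" "\<And>x. x \<in> \<X> \<Longrightarrow> norm (f x) \<le> R"
proof -
  have "bounded (f ` \<X>)" using f \<X>(1) by (intro compact_imp_bounded compact_continuous_image)
  then obtain B where "\<forall>y\<in>f ` \<X>. norm y \<le> B" unfolding bounded_iff by blast
  then show thesis by (intro that[of "max B 1"]) (auto intro: max.coboundedI1)
qed

lemma continuous_on_predictor: "continuous_on {lo..hi} g \<Longrightarrow> \<theta> \<in> \<Theta> \<Longrightarrow> continuous_on \<X> (\<lambda>x. g (f x \<bullet> \<theta>))"
  by (rule continuous_on_compose2[of "{lo..hi}" g]) (auto intro!: continuous_intros f lo_hi(3) simp del: atLeastAtMost_iff)

lemma G_cont: "continuous_on {lo..hi} G"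
  by (rule DERIV_continuous_on, rule has_field_derivative_at_within, rule C1_has_derivative(1)[OF G(1)])
     (use lo_hi(2) in blast)

lemma continuous_bound:
  assumes "continuous_on \<X> (c :: 'x \<Rightarrow> real)"
  obtains B where "B \<ge> 1" "\<And>x. x \<in> \<X> \<Longrightarrow> \<bar>c x\<bar> \<le> B"
proof -
  have "bounded (c ` \<X>)" using assms \<X>(1) by (intro compact_imp_bounded compact_continuous_image)
  then obtain B where "\<forall>y\<in>c ` \<X>. norm y \<le> B" unfolding bounded_iff by blast
  then show thesis by (intro that[of "max B 1"]) (auto intro: max.coboundedI1)
qed

lemma weighted_noise_measurable:
  assumes c: "continuous_on \<X> c"
  shows "(\<lambda>(\<omega>, y). c (X (Suc k) \<omega>) * (y - G (f (X (Suc k) \<omega>) \<bullet> \<theta>bar))) \<in> borel_measurable (F k \<Otimes>\<^sub>M borel)"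
proof -
  note [measurable] = X_meas[OF c] X_meas[OF continuous_on_predictor[OF G_cont \<theta>bar_mem]]
  show ?thesis unfolding split_beta by measurable
qed

lemma noise_lln:
  assumes c: "continuous_on \<X> c"
  shows "AE \<omega> in M. (\<lambda>n. (\<Sum>k<n. c (X (Suc k) \<omega>) * noise k \<omega>) / real n) \<longlonglongrightarrow> 0"
proof -
  obtain C where C: "C \<ge> 1"
    "\<And>u j. u \<in> {lo..hi} \<Longrightarrow> j \<le> 8 \<Longrightarrow> integrable (expfam \<nu> K b (link u)) (\<lambda>y. \<bar>y - G u\<bar> ^ j)"
    "\<And>u j. u \<in> {lo..hi} \<Longrightarrow> j \<le> 8 \<Longrightarrow> (\<integral>y. \<bar>y - G u\<bar> ^ j \<partial>expfam \<nu> K b (link u)) \<le> C"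
    "\<And>u. u \<in> {lo..hi} \<Longrightarrow> (\<integral>y. y - G u \<partial>expfam \<nu> K b (link u)) = 0"
    using noise_moments[OF lo_hi(1,2)] by metis
  obtain B where B: "B \<ge> 1" "\<And>x. x \<in> \<X> \<Longrightarrow> \<bar>c x\<bar> \<le> B" using continuous_bound[OF c] by blast
  let ?g = "\<lambda>k \<omega> y. c (X (Suc k) \<omega>) * (y - G (f (X (Suc k) \<omega>) \<bullet> \<theta>bar))"
  have "AE \<omega> in M. (\<lambda>n. (\<Sum>k<n. ?g k \<omega> (Y (Suc k) \<omega>)) / real n) \<longlonglongrightarrow> 0"
  proof (rule martingale_slln[where C="B ^ 4 * C"])
    show "(\<lambda>(\<omega>, y). ?g k \<omega> y) \<in> borel_measurable (F k \<Otimes>\<^sub>M borel)" for k by (rule weighted_noise_measurable[OF c])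
    fix k \<omega> assume \<omega>: "\<omega> \<in> space M"
    have u: "f (X (Suc k) \<omega>) \<bullet> \<theta>bar \<in> {lo..hi}" using Z_interval[OF \<omega> \<theta>bar_mem] by (simp add: Z_def)
    have p4: "(y - G u) ^ 4 = \<bar>y - G u\<bar> ^ 4" for y u by (simp add: power_even_abs)
    show "integrable (expfam \<nu> K b (link (f (X (Suc k) \<omega>) \<bullet> \<theta>bar))) (\<lambda>y. ?g k \<omega> y ^ 4)"
      unfolding power_mult_distrib p4 using C(2)[OF u, of 4] by simp
    show "(\<integral>y. ?g k \<omega> y \<partial>expfam \<nu> K b (link (f (X (Suc k) \<omega>) \<bullet> \<theta>bar))) = 0"
      by (simp add: C(4)[OF u])
    have "c (X (Suc k) \<omega>) ^ 4 \<le> B ^ 4"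
      using power_mono[OF B(2)[OF X_mem[OF \<omega>, of k]], of 4] by (simp add: power_even_abs)
    then have "c (X (Suc k) \<omega>) ^ 4 * (\<integral>y. \<bar>y - G (f (X (Suc k) \<omega>) \<bullet> \<theta>bar)\<bar> ^ 4 \<partial>expfam \<nu> K b (link (f (X (Suc k) \<omega>) \<bullet> \<theta>bar))) \<le> B ^ 4 * C"
      using C(3)[OF u, of 4] by (intro mult_mono) (auto intro: integral_nonneg_AE)
    then show "(\<integral>y. ?g k \<omega> y ^ 4 \<partial>expfam \<nu> K b (link (f (X (Suc k) \<omega>) \<bullet> \<theta>bar))) \<le> B ^ 4 * C"
      unfolding power_mult_distrib p4 by simp
  qed
  then show ?thesis by (simp add: noise_def Z_def)
qed

text \<open>Because of \<open>\<bar>t\<bar> \<le> 1 + t\<^sup>2\<close> it suffices to consider the squared noise. Its deviation from the bounded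
  conditional variance obeys the law of large numbers, its fourth moments being eighth moments of the noise.\<close>

lemma abs_noise_bounded:
  obtains C where "AE \<omega> in M. eventually (\<lambda>n. (\<Sum>k<n. \<bar>noise k \<omega>\<bar>) \<le> C * real n) sequentially"
proof -
  obtain C where C: "C \<ge> 1"
    "\<And>u j. u \<in> {lo..hi} \<Longrightarrow> j \<le> 8 \<Longrightarrow> integrable (expfam \<nu> K b (link u)) (\<lambda>y. \<bar>y - G u\<bar> ^ j)"
    "\<And>u j. u \<in> {lo..hi} \<Longrightarrow> j \<le> 8 \<Longrightarrow> (\<integral>y. \<bar>y - G u\<bar> ^ j \<partial>expfam \<nu> K b (link u)) \<le> C"
    "\<And>u. u \<in> {lo..hi} \<Longrightarrow> (\<integral>y. y - G u \<partial>expfam \<nu> K b (link u)) = 0"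
    "\<And>u. u \<in> {lo..hi} \<Longrightarrow> (\<integral>y. (y - G u)\<^sup>2 \<partial>expfam \<nu> K b (link u)) = deriv (deriv b) (link u)"
    using noise_moments[OF lo_hi(1,2)] by metis
  define s where "s = (\<lambda>u. deriv (deriv b) (link u))"
  have s: "0 \<le> s u" "s u \<le> C" if "u \<in> {lo..hi}" for u
  proof -
    have "u \<in> I" using that lo_hi(2) by blast
    then show "0 \<le> s u" using var_pos[OF link(1), of u] by (simp add: s_def less_imp_le)
    show "s u \<le> C" using C(3)[OF that, of 2] C(5)[OF that] by (simp add: s_def)
  qed
  have sc: "continuous_on {lo..hi} s"
  proof -
    have "continuous_on {lo..hi} (\<lambda>u. (deriv ^^ 2) b (link u))"
      using link(1) lo_hi(2)
      by (intro continuous_on_compose2[OF continuous_on_deriv_b continuous_on_subset[OF continuous_on_link(1) lo_hi(2)]]) auto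
    then show ?thesis by (simp add: s_def numeral_2_eq_2)
  qed
  let ?u = "\<lambda>k \<omega>. f (X (Suc k) \<omega>) \<bullet> \<theta>bar"
  let ?g = "\<lambda>k \<omega> y. (y - G (?u k \<omega>))\<^sup>2 - s (?u k \<omega>)"
  have ae: "AE \<omega> in M. (\<lambda>n. (\<Sum>k<n. ?g k \<omega> (Y (Suc k) \<omega>)) / real n) \<longlonglongrightarrow> 0"
  proof (rule martingale_slln[where C="8 * C + 8 * C ^ 4"])
    show "(\<lambda>(\<omega>, y). ?g k \<omega> y) \<in> borel_measurable (F k \<Otimes>\<^sub>M borel)" for k
    proof -
      note [measurable] = X_meas[OF continuous_on_predictor[OF sc \<theta>bar_mem]] X_meas[OF continuous_on_predictor[OF G_cont \<theta>bar_mem]]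
      show ?thesis unfolding split_beta by measurable
    qed
    fix k \<omega> assume \<omega>: "\<omega> \<in> space M"
    have u: "?u k \<omega> \<in> {lo..hi}" using Z_interval[OF \<omega> \<theta>bar_mem] by (simp add: Z_def)
    let ?P = "expfam \<nu> K b (link (?u k \<omega>))"
    interpret P: prob_space ?P using \<omega> by (rule kernel(1))
    have sq: "\<bar>t\<bar>\<^sup>2 = t\<^sup>2" "\<bar>t\<bar> ^ 8 = t ^ 8" for t :: real by (simp_all add: power_even_abs)
    have i2: "integrable ?P (\<lambda>y. (y - G (?u k \<omega>))\<^sup>2)" using C(2)[OF u, of 2] by simp
    have i8: "integrable ?P (\<lambda>y. (y - G (?u k \<omega>)) ^ 8)" using C(2)[OF u, of 8] by (simp add: sq)
    show "(\<integral>y. ?g k \<omega> y \<partial>?P) = 0"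
      using i2 C(5)[OF u] by (simp add: P.prob_space s_def)
    have pt: "?g k \<omega> y ^ 4 \<le> 8 * (y - G (?u k \<omega>)) ^ 8 + 8 * C ^ 4" for y
    proof -
      have "(p - q) ^ 4 \<le> 8 * p ^ 4 + 8 * q ^ 4" for p q :: real
      proof -
        have "(p - q)\<^sup>2 \<le> 2 * p\<^sup>2 + 2 * q\<^sup>2" using zero_le_power2[of "p + q"] by (simp add: power2_sum power2_diff)
        then have "((p - q)\<^sup>2)\<^sup>2 \<le> (2 * p\<^sup>2 + 2 * q\<^sup>2)\<^sup>2" by (intro power_mono) auto
        also have "\<dots> \<le> 8 * (p\<^sup>2)\<^sup>2 + 8 * (q\<^sup>2)\<^sup>2"
          using zero_le_power2[of "p\<^sup>2 - q\<^sup>2"] by (simp add: power2_sum power2_diff power_mult_distrib)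
        finally show ?thesis by (simp flip: power_mult)
      qed
      from this[of "(y - G (?u k \<omega>))\<^sup>2" "s (?u k \<omega>)"]
      have "?g k \<omega> y ^ 4 \<le> 8 * (y - G (?u k \<omega>)) ^ 8 + 8 * s (?u k \<omega>) ^ 4" by (simp flip: power_mult)
      moreover have "s (?u k \<omega>) ^ 4 \<le> C ^ 4" using s[OF u] by (intro power_mono)
      ultimately show ?thesis by linarith
    qed
    have dom: "integrable ?P (\<lambda>y. 8 * (y - G (?u k \<omega>)) ^ 8 + 8 * C ^ 4)" using i8 by simp
    have gm: "(\<lambda>y. ?g k \<omega> y ^ 4) \<in> borel_measurable ?P" by (simp cong: measurable_cong_sets)
    show i4: "integrable ?P (\<lambda>y. ?g k \<omega> y ^ 4)"
      using gm pt by (intro Bochner_Integration.integrable_bound[OF dom]) (auto intro!: order_trans[OF _ abs_ge_self])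
    have "(\<integral>y. ?g k \<omega> y ^ 4 \<partial>?P) \<le> (\<integral>y. 8 * (y - G (?u k \<omega>)) ^ 8 + 8 * C ^ 4 \<partial>?P)"
      by (intro integral_mono i4 dom pt)
    also have "\<dots> \<le> 8 * C + 8 * C ^ 4"
      using i8 C(3)[OF u, of 8] by (simp add: P.prob_space sq)
    finally show "(\<integral>y. ?g k \<omega> y ^ 4 \<partial>?P) \<le> 8 * C + 8 * C ^ 4" .
  qed
  have "AE \<omega> in M. eventually (\<lambda>n. (\<Sum>k<n. \<bar>noise k \<omega>\<bar>) \<le> (C + 2) * real n) sequentially"
    using ae AE_space
  proof eventually_elim
    case (elim \<omega>)
    have "eventually (\<lambda>n. (\<Sum>k<n. ?g k \<omega> (Y (Suc k) \<omega>)) / real n < 1) sequentially"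
      using elim(1) by (rule order_tendstoD) simp
    with eventually_ge_at_top[of 1] show ?case
    proof eventually_elim
      case (elim n)
      have "(\<Sum>k<n. \<bar>noise k \<omega>\<bar>) \<le> (\<Sum>k<n. (1 + C) + ?g k \<omega> (Y (Suc k) \<omega>))"
      proof (rule sum_mono)
        fix k
        have "\<bar>t\<bar> \<le> 1 + t\<^sup>2" for t :: real
          using zero_le_power2[of "\<bar>t\<bar> - 1 / 2"] by (simp add: power2_diff power_divide)
        from this[of "noise k \<omega>"] show "\<bar>noise k \<omega>\<bar> \<le> (1 + C) + ?g k \<omega> (Y (Suc k) \<omega>)"
          using s(2)[of "?u k \<omega>"] Z_interval[OF \<open>\<omega> \<in> space M\<close> \<theta>bar_mem, of k] by (simp add: noise_def Z_def)
      qed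
      also have "\<dots> = real n * (1 + C) + (\<Sum>k<n. ?g k \<omega> (Y (Suc k) \<omega>))" by (simp add: sum.distrib)
      also have "\<dots> \<le> real n * (1 + C) + real n" using elim by (simp add: field_simps)
      finally show ?case by (simp add: algebra_simps)
    qed
  qed
  then show thesis by (rule that)
qed

text \<open>Each conditional distribution gives probability \<open>0\<close> to the zeros of \<open>K\<close>. Thus the maximum likelihood property
  of the estimators, which presupposes positivity, is available for almost every path.\<close>

lemma AE_K_pos: "AE \<omega> in M. \<forall>i\<ge>1. K (Y i \<omega>) > 0"
proof -
  have "AE \<omega> in M. K (Y (Suc k) \<omega>) > 0" for k
  proof -
    have H: "(\<lambda>(\<omega>, y). indicator {y. K y \<le> 0} y :: ennreal) \<in> borel_measurable (F k \<Otimes>\<^sub>M borel)"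
      by measurable
    have "(\<integral>\<^sup>+\<omega>. indicator {y. K y \<le> 0} (Y (Suc k) \<omega>) \<partial>M) =
        (\<integral>\<^sup>+\<omega>. \<integral>\<^sup>+y. indicator {y. K y \<le> 0} y \<partial>expfam \<nu> K b (link (f (X (Suc k) \<omega>) \<bullet> \<theta>bar)) \<partial>M)"
      by (rule nn_integral_disintegrate[OF M sub Y_M adapted_sequence.cond[OF adapted_sequence_axioms] H])
    also have "\<dots> = (\<integral>\<^sup>+\<omega>. 0 \<partial>M)"
    proof (rule nn_integral_cong)
      fix \<omega> assume \<omega>: "\<omega> \<in> space M"
      let ?P = "expfam \<nu> K b (link (f (X (Suc k) \<omega>) \<bullet> \<theta>bar))"
      interpret P: prob_space ?P using \<omega> by (rule kernel(1))
      have "link (f (X (Suc k) \<omega>) \<bullet> \<theta>bar) \<in> J" using I(2) X_mem[OF \<omega>] \<theta>bar_mem by (intro link) auto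
      then have "emeasure ?P {y. K y \<le> 0} = 0" by (simp add: P.emeasure_eq_measure measure_K_pos)
      moreover have "{y. K y \<le> 0} \<in> sets ?P" by simp
      ultimately show "(\<integral>\<^sup>+y. indicator {y. K y \<le> 0} y \<partial>?P) = 0" by (simp add: nn_integral_indicator)
    qed
    finally have z: "(\<integral>\<^sup>+\<omega>. indicator {y. K y \<le> 0} (Y (Suc k) \<omega>) \<partial>M) = 0" by simp
    have "(\<lambda>\<omega>. indicator {y. K y \<le> 0} (Y (Suc k) \<omega>) :: ennreal) \<in> borel_measurable M"
      using Y_M[of k] by measurable
    from nn_integral_0_iff_AE[OF this] z
    have "AE \<omega> in M. indicator {y. K y \<le> 0} (Y (Suc k) \<omega>) = (0 :: ennreal)" by simp
    then show ?thesis by eventually_elim (auto simp: indicator_def split: if_splits)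
  qed
  then have "AE \<omega> in M. \<forall>k. K (Y (Suc k) \<omega>) > 0" by (simp add: AE_all_countable)
  then show ?thesis by eventually_elim (metis Suc_le_D One_nat_def)
qed

end

section \<open>Adaptive Wynn designs and the normalised score\<close>

locale wynn_ml = adaptive_glm \<nu> K b J G I \<X> \<Theta> \<theta>bar f M F X Y
  for \<nu> :: "real measure" and K b :: "real \<Rightarrow> real" and J :: "real set" and G :: "real \<Rightarrow> real" and I :: "real set"
    and \<X> :: "'x::metric_space set" and \<Theta> :: "(real^'p) set" and \<theta>bar :: "real^'p" and f :: "'x \<Rightarrow> real^'p"
    and M :: "'w measure" and F :: "nat \<Rightarrow> 'w measure" and X :: "nat \<Rightarrow> 'w \<Rightarrow> 'x" and Y :: "nat \<Rightarrow> 'w \<Rightarrow> real" +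
  fixes n_st :: nat and \<theta>hat \<theta>mle :: "nat \<Rightarrow> 'w \<Rightarrow> real^'p"
  assumes n_st: "n_st \<ge> 1"
    and start: "\<And>\<omega> \<theta>. \<omega> \<in> space M \<Longrightarrow> \<theta> \<in> \<Theta> \<Longrightarrow>
         pos_def (info_matrix (f_theta b J G f \<theta>) (empirical_design n_st (\<lambda>i. X i \<omega>)))"
    and \<theta>hat: "\<And>n \<omega>. n \<ge> n_st \<Longrightarrow> \<omega> \<in> space M \<Longrightarrow> \<theta>hat n \<omega> \<in> \<Theta>"
    and wynn: "\<And>n \<omega> x. n \<ge> n_st \<Longrightarrow> \<omega> \<in> space M \<Longrightarrow> x \<in> \<X> \<Longrightarrow>
        f_theta b J G f (\<theta>hat n \<omega>) x \<bullet> (matrix_inv (info_matrix (f_theta b J G f (\<theta>hat n \<omega>)) (empirical_design n (\<lambda>i. X i \<omega>)))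
                     *v f_theta b J G f (\<theta>hat n \<omega>) x) \<le>
        f_theta b J G f (\<theta>hat n \<omega>) (X (Suc n) \<omega>) \<bullet> (matrix_inv (info_matrix (f_theta b J G f (\<theta>hat n \<omega>)) (empirical_design n (\<lambda>i. X i \<omega>)))
                     *v f_theta b J G f (\<theta>hat n \<omega>) (X (Suc n) \<omega>))"
    and \<theta>mle: "\<And>n \<omega>. n \<ge> n_st \<Longrightarrow> \<omega> \<in> space M \<Longrightarrow> \<theta>mle n \<omega> \<in> \<Theta>"
    and \<theta>mle_meas: "\<And>n. n \<ge> n_st \<Longrightarrow> \<theta>mle n \<in> M \<rightarrow>\<^sub>M borel"
    and ml: "\<And>n \<omega> \<theta>. n \<ge> n_st \<Longrightarrow> \<omega> \<in> space M \<Longrightarrow> (\<And>i. i \<in> {1..n} \<Longrightarrow> K (Y i \<omega>) > 0) \<Longrightarrow> \<theta> \<in> \<Theta> \<Longrightarrow>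
         log_likelihood K b J G f n (\<lambda>i. X i \<omega>) (\<lambda>i. Y i \<omega>) \<theta> \<le> log_likelihood K b J G f n (\<lambda>i. X i \<omega>) (\<lambda>i. Y i \<omega>) (\<theta>mle n \<omega>)"
    and consistent: "AE \<omega> in M. (\<lambda>n. \<theta>hat n \<omega>) \<longlonglongrightarrow> \<theta>bar"
begin

abbreviation \<phi> :: "real \<Rightarrow> real" where "\<phi> \<equiv> glm_phi b J G"

definition info :: "nat \<Rightarrow> real^'p \<Rightarrow> 'w \<Rightarrow> real^'p^'p" where
  "info n \<theta> \<omega> = info_matrix (f_theta b J G f \<theta>) (empirical_design n (\<lambda>i. X i \<omega>))"

lemma info_eq: "n \<ge> 1 \<Longrightarrow> info n \<theta> \<omega> = (1 / real n) *\<^sub>R (\<Sum>k<n. (\<phi> (Z k \<omega> \<bullet> \<theta>))\<^sup>2 *\<^sub>R outer (Z k \<omega>))"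
  by (simp add: info_def info_matrix_empirical f_theta_def outer_scaleR Z_def)

lemma \<phi>_cont: "continuous_on {lo..hi} \<phi>"
  using continuous_on_glm_phi lo_hi(2) by (rule continuous_on_subset)

lemma \<phi>_pos: "u \<in> {lo..hi} \<Longrightarrow> \<phi> u > 0"
  using glm_phi_pos lo_hi(2) by blast

lemma info_pos_def:
  assumes n: "n \<ge> n_st" and \<omega>: "\<omega> \<in> space M" and \<theta>: "\<theta> \<in> \<Theta>"
  shows "pos_def (info n \<theta> \<omega>)"
proof -
  define A where "A = (\<lambda>n. \<Sum>k<n. (\<phi> (Z k \<omega> \<bullet> \<theta>))\<^sup>2 *\<^sub>R outer (Z k \<omega>))"
  have "pos_def (A n)"
    using n
  proof (induction n rule: dec_induct)
    case base
    have "A n_st = real n_st *\<^sub>R info n_st \<theta> \<omega>" using n_st by (simp add: info_eq A_def)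
    then show ?case using pos_def_scaleR[OF start[OF \<omega> \<theta>], of "real n_st"] n_st by (simp add: info_def)
  next
    case (step n)
    then show ?case by (simp add: A_def pos_def_add_psd psd_scaleR psd_outer)
  qed
  then have "pos_def ((1 / real n) *\<^sub>R A n)" using n n_st by (intro pos_def_scaleR) auto
  then show ?thesis using n n_st by (simp add: info_eq A_def)
qed

abbreviation hull_outer :: "(real^'p^'p) set" where
  "hull_outer \<equiv> convex hull (outer ` f_theta b J G f \<theta>bar ` \<X>)"

lemma compact_f_theta: "compact (f_theta b J G f \<theta>bar ` \<X>)"
  unfolding f_theta_def
  by (intro compact_continuous_image \<X> continuous_on_scaleR f continuous_on_predictor \<phi>_cont \<theta>bar_mem)

text \<open>The information matrices at \<open>\<theta>bar\<close> of all designs lie in the convex hull of the rank-one matrices. A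
  maximiser of the determinant over this hull exists by compactness, and \<open>D_optimal_unique\<close> below identifies it
  with the information matrix of any locally D-optimal design.\<close>

definition opt_info :: "real^'p^'p" where
  "opt_info = (SOME L. L \<in> hull_outer \<and> (\<forall>L'\<in>hull_outer. det L' \<le> det L))"

lemma opt_info: "opt_info \<in> hull_outer" "L \<in> hull_outer \<Longrightarrow> det L \<le> det opt_info"
proof -
  have "hull_outer \<noteq> {}" using \<X>(2) by simp
  from continuous_attains_sup[OF compact_outer_hull[OF compact_f_theta] this continuous_on_det]
  have "\<exists>L. L \<in> hull_outer \<and> (\<forall>L'\<in>hull_outer. det L' \<le> det L)" by blast
  from someI_ex[OF this, folded opt_info_def]
  show "opt_info \<in> hull_outer" "L \<in> hull_outer \<Longrightarrow> det L \<le> det opt_info" by auto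
qed

lemma empirical_design_design: "n \<ge> 1 \<Longrightarrow> \<omega> \<in> space M \<Longrightarrow> design \<X> (empirical_design n (\<lambda>i. X i \<omega>))"
  unfolding design_def empirical_design_def
  using X_mem[of \<omega>] by (auto simp: set_pmf_of_set) (metis One_nat_def Suc_le_D)

lemma info_in_hull: "n \<ge> 1 \<Longrightarrow> \<omega> \<in> space M \<Longrightarrow> info n \<theta>bar \<omega> \<in> hull_outer"
  unfolding info_def by (intro info_matrix_in_hull empirical_design_design)

lemma opt_info_det_pos: "det opt_info > 0"
proof -
  obtain \<omega> where \<omega>: "\<omega> \<in> space M" using not_empty by blast
  have "det (info n_st \<theta>bar \<omega>) > 0" by (intro pos_def_det info_pos_def order_refl \<omega> \<theta>bar_mem)
  with opt_info(2)[OF info_in_hull[OF n_st \<omega>]] show ?thesis by linarith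
qed

lemma opt_info_pos_def: "pos_def opt_info"
  using psd_det_pos_def[of opt_info] psd_hull opt_info(1) opt_info_det_pos by force

text \<open>The regression functions at \<open>\<theta>hat n\<close> and \<open>\<theta>bar\<close> differ by the scalar factor \<open>r n\<close>, a ratio of values of \<open>\<phi>\<close>
  which tends to \<open>1\<close> uniformly on the design space.\<close>

lemma info_tendsto_opt:
  assumes \<omega>: "\<omega> \<in> space M" and lim: "(\<lambda>n. \<theta>hat n \<omega>) \<longlonglongrightarrow> \<theta>bar"
  shows "(\<lambda>n. info n \<theta>bar \<omega>) \<longlonglongrightarrow> opt_info"
proof -
  let ?a = "f_theta b J G f \<theta>bar"
  define r where "r = (\<lambda>n x. \<phi> (f x \<bullet> \<theta>hat n \<omega>) / \<phi> (f x \<bullet> \<theta>bar))"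
  have ra: "r n x *\<^sub>R ?a x = f_theta b J G f (\<theta>hat n \<omega>) x" if "x \<in> \<X>" for n x
    using \<phi>_pos[OF lo_hi(3)[OF that \<theta>bar_mem]] by (simp add: r_def f_theta_def)
  have sumA: "(\<Sum>i=1..n. outer (?a (X i \<omega>))) = real n *\<^sub>R info n \<theta>bar \<omega>" if "n \<ge> 1" for n
    using that by (simp add: info_def info_matrix_empirical sum.atLeast1_atMost_eq)
  have "(\<lambda>n. (1 / real n) *\<^sub>R (\<Sum>i=1..n. outer (?a (X i \<omega>)))) \<longlonglongrightarrow> opt_info"
  proof (rule adaptive_wynn_convergence[where D="\<X>" and r=r, OF compact_f_theta _ n_st])
    show "X i \<omega> \<in> \<X>" if "i \<ge> 1" for i using X_mem[OF \<omega>, of "i - 1"] that by simp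
    show "pos_def (\<Sum>i=1..n_st. outer (?a (X i \<omega>)))"
      unfolding sumA[OF n_st] using n_st by (intro pos_def_scaleR info_pos_def \<omega> \<theta>bar_mem) auto
    show "uniform_limit \<X> r (\<lambda>_. 1) sequentially"
    proof (rule uniform_limitI)
      fix e :: real assume e: "e > 0"
      obtain c where c: "c > 0" "\<And>u. u \<in> {lo..hi} \<Longrightarrow> c \<le> \<phi> u"
        using continuous_on_compact_interval_lower_bound[OF \<phi>_cont \<phi>_pos] by blast
      have "e * c > 0" using e c by simp
      from uniformly_continuous_interval[OF \<phi>_cont this]
      obtain d where d: "d > 0" "\<And>u v. u \<in> {lo..hi} \<Longrightarrow> v \<in> {lo..hi} \<Longrightarrow> \<bar>u - v\<bar> < d \<Longrightarrow> \<bar>\<phi> u - \<phi> v\<bar> < e * c" by metis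
      obtain R where R: "R > 0" "\<And>x. x \<in> \<X> \<Longrightarrow> norm (f x) \<le> R" using f_bound by blast
      have "eventually (\<lambda>n. dist (\<theta>hat n \<omega>) \<theta>bar < d / R) sequentially" using lim d R by (intro tendstoD) auto
      with eventually_ge_at_top[of n_st] show "eventually (\<lambda>n. \<forall>x\<in>\<X>. dist (r n x) 1 < e) sequentially"
      proof eventually_elim
        case (elim n)
        show ?case
        proof
          fix x assume x: "x \<in> \<X>"
          have u: "f x \<bullet> \<theta>hat n \<omega> \<in> {lo..hi}" "f x \<bullet> \<theta>bar \<in> {lo..hi}"
            using lo_hi(3)[OF x] \<theta>hat[OF elim(1) \<omega>] \<theta>bar_mem by blast+
          have "\<bar>f x \<bullet> \<theta>hat n \<omega> - f x \<bullet> \<theta>bar\<bar> \<le> norm (f x) * norm (\<theta>hat n \<omega> - \<theta>bar)"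
            by (simp flip: inner_diff_right add: Cauchy_Schwarz_ineq2)
          also have "\<dots> \<le> R * norm (\<theta>hat n \<omega> - \<theta>bar)" using R(2)[OF x] by (intro mult_right_mono) auto
          also have "\<dots> < d" using elim(2) R(1) by (simp add: dist_norm field_simps)
          finally have "\<bar>\<phi> (f x \<bullet> \<theta>hat n \<omega>) - \<phi> (f x \<bullet> \<theta>bar)\<bar> < e * c" by (intro d(2) u)
          also have "\<dots> \<le> e * \<phi> (f x \<bullet> \<theta>bar)" using c(2)[OF u(2)] e by simp
          finally have "\<bar>\<phi> (f x \<bullet> \<theta>hat n \<omega>) - \<phi> (f x \<bullet> \<theta>bar)\<bar> / \<phi> (f x \<bullet> \<theta>bar) < e"
            using \<phi>_pos[OF u(2)] by (simp add: pos_divide_less_eq)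
          moreover have "dist (r n x) 1 = \<bar>\<phi> (f x \<bullet> \<theta>hat n \<omega>) - \<phi> (f x \<bullet> \<theta>bar)\<bar> / \<phi> (f x \<bullet> \<theta>bar)"
          proof -
            have "r n x - 1 = (\<phi> (f x \<bullet> \<theta>hat n \<omega>) - \<phi> (f x \<bullet> \<theta>bar)) / \<phi> (f x \<bullet> \<theta>bar)"
              using \<phi>_pos[OF u(2)] by (simp add: r_def diff_divide_distrib)
            then show ?thesis using \<phi>_pos[OF u(2)] by (simp add: dist_real_def)
          qed
          ultimately show "dist (r n x) 1 < e" by simp
        qed
      qed
    qed
    show "(r n y *\<^sub>R ?a y) \<bullet> (matrix_inv ((1 / real n) *\<^sub>R (\<Sum>i=1..n. outer (r n (X i \<omega>) *\<^sub>R ?a (X i \<omega>)))) *v (r n y *\<^sub>R ?a y)) \<le>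
       (r n (X (Suc n) \<omega>) *\<^sub>R ?a (X (Suc n) \<omega>)) \<bullet> (matrix_inv ((1 / real n) *\<^sub>R (\<Sum>i=1..n. outer (r n (X i \<omega>) *\<^sub>R ?a (X i \<omega>)))) *v (r n (X (Suc n) \<omega>) *\<^sub>R ?a (X (Suc n) \<omega>)))"
      if n: "n \<ge> n_st" and y: "y \<in> \<X>" for n y
    proof -
      have n1: "n \<ge> 1" using n n_st by simp
      have "(1 / real n) *\<^sub>R (\<Sum>i=1..n. outer (r n (X i \<omega>) *\<^sub>R ?a (X i \<omega>))) =
          info_matrix (f_theta b J G f (\<theta>hat n \<omega>)) (empirical_design n (\<lambda>i. X i \<omega>))"
        unfolding info_matrix_empirical[OF n1] One_nat_def sum.atLeast1_atMost_eq
        by (simp add: ra[OF X_mem[OF \<omega>]])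
      then show ?thesis using wynn[OF n \<omega> y] ra[OF y] ra[OF X_mem[OF \<omega>]] by simp
    qed
  qed (use opt_info in auto)
  moreover have "eventually (\<lambda>n. (1 / real n) *\<^sub>R (\<Sum>i=1..n. outer (?a (X i \<omega>))) = info n \<theta>bar \<omega>) sequentially"
    using eventually_ge_at_top[of 1] by eventually_elim (subst sumA, simp_all)
  ultimately show ?thesis by (simp add: tendsto_cong)
qed

text \<open>The determinant of the limit is approached by designs, namely by those of the algorithm along one path, so
  that it does not exceed the maximal determinant of a design.\<close>

lemma D_optimal_unique:
  assumes \<xi>: "D_optimal \<X> (f_theta b J G f \<theta>bar) \<xi>"
  shows "info_matrix (f_theta b J G f \<theta>bar) \<xi> = opt_info"
proof -
  let ?L = "info_matrix (f_theta b J G f \<theta>bar) \<xi>"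
  have \<xi>': "design \<X> \<xi>" and max: "\<And>\<eta>. design \<X> \<eta> \<Longrightarrow> det (info_matrix (f_theta b J G f \<theta>bar) \<eta>) \<le> det ?L"
    using \<xi> unfolding D_optimal_def is_arg_max_linorder by auto
  have "AE \<omega> in M. det opt_info \<le> det ?L"
    using consistent AE_space
  proof eventually_elim
    case (elim \<omega>)
    have "(\<lambda>n. det (info n \<theta>bar \<omega>)) \<longlonglongrightarrow> det opt_info"
      using continuous_on_tendsto_compose[OF continuous_on_det[of UNIV] info_tendsto_opt[OF elim(2,1)]] by simp
    moreover have "eventually (\<lambda>n. det (info n \<theta>bar \<omega>) \<le> det ?L) sequentially"
      using eventually_ge_at_top[of 1]
      by eventually_elim (auto simp: info_def intro!: max empirical_design_design elim(2))
    ultimately show ?case by (rule tendsto_upperbound) simp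
  qed
  then have "det opt_info \<le> det ?L" by simp
  then show ?thesis
    using opt_info opt_info_det_pos info_matrix_in_hull[OF \<xi>'] by (intro det_max_unique[of opt_info _ ?L]) auto
qed

text \<open>The score at \<open>\<theta>bar\<close> is a martingale, since the noise has conditional mean \<open>0\<close>.\<close>

definition score :: "nat \<Rightarrow> 'w \<Rightarrow> real^'p" where
  "score n \<omega> = (\<Sum>k<n. (link' (Z k \<omega> \<bullet> \<theta>bar) * noise k \<omega>) *\<^sub>R Z k \<omega>)"

definition nscore :: "nat \<Rightarrow> 'w \<Rightarrow> real^'p" where "nscore n \<omega> = score n \<omega> /\<^sub>R sqrt (real n)"

lemma subset_cont: "continuous_on I g \<Longrightarrow> continuous_on {lo..hi} g"
  using lo_hi(2) by (rule continuous_on_subset[rotated])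

lemma score_weight_cont: "continuous_on \<X> (\<lambda>x. (t \<bullet> f x) * link' (f x \<bullet> \<theta>bar))"
  by (intro continuous_on_mult continuous_on_inner continuous_on_const f continuous_on_predictor
      subset_cont continuous_on_link \<theta>bar_mem)

lemma inner_score: "t \<bullet> score n \<omega> = (\<Sum>k<n. (t \<bullet> f (X (Suc k) \<omega>)) * link' (f (X (Suc k) \<omega>) \<bullet> \<theta>bar) * (Y (Suc k) \<omega> - G (f (X (Suc k) \<omega>) \<bullet> \<theta>bar)))"
  by (simp add: score_def inner_sum_right Z_def noise_def mult.commute mult.left_commute)

lemma nscore_measurable: "nscore n \<in> borel_measurable M"
proof -
  have "(\<lambda>\<omega>. t \<bullet> score n \<omega>) \<in> borel_measurable M" for t
    unfolding inner_score
    using partial_sum_measurable[of "\<lambda>k \<omega> y. (t \<bullet> f (X (Suc k) \<omega>)) * link' (f (X (Suc k) \<omega>) \<bullet> \<theta>bar) * (y - G (f (X (Suc k) \<omega>) \<bullet> \<theta>bar))"]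
      weighted_noise_measurable[OF score_weight_cont[of t]]
    by (intro measurable_F_M) blast
  then have "score n \<in> borel_measurable M"
    by (subst borel_measurable_euclidean_space) (simp add: inner_commute)
  then show ?thesis unfolding nscore_def[abs_def] by measurable
qed

text \<open>The projection of the score on \<open>t\<close> has bounded weights and the conditional variances
  \<open>(\<phi> (Z k \<omega> \<bullet> \<theta>bar))\<^sup>2 * (Z k \<omega> \<bullet> t)\<^sup>2\<close>, whose averages are the values at \<open>t\<close> of the quadratic forms
  of the information matrices. The latter converge, so that the martingale central limit theorem applies.\<close>

lemma
  shows nscore_second_moment: "\<exists>C. \<forall>n. (\<integral>\<^sup>+\<omega>. ennreal ((norm (nscore n \<omega>))\<^sup>2) \<partial>M) \<le> ennreal C"
    and nscore_cos: "(\<lambda>n. expectation (\<lambda>\<omega>. cos (t \<bullet> nscore n \<omega> + c))) \<longlonglongrightarrow> exp (- (t \<bullet> (opt_info *v t)) / 2) * cos c"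
proof -
  obtain C where C: "C \<ge> 1"
    "\<And>u j. u \<in> {lo..hi} \<Longrightarrow> j \<le> 8 \<Longrightarrow> integrable (expfam \<nu> K b (link u)) (\<lambda>y. \<bar>y - G u\<bar> ^ j)"
    "\<And>u j. u \<in> {lo..hi} \<Longrightarrow> j \<le> 8 \<Longrightarrow> (\<integral>y. \<bar>y - G u\<bar> ^ j \<partial>expfam \<nu> K b (link u)) \<le> C"
    "\<And>u. u \<in> {lo..hi} \<Longrightarrow> (\<integral>y. y - G u \<partial>expfam \<nu> K b (link u)) = 0"
    "\<And>u. u \<in> {lo..hi} \<Longrightarrow> (\<integral>y. (y - G u)\<^sup>2 \<partial>expfam \<nu> K b (link u)) = deriv (deriv b) (link u)"
    using noise_moments[OF lo_hi(1,2)] by metis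
  define w where "w = (\<lambda>t x. (t \<bullet> f x) * link' (f x \<bullet> \<theta>bar))"
  have w_cont: "continuous_on \<X> (w t)" for t unfolding w_def by (rule score_weight_cont)
  define g where "g = (\<lambda>t k \<omega> y. w t (X (Suc k) \<omega>) * (y - G (f (X (Suc k) \<omega>) \<bullet> \<theta>bar)))"
  have g_meas: "(\<lambda>(\<omega>, y). g t k \<omega> y) \<in> borel_measurable (F k \<Otimes>\<^sub>M borel)" for t k
    unfolding g_def by (rule weighted_noise_measurable[OF w_cont])
  have tW: "t \<bullet> score n \<omega> = (\<Sum>k<n. g t k \<omega> (Y (Suc k) \<omega>))" for t n \<omega>
    by (simp add: inner_score g_def w_def)
  let ?u = "\<lambda>k \<omega>. f (X (Suc k) \<omega>) \<bullet> \<theta>bar"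
  let ?P = "\<lambda>k \<omega>. expfam \<nu> K b (link (?u k \<omega>))"
  have u: "?u k \<omega> \<in> {lo..hi}" if "\<omega> \<in> space M" for k \<omega> using Z_interval[OF that \<theta>bar_mem] by (simp add: Z_def)
  have meas: "(\<lambda>y. y - G (?u k \<omega>)) \<in> borel_measurable (?P k \<omega>)" for k \<omega> by (simp cong: measurable_cong_sets)
  have abs_i: "integrable (?P k \<omega>) (\<lambda>y. \<bar>g t k \<omega> y\<bar> ^ j)" and abs_e: "(\<integral>y. \<bar>g t k \<omega> y\<bar> ^ j \<partial>?P k \<omega>) \<le> \<bar>w t (X (Suc k) \<omega>)\<bar> ^ j * C"
    if \<omega>: "\<omega> \<in> space M" and j: "j \<le> 8" for t k \<omega> j
  proof -
    show "integrable (?P k \<omega>) (\<lambda>y. \<bar>g t k \<omega> y\<bar> ^ j)"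
      unfolding g_def abs_mult power_mult_distrib by (intro integrable_mult_right C(2)[OF u[OF \<omega>] j])
    show "(\<integral>y. \<bar>g t k \<omega> y\<bar> ^ j \<partial>?P k \<omega>) \<le> \<bar>w t (X (Suc k) \<omega>)\<bar> ^ j * C"
      unfolding g_def abs_mult power_mult_distrib integral_mult_right_zero
      by (intro mult_left_mono C(3)[OF u[OF \<omega>] j]) auto
  qed
  have mean0: "(\<integral>y. g t k \<omega> y \<partial>?P k \<omega>) = 0" if "\<omega> \<in> space M" for t k \<omega>
    unfolding g_def integral_mult_right_zero C(4)[OF u[OF that]] by simp
  have bound: "\<exists>B\<ge>1. \<forall>x\<in>\<X>. \<bar>w t x\<bar> \<le> B" for t using continuous_bound[OF w_cont[of t]] by metis
  have comp: "\<exists>D\<ge>0. \<forall>n. (\<integral>\<^sup>+\<omega>. ennreal ((t \<bullet> nscore n \<omega>)\<^sup>2) \<partial>M) \<le> ennreal D" for t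
  proof -
    obtain B where B: "B \<ge> 1" "\<And>x. x \<in> \<X> \<Longrightarrow> \<bar>w t x\<bar> \<le> B" using bound[of t] by blast
    have "(\<integral>\<^sup>+\<omega>. ennreal ((t \<bullet> score n \<omega>)\<^sup>2) \<partial>M) \<le> ennreal (real n * (B ^ 4 * C + 1))" for n
      unfolding tW
    proof (rule martingale_second_moment[OF g_meas])
      fix k \<omega> assume \<omega>: "\<omega> \<in> space M"
      show "integrable (?P k \<omega>) (\<lambda>y. g t k \<omega> y ^ 4)" using abs_i[OF \<omega>, of 4 k t] by (simp add: power_even_abs)
      show "(\<integral>y. g t k \<omega> y \<partial>?P k \<omega>) = 0" by (rule mean0[OF \<omega>])
      have "\<bar>w t (X (Suc k) \<omega>)\<bar> ^ 4 * C \<le> B ^ 4 * C"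
        using B(2)[OF X_mem[OF \<omega>]] C(1) by (intro mult_right_mono power_mono) auto
      with abs_e[OF \<omega>, of 4 k t] show "(\<integral>y. g t k \<omega> y ^ 4 \<partial>?P k \<omega>) + 1 \<le> B ^ 4 * C + 1"
        by (simp add: power_even_abs)
    qed (use B C in simp)
    then have "(\<integral>\<^sup>+\<omega>. ennreal ((t \<bullet> nscore n \<omega>)\<^sup>2) \<partial>M) \<le> ennreal (B ^ 4 * C + 1)" for n
    proof (cases "n = 0")
      case False
      have "(\<integral>\<^sup>+\<omega>. ennreal ((t \<bullet> nscore n \<omega>)\<^sup>2) \<partial>M) = (\<integral>\<^sup>+\<omega>. ennreal (1 / real n) * ennreal ((t \<bullet> score n \<omega>)\<^sup>2) \<partial>M)"
        by (intro nn_integral_cong) (simp add: nscore_def power_mult_distrib power_divide power_inverse ennreal_mult'[symmetric] inverse_eq_divide)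
      also have "\<dots> = ennreal (1 / real n) * (\<integral>\<^sup>+\<omega>. ennreal ((t \<bullet> score n \<omega>)\<^sup>2) \<partial>M)"
      proof (rule nn_integral_cmult)
        have "(\<lambda>\<omega>. t \<bullet> score n \<omega>) \<in> borel_measurable M"
          unfolding tW by (rule measurable_F_M[OF partial_sum_measurable[OF g_meas]])
        then show "(\<lambda>\<omega>. ennreal ((t \<bullet> score n \<omega>)\<^sup>2)) \<in> borel_measurable M" by measurable
      qed
      also have "\<dots> \<le> ennreal (1 / real n) * ennreal (real n * (B ^ 4 * C + 1))"
        by (intro mult_left_mono) (use \<open>\<And>n. (\<integral>\<^sup>+\<omega>. ennreal ((t \<bullet> score n \<omega>)\<^sup>2) \<partial>M) \<le> ennreal (real n * (B ^ 4 * C + 1))\<close> in auto)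
      also have "\<dots> = ennreal (B ^ 4 * C + 1)" using False by (simp add: ennreal_mult'[symmetric])
      finally show ?thesis .
    qed (simp add: nscore_def)
    moreover have "B ^ 4 * C + 1 \<ge> 0" using B C by simp
    ultimately show ?thesis by blast
  qed
  then obtain D where D: "\<And>t. D t \<ge> 0" "\<And>t n. (\<integral>\<^sup>+\<omega>. ennreal ((t \<bullet> nscore n \<omega>)\<^sup>2) \<partial>M) \<le> ennreal (D t)" by metis
  show "\<exists>C. \<forall>n. (\<integral>\<^sup>+\<omega>. ennreal ((norm (nscore n \<omega>))\<^sup>2) \<partial>M) \<le> ennreal C"
  proof (intro exI allI)
    fix n
    note [measurable] = nscore_measurable
    have "(\<integral>\<^sup>+\<omega>. ennreal ((norm (nscore n \<omega>))\<^sup>2) \<partial>M) = (\<integral>\<^sup>+\<omega>. (\<Sum>v\<in>Basis. ennreal ((v \<bullet> nscore n \<omega>)\<^sup>2)) \<partial>M)"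
      by (simp add: norm_power2_Basis sum_ennreal inner_commute)
    also have "\<dots> = (\<Sum>v\<in>Basis. \<integral>\<^sup>+\<omega>. ennreal ((v \<bullet> nscore n \<omega>)\<^sup>2) \<partial>M)"
      by (rule nn_integral_sum) measurable
    also have "\<dots> \<le> (\<Sum>v\<in>Basis. ennreal (D v))" by (intro sum_mono D)
    also have "\<dots> = ennreal (\<Sum>v\<in>Basis. D v)" using D(1) by (simp add: sum_ennreal)
    finally show "(\<integral>\<^sup>+\<omega>. ennreal ((norm (nscore n \<omega>))\<^sup>2) \<partial>M) \<le> ennreal (\<Sum>v\<in>(Basis :: (real^'p) set). D v)" .
  qed
  obtain B where B: "B \<ge> 1" "\<And>x. x \<in> \<X> \<Longrightarrow> \<bar>w t x\<bar> \<le> B" using bound[of t] by blast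
  define v where "v = (\<lambda>k \<omega>. (w t (X (Suc k) \<omega>))\<^sup>2 * deriv (deriv b) (link (?u k \<omega>)))"
  have v_eq: "v k \<omega> = (\<phi> (Z k \<omega> \<bullet> \<theta>bar))\<^sup>2 * (Z k \<omega> \<bullet> t)\<^sup>2" if "\<omega> \<in> space M" for k \<omega>
  proof -
    have "?u k \<omega> \<in> I" using u[OF that] lo_hi(2) by blast
    from variance_link[OF this] show ?thesis
      by (simp add: v_def w_def Z_def power_mult_distrib inner_commute mult.commute mult.left_commute)
  qed
  have "(\<lambda>n. expectation (\<lambda>\<omega>. cos (c + (\<Sum>k<n. g t k \<omega> (Y (Suc k) \<omega>)) / sqrt (real n)))) \<longlonglongrightarrow> exp (- (t \<bullet> (opt_info *v t)) / 2) * cos c"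
  proof (rule martingale_clt[where v=v and \<beta>="B ^ 3 * C", OF g_meas])
    fix k \<omega> assume \<omega>: "\<omega> \<in> space M"
    show "integrable (?P k \<omega>) (g t k \<omega>)"
    proof (rule integrable_abs_cancel)
      show "integrable (?P k \<omega>) (\<lambda>y. \<bar>g t k \<omega> y\<bar>)" using abs_i[OF \<omega>, of 1 k t] by simp
      show "g t k \<omega> \<in> borel_measurable (?P k \<omega>)" unfolding g_def using meas by measurable
    qed
    show "integrable (?P k \<omega>) (\<lambda>y. (g t k \<omega> y)\<^sup>2)" using abs_i[OF \<omega>, of 2 k t] by simp
    show "integrable (?P k \<omega>) (\<lambda>y. \<bar>g t k \<omega> y\<bar> ^ 3)" by (rule abs_i[OF \<omega>]) simp
    show "(\<integral>y. g t k \<omega> y \<partial>?P k \<omega>) = 0" by (rule mean0[OF \<omega>])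
    show veq: "(\<integral>y. (g t k \<omega> y)\<^sup>2 \<partial>?P k \<omega>) = v k \<omega>"
      unfolding g_def power_mult_distrib integral_mult_right_zero C(5)[OF u[OF \<omega>]] v_def ..
    have Bj: "\<bar>w t (X (Suc k) \<omega>)\<bar> ^ j * C \<le> B ^ 3 * C" if "j \<le> 3" for j
    proof -
      have "\<bar>w t (X (Suc k) \<omega>)\<bar> ^ j \<le> B ^ j" by (intro power_mono B X_mem[OF \<omega>]) auto
      also have "\<dots> \<le> B ^ 3" using B(1) that by (intro power_increasing) auto
      finally show ?thesis using C(1) by (intro mult_right_mono) auto
    qed
    show "(\<integral>y. \<bar>g t k \<omega> y\<bar> ^ 3 \<partial>?P k \<omega>) \<le> B ^ 3 * C"
      using abs_e[OF \<omega>, of 3 k t] Bj[of 3] by simp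
    show "v k \<omega> \<le> B ^ 3 * C"
      using abs_e[OF \<omega>, of 2 k t] Bj[of 2] by (simp add: veq)
  next
    fix k
    have "continuous_on {lo..hi} (\<lambda>u. (deriv ^^ 2) b (link u))"
      using link(1) lo_hi(2)
      by (intro continuous_on_compose2[OF continuous_on_deriv_b continuous_on_subset[OF continuous_on_link(1) lo_hi(2)]]) auto
    then have s_cont: "continuous_on {lo..hi} (\<lambda>u. deriv (deriv b) (link u))" by (simp add: numeral_2_eq_2)
    note [measurable] = X_meas[OF w_cont] X_meas[OF continuous_on_predictor[OF s_cont \<theta>bar_mem]]
    show "v k \<in> borel_measurable (F k)" unfolding v_def by measurable
  next
    show "AE \<omega> in M. (\<lambda>n. (\<Sum>k<n. v k \<omega>) / real n) \<longlonglongrightarrow> t \<bullet> (opt_info *v t)"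
      using consistent AE_space
    proof eventually_elim
      case (elim \<omega>)
      have lim: "(\<lambda>n. info n \<theta>bar \<omega>) \<longlonglongrightarrow> opt_info" by (rule info_tendsto_opt[OF elim(2,1)])
      have "continuous_on UNIV (\<lambda>A :: real^'p^'p. t \<bullet> (A *v t))"
        unfolding matrix_vector_mult_def by (intro continuous_intros)
      from continuous_on_tendsto_compose[OF this lim] have "(\<lambda>n. t \<bullet> (info n \<theta>bar \<omega> *v t)) \<longlonglongrightarrow> t \<bullet> (opt_info *v t)" by simp
      moreover have "eventually (\<lambda>n. t \<bullet> (info n \<theta>bar \<omega> *v t) = (\<Sum>k<n. v k \<omega>) / real n) sequentially"
        using eventually_ge_at_top[of 1]
        by eventually_elim (simp add: info_eq scaleR_matrix_vector_assoc[symmetric] inner_sum_outer v_eq[OF elim(2)])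
      ultimately show ?case by (simp add: tendsto_cong)
    qed
  qed
  moreover have "t \<bullet> nscore n \<omega> + c = c + (\<Sum>k<n. g t k \<omega> (Y (Suc k) \<omega>)) / sqrt (real n)" for n \<omega>
    by (simp add: nscore_def tW[symmetric] divide_inverse mult.commute)
  ultimately show "(\<lambda>n. expectation (\<lambda>\<omega>. cos (t \<bullet> nscore n \<omega> + c))) \<longlonglongrightarrow> exp (- (t \<bullet> (opt_info *v t)) / 2) * cos c"
    by (simp only:)
qed


section \<open>Asymptotic normality of the maximum likelihood estimators\<close>

lemma info_tendsto_along:
  assumes \<omega>: "\<omega> \<in> space M" and bar: "(\<lambda>n. info n \<theta>bar \<omega>) \<longlonglongrightarrow> L"
    and \<theta>: "\<And>n. n \<ge> n_st \<Longrightarrow> \<theta> n \<in> \<Theta>" "\<theta> \<longlonglongrightarrow> \<theta>bar"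
  shows "(\<lambda>n. info n (\<theta> n) \<omega>) \<longlonglongrightarrow> L"
proof -
  obtain R where R: "R > 0" "\<And>x. x \<in> \<X> \<Longrightarrow> norm (f x) \<le> R" using f_bound by blast
  have q: "continuous_on {lo..hi} (\<lambda>u. (\<phi> u)\<^sup>2)" by (intro continuous_on_power \<phi>_cont)
  define B where "B = norm (\<chi> i j. R * R :: real^'p^'p)"
  have outer_B: "norm (outer (Z k \<omega>)) \<le> B" for k
  proof -
    have "\<bar>Z k \<omega> $ i\<bar> \<le> R" for i
      using component_le_norm_cart[of "Z k \<omega>" i] R(2)[OF X_mem[OF \<omega>, of k]] unfolding Z_def by linarith
    then show ?thesis using R(1)
      unfolding B_def norm_vec_def by (intro L2_set_mono) (auto simp: outer_def abs_mult norm_vec_def intro!: L2_set_mono mult_mono L2_set_nonneg)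
  qed
  have B: "B \<ge> 0" by (simp add: B_def)
  have "(\<lambda>n. info n (\<theta> n) \<omega> - info n \<theta>bar \<omega>) \<longlonglongrightarrow> 0"
  proof (rule tendstoI)
    fix e :: real assume e: "e > 0"
    define e' where "e' = e / (2 * (B + 1))"
    have e': "e' > 0" "e' * B < e" using e B by (auto simp: e'_def field_simps intro: add_nonneg_pos)
    from uniformly_continuous_interval[OF q e'(1)]
    obtain d where d: "d > 0" "\<And>u v. u \<in> {lo..hi} \<Longrightarrow> v \<in> {lo..hi} \<Longrightarrow> \<bar>u - v\<bar> < d \<Longrightarrow> \<bar>(\<phi> u)\<^sup>2 - (\<phi> v)\<^sup>2\<bar> < e'" by metis
    have "eventually (\<lambda>n. dist (\<theta> n) \<theta>bar < d / R) sequentially" using \<theta>(2) d R by (intro tendstoD) auto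
    with eventually_ge_at_top[of n_st] show "eventually (\<lambda>n. dist (info n (\<theta> n) \<omega> - info n \<theta>bar \<omega>) 0 < e) sequentially"
    proof eventually_elim
      case (elim n)
      have n1: "n \<ge> 1" using elim n_st by simp
      have w: "\<bar>(\<phi> (Z k \<omega> \<bullet> \<theta> n))\<^sup>2 - (\<phi> (Z k \<omega> \<bullet> \<theta>bar))\<^sup>2\<bar> \<le> e'" for k
      proof -
        have "\<bar>Z k \<omega> \<bullet> \<theta> n - Z k \<omega> \<bullet> \<theta>bar\<bar> \<le> norm (Z k \<omega>) * norm (\<theta> n - \<theta>bar)"
          by (simp flip: inner_diff_right add: Cauchy_Schwarz_ineq2)
        also have "\<dots> \<le> R * norm (\<theta> n - \<theta>bar)"
          using R(2)[OF X_mem[OF \<omega>, of k]] by (intro mult_right_mono) (auto simp: Z_def)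
        also have "\<dots> < d" using elim(2) R(1) by (simp add: dist_norm field_simps)
        finally show ?thesis by (intro less_imp_le d(2) Z_interval \<omega> \<theta>(1)[OF elim(1)] \<theta>bar_mem)
      qed
      have "info n (\<theta> n) \<omega> - info n \<theta>bar \<omega> =
          (1 / real n) *\<^sub>R (\<Sum>k<n. ((\<phi> (Z k \<omega> \<bullet> \<theta> n))\<^sup>2 - (\<phi> (Z k \<omega> \<bullet> \<theta>bar))\<^sup>2) *\<^sub>R outer (Z k \<omega>))"
        using n1 by (simp add: info_eq scaleR_diff_right[symmetric] sum_subtractf[symmetric] scaleR_diff_left)
      also have "norm \<dots> \<le> (1 / real n) * (\<Sum>k<n. e' * B)"
      proof -
        have "norm (\<Sum>k<n. ((\<phi> (Z k \<omega> \<bullet> \<theta> n))\<^sup>2 - (\<phi> (Z k \<omega> \<bullet> \<theta>bar))\<^sup>2) *\<^sub>R outer (Z k \<omega>)) \<le> (\<Sum>k<n. e' * B)"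
        proof (rule sum_norm_le)
          fix k
          show "norm (((\<phi> (Z k \<omega> \<bullet> \<theta> n))\<^sup>2 - (\<phi> (Z k \<omega> \<bullet> \<theta>bar))\<^sup>2) *\<^sub>R outer (Z k \<omega>)) \<le> e' * B"
            unfolding norm_scaleR using w[of k] outer_B[of k] e'(1) by (intro mult_mono) auto
        qed
        then show ?thesis using n1 by (simp add: field_simps)
      qed
      also have "\<dots> = e' * B" using n1 by simp
      also have "\<dots> < e" by (rule e'(2))
      finally show ?case by (simp add: dist_norm)
    qed
  qed
  from tendsto_add[OF this bar] show ?thesis by simp
qed

text \<open>Almost every path satisfies the assumptions of \<open>ml_path\<close>: the laws of large numbers are applied for the
  parameters in a countable dense subset of \<open>\<Theta>\<close> and for the entries of a matrix, which are countably many
  instances.\<close>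

lemma ml_path_expansion:
  "AE \<omega> in M. (\<lambda>n. \<theta>mle n \<omega>) \<longlonglongrightarrow> \<theta>bar \<and>
     (\<forall>\<epsilon>>0. eventually (\<lambda>n. norm (sqrt (real n) *\<^sub>R (\<theta>mle n \<omega> - \<theta>bar) - matrix_inv opt_info *v nscore n \<omega>) \<le> \<epsilon> * norm (nscore n \<omega>)) sequentially)"
proof -
  obtain T where T: "countable T" "T \<subseteq> \<Theta>" "\<Theta> \<subseteq> closure T" using separable by blast
  obtain R where R: "R > 0" "\<And>x. x \<in> \<X> \<Longrightarrow> norm (f x) \<le> R" using f_bound by blast
  obtain C where C: "AE \<omega> in M. eventually (\<lambda>n. (\<Sum>k<n. \<bar>noise k \<omega>\<bar>) \<le> C * real n) sequentially"
    using abs_noise_bounded by blast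
  have "AE \<omega> in M. \<forall>\<eta>\<in>T. (\<lambda>n. (\<Sum>k<n. (link (Z k \<omega> \<bullet> \<eta>) - link (Z k \<omega> \<bullet> \<theta>bar)) * noise k \<omega>) / real n) \<longlonglongrightarrow> 0"
  proof (rule AE_ball_countable'[OF _ T(1)])
    fix \<eta> assume "\<eta> \<in> T"
    then have "continuous_on \<X> (\<lambda>x. link (f x \<bullet> \<eta>) - link (f x \<bullet> \<theta>bar))"
      using T(2) \<theta>bar_mem by (intro continuous_on_diff continuous_on_predictor subset_cont continuous_on_link) auto
    from noise_lln[OF this]
    show "AE \<omega> in M. (\<lambda>n. (\<Sum>k<n. (link (Z k \<omega> \<bullet> \<eta>) - link (Z k \<omega> \<bullet> \<theta>bar)) * noise k \<omega>) / real n) \<longlonglongrightarrow> 0"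
      by (simp add: Z_def)
  qed
  moreover have "AE \<omega> in M. \<forall>i j. (\<lambda>n. (\<Sum>k<n. link'' (Z k \<omega> \<bullet> \<theta>bar) * Z k \<omega> $ i * Z k \<omega> $ j * noise k \<omega>) / real n) \<longlonglongrightarrow> 0"
  proof -
    have "AE \<omega> in M. (\<lambda>n. (\<Sum>k<n. link'' (Z k \<omega> \<bullet> \<theta>bar) * Z k \<omega> $ i * Z k \<omega> $ j * noise k \<omega>) / real n) \<longlonglongrightarrow> 0" for i j
    proof -
      have "continuous_on \<X> (\<lambda>x. link'' (f x \<bullet> \<theta>bar) * f x $ i * f x $ j)"
        by (intro continuous_on_mult continuous_on_component f continuous_on_predictor subset_cont continuous_on_link \<theta>bar_mem)
      from noise_lln[OF this] show ?thesis by (simp add: Z_def)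
    qed
    then show ?thesis by (simp add: AE_all_countable)
  qed
  ultimately show ?thesis using consistent AE_K_pos C AE_space
  proof eventually_elim
    case (elim \<omega>)
    note \<omega> = elim(6)
    have uI: "u \<in> I" if "u \<in> {lo..hi}" for u using that lo_hi(2) by blast
    have noise_eq: "Y (Suc k) \<omega> - G (Z k \<omega> \<bullet> \<theta>bar) = noise k \<omega>" for k by (simp add: noise_def)
    interpret P: ml_path link link' link'' G "deriv G" "\<lambda>u. b (link u)" lo hi "\<lambda>k. Z k \<omega>" "\<lambda>k. Y (Suc k) \<omega>"
      \<Theta> \<theta>bar opt_info R C T "\<lambda>n. \<theta>mle n \<omega>" n_st
    proof (rule ml_path.intro)
      show "(link has_real_derivative link' u) (at u)" "(link' has_real_derivative link'' u) (at u)"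
        "(G has_real_derivative deriv G u) (at u)" "((\<lambda>u. b (link u)) has_real_derivative G u * link' u) (at u)"
        "link' u > 0" "deriv G u > 0" if "u \<in> {lo..hi}" for u
        using link_deriv link'_deriv C1_has_derivative(1)[OF G(1)] b_link_deriv link'_pos G(2) uI[OF that] by blast+
      show "continuous_on {lo..hi} link'" "continuous_on {lo..hi} link''" "continuous_on {lo..hi} (deriv G)"
        by (intro subset_cont continuous_on_link C1_has_derivative(2)[OF G(1)])+
      show "Z k \<omega> \<bullet> \<eta> \<in> {lo..hi}" if "\<eta> \<in> \<Theta>" for k \<eta> using Z_interval[OF \<omega> that] .
      show "norm (Z k \<omega>) \<le> R" for k unfolding Z_def by (intro R X_mem \<omega>)
      show "(\<lambda>n. (1 / real n) *\<^sub>R (\<Sum>k<n. (link' (Z k \<omega> \<bullet> \<theta>bar) * deriv G (Z k \<omega> \<bullet> \<theta>bar)) *\<^sub>R outer (Z k \<omega>))) \<longlonglongrightarrow> opt_info"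
      proof (rule Lim_transform_eventually[OF info_tendsto_opt[OF \<omega> elim(3)]])
        show "eventually (\<lambda>n. info n \<theta>bar \<omega> =
          (1 / real n) *\<^sub>R (\<Sum>k<n. (link' (Z k \<omega> \<bullet> \<theta>bar) * deriv G (Z k \<omega> \<bullet> \<theta>bar)) *\<^sub>R outer (Z k \<omega>))) sequentially"
          using eventually_ge_at_top[of 1]
        proof eventually_elim
          case (elim n)
          show ?case unfolding info_eq[OF elim] by (simp add: glm_phi_power2[OF uI[OF Z_interval[OF \<omega> \<theta>bar_mem]]])
        qed
      qed
      show "(\<lambda>n. (\<Sum>k<n. (link (Z k \<omega> \<bullet> \<eta>) - link (Z k \<omega> \<bullet> \<theta>bar)) * (Y (Suc k) \<omega> - G (Z k \<omega> \<bullet> \<theta>bar))) / real n) \<longlonglongrightarrow> 0"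
        if "\<eta> \<in> T" for \<eta> unfolding noise_eq using elim(1) that by blast
      show "(\<lambda>n. (1 / real n) *\<^sub>R (\<Sum>k<n. (link'' (Z k \<omega> \<bullet> \<theta>bar) * (Y (Suc k) \<omega> - G (Z k \<omega> \<bullet> \<theta>bar))) *\<^sub>R outer (Z k \<omega>))) \<longlonglongrightarrow> 0"
        unfolding noise_eq
      proof (intro vec_tendstoI)
        fix i j
        have eq: "((1 / real n) *\<^sub>R (\<Sum>k<n. (link'' (Z k \<omega> \<bullet> \<theta>bar) * noise k \<omega>) *\<^sub>R outer (Z k \<omega>))) $ i $ j =
            (\<Sum>k<n. link'' (Z k \<omega> \<bullet> \<theta>bar) * Z k \<omega> $ i * Z k \<omega> $ j * noise k \<omega>) / real n" for n
          by (simp add: outer_def mult_ac)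
        show "(\<lambda>n. ((1 / real n) *\<^sub>R (\<Sum>k<n. (link'' (Z k \<omega> \<bullet> \<theta>bar) * noise k \<omega>) *\<^sub>R outer (Z k \<omega>))) $ i $ j) \<longlonglongrightarrow> 0 $ i $ j"
          unfolding eq using elim(2) by simp
      qed
      show "eventually (\<lambda>n. (\<Sum>k<n. \<bar>Y (Suc k) \<omega> - G (Z k \<omega> \<bullet> \<theta>bar)\<bar>) \<le> C * real n) sequentially"
        unfolding noise_eq by (rule elim(5))
      show "(\<Sum>k<n. link (Z k \<omega> \<bullet> \<eta>) * Y (Suc k) \<omega> - b (link (Z k \<omega> \<bullet> \<eta>))) \<le>
          (\<Sum>k<n. link (Z k \<omega> \<bullet> \<theta>mle n \<omega>) * Y (Suc k) \<omega> - b (link (Z k \<omega> \<bullet> \<theta>mle n \<omega>)))"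
        if "n \<ge> n_st" "\<eta> \<in> \<Theta>" for n \<eta>
      proof -
        \<comment> \<open>The terms with \<open>K\<close> do not depend on the parameter and cancel.\<close>
        have "log_likelihood K b J G f n (\<lambda>i. X i \<omega>) (\<lambda>i. Y i \<omega>) \<theta> =
            (\<Sum>k<n. ln (K (Y (Suc k) \<omega>))) + (\<Sum>k<n. link (Z k \<omega> \<bullet> \<theta>) * Y (Suc k) \<omega> - b (link (Z k \<omega> \<bullet> \<theta>)))" for \<theta>
          unfolding log_likelihood_def One_nat_def sum.atLeast1_atMost_eq
          by (simp add: sum.distrib[symmetric] glm_tau_def link_def Z_def add_diff_eq)
        moreover have "log_likelihood K b J G f n (\<lambda>i. X i \<omega>) (\<lambda>i. Y i \<omega>) \<eta> \<le> log_likelihood K b J G f n (\<lambda>i. X i \<omega>) (\<lambda>i. Y i \<omega>) (\<theta>mle n \<omega>)"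
          by (rule ml[OF that(1) \<omega> _ that(2)]) (use elim(4) in auto)
        ultimately show ?thesis by simp
      qed
    qed (use R(1) \<Theta> T opt_info_pos_def \<theta>mle[OF _ \<omega>] in auto)
    have "P.score n = score n \<omega>" for n
      by (simp add: P.score_def P.e_def score_def noise_def)
    then show ?case using P.consistent P.asymptotic_linearity by (simp add: nscore_def)
  qed
qed

text \<open>The linear image \<open>A *v nscore n\<close> of the normalised score is asymptotically normal, and \<open>V n\<close> has the same limit
  by Slutsky's lemma. The error, being relative to the score, is also relative to \<open>A *v nscore n\<close>, because \<open>A\<close> is
  invertible.\<close>

lemma asymptotic_normality:
  assumes A: "pos_def A" and V: "\<And>n. n \<ge> n_st \<Longrightarrow> V n \<in> borel_measurable M"
    and close: "AE \<omega> in M. \<forall>\<epsilon>>0. eventually (\<lambda>n. norm (V n \<omega> - A *v nscore n \<omega>) \<le> \<epsilon> * norm (nscore n \<omega>)) sequentially"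
  shows "converges_in_distribution M V (multi_normal 0 (A ** opt_info ** A))"
proof -
  have sym: "transpose A = A" using A by (simp add: pos_def_def)
  define C where "C = A ** opt_info ** A"
  have C: "pos_def C"
    using pos_def_conj[OF opt_info_pos_def pos_def_invertible[OF A]] by (simp add: C_def sym)
  define U where "U = (\<lambda>n \<omega>. A *v nscore n \<omega>)"
  have U_meas [measurable]: "U n \<in> borel_measurable M" for n
    unfolding U_def by (intro borel_measurable_matrix_vector_mult nscore_measurable) simp
  obtain C0 where C0: "\<And>n. (\<integral>\<^sup>+\<omega>. ennreal ((norm (nscore n \<omega>))\<^sup>2) \<partial>M) \<le> ennreal C0" using nscore_second_moment by blast
  have tight: "\<exists>R. eventually (\<lambda>n. measure M {\<omega>\<in>space M. norm (U n \<omega>) > R} \<le> \<epsilon>) sequentially" if "\<epsilon> > 0" for \<epsilon>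
  proof (rule tight_if_second_moment[OF M U_meas _ that])
    fix n
    note [measurable] = nscore_measurable
    have "(\<integral>\<^sup>+\<omega>. ennreal ((norm (U n \<omega>))\<^sup>2) \<partial>M) \<le> (\<integral>\<^sup>+\<omega>. ennreal ((norm A)\<^sup>2) * ennreal ((norm (nscore n \<omega>))\<^sup>2) \<partial>M)"
      by (intro nn_integral_mono)
         (simp add: U_def ennreal_mult'[symmetric] power_mult_distrib[symmetric] power_mono norm_matrix_vector_le)
    also have "\<dots> = ennreal ((norm A)\<^sup>2) * (\<integral>\<^sup>+\<omega>. ennreal ((norm (nscore n \<omega>))\<^sup>2) \<partial>M)"
      by (rule nn_integral_cmult) measurable
    also have "\<dots> \<le> ennreal ((norm A)\<^sup>2) * ennreal C0" by (intro mult_left_mono C0) simp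
    also have "\<dots> = ennreal ((norm A)\<^sup>2 * C0)" by (simp add: ennreal_mult')
    finally show "(\<integral>\<^sup>+\<omega>. ennreal ((norm (U n \<omega>))\<^sup>2) \<partial>M) \<le> ennreal ((norm A)\<^sup>2 * C0)" .
  qed
  have "weak_conv_measures (\<lambda>n. distr M borel (U n)) (multi_normal 0 C)"
  proof (rule weak_conv_measures_if_cos)
    show "prob_space (distr M borel (U n))" for n by (rule prob_space_distr[OF U_meas])
    show "prob_space (multi_normal 0 C)" by (rule prob_space_multi_normal[OF C])
    show "(\<lambda>n. LINT x|distr M borel (U n). cos (t \<bullet> x + c)) \<longlonglongrightarrow> (LINT x|multi_normal 0 C. cos (t \<bullet> x + c))" for t c
    proof -
      have "(LINT x|distr M borel (U n). cos (t \<bullet> x + c)) = expectation (\<lambda>\<omega>. cos ((A *v t) \<bullet> nscore n \<omega> + c))" for n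
        by (subst integral_distr[OF U_meas]) (simp_all add: U_def inner_transpose[of t A] sym del: transpose_matrix_vector)
      moreover have "(A *v t) \<bullet> (opt_info *v (A *v t)) = t \<bullet> (C *v t)"
        by (simp add: C_def matrix_vector_mul_assoc[symmetric] inner_transpose[of t A] sym del: transpose_matrix_vector)
      ultimately show ?thesis using nscore_cos[of "A *v t" c] by (simp add: cos_multi_normal[OF C])
    qed
    show "\<exists>R. eventually (\<lambda>n. measure (distr M borel (U n)) {x. norm x > R} \<le> \<epsilon>) sequentially" if "\<epsilon> > 0" for \<epsilon>
    proof -
      have "measure (distr M borel (U n)) {x. norm x > R} = prob {\<omega>\<in>space M. norm (U n \<omega>) > R}" for n R
        by (subst measure_distr[OF U_meas]) (auto intro!: arg_cong[where f=prob])
      then show ?thesis using tight[OF that] by simp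
    qed
  qed simp_all
  then have U_lim: "converges_in_distribution M U (multi_normal 0 C)" by (simp add: converges_in_distribution_def)
  show ?thesis unfolding C_def[symmetric]
  proof (rule slutsky[where W=U and ?n0.0=n_st])
    show "prob_space M" by (rule M)
    show "U n \<in> borel_measurable M" for n by (rule U_meas)
    show "V n \<in> borel_measurable M" if "n \<ge> n_st" for n using that by (rule V)
    show "converges_in_distribution M U (multi_normal 0 C)" by (rule U_lim)
    show "\<exists>R. eventually (\<lambda>n. measure M {\<omega>\<in>space M. norm (U n \<omega>) > R} \<le> \<epsilon>) sequentially" if "\<epsilon> > 0" for \<epsilon>
      using that by (rule tight)
    define D where "D = norm (matrix_inv A) + 1"
    have D: "D > 0" unfolding D_def by (rule add_nonneg_pos) auto
    have WU: "norm (nscore n \<omega>) \<le> D * (1 + norm (U n \<omega>))" for n \<omega>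
    proof -
      have "norm (nscore n \<omega>) = norm (matrix_inv A *v U n \<omega>)" by (simp add: U_def matrix_inv_vector[OF A])
      also have "\<dots> \<le> norm (matrix_inv A) * norm (U n \<omega>)" by (rule norm_matrix_vector_le)
      also have "\<dots> \<le> D * (1 + norm (U n \<omega>))" unfolding D_def by (intro mult_mono) auto
      finally show ?thesis .
    qed
    show "AE \<omega> in M. \<forall>\<epsilon>>0. eventually (\<lambda>n. norm (V n \<omega> - U n \<omega>) \<le> \<epsilon> * (1 + norm (U n \<omega>))) sequentially"
      using close
    proof eventually_elim
      case (elim \<omega>)
      show ?case
      proof (intro allI impI)
        fix \<epsilon> :: real assume \<epsilon>: "\<epsilon> > 0"
        then have "\<epsilon> / D > 0" using D by simp
        with elim have "eventually (\<lambda>n. norm (V n \<omega> - A *v nscore n \<omega>) \<le> (\<epsilon> / D) * norm (nscore n \<omega>)) sequentially" by blast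
        then show "eventually (\<lambda>n. norm (V n \<omega> - U n \<omega>) \<le> \<epsilon> * (1 + norm (U n \<omega>))) sequentially"
        proof eventually_elim
          case (elim n)
          have "(\<epsilon> / D) * norm (nscore n \<omega>) \<le> (\<epsilon> / D) * (D * (1 + norm (U n \<omega>)))"
            using WU[of n \<omega>] \<epsilon> D by (intro mult_left_mono) auto
          with elim D show ?case by (simp add: U_def)
        qed
      qed
    qed
  qed
qed

text \<open>By \<open>ml_path_expansion\<close> the linear image is that under \<open>opt_info\<^sup>-\<^sup>1\<close>, which has the covariance
  \<open>opt_info\<^sup>-\<^sup>1 opt_info opt_info\<^sup>-\<^sup>1 = opt_info\<^sup>-\<^sup>1\<close>.\<close>

theorem ml_asymptotically_normal:
  "converges_in_distribution M (\<lambda>n \<omega>. sqrt (real n) *\<^sub>R (\<theta>mle n \<omega> - \<theta>bar)) (multi_normal 0 (matrix_inv opt_info))"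
proof -
  have "matrix_inv opt_info ** opt_info ** matrix_inv opt_info = matrix_inv opt_info"
    using matrix_inv_mult[OF pos_def_invertible[OF opt_info_pos_def]] by simp
  moreover have "converges_in_distribution M (\<lambda>n \<omega>. sqrt (real n) *\<^sub>R (\<theta>mle n \<omega> - \<theta>bar))
      (multi_normal 0 (matrix_inv opt_info ** opt_info ** matrix_inv opt_info))"
  proof (rule asymptotic_normality[OF pos_def_inv[OF opt_info_pos_def]])
    show "(\<lambda>\<omega>. sqrt (real n) *\<^sub>R (\<theta>mle n \<omega> - \<theta>bar)) \<in> borel_measurable M" if "n \<ge> n_st" for n
      using \<theta>mle_meas[OF that] by measurable
  qed (use ml_path_expansion in eventually_elim, blast)
  ultimately show ?thesis by simp
qed

lemma info_measurable:
  assumes n: "n \<ge> n_st" and \<theta>: "\<theta> \<in> borel_measurable M" "\<And>\<omega>. \<omega> \<in> space M \<Longrightarrow> \<theta> \<omega> \<in> \<Theta>"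
  shows "(\<lambda>\<omega>. info n (\<theta> \<omega>) \<omega>) \<in> borel_measurable M"
proof -
  have n1: "n \<ge> 1" using n n_st by simp
  have Z: "Z k \<in> borel_measurable M" for k
  proof -
    have "Z k \<in> borel_measurable (F k)" unfolding Z_def[abs_def]
      by (rule measurable_compose[OF _ borel_measurable_continuous_on_restrict[OF f]]) (use X[of "Suc k"] in auto)
    then show ?thesis by (rule measurable_F_M)
  qed
  have "(\<lambda>\<omega>. Z k \<omega> \<bullet> \<theta> \<omega>) \<in> borel_measurable M" for k using Z \<theta>(1) by measurable
  then have [measurable]: "(\<lambda>\<omega>. \<phi> (Z k \<omega> \<bullet> \<theta> \<omega>)) \<in> borel_measurable M" for k
    by (rule measurable_continuous_on_compose[OF \<phi>_cont]) (intro Z_interval \<theta>(2))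
  have [measurable]: "(\<lambda>\<omega>. outer (Z k \<omega>)) \<in> borel_measurable M" for k
    by (rule measurable_continuous_on_compose[OF continuous_on_outer Z]) (rule UNIV_I)
  show ?thesis unfolding info_eq[OF n1] by measurable
qed

text \<open>The information matrices at \<open>\<theta>mle n\<close> have the same limit \<open>opt_info\<close> as those at \<open>\<theta>bar\<close>, by consistency. Hence their
  square roots, random as they are, can be replaced by the constant \<open>opt_info\<^sup>1\<^sup>/\<^sup>2\<close>, and the linear image becomes
  that under \<open>R = opt_info\<^sup>1\<^sup>/\<^sup>2 opt_info\<^sup>-\<^sup>1 = opt_info\<^sup>-\<^sup>1\<^sup>/\<^sup>2\<close>.\<close>

theorem standardised_ml_asymptotically_normal:
  "converges_in_distribution M (\<lambda>n \<omega>. sqrt (real n) *\<^sub>R (matrix_sqrt (info n (\<theta>mle n \<omega>) \<omega>) *v (\<theta>mle n \<omega> - \<theta>bar)))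
     (multi_normal 0 (mat 1))"
proof -
  define S where "S = matrix_sqrt opt_info"
  define R where "R = matrix_inv S"
  note R = matrix_inv_sqrt[OF opt_info_pos_def, folded S_def, folded R_def]
  have "converges_in_distribution M (\<lambda>n \<omega>. sqrt (real n) *\<^sub>R (matrix_sqrt (info n (\<theta>mle n \<omega>) \<omega>) *v (\<theta>mle n \<omega> - \<theta>bar)))
     (multi_normal 0 (R ** opt_info ** R))"
  proof (rule asymptotic_normality[OF R(1)])
    fix n assume n: "n \<ge> n_st"
    have "(\<lambda>\<omega>. matrix_sqrt (info n (\<theta>mle n \<omega>) \<omega>)) \<in> borel_measurable M"
      by (rule measurable_continuous_on_compose[OF continuous_on_matrix_sqrt info_measurable])
         (use n \<theta>mle_meas \<theta>mle info_pos_def in auto)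
    then show "(\<lambda>\<omega>. sqrt (real n) *\<^sub>R (matrix_sqrt (info n (\<theta>mle n \<omega>) \<omega>) *v (\<theta>mle n \<omega> - \<theta>bar))) \<in> borel_measurable M"
      using \<theta>mle_meas[OF n]
      by (intro borel_measurable_scaleR borel_measurable_const borel_measurable_matrix_vector_mult borel_measurable_diff)
  next
    show "AE \<omega> in M. \<forall>\<epsilon>>0. eventually (\<lambda>n. norm (sqrt (real n) *\<^sub>R (matrix_sqrt (info n (\<theta>mle n \<omega>) \<omega>) *v (\<theta>mle n \<omega> - \<theta>bar)) - R *v nscore n \<omega>)
       \<le> \<epsilon> * norm (nscore n \<omega>)) sequentially"
      using ml_path_expansion consistent AE_space
    proof eventually_elim
      case (elim \<omega>)
      define Sn where "Sn = (\<lambda>n. matrix_sqrt (info n (\<theta>mle n \<omega>) \<omega>))"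
      define D where "D = norm (matrix_inv opt_info)"
      have "(\<lambda>n. info n (\<theta>mle n \<omega>) \<omega>) \<longlonglongrightarrow> opt_info"
        by (rule info_tendsto_along[OF elim(3) info_tendsto_opt[OF elim(3,2)] \<theta>mle[OF _ elim(3)] conjunct1[OF elim(1)]])
      moreover have "eventually (\<lambda>n. pos_def (info n (\<theta>mle n \<omega>) \<omega>)) sequentially"
        using eventually_ge_at_top[of n_st] by eventually_elim (intro info_pos_def elim(3) \<theta>mle)
      ultimately have Sn: "Sn \<longlonglongrightarrow> S" unfolding Sn_def S_def by (intro tendsto_matrix_sqrt opt_info_pos_def)
      show ?case
      proof (intro allI impI)
        fix \<epsilon> :: real assume \<epsilon>: "\<epsilon> > 0"
        \<comment> \<open>Both errors, that of the expansion and that of the square root, are relative to the normalised score.\<close>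
        define \<delta> where "\<delta> = \<epsilon> / (2 * (norm S + 1))"
        have p: "norm S + 1 > 0" by (rule add_nonneg_pos) auto
        then have \<delta>: "\<delta> > 0" using \<epsilon> by (simp add: \<delta>_def)
        have "(\<lambda>n. norm (Sn n) * \<delta> + norm (Sn n - S) * D) \<longlonglongrightarrow> norm S * \<delta> + norm (S - S) * D"
          by (intro tendsto_intros Sn)
        moreover have "norm S * \<delta> + norm (S - S) * D < \<epsilon>"
          using p \<epsilon> by (auto simp: \<delta>_def field_simps intro!: add_nonneg_pos)
        ultimately have "eventually (\<lambda>n. norm (Sn n) * \<delta> + norm (Sn n - S) * D < \<epsilon>) sequentially"
          by (rule order_tendstoD)
        moreover have "eventually (\<lambda>n. norm (sqrt (real n) *\<^sub>R (\<theta>mle n \<omega> - \<theta>bar) - matrix_inv opt_info *v nscore n \<omega>) \<le> \<delta> * norm (nscore n \<omega>)) sequentially"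
          using elim(1) \<delta> by blast
        ultimately show "eventually (\<lambda>n. norm (sqrt (real n) *\<^sub>R (matrix_sqrt (info n (\<theta>mle n \<omega>) \<omega>) *v (\<theta>mle n \<omega> - \<theta>bar)) - R *v nscore n \<omega>)
            \<le> \<epsilon> * norm (nscore n \<omega>)) sequentially"
        proof eventually_elim
          case (elim n)
          define d where "d = sqrt (real n) *\<^sub>R (\<theta>mle n \<omega> - \<theta>bar)"
          define w where "w = matrix_inv opt_info *v nscore n \<omega>"
          have Sw: "S *v w = R *v nscore n \<omega>"
            by (simp add: w_def matrix_vector_mul_assoc R(4)[symmetric] matrix_mul_assoc R(3))
          have "sqrt (real n) *\<^sub>R (matrix_sqrt (info n (\<theta>mle n \<omega>) \<omega>) *v (\<theta>mle n \<omega> - \<theta>bar)) - R *v nscore n \<omega> =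
              Sn n *v (d - w) + (Sn n - S) *v w"
            unfolding Sw[symmetric]
            by (simp add: Sn_def d_def matrix_vector_mult_diff_distrib matrix_vector_mult_diff_rdistrib matrix_vector_mult_scaleR)
          also have "norm \<dots> \<le> norm (Sn n) * norm (d - w) + norm (Sn n - S) * norm w"
            by (intro norm_triangle_mono norm_matrix_vector_le)
          also have "\<dots> \<le> norm (Sn n) * (\<delta> * norm (nscore n \<omega>)) + norm (Sn n - S) * (D * norm (nscore n \<omega>))"
            using elim(2) norm_matrix_vector_le[of "matrix_inv opt_info" "nscore n \<omega>"]
            by (intro add_mono mult_left_mono) (auto simp: d_def w_def D_def)
          also have "\<dots> = (norm (Sn n) * \<delta> + norm (Sn n - S) * D) * norm (nscore n \<omega>)" by (simp add: algebra_simps)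
          also have "\<dots> \<le> \<epsilon> * norm (nscore n \<omega>)" using elim(1) by (intro mult_right_mono) auto
          finally show ?case .
        qed
      qed
    qed
  qed
  then show ?thesis unfolding R(5) .
qed

end

theorem theorem3p4:
  fixes \<X> :: "'x::metric_space set"
    and \<Theta> :: "(real^'p) set" and \<theta>bar :: "real^'p"
    and f :: "'x \<Rightarrow> real^'p"
    and I :: "real set" and G :: "real \<Rightarrow> real"
    and \<nu> :: "real measure" and K b :: "real \<Rightarrow> real" and J :: "real set"
    and M :: "'w measure" and F :: "nat \<Rightarrow> 'w measure"
    and X :: "nat \<Rightarrow> 'w \<Rightarrow> 'x" and Y :: "nat \<Rightarrow> 'w \<Rightarrow> real"
    and n_st :: nat
    and \<theta>hat \<theta>mle :: "nat \<Rightarrow> 'w \<Rightarrow> real^'p"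
  assumes \<X>: "compact \<X>" "\<X> \<noteq> {}"
    and \<Theta>: "compact \<Theta>" "\<Theta> \<noteq> {}" "\<theta>bar \<in> \<Theta>"
    and f: "continuous_on \<X> f" "span (f ` \<X>) = UNIV"
    and I: "open I" "is_interval I" "\<And>x \<theta>. x \<in> \<X> \<Longrightarrow> \<theta> \<in> \<Theta> \<Longrightarrow> f x \<bullet> \<theta> \<in> I"
    and G: "G C1_differentiable_on I" "\<And>u. u \<in> I \<Longrightarrow> deriv G u > 0"
    and family: "exponential_family \<nu> K b J"
    and M: "prob_space M"
    and A1: "filtration (space M) F" "\<And>i. subalgebra M (F i)"
      "\<And>i. i \<ge> 1 \<Longrightarrow> X i \<in> F (i - 1) \<rightarrow>\<^sub>M restrict_space borel \<X>"
      "\<And>i. i \<ge> 1 \<Longrightarrow> Y i \<in> F i \<rightarrow>\<^sub>M borel"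
    and A2': "G ` I \<subseteq> deriv b ` J"
      "\<And>i. i \<ge> 1 \<Longrightarrow> is_cond_distribution M (F (i - 1)) (Y i)
                        (\<lambda>\<omega>. expfam \<nu> K b (glm_tau b J G f \<theta>bar (X i \<omega>)))"
    and start: "n_st \<ge> 1"
      "\<And>\<omega> \<theta>. \<omega> \<in> space M \<Longrightarrow> \<theta> \<in> \<Theta> \<Longrightarrow>
         pos_def (info_matrix (f_theta b J G f \<theta>) (empirical_design n_st (\<lambda>i. X i \<omega>)))"
    and adaptive_estimators: "\<And>n. n \<ge> n_st \<Longrightarrow> estimator M X Y \<Theta> n (\<theta>hat n)"
    and wynn: "\<And>n \<omega>. n \<ge> n_st \<Longrightarrow> \<omega> \<in> space M \<Longrightarrow>
         is_arg_max
           (\<lambda>x. f_theta b J G f (\<theta>hat n \<omega>) x \<bullet>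
                  (matrix_inv (info_matrix (f_theta b J G f (\<theta>hat n \<omega>))
                                 (empirical_design n (\<lambda>i. X i \<omega>)))
                     *v f_theta b J G f (\<theta>hat n \<omega>) x))
           (\<lambda>x. x \<in> \<X>) (X (Suc n) \<omega>)"
    and max_likelihood:
      "\<And>n. n \<ge> n_st \<Longrightarrow> estimator M X Y \<Theta> n (\<theta>mle n)"
      "\<And>n. n \<ge> n_st \<Longrightarrow> \<theta>mle n \<in> M \<rightarrow>\<^sub>M borel"
      "\<And>n \<omega>. n \<ge> n_st \<Longrightarrow> \<omega> \<in> space M \<Longrightarrow> (\<And>i. i \<in> {1..n} \<Longrightarrow> K (Y i \<omega>) > 0) \<Longrightarrow>
         is_arg_max (log_likelihood K b J G f n (\<lambda>i. X i \<omega>) (\<lambda>i. Y i \<omega>))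
           (\<lambda>\<theta>. \<theta> \<in> \<Theta>) (\<theta>mle n \<omega>)"
    and G_C2: "deriv G C1_differentiable_on I"
    and interior: "\<theta>bar \<in> interior \<Theta>"
    and consistent: "AE \<omega> in M. (\<lambda>n. \<theta>hat n \<omega>) \<longlonglongrightarrow> \<theta>bar"
  shows "converges_in_distribution M
           (\<lambda>n \<omega>. sqrt (real n) *\<^sub>R
              (matrix_sqrt (info_matrix (f_theta b J G f (\<theta>mle n \<omega>))
                              (empirical_design n (\<lambda>i. X i \<omega>)))
                 *v (\<theta>mle n \<omega> - \<theta>bar)))
           (multi_normal 0 (mat 1))
       \<and> (\<forall>\<xi>opt. D_optimal \<X> (f_theta b J G f \<theta>bar) \<xi>opt \<longrightarrow>
           converges_in_distribution M (\<lambda>n \<omega>. sqrt (real n) *\<^sub>R (\<theta>mle n \<omega> - \<theta>bar))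
             (multi_normal 0 (matrix_inv (info_matrix (f_theta b J G f \<theta>bar) \<xi>opt))))"
proof -
  interpret prob_space M by (rule M)
  have estimator_mem: "T \<omega> \<in> \<Theta>" if "estimator M X Y \<Theta> n T" "\<omega> \<in> space M" for n T \<omega>
    using that unfolding estimator_def by blast
  interpret wynn_ml \<nu> K b J G I \<X> \<Theta> \<theta>bar f M F X Y n_st \<theta>hat \<theta>mle
  proof (intro wynn_ml.intro adaptive_glm.intro glm_link.intro glm_link_axioms.intro adaptive_glm_axioms.intro wynn_ml_axioms.intro)
    fix n \<omega> x assume n: "n \<ge> n_st" and \<omega>: "\<omega> \<in> space M"
    show "\<theta>hat n \<omega> \<in> \<Theta>" "\<theta>mle n \<omega> \<in> \<Theta>"
      using estimator_mem adaptive_estimators[OF n] max_likelihood(1)[OF n] \<omega> by blast+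
    show "f_theta b J G f (\<theta>hat n \<omega>) x \<bullet> (matrix_inv (info_matrix (f_theta b J G f (\<theta>hat n \<omega>)) (empirical_design n (\<lambda>i. X i \<omega>)))
                     *v f_theta b J G f (\<theta>hat n \<omega>) x) \<le>
        f_theta b J G f (\<theta>hat n \<omega>) (X (Suc n) \<omega>) \<bullet> (matrix_inv (info_matrix (f_theta b J G f (\<theta>hat n \<omega>)) (empirical_design n (\<lambda>i. X i \<omega>)))
                     *v f_theta b J G f (\<theta>hat n \<omega>) (X (Suc n) \<omega>))" if "x \<in> \<X>"
      using wynn[OF n \<omega>] that unfolding is_arg_max_linorder by blast
    fix \<theta> assume "\<And>i. i \<in> {1..n} \<Longrightarrow> K (Y i \<omega>) > 0" "\<theta> \<in> \<Theta>"
    then show "log_likelihood K b J G f n (\<lambda>i. X i \<omega>) (\<lambda>i. Y i \<omega>) \<theta> \<le> log_likelihood K b J G f n (\<lambda>i. X i \<omega>) (\<lambda>i. Y i \<omega>) (\<theta>mle n \<omega>)"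
      using max_likelihood(3)[OF n \<omega>] unfolding is_arg_max_linorder by blast
  qed (fact \<X> \<Theta> f I G family M A1 A2' start max_likelihood G_C2 interior consistent)+
  show ?thesis
    using standardised_ml_asymptotically_normal ml_asymptotically_normal D_optimal_unique
    unfolding info_def by simp
qed

end
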